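(* Fix integers $p,N\ge 1$, $M\in\mathbb Z$ and $\rho\in(0,1)$. Let $\phi_1,\dots,\phi_N$ be $p\times p$ matrix-valued symbols that are analytic and non-singular in the annulus $\rho<|z|<1/\rho$, and put $\phi(z)=\prod_{m=1}^N\phi_m(z)$ (product in increasing order of $m$). Consider, for each $n$, the model $\mathbb P_n$ defined in the context by products of $pn\times pn$ minors of the block Toeplitz matrices $T_{\phi_m}$, with endpoints $u_0^j=j-1$, $u_N^j=pM+j-1$, and let $K_n$ be its correlation kernel given in the context. Assume that $\phi$ admits two factorizations $$\phi(z)=\phi_+(z)\phi_-(z)=\widetilde\phi_-(z)\widetilde\phi_+(z)$$ such that (1) $\phi_+^{\pm1},\widetilde\phi_+^{\pm1}$ are analytic for $|z|<1$ and continuous for $|z|\le1$; (2) $\phi_-^{\pm1},\widetilde\phi_-^{\pm1}$ are analytic for $|z|>1$ and continuous for $|z|\ge1$; (3) $\phi_-(z),\widetilde\phi_-(z)\sim z^M I_p$ as $z\to\infty$ (that is, $z^{-M}\phi_-(z)\to I_p$ and $z^{-M}\widetilde\phi_-(z)\to I_p$). Then for all $x,x'\in\mathbb Z$ and $0<m,m'<N$, $$\lim_{n\to\infty}\left[K_n(m,px+j;m',px'+i)\right]_{i,j=0}^{p-1}=\left[K_{bottom}(m,px+j;m',px'+i)\right]_{i,j=0}^{p-1},$$ where $$\left[K_{bottom}(m,px+j;m',px'+i)\right]_{i,j=0}^{p-1}=-\frac{\chi_{m>m'}}{2\pi\mathrm i}\oint_{|z|=1}\phi_{m',m}(z)z^{x'-x}\frac{dz}{z}-\frac{1}{(2\pi\mathrm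 i)^2}\iint_{|z|<|w|}\phi_{m',N}(w)\,\phi_-^{-1}(w)\,\phi_+^{-1}(z)\,\phi_{0,m}(z)\,\frac{w^{x'}\,dz\,dw}{z^{x+1}(z-w)}.$$ That is, as $n\to\infty$ the bottom paths converge to a determinantal point process with kernel $K_{bottom}$. Likewise, for all $\xi,\xi'\in\mathbb Z$ and $0<m,m'<N$, $$\lim_{n\to\infty}\left[K_n(m,p(n+\xi)+j;m',p(n+\xi')+i)\right]_{i,j=0}^{p-1}=\left[K_{top}(m,p\xi+j;m',p\xi'+i)\right]_{i,j=0}^{p-1},$$ where $$\left[K_{top}(m,p\xi+j;m',p\xi'+i)\right]_{i,j=0}^{p-1}=-\frac{\chi_{m>m'}}{2\pi\mathrm i}\oint_{|z|=1}\phi_{m',m}(z)z^{\xi'-\xi}\frac{dz}{z}+\frac{1}{(2\pi\mathrm i)^2}\iint_{|w|<|z|}\phi_{m',N}(w)\,\widetilde\phi_+^{-1}(w)\,\widetilde\phi_-^{-1}(z)\,\phi_{0,m}(z)\,\frac{w^{\xi'-M}\,dz\,dw}{z^{\xi-M+1}(z-w)}.$$ That is, as $n\to\infty$ the top paths (heights shifted by $-pn$) converge to a determinantal point process with kernel $K_{top}$. Here the double integrals are over positively oriented circles centered at $0$ inside the annulus $\rho<|\cdot|<1/\rho$, with $|z|<1<|w|$ in $K_{bottom}$ and $|w|<1<|z|$ in $K_{top}$.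
   Context: Block Toeplitz matrices: for a $p\times p$ matrix-valued function $\psi$ (entries are rational functions, and neither $\psi$ nor $\psi^{-1}$ has poles on the unit circle) with Fourier coefficients $\hat\psi(k)=\frac1{2\pi\mathrm i}\oint_{|z|=1}\psi(z)\frac{dz}{z^{k+1}}$, the doubly infinite block Toeplitz matrix is $T_\psi(px+r,py+s)=(\hat\psi(y-x))_{r+1,s+1}$, $0\le r,s\le p-1$, $x,y\in\mathbb Z$. The model: $\mathbb P_n$ is the probability measure on point configurations $\{(m,u_m^j)\}_{1\le m\le N-1,\,1\le j\le pn}\subset\{1,\dots,N-1\}\times\mathbb Z$ proportional to $$\prod_{m=1}^N\det\left(T_{\phi_m}(u_{m-1}^j,u_m^k)\right)_{j,k=1}^{pn},\qquad u_0^j=j-1,\ u_N^j=pM+j-1 .$$ Standing assumptions: all minors of every $T_{\phi_m}$ are non-negative, and the normalizing constant is positive, so that $\mathbb P_n$ is a probability measure. Notation: $\phi_{k,\ell}(z)=\prod_{m=k+1}^{\ell}\phi_m(z)$ for $k<\ell$; $\chi_{m>m'}=1$ if $m>m'$ and $0$ otherwise. In $[\,\cdot\,]_{i,j=0}^{p-1}$, $i$ is the row index and $j$ the column index. Kernel: $\mathbb P_n$ is determinantal: $\mathbb P_n(\text{points at }(m_1,u_1),\dots,(m_k,u_k))=\det(K_n(m_a,u_a;m_b,u_b))_{a,b=1}^k$ for distinct points, with $$\left[K_n(m,px+j;m',px'+i)\right]_{i,j=0}^{p-1}=-\frac{\chi_{m>m'}}{2\pi\mathrm i}\oint_{|z|=1}\phi_{m',m}(z)\frac{dz}{z^{x-x'+1}}+\frac1{(2\pi\mathrm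 i)^2}\oint_{|w|=1}\oint_{|z|=1}\phi_{m',N}(w)R_n(z,w)\phi_{0,m}(z)\frac{w^{x'}}{z^{x+1}}\frac{dz\,dw}{w^{M+n}},$$ where $R_n(z,w)$ is the unique $p\times p$ matrix-valued bivariate polynomial of degree $\le n-1$ in each of $z$ and $w$ such that $\frac1{2\pi\mathrm i}\oint_{|w|=1}P(w)\phi(w)R_n(z,w)\frac{dw}{w^{M+n}}=P(z)$ for every $p\times p$ matrix-valued polynomial $P$ of degree $\le n-1$. *)

theory Defs
  imports
    "HOL-Complex_Analysis.Complex_Analysis"
    "HOL-Probability.Probability"
    "Jordan_Normal_Form.Determinant"
    "Jordan_Normal_Form.Gauss_Jordan_Elimination"
begin

text \<open>
  Matrices are those of \<open>Jordan_Normal_Form\<close>, with indices starting at 0. The names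
  \<open>mat\<close> and \<open>det\<close> are qualified because HOL-Analysis has constants with these names.
\<close>

section \<open>Matrix-valued functions\<close>

abbreviation mat_inv :: "complex mat \<Rightarrow> complex mat" where
  "mat_inv A \<equiv> the (mat_inverse A)"

definition mat_holomorphic_on :: "nat \<Rightarrow> (complex \<Rightarrow> complex mat) \<Rightarrow> complex set \<Rightarrow> bool" where
  "mat_holomorphic_on p F S \<longleftrightarrow>
     (\<forall>z\<in>S. F z \<in> carrier_mat p p) \<and>
     (\<forall>i<p. \<forall>j<p. (\<lambda>z. F z $$ (i, j)) holomorphic_on S)"

definition mat_continuous_on :: "nat \<Rightarrow> complex set \<Rightarrow> (complex \<Rightarrow> complex mat) \<Rightarrow> bool" where
  "mat_continuous_on p S F \<longleftrightarrow>
     (\<forall>z\<in>S. F z \<in> carrier_mat p p) \<and>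
     (\<forall>i<p. \<forall>j<p. continuous_on S (\<lambda>z. F z $$ (i, j)))"

definition annulus :: "real \<Rightarrow> complex set" where
  "annulus \<rho> = {z. \<rho> < norm z \<and> norm z < 1 / \<rho>}"

definition plus_factor :: "nat \<Rightarrow> (complex \<Rightarrow> complex mat) \<Rightarrow> bool" where
  "plus_factor p F \<longleftrightarrow>
     (\<forall>z. norm z \<le> 1 \<longrightarrow> invertible_mat (F z)) \<and>
     (\<forall>G \<in> {F, \<lambda>z. mat_inv (F z)}.
        mat_holomorphic_on p G {z. norm z < 1} \<and> mat_continuous_on p {z. norm z \<le> 1} G)"

definition minus_factor :: "nat \<Rightarrow> int \<Rightarrow> (complex \<Rightarrow> complex mat) \<Rightarrow> bool" where
  "minus_factor p M F \<longleftrightarrow>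
     (\<forall>z. 1 \<le> norm z \<longrightarrow> invertible_mat (F z)) \<and>
     (\<forall>G \<in> {F, \<lambda>z. mat_inv (F z)}.
        mat_holomorphic_on p G {z. 1 < norm z} \<and> mat_continuous_on p {z. 1 \<le> norm z} G) \<and>
     (\<forall>i<p. \<forall>j<p. ((\<lambda>z. z powi (- M) * F z $$ (i, j)) \<longlongrightarrow> 1\<^sub>m p $$ (i, j)) at_infinity)"

text \<open>The entrywise integral over the circle of radius \<open>r\<close>, including the factor $1/(2\pi i)$.\<close>

definition circ_int :: "nat \<Rightarrow> real \<Rightarrow> (complex \<Rightarrow> complex mat) \<Rightarrow> complex mat" where
  "circ_int p r F = Matrix.mat p p
     (\<lambda>(i, j). 1 / (2 * of_real pi * \<i>) * contour_integral (circlepath 0 r) (\<lambda>z. F z $$ (i, j)))"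

text \<open>
  The ordered product $\phi_{k,l}(z) = \phi_{k+1}(z) \cdots \phi_l(z)$.
\<close>

definition symbol_prod ::
    "nat \<Rightarrow> (nat \<Rightarrow> complex \<Rightarrow> complex mat) \<Rightarrow> nat \<Rightarrow> nat \<Rightarrow> complex \<Rightarrow> complex mat" where
  "symbol_prod p \<phi> k l z = foldr (*) (map (\<lambda>m. \<phi> m z) [k + 1..<l + 1]) (1\<^sub>m p)"


section \<open>Block Toeplitz matrices\<close>

definition fourier_coeff :: "nat \<Rightarrow> (complex \<Rightarrow> complex mat) \<Rightarrow> int \<Rightarrow> complex mat" where
  "fourier_coeff p \<psi> k = circ_int p 1 (\<lambda>z. (1 / z powi (k + 1)) \<cdot>\<^sub>m \<psi> z)"

text \<open>Here $u = px + r$ and $v = py + s$ with $0 \le r, s < p$.\<close>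

definition toeplitz :: "nat \<Rightarrow> (complex \<Rightarrow> complex mat) \<Rightarrow> int \<Rightarrow> int \<Rightarrow> complex" where
  "toeplitz p \<psi> u v =
     fourier_coeff p \<psi> (v div int p - u div int p) $$ (nat (u mod int p), nat (v mod int p))"

definition minors_nonneg :: "(int \<Rightarrow> int \<Rightarrow> complex) \<Rightarrow> bool" where
  "minors_nonneg T \<longleftrightarrow>
     (\<forall>k (a :: nat \<Rightarrow> int) (b :: nat \<Rightarrow> int).
        strict_mono_on {..<k} a \<longrightarrow> strict_mono_on {..<k} b \<longrightarrow>
        Determinant.det (Matrix.mat k k (\<lambda>(i, j). T (a i) (b j))) \<in> \<real>\<^sub>\<ge>\<^sub>0)"


section \<open>The model\<close>

text \<open>
  A configuration is the set of its points \<open>(m, u)\<close>; it has $pn$ points on each of the levels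
  $1, \dots, N-1$.
\<close>

definition sites :: "nat \<Rightarrow> (nat \<times> int) set" where
  "sites N = {1..<N} \<times> UNIV"

definition level :: "nat \<Rightarrow> (nat \<times> int) set \<Rightarrow> int set" where
  "level m X = {u. (m, u) \<in> X}"

definition configs :: "nat \<Rightarrow> nat \<Rightarrow> nat \<Rightarrow> (nat \<times> int) set set" where
  "configs p N n =
     {X. X \<subseteq> sites N \<and> (\<forall>m\<in>{1..<N}. finite (level m X) \<and> card (level m X) = p * n)}"

text \<open>
  \<open>pos p M N X m j\<close> is $u_m^{j+1}$. The points on a level are labelled in increasing order; on the
  levels $1, \dots, N-1$ the weight does not depend on the labelling, since relabelling a level
  changes the signs of two factors.
\<close>

definition pos :: "nat \<Rightarrow> int \<Rightarrow> nat \<Rightarrow> (nat \<times> int) set \<Rightarrow> nat \<Rightarrow> nat \<Rightarrow> int" where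
  "pos p M N X m j =
     (if m = 0 then int j
      else if m = N then int p * M + int j
      else sorted_list_of_set (level m X) ! j)"

text \<open>
  The product of minors is a non-negative real number under \<open>minors_nonneg\<close>; \<open>Re\<close> only
  converts it to type \<^typ>\<open>real\<close>.
\<close>

definition weight ::
    "nat \<Rightarrow> int \<Rightarrow> nat \<Rightarrow> (nat \<Rightarrow> complex \<Rightarrow> complex mat) \<Rightarrow> nat \<Rightarrow> (nat \<times> int) set \<Rightarrow> real" where
  "weight p M N \<phi> n X = Re (\<Prod>m = 1..N. Determinant.det (Matrix.mat (p * n) (p * n)
     (\<lambda>(j, k). toeplitz p (\<phi> m) (pos p M N X (m - 1) j) (pos p M N X m k))))"

definition norm_const ::
    "nat \<Rightarrow> int \<Rightarrow> nat \<Rightarrow> (nat \<Rightarrow> complex \<Rightarrow> complex mat) \<Rightarrow> nat \<Rightarrow> real" where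
  "norm_const p M N \<phi> n = (\<Sum>\<^sub>\<infinity>X \<in> configs p N n. weight p M N \<phi> n X)"

definition model ::
    "nat \<Rightarrow> int \<Rightarrow> nat \<Rightarrow> (nat \<Rightarrow> complex \<Rightarrow> complex mat) \<Rightarrow> nat \<Rightarrow> (nat \<times> int) set measure" where
  "model p M N \<phi> n =
     point_measure (configs p N n) (\<lambda>X. ennreal (weight p M N \<phi> n X / norm_const p M N \<phi> n))"


section \<open>Correlation kernels\<close>

abbreviation eval_mat :: "complex poly mat \<Rightarrow> complex \<Rightarrow> complex mat" where
  "eval_mat P z \<equiv> map_mat (\<lambda>q. poly q z) P"

text \<open>
  In a bivariate polynomial of type \<^typ>\<open>complex poly poly\<close> the outer variable is $z$ and the
  coefficients are polynomials in $w$.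
\<close>

definition eval_mat2 :: "complex poly poly mat \<Rightarrow> complex \<Rightarrow> complex \<Rightarrow> complex mat" where
  "eval_mat2 R z w = map_mat (\<lambda>q. poly (poly q [:z:]) w) R"

definition is_rep_kernel ::
    "nat \<Rightarrow> int \<Rightarrow> (complex \<Rightarrow> complex mat) \<Rightarrow> nat \<Rightarrow> complex poly poly mat \<Rightarrow> bool" where
  "is_rep_kernel p M \<Phi> n R \<longleftrightarrow>
     R \<in> carrier_mat p p \<and>
     (\<forall>i<p. \<forall>j<p. degree (R $$ (i, j)) \<le> n - 1 \<and> (\<forall>a. degree (coeff (R $$ (i, j)) a) \<le> n - 1)) \<and>
     (\<forall>P \<in> carrier_mat p p. (\<forall>i<p. \<forall>j<p. degree (P $$ (i, j)) \<le> n - 1) \<longrightarrow>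
        (\<forall>z. circ_int p 1 (\<lambda>w. (1 / w powi (M + int n)) \<cdot>\<^sub>m
                (eval_mat P w * \<Phi> w * eval_mat2 R z w)) = eval_mat P z))"

definition rep_kernel ::
    "nat \<Rightarrow> int \<Rightarrow> (complex \<Rightarrow> complex mat) \<Rightarrow> nat \<Rightarrow> complex poly poly mat" where
  "rep_kernel p M \<Phi> n = (THE R. is_rep_kernel p M \<Phi> n R)"

text \<open>
  The block with arguments \<open>m x m' x'\<close> has the entry $K(m, px+j; m', px'+i)$ in row $i$ and
  column $j$.
\<close>

definition kernel_of_blocks ::
    "nat \<Rightarrow> (nat \<Rightarrow> int \<Rightarrow> nat \<Rightarrow> int \<Rightarrow> complex mat) \<Rightarrow> nat \<times> int \<Rightarrow> nat \<times> int \<Rightarrow> complex" where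
  "kernel_of_blocks p B = (\<lambda>(m, u) (m', u').
     B m (u div int p) m' (u' div int p) $$ (nat (u' mod int p), nat (u mod int p)))"

definition transition_block ::
    "nat \<Rightarrow> (nat \<Rightarrow> complex \<Rightarrow> complex mat) \<Rightarrow> nat \<Rightarrow> int \<Rightarrow> nat \<Rightarrow> int \<Rightarrow> complex mat" where
  "transition_block p \<phi> m x m' x' =
     (if m > m' then circ_int p 1 (\<lambda>z. (z powi (x' - x) / z) \<cdot>\<^sub>m symbol_prod p \<phi> m' m z)
      else 0\<^sub>m p p)"

definition K_fin ::
    "nat \<Rightarrow> int \<Rightarrow> nat \<Rightarrow> (nat \<Rightarrow> complex \<Rightarrow> complex mat) \<Rightarrow> nat
      \<Rightarrow> nat \<times> int \<Rightarrow> nat \<times> int \<Rightarrow> complex" where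
  "K_fin p M N \<phi> n = kernel_of_blocks p (\<lambda>m x m' x'.
     - transition_block p \<phi> m x m' x' +
     circ_int p 1 (\<lambda>w. circ_int p 1 (\<lambda>z.
       (w powi x' / (z powi (x + 1) * w powi (M + int n))) \<cdot>\<^sub>m
       (symbol_prod p \<phi> m' N w * eval_mat2 (rep_kernel p M (symbol_prod p \<phi> 0 N) n) z w
          * symbol_prod p \<phi> 0 m z))))"

text \<open>
  In the limiting kernels \<open>a\<close> and \<open>b\<close> are the radii of the inner and the outer circle:
  $|z| = a$, $|w| = b$ in \<open>K_bottom\<close>, and $|w| = a$, $|z| = b$ in \<open>K_top\<close>.
\<close>

definition K_bottom ::
    "nat \<Rightarrow> nat \<Rightarrow> (nat \<Rightarrow> complex \<Rightarrow> complex mat)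
      \<Rightarrow> (complex \<Rightarrow> complex mat) \<Rightarrow> (complex \<Rightarrow> complex mat) \<Rightarrow> real \<Rightarrow> real
      \<Rightarrow> nat \<times> int \<Rightarrow> nat \<times> int \<Rightarrow> complex" where
  "K_bottom p N \<phi> \<phi>p \<phi>m a b = kernel_of_blocks p (\<lambda>m x m' x'.
     - transition_block p \<phi> m x m' x' -
     circ_int p b (\<lambda>w. circ_int p a (\<lambda>z.
       (w powi x' / (z powi (x + 1) * (z - w))) \<cdot>\<^sub>m
       (symbol_prod p \<phi> m' N w * mat_inv (\<phi>m w) * mat_inv (\<phi>p z) * symbol_prod p \<phi> 0 m z))))"

definition K_top ::
    "nat \<Rightarrow> int \<Rightarrow> nat \<Rightarrow> (nat \<Rightarrow> complex \<Rightarrow> complex mat)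
      \<Rightarrow> (complex \<Rightarrow> complex mat) \<Rightarrow> (complex \<Rightarrow> complex mat) \<Rightarrow> real \<Rightarrow> real
      \<Rightarrow> nat \<times> int \<Rightarrow> nat \<times> int \<Rightarrow> complex" where
  "K_top p M N \<phi> \<psi>p \<psi>m a b = kernel_of_blocks p (\<lambda>m x m' x'.
     - transition_block p \<phi> m x m' x' +
     circ_int p a (\<lambda>w. circ_int p b (\<lambda>z.
       (w powi (x' - M) / (z powi (x - M + 1) * (z - w))) \<cdot>\<^sub>m
       (symbol_prod p \<phi> m' N w * mat_inv (\<psi>p w) * mat_inv (\<psi>m z) * symbol_prod p \<phi> 0 m z))))"


section \<open>Convergence to a determinantal point process\<close>

definition config_space :: "'a set \<Rightarrow> 'a set measure" where
  "config_space E = sigma (Pow E) ((\<lambda>s. {X \<in> Pow E. s \<in> X}) ` E)"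

definition determinantal_process ::
    "'a set \<Rightarrow> ('a \<Rightarrow> 'a \<Rightarrow> complex) \<Rightarrow> 'a set measure \<Rightarrow> bool" where
  "determinantal_process E K Q \<longleftrightarrow>
     prob_space Q \<and> space Q = Pow E \<and> sets Q = sets (config_space E) \<and>
     (\<forall>ps. distinct ps \<longrightarrow> set ps \<subseteq> E \<longrightarrow>
        complex_of_real (measure Q {X \<in> space Q. set ps \<subseteq> X}) =
        Determinant.det (Matrix.mat (length ps) (length ps) (\<lambda>(a, b). K (ps ! a) (ps ! b))))"

text \<open>
  Convergence of the finite-dimensional distributions; for point processes without multiple
  points on a countable discrete set this is convergence in distribution.
\<close>

definition process_converges ::
    "'a set \<Rightarrow> (nat \<Rightarrow> 'a set measure) \<Rightarrow> 'a set measure \<Rightarrow> bool" where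
  "process_converges E P Q \<longleftrightarrow>
     (\<forall>A B. finite A \<longrightarrow> A \<subseteq> E \<longrightarrow> B \<subseteq> A \<longrightarrow>
        (\<lambda>n. measure (P n) {X \<in> space (P n). X \<inter> A = B})
          \<longlonglongrightarrow> measure Q {X \<in> space Q. X \<inter> A = B})"

definition converges_to_determinantal ::
    "'a set \<Rightarrow> (nat \<Rightarrow> 'a set measure) \<Rightarrow> ('a \<Rightarrow> 'a \<Rightarrow> complex) \<Rightarrow> bool" where
  "converges_to_determinantal E P K \<longleftrightarrow>
     (\<exists>Q. determinantal_process E K Q \<and> process_converges E P Q)"

definition shift_down :: "int \<Rightarrow> (nat \<times> int) set \<Rightarrow> (nat \<times> int) set" where
  "shift_down h X = (\<lambda>(m, u). (m, u - h)) ` X"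

end

theory Submission imports Defs begin

text \<open>
  Summing the product of minors over all configurations is an iterated Cauchy--Binet formula, so the
  probability that no path visits a finite set \<open>S\<close> of sites is a quotient of two determinants of
  size $pn$. Decomposing a path at its first visit to \<open>S\<close> exhibits the numerator as a perturbation of
  the denominator of rank $|S|$; this gives all correlations with the inverse of the finite
  block Toeplitz matrix of $\phi$ in the kernel, and the coefficients of $R_n$ are the entries
  of this inverse.

  A factorization of $\phi$ gives the inverse on a half-line as a product of two
  triangular Toeplitz matrices. Since the Fourier coefficients decay geometrically, the inverse of the
  finite section equals, up to exponentially small errors, the full inverse plus one correction at
  each end of the section, and the entries near an end converge to those of the half-line inverse at
  this end. Dominated convergence then gives the limits of the kernels as sums over a half-line, which
  are the expansions of the double integrals in powers of $z/w$ or $w/z$.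
\<close>

section \<open>Means over circles and Fourier coefficients\<close>

text \<open>Each factor of \<open>\<phi>\<close> is analytic on one side of the unit circle and
  merely continuous up to it, and the coefficients that do not vanish get no decay from its own
  side. They decay geometrically because \<open>\<phi> = \<phi>p * \<phi>m\<close> expresses
  \<open>\<phi>p\<close> through \<open>\<phi>\<close> and the inverse of \<open>\<phi>m\<close> on
  the other side: two one-sided extensions with the same boundary values suffice for moving the
  contour. The endpoint shift \<open>p * M\<close> is moved into the symbol as
  \<open>z^(-M)\<close>. This cancels the growth of the minus factors at infinity and turns the
  matrix between the end points into a principal section. Its invertibility is free, since its
  determinant is the normalizing constant. Only an approximate right inverse is constructed; its
  error is of order \<open>q^(p * n)\<close> at size \<open>p * n\<close>, so comparison with the
  exact inverse yields uniform bounds and limits by finite sums alone. The limiting processes are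
  not known beforehand. They come from Kolmogorov extension of the limiting finite-dimensional
  probabilities, whose non-negativity and consistency are inherited from the models.\<close>

definition circle_mean :: "real \<Rightarrow> (complex \<Rightarrow> complex) \<Rightarrow> complex" where
  "circle_mean r f = 1 / (2 * of_real pi * \<i>) * contour_integral (circlepath 0 r) f"

lemma circle_integrable:
  "0 < r \<Longrightarrow> continuous_on (sphere 0 r) f \<Longrightarrow> f contour_integrable_on circlepath 0 r"
  by (rule contour_integrable_continuous_circlepath) simp

lemma circle_mean_cong:
  assumes "0 < r" "\<And>z. norm z = r \<Longrightarrow> f z = g z"
  shows "circle_mean r f = circle_mean r g"
  unfolding circle_mean_def
  by (subst contour_integral_cong[OF refl, of "circlepath 0 r" f g]) (use assms in auto)

lemma circle_mean_add:
  assumes "0 < r" "continuous_on (sphere 0 r) f" "continuous_on (sphere 0 r) g"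
  shows "circle_mean r (\<lambda>z. f z + g z) = circle_mean r f + circle_mean r g"
  unfolding circle_mean_def
  by (simp add: contour_integral_add circle_integrable assms algebra_simps)

lemma circle_mean_diff:
  assumes "0 < r" "continuous_on (sphere 0 r) f" "continuous_on (sphere 0 r) g"
  shows "circle_mean r (\<lambda>z. f z - g z) = circle_mean r f - circle_mean r g"
  unfolding circle_mean_def
  by (simp add: contour_integral_diff circle_integrable assms algebra_simps)

lemma circle_mean_cmult:
  assumes "0 < r" "continuous_on (sphere 0 r) f"
  shows "circle_mean r (\<lambda>z. c * f z) = c * circle_mean r f"
  unfolding circle_mean_def
  by (simp add: contour_integral_lmul circle_integrable assms algebra_simps)

lemma circle_mean_sum:
  assumes "0 < r" "finite S" "\<And>s. s \<in> S \<Longrightarrow> continuous_on (sphere 0 r) (f s)"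
  shows "circle_mean r (\<lambda>z. \<Sum>s\<in>S. f s z) = (\<Sum>s\<in>S. circle_mean r (f s))"
  unfolding circle_mean_def
  by (simp add: contour_integral_sum circle_integrable assms sum_distrib_left)

lemma circle_mean_bound:
  assumes "0 < r" "continuous_on (sphere 0 r) f" "\<And>z. norm z = r \<Longrightarrow> norm (f z) \<le> B"
  shows "norm (circle_mean r f) \<le> B * r"
proof -
  have B: "0 \<le> B" using assms(3)[of "of_real r"] assms(1) norm_ge_zero order_trans
    by (metis norm_of_real abs_of_pos)
  have "(f has_contour_integral contour_integral (circlepath 0 r) f) (circlepath 0 r)"
    using circle_integrable[OF assms(1,2)] by (simp add: has_contour_integral_integral)
  from has_contour_integral_bound_circlepath[OF this B assms(1)] assms(3)
  have "norm (contour_integral (circlepath 0 r) f) \<le> B * (2 * pi * r)" by simp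
  then show ?thesis
    by (simp add: circle_mean_def norm_mult norm_divide field_simps)
qed

lemma circle_mean_integral:
  assumes "0 < r"
  shows "circle_mean r f =
    integral {0..1} (\<lambda>t. f (of_real r * exp (2 * of_real pi * \<i> * of_real t))
       * (of_real r * exp (2 * of_real pi * \<i> * of_real t)))"
proof -
  have "contour_integral (circlepath 0 r) f = integral {0..1} (\<lambda>t. (2 * of_real pi * \<i>) *
     (f (of_real r * exp (2 * of_real pi * \<i> * of_real t))
       * (of_real r * exp (2 * of_real pi * \<i> * of_real t))))"
    unfolding contour_integral_integral vector_derivative_circlepath
    by (intro integral_cong) (simp add: circlepath algebra_simps)
  then show ?thesis by (simp add: circle_mean_def)
qed

text \<open>The substitution \<open>z = exp s\<close> turns the annulus into a rectangle, which is
  convex, so Cauchy's theorem applies to a function holomorphic only in the interior. Continuity up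
  to the boundary is the right hypothesis because one of the two circles will be the unit circle,
  where the factors are only continuous.\<close>

lemma circle_mean_annulus:
  assumes "0 < r1" "r1 \<le> r2"
    and cont: "continuous_on {z. r1 \<le> norm z \<and> norm z \<le> r2} f"
    and hol: "f holomorphic_on {z. r1 < norm z \<and> norm z < r2}"
  shows "circle_mean r1 f = circle_mean r2 f"
proof (cases "r1 = r2")
  case False
  with assms have r: "r1 < r2" by simp
  \<comment> \<open>The factor \<open>exp s\<close> is the Jacobian of the substitution.\<close>
  define h where "h = (\<lambda>s. f (exp s) * exp s)"
  define S where "S = cbox (Complex (ln r1) 0) (Complex (ln r2) (2 * pi))"
  have rS: "r1 \<le> norm (exp s) \<and> norm (exp s) \<le> r2" if "s \<in> S" for s
  proof -
    have "ln r1 \<le> Re s" "Re s \<le> ln r2" using that by (auto simp: S_def in_cbox_complex_iff)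
    then have "exp (ln r1) \<le> exp (Re s)" "exp (Re s) \<le> exp (ln r2)" by (simp_all only: exp_le_cancel_iff)
    then show ?thesis using assms r by simp
  qed
  have conth: "continuous_on S h" unfolding h_def
    by (intro continuous_intros continuous_on_compose2[OF cont]) (use rS in auto)
  have holh: "h field_differentiable at s" if "s \<in> interior S - {}" for s
  proof -
    have "s \<in> box (Complex (ln r1) 0) (Complex (ln r2) (2 * pi))" using that by (simp add: S_def)
    then have "ln r1 < Re s" "Re s < ln r2" by (auto simp: in_box_complex_iff)
    then have "exp (ln r1) < exp (Re s)" "exp (Re s) < exp (ln r2)"
      by (simp_all only: exp_less_cancel_iff)
    then have "exp s \<in> {z. r1 < norm z \<and> norm z < r2}" using assms r by simp
    moreover have "open {z::complex. r1 < norm z \<and> norm z < r2}"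
      by (intro open_Collect_conj open_Collect_less continuous_intros)
    ultimately have "f field_differentiable at (exp s)"
      using hol holomorphic_on_imp_differentiable_at by blast
    then have "(f \<circ> exp) field_differentiable at s"
      by (intro field_differentiable_compose field_differentiable_within_exp)
    then show ?thesis unfolding h_def comp_def
      by (intro field_differentiable_mult field_differentiable_within_exp)
  qed
  define a1 a2 a3 a4 where a: "a1 = Complex (ln r1) 0" "a2 = Complex (ln r2) 0"
    "a3 = Complex (ln r2) (2*pi)" "a4 = Complex (ln r1) (2*pi)"
  have inS: "a1 \<in> S" "a2 \<in> S" "a3 \<in> S" "a4 \<in> S"
    using assms r by (auto simp: S_def a in_cbox_complex_iff)
  have cS: "convex S" by (simp add: S_def)
  have seg: "closed_segment x y \<subseteq> S" if "x \<in> S" "y \<in> S" for x y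
    using that cS by (simp add: closed_segment_subset)
  have int: "h contour_integrable_on linepath x y" if "x \<in> S" "y \<in> S" for x y
    by (rule contour_integrable_continuous_linepath, rule continuous_on_subset[OF conth seg[OF that]])
  let ?g = "linepath a1 a2 +++ linepath a2 a3 +++ linepath a3 a4 +++ linepath a4 a1"
  have "(h has_contour_integral 0) ?g"
    by (rule Cauchy_theorem_convex[OF conth cS finite.emptyI holh])
       (use seg inS in \<open>auto simp: path_image_join\<close>)
  then have "contour_integral ?g h = 0" by (rule contour_integral_unique)
  then have s: "contour_integral (linepath a1 a2) h + contour_integral (linepath a2 a3) h
     + contour_integral (linepath a3 a4) h + contour_integral (linepath a4 a1) h = 0"
    using int inS by (simp add: contour_integrable_joinI add.assoc)
  have r1: "contour_integral (linepath a3 a4) h = - contour_integral (linepath a4 a3) h"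
    "contour_integral (linepath a4 a1) h = - contour_integral (linepath a1 a4) h"
    by (intro contour_integral_reverse_linepath continuous_on_subset[OF conth seg] inS)+
  \<comment> \<open>The horizontal sides differ by the period of \<open>exp\<close>, so their
    contributions cancel.\<close>
  have per: "contour_integral (linepath a4 a3) h = contour_integral (linepath a1 a2) h"
  proof -
    have "h (linepath a4 a3 t) = h (linepath a1 a2 t)" for t
    proof -
      have "linepath a4 a3 t = linepath a1 a2 t + of_real (2 * pi) * \<i>"
        by (simp add: linepath_def a complex_eq_iff algebra_simps)
      then show ?thesis by (simp add: h_def exp_add)
    qed
    moreover have "a3 - a4 = a2 - a1" by (simp add: a complex_eq_iff)
    ultimately show ?thesis by (simp add: contour_integral_integral)
  qed
  have vert: "contour_integral (linepath (Complex (ln R) 0) (Complex (ln R) (2*pi))) h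
      = 2 * of_real pi * \<i> * circle_mean R f" if "R > 0" for R
  proof -
    have e: "exp (linepath (Complex (ln R) 0) (Complex (ln R) (2*pi)) t)
       = of_real R * exp (2 * of_real pi * \<i> * of_real t)" for t
    proof -
      have "linepath (Complex (ln R) 0) (Complex (ln R) (2*pi)) t
        = of_real (ln R) + 2 * of_real pi * \<i> * of_real t"
        by (simp add: linepath_def complex_eq_iff algebra_simps)
      then show ?thesis using that by (simp add: exp_add exp_of_real)
    qed
    have d: "Complex (ln R) (2*pi) - Complex (ln R) 0 = 2 * of_real pi * \<i>"
      by (simp add: complex_eq_iff)
    show ?thesis
      unfolding contour_integral_integral circle_mean_integral[OF that] vector_derivative_linepath_at d h_def e
      by (simp add: mult.commute)
  qed
  have "contour_integral (linepath a2 a3) h = contour_integral (linepath a1 a4) h"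
    using s r1 per by (simp add: algebra_simps)
  then show ?thesis using vert[of r1] vert[of r2] assms(1) r by (simp add: a)
qed auto

lemma continuous_on_powi [continuous_intros]:
  fixes f :: "'a::topological_space \<Rightarrow> complex"
  shows "continuous_on S f \<Longrightarrow> (\<And>x. x \<in> S \<Longrightarrow> f x \<noteq> 0) \<Longrightarrow> continuous_on S (\<lambda>x. f x powi k)"
  by (intro continuous_on_power_int) auto

lemma circle_mean_powi:
  assumes "0 < r"
  shows "circle_mean r (\<lambda>z. z powi k) = (if k = -1 then 1 else 0)"
proof (cases "k = -1")
  case True
  have "contour_integral (circlepath 0 r) (\<lambda>z. z powi k) = contour_integral (circlepath 0 r) (\<lambda>z. 1 / (z - 0))"
    using True by (simp add: field_simps)
  also have "\<dots> = 2 * of_real pi * \<i>" by (rule contour_integral_circlepath[OF assms])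
  finally show ?thesis using True by (simp add: circle_mean_def)
next
  case False
  have nz: "(of_int k + 1 :: complex) \<noteq> 0"
    using False by (metis add.commute add_eq_0_iff of_int_1 of_int_add of_int_eq_0_iff)
  have "((\<lambda>z. z powi k) has_contour_integral 0) (circlepath 0 r)"
  proof (rule Cauchy_theorem_primitive[where S="-{0}" and f="\<lambda>z. z powi (k+1) / (of_int k + 1)"])
    fix x :: complex assume x: "x \<in> - {0}"
    have "((\<lambda>z. z powi (k+1) / (of_int k + 1)) has_field_derivative
       (of_int (k+1) * x powi (k+1-1) * 1) / (of_int k + 1)) (at x within - {0})"
      using x by (intro derivative_intros DERIV_cdivide) auto
    then show "((\<lambda>z. z powi (k+1) / (of_int k + 1)) has_field_derivative x powi k) (at x within - {0})"
      using nz by simp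
  qed (use assms in auto)
  then show ?thesis using False by (simp add: circle_mean_def contour_integral_unique)
qed

text \<open>The M-test gives uniform convergence along the net of finite subsets, so one statement
  serves sums over integers and over naturals.\<close>

lemma circle_mean_has_sum:
  assumes r: "0 < r" and c: "\<And>s. s \<in> S \<Longrightarrow> continuous_on (sphere 0 r) (f s)"
    and b: "\<And>s z. s \<in> S \<Longrightarrow> norm z = r \<Longrightarrow> norm (f s z) \<le> M s" and M: "M summable_on S"
  shows "((\<lambda>s. circle_mean r (f s)) has_sum circle_mean r (\<lambda>z. \<Sum>\<^sub>\<infinity>s\<in>S. f s z)) S"
proof -
  have u: "uniform_limit (path_image (circlepath 0 r)) (\<lambda>F z. \<Sum>s\<in>F. f s z) (\<lambda>z. \<Sum>\<^sub>\<infinity>s\<in>S. f s z) (finite_subsets_at_top S)"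
    by (rule Weierstrass_m_test_general[OF _ M]) (use b r in auto)
  have "\<forall>\<^sub>F F in finite_subsets_at_top S. (\<lambda>z. \<Sum>s\<in>F. f s z) contour_integrable_on circlepath 0 r"
    by (rule eventually_finite_subsets_at_top_weakI)
       (intro circle_integrable r continuous_on_sum c, auto)
  from contour_integral_uniform_limit_circlepath(2)[OF this _ _ r] u r
  have "((\<lambda>F. contour_integral (circlepath 0 r) (\<lambda>z. \<Sum>s\<in>F. f s z)) \<longlongrightarrow>
     contour_integral (circlepath 0 r) (\<lambda>z. \<Sum>\<^sub>\<infinity>s\<in>S. f s z)) (finite_subsets_at_top S)" by simp
  then have "((\<lambda>F. circle_mean r (\<lambda>z. \<Sum>s\<in>F. f s z)) \<longlongrightarrow>
     circle_mean r (\<lambda>z. \<Sum>\<^sub>\<infinity>s\<in>S. f s z)) (finite_subsets_at_top S)"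
    unfolding circle_mean_def by (intro tendsto_intros)
  then show ?thesis unfolding has_sum_def
    by (rule Lim_transform_eventually)
       (rule eventually_finite_subsets_at_top_weakI, rule circle_mean_sum[OF r], use c in auto)
qed

lemma continuous_on_infsum_circle:
  fixes f :: "'s \<Rightarrow> complex \<Rightarrow> complex"
  assumes r: "0 < r" and c: "\<And>s. s \<in> S \<Longrightarrow> continuous_on (sphere 0 r) (f s)"
    and b: "\<And>s z. s \<in> S \<Longrightarrow> norm z = r \<Longrightarrow> norm (f s z) \<le> M s" and M: "M summable_on S"
  shows "continuous_on (sphere 0 r) (\<lambda>z. \<Sum>\<^sub>\<infinity>s\<in>S. f s z)"
proof (rule uniform_limit_theorem)
  show "uniform_limit (sphere 0 r) (\<lambda>F z. \<Sum>s\<in>F. f s z) (\<lambda>z. \<Sum>\<^sub>\<infinity>s\<in>S. f s z) (finite_subsets_at_top S)"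
    by (rule Weierstrass_m_test_general[OF _ M]) (use b r in auto)
qed (auto intro!: eventually_finite_subsets_at_top_weakI continuous_on_sum c)

text \<open>The class of multipliers preserving the vanishing of all Fourier coefficients contains the
  coordinate functions and is closed under sums and products, so Stone--Weierstrass applies.\<close>

lemma continuous_on_real_polynomial_function:
  fixes q :: "complex \<Rightarrow> real"
  assumes "real_polynomial_function q"
  shows "continuous_on S q"
  using assms continuous_on_polymonial_function[of q S] real_polynomial_function_eq[of q] by blast

lemma vanishing_coeffs_polynomial:
  assumes "real_polynomial_function q" "continuous_on (sphere 0 1) f"
    and "\<And>k. circle_mean 1 (\<lambda>z. f z * z powi k) = 0"
  shows "circle_mean 1 (\<lambda>z. f z * of_real (q z) * z powi k) = 0"
  using assms
proof (induction q arbitrary: f k rule: real_polynomial_function.induct)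
  case (linear q f k)
  interpret q: bounded_linear q by fact
  define u v where "u = complex_of_real (q 1)" "v = complex_of_real (q \<i>)"
  have nz: "z \<noteq> 0" if "norm z = 1" for z :: complex using that by auto
  \<comment> \<open>On the unit circle \<open>cnj z = 1 / z\<close>, so a real-linear functional is
    a combination of \<open>z\<close> and \<open>1 / z\<close>. Multiplying by it only shifts the
    index of the Fourier coefficient by one in either direction.\<close>
  have "of_real (q z) = (u/2 + v/(2*\<i>)) * z + (u/2 - v/(2*\<i>)) * (1 / z)" if "norm z = 1" for z
  proof -
    have "z = Re z *\<^sub>R 1 + Im z *\<^sub>R \<i>" by (simp add: complex_eq_iff)
    then have "q z = Re z * q 1 + Im z * q \<i>" by (metis q.add q.scaleR real_scaleR_def)
    moreover have "1 / z = cnj z" using that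
      by (metis complex_div_cnj div_by_1 mult_1 of_real_1 power_one)
    moreover have "v / (2 * \<i>) = - \<i> * (v / 2)" by (simp add: complex_eq_iff)
    ultimately show ?thesis
      by (simp only:) (simp add: u_v_def complex_eq_iff field_simps)
  qed
  then have "circle_mean 1 (\<lambda>z. f z * of_real (q z) * z powi k) =
     circle_mean 1 (\<lambda>z. (u/2 + v/(2*\<i>)) * (f z * z powi (k+1)) + (u/2 - v/(2*\<i>)) * (f z * z powi (k-1)))"
  proof (intro circle_mean_cong)
    fix z :: complex assume z: "norm z = 1" and q: "\<And>z. norm z = 1 \<Longrightarrow> of_real (q z) = (u/2 + v/(2*\<i>)) * z + (u/2 - v/(2*\<i>)) * (1 / z)"
    have p: "z powi (k+1) = z powi k * z" "z powi (k-1) = z powi k * (1 / z)"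
      using nz[OF z] by (auto simp: power_int_add power_int_diff)
    show "f z * of_real (q z) * z powi k =
      (u/2 + v/(2*\<i>)) * (f z * z powi (k+1)) + (u/2 - v/(2*\<i>)) * (f z * z powi (k-1))"
      unfolding q[OF z] p by (simp only: algebra_simps)
  qed auto
  also have "\<dots> = (u/2 + v/(2*\<i>)) * circle_mean 1 (\<lambda>z. f z * z powi (k+1))
     + (u/2 - v/(2*\<i>)) * circle_mean 1 (\<lambda>z. f z * z powi (k-1))"
    using linear.prems(1)
    by (subst circle_mean_add) (auto intro!: continuous_intros circle_mean_cmult arg_cong2[of _ _ _ _ "(+)"])
  finally show ?case by (simp add: linear.prems)
next
  case (const c f k)
  have "circle_mean 1 (\<lambda>z. f z * of_real c * z powi k) = circle_mean 1 (\<lambda>z. of_real c * (f z * z powi k))"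
    by (simp add: mult_ac)
  also have "\<dots> = of_real c * circle_mean 1 (\<lambda>z. f z * z powi k)"
    using const.prems by (intro circle_mean_cmult) (auto intro!: continuous_intros)
  finally show ?case using const.prems by simp
next
  case (add q1 q2 f k)
  have c: "continuous_on (sphere 0 1) q1" "continuous_on (sphere 0 1) q2"
    using add.hyps by (auto intro: continuous_on_real_polynomial_function)
  have "circle_mean 1 (\<lambda>z. f z * of_real (q1 z + q2 z) * z powi k) =
    circle_mean 1 (\<lambda>z. f z * of_real (q1 z) * z powi k + f z * of_real (q2 z) * z powi k)"
    by (simp add: algebra_simps)
  also have "\<dots> = circle_mean 1 (\<lambda>z. f z * of_real (q1 z) * z powi k) + circle_mean 1 (\<lambda>z. f z * of_real (q2 z) * z powi k)"
    using add.prems c by (intro circle_mean_add) (auto intro!: continuous_intros)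
  also have "\<dots> = 0" using add.IH(1)[OF add.prems] add.IH(2)[OF add.prems] by simp
  finally show ?case .
next
  case (mult q1 q2 f k)
  have c: "continuous_on (sphere 0 1) q1"
    using mult.hyps by (auto intro: continuous_on_real_polynomial_function)
  have "circle_mean 1 (\<lambda>z. (f z * of_real (q1 z)) * of_real (q2 z) * z powi k) = 0"
  proof (rule mult.IH(2))
    show "continuous_on (sphere 0 1) (\<lambda>z. f z * complex_of_real (q1 z))"
      using mult.prems c by (intro continuous_intros)
    show "circle_mean 1 (\<lambda>z. f z * complex_of_real (q1 z) * z powi k) = 0" for k
      by (rule mult.IH(1)) (use mult.prems in auto)
  qed
  then show ?case by (simp add: mult_ac)
qed

text \<open>Vanishing coefficients make the mean of \<open>f\<close> times any real polynomial in
  the coordinates zero. Approximating \<open>cnj f\<close> by such polynomials shows that the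
  squared modulus of \<open>f\<close> has mean zero, and a continuous non-negative function with
  zero integral vanishes.\<close>

lemma fourier_unique:
  assumes f: "continuous_on (sphere 0 1) f"
    and 0: "\<And>k. circle_mean 1 (\<lambda>z. f z * z powi k) = 0" and z: "norm z = 1"
  shows "f z = 0"
proof -
  obtain B where "\<And>z. z \<in> sphere 0 1 \<Longrightarrow> norm (f z) \<le> B"
    using compact_imp_bounded[OF compact_continuous_image[OF f compact_sphere]]
    unfolding bounded_iff by blast
  then have B: "\<And>z. norm z = 1 \<Longrightarrow> norm (f z) \<le> B" by simp
  have B0: "B \<ge> 0" using B[OF z] norm_ge_zero order_trans by blast
  let ?I = "circle_mean 1 (\<lambda>z. f z * cnj (f z) * z powi (-1))"
  have small: "norm ?I \<le> B * e" if e: "e > 0" for e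
  proof -
    obtain g where g: "polynomial_function g" "\<And>x. x \<in> sphere 0 1 \<Longrightarrow> norm (cnj (f x) - g x) < e"
      using Stone_Weierstrass_polynomial_function[OF compact_sphere, of 0 1 "\<lambda>x. cnj (f x)" e] f e
      by (auto intro: continuous_on_cnj)
    have gr: "real_polynomial_function (\<lambda>x. Re (g x))" "real_polynomial_function (\<lambda>x. Im (g x))"
      using g(1) by (auto simp: polynomial_function_iff_Basis_inner Basis_complex_def inner_complex_def)
    have cg: "continuous_on (sphere 0 1) g" using g(1) by (rule continuous_on_polymonial_function)
    have "circle_mean 1 (\<lambda>z. f z * g z * z powi (-1)) =
       circle_mean 1 (\<lambda>z. f z * of_real (Re (g z)) * z powi (-1) + \<i> * (f z * of_real (Im (g z)) * z powi (-1)))"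
    proof (rule circle_mean_cong)
      fix z :: complex
      have "f z * (of_real (Re (g z)) + \<i> * of_real (Im (g z))) * z powi (-1) =
        f z * of_real (Re (g z)) * z powi (-1) + \<i> * (f z * of_real (Im (g z)) * z powi (-1))"
        by (simp only: algebra_simps)
      then show "f z * g z * z powi (-1) =
        f z * of_real (Re (g z)) * z powi (-1) + \<i> * (f z * of_real (Im (g z)) * z powi (-1))"
        by (simp only: complex_eq[symmetric])
    qed simp
    also have "\<dots> = circle_mean 1 (\<lambda>z. f z * of_real (Re (g z)) * z powi (-1))
       + \<i> * circle_mean 1 (\<lambda>z. f z * of_real (Im (g z)) * z powi (-1))"
      using cg f by (subst circle_mean_add) (auto intro!: continuous_intros circle_mean_cmult arg_cong2[of _ _ _ _ "(+)"])
    also have "\<dots> = 0"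
      by (simp only: vanishing_coeffs_polynomial[OF gr(1) f 0] vanishing_coeffs_polynomial[OF gr(2) f 0]
        mult_zero_right add_0_right)
    finally have z0: "circle_mean 1 (\<lambda>z. f z * g z * z powi (-1)) = 0" .
    have "?I = circle_mean 1 (\<lambda>z. f z * cnj (f z) * z powi (-1)) - circle_mean 1 (\<lambda>z. f z * g z * z powi (-1))"
      using z0 by simp
    also have "\<dots> = circle_mean 1 (\<lambda>z. f z * cnj (f z) * z powi (-1) - f z * g z * z powi (-1))"
      using f cg by (intro circle_mean_diff[symmetric]) (auto intro!: continuous_intros)
    also have "norm \<dots> \<le> (B * e) * 1"
    proof (rule circle_mean_bound)
      show "continuous_on (sphere 0 1) (\<lambda>z. f z * cnj (f z) * z powi (-1) - f z * g z * z powi (-1))"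
        using f cg by (auto intro!: continuous_intros)
      fix z :: complex assume z: "norm z = 1"
      have "norm (f z * cnj (f z) * z powi (-1) - f z * g z * z powi (-1)) = norm (f z) * norm (cnj (f z) - g z)"
        using z by (simp flip: norm_mult add: left_diff_distrib[symmetric] right_diff_distrib[symmetric])
           (simp add: norm_mult norm_inverse)
      also have "\<dots> \<le> B * e" using B[OF z] g(2)[of z] z B0 by (intro mult_mono) auto
      finally show "norm (f z * cnj (f z) * z powi (-1) - f z * g z * z powi (-1)) \<le> B * e" .
    qed simp
    finally show ?thesis by simp
  qed
  have "norm ?I \<le> 0"
  proof (rule field_le_epsilon)
    fix e :: real assume "e > 0"
    \<comment> \<open>Division by \<open>B + 1\<close> instead of \<open>B\<close>, because
      \<open>B\<close> may be 0.\<close>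
    then have "norm ?I \<le> B * (e / (B + 1))" by (intro small) (use B0 in auto)
    also have "\<dots> \<le> e" using B0 \<open>e > 0\<close> by (simp add: field_simps)
    finally show "norm ?I \<le> 0 + e" by simp
  qed
  then have I0: "?I = 0" by simp
  \<comment> \<open>Parametrizing the circle turns the mean of \<open>f * cnj f / z\<close> into an
    integral of a non-negative real function.\<close>
  define w where "w = (\<lambda>t::real. exp (2 * of_real pi * \<i> * of_real t))"
  have nw: "norm (w t) = 1" for t by (simp add: w_def)
  have cw: "continuous_on {0..1} w" unfolding w_def by (intro continuous_intros)
  have one_pos: "(0::real) < 1" by simp
  have cn: "continuous_on {0..1} (\<lambda>t. norm (f (w t)) ^ 2)"
    by (intro continuous_intros continuous_on_compose2[OF f cw]) (use nw in auto)
  have "?I = integral {0..1} (\<lambda>t. of_real (norm (f (w t)) ^ 2))"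
    unfolding circle_mean_integral[OF one_pos]
  proof (intro integral_cong, goal_cases)
    case (1 t)
    have "w t \<noteq> 0" by (simp add: w_def)
    moreover have "complex_of_real 1 * exp (2 * of_real pi * \<i> * of_real t) = w t" by (simp add: w_def)
    ultimately show ?case by (simp only: complex_norm_square) (simp add: complex_norm_square field_simps)
  qed
  also have "\<dots> = of_real (integral {0..1} (\<lambda>t. norm (f (w t)) ^ 2))"
    by (rule integral_linear[OF integrable_continuous_real[OF cn] bounded_linear_of_real, unfolded o_def])
  finally have "integral {0..1} (\<lambda>t. norm (f (w t)) ^ 2) = 0" using I0 by simp
  then have all: "f (w t) = 0" if "t \<in> {0..1}" for t
    using integral_eq_0_iff[OF cn] that by auto
  have "z \<in> path_image (circlepath 0 1)" using z by simp
  then obtain t where "t \<in> {0..1}" "z = circlepath 0 1 t" by (auto simp: path_image_def)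
  then show ?thesis using all by (simp add: w_def circlepath)
qed

section \<open>Absolutely convergent Fourier series\<close>

definition fcoef :: "(complex \<Rightarrow> complex) \<Rightarrow> int \<Rightarrow> complex" where
  "fcoef f k = circle_mean 1 (\<lambda>z. f z * z powi (- k - 1))"

text \<open>The series defines a continuous function with the same coefficients as \<open>f\<close>,
  so the difference vanishes by \<open>fourier_unique\<close>. Summability will come from geometric
  decay.\<close>

lemma fourier_series:
  assumes f: "continuous_on (sphere 0 1) f" and s: "(\<lambda>k. norm (fcoef f k)) summable_on UNIV"
    and z: "norm z = 1"
  shows "f z = (\<Sum>\<^sub>\<infinity>k. fcoef f k * z powi k)"
proof -
  define g where "g = (\<lambda>z. \<Sum>\<^sub>\<infinity>k. fcoef f k * z powi k)"
  have b: "norm (fcoef f k * z powi k) \<le> norm (fcoef f k)" if "norm z = 1" for k z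
    using that by (simp add: norm_mult norm_power_int)
  have cg: "continuous_on (sphere 0 1) g" unfolding g_def
    by (rule continuous_on_infsum_circle[OF _ _ b s]) (auto intro!: continuous_intros)
  have "fcoef f j = circle_mean 1 (\<lambda>z. g z * z powi (-j-1))" for j
  proof -
    have "((\<lambda>k. circle_mean 1 (\<lambda>z. fcoef f k * z powi k * z powi (-j-1))) has_sum
        circle_mean 1 (\<lambda>z. \<Sum>\<^sub>\<infinity>k. fcoef f k * z powi k * z powi (-j-1))) UNIV"
      by (rule circle_mean_has_sum[OF _ _ _ s])
         (auto intro!: continuous_intros simp: norm_mult norm_power_int)
    also have "(\<lambda>k. circle_mean 1 (\<lambda>z. fcoef f k * z powi k * z powi (-j-1))) = (\<lambda>k. if k = j then fcoef f j else 0)"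
    proof
      fix k
      have "circle_mean 1 (\<lambda>z. fcoef f k * z powi k * z powi (-j-1)) = circle_mean 1 (\<lambda>z. fcoef f k * z powi (k-j-1))"
      proof (rule circle_mean_cong)
        fix z :: complex assume "norm z = 1"
        then have "z \<noteq> 0" by auto
        then show "fcoef f k * z powi k * z powi (-j-1) = fcoef f k * z powi (k-j-1)"
          by (simp add: power_int_add[symmetric] algebra_simps)
      qed simp
      also have "\<dots> = fcoef f k * circle_mean 1 (\<lambda>z. z powi (k-j-1))"
        by (rule circle_mean_cmult) (auto intro!: continuous_intros)
      finally show "circle_mean 1 (\<lambda>z. fcoef f k * z powi k * z powi (-j-1)) = (if k = j then fcoef f j else 0)"
        by (simp add: circle_mean_powi)
    qed
    finally have 1: "((\<lambda>k. if k = j then fcoef f j else 0) has_sum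
      circle_mean 1 (\<lambda>z. \<Sum>\<^sub>\<infinity>k. fcoef f k * z powi k * z powi (-j-1))) UNIV" .
    have "((\<lambda>k. if k = j then fcoef f j else 0) has_sum fcoef f j) UNIV"
      by (rule has_sum_finite_neutralI[of "{j}"]) auto
    with 1 have "fcoef f j = circle_mean 1 (\<lambda>z. \<Sum>\<^sub>\<infinity>k. fcoef f k * z powi k * z powi (-j-1))"
      using has_sum_unique by blast
    also have "\<dots> = circle_mean 1 (\<lambda>z. g z * z powi (-j-1))"
      unfolding g_def by (subst infsum_cmult_left') simp
    finally show ?thesis .
  qed
  then have "circle_mean 1 (\<lambda>z. (f z - g z) * z powi k) = 0" for k
  proof -
    have "circle_mean 1 (\<lambda>z. (f z - g z) * z powi k) = fcoef f (-k-1) - circle_mean 1 (\<lambda>z. g z * z powi (-(-k-1)-1))"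
      unfolding fcoef_def
      by (subst circle_mean_diff[symmetric]) (use f cg in \<open>auto intro!: continuous_intros simp: algebra_simps\<close>)
    then show ?thesis using \<open>\<And>j. fcoef f j = _\<close> by simp
  qed
  from fourier_unique[OF _ this z] f cg have "f z - g z = 0" by (auto intro: continuous_intros)
  then show ?thesis by (simp add: g_def)
qed

text \<open>Only \<open>f\<close> is expanded; integrating its series term by term against the
  bounded function \<open>g\<close> gives the convolution.\<close>

lemma fcoef_mult_has_sum:
  assumes f: "continuous_on (sphere 0 1) f" and s: "(\<lambda>k. norm (fcoef f k)) summable_on UNIV"
    and g: "continuous_on (sphere 0 1) g"
  shows "((\<lambda>l. fcoef f l * fcoef g (k - l)) has_sum fcoef (\<lambda>z. f z * g z) k) UNIV"
proof -
  obtain B where "\<And>z. z \<in> sphere 0 1 \<Longrightarrow> norm (g z) \<le> B"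
    using compact_imp_bounded[OF compact_continuous_image[OF g compact_sphere]]
    unfolding bounded_iff by blast
  then have B: "\<And>z. norm z = 1 \<Longrightarrow> norm (g z) \<le> B" by simp
  have 1: "((\<lambda>l. circle_mean 1 (\<lambda>z. fcoef f l * (z powi l * g z * z powi (-k-1)))) has_sum
        circle_mean 1 (\<lambda>z. \<Sum>\<^sub>\<infinity>l. fcoef f l * (z powi l * g z * z powi (-k-1)))) UNIV"
  proof (rule circle_mean_has_sum)
    show "(\<lambda>k. norm (fcoef f k) * B) summable_on UNIV" using s by (rule summable_on_cmult_left)
    show "norm (fcoef f l * (z powi l * g z * z powi (-k-1))) \<le> norm (fcoef f l) * B"
      if "l \<in> UNIV" "norm z = 1" for l z
      using that B[OF that(2)] by (simp add: norm_mult norm_power_int mult_left_mono)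
  qed (use g in \<open>auto intro!: continuous_intros\<close>)
  have 2: "(\<lambda>l. circle_mean 1 (\<lambda>z. fcoef f l * (z powi l * g z * z powi (-k-1)))) = (\<lambda>l. fcoef f l * fcoef g (k - l))"
  proof
    fix l
    have "circle_mean 1 (\<lambda>z. fcoef f l * (z powi l * g z * z powi (-k-1)))
      = fcoef f l * circle_mean 1 (\<lambda>z. z powi l * g z * z powi (-k-1))"
      using g by (intro circle_mean_cmult) (auto intro!: continuous_intros)
    also have "circle_mean 1 (\<lambda>z. z powi l * g z * z powi (-k-1)) = fcoef g (k-l)"
      unfolding fcoef_def
    proof (rule circle_mean_cong)
      fix z :: complex assume "norm z = 1"
      then have "z \<noteq> 0" by auto
      then have "z powi l * z powi (-k-1) = z powi (-(k-l)-1)"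
        by (simp add: power_int_add[symmetric] algebra_simps)
      then show "z powi l * g z * z powi (-k-1) = g z * z powi (-(k-l)-1)"
        by (metis mult.assoc mult.commute)
    qed simp
    finally show "circle_mean 1 (\<lambda>z. fcoef f l * (z powi l * g z * z powi (-k-1))) = fcoef f l * fcoef g (k - l)" .
  qed
  have 3: "circle_mean 1 (\<lambda>z. \<Sum>\<^sub>\<infinity>l. fcoef f l * (z powi l * g z * z powi (-k-1))) = fcoef (\<lambda>z. f z * g z) k"
    unfolding fcoef_def[of "\<lambda>z. f z * g z"]
  proof (rule circle_mean_cong)
    fix z :: complex assume z: "norm z = 1"
    have "(\<Sum>\<^sub>\<infinity>l. fcoef f l * (z powi l * g z * z powi (-k-1))) = (\<Sum>\<^sub>\<infinity>l. (fcoef f l * z powi l) * (g z * z powi (-k-1)))"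
      by (simp add: mult_ac)
    also have "\<dots> = (\<Sum>\<^sub>\<infinity>l. (fcoef f l * z powi l)) * (g z * z powi (-k-1))" by (rule infsum_cmult_left')
    also have "\<dots> = f z * g z * z powi (-k-1)" using fourier_series[OF f s z] by simp
    finally show "(\<Sum>\<^sub>\<infinity>l. fcoef f l * (z powi l * g z * z powi (-k-1))) = f z * g z * z powi (-k-1)" .
  qed simp
  show ?thesis using 1 unfolding 2 3 .
qed

section \<open>Non-intersecting paths\<close>

lemma det_rows_sum_expand:
  fixes F :: "nat \<Rightarrow> 'c \<Rightarrow> 'a::comm_ring_1" and G :: "'c \<Rightarrow> nat \<Rightarrow> 'a"
  assumes W: "finite W"
  shows "Determinant.det (Matrix.mat k k (\<lambda>(i,j). \<Sum>u\<in>W. F i u * G u j)) =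
    (\<Sum>f\<in>{0..<k} \<rightarrow>\<^sub>E W. (\<Prod>i<k. F i (f i)) * Determinant.det (Matrix.mat k k (\<lambda>(i,j). G (f i) j)))"
proof -
  have "Determinant.det (Matrix.mat k k (\<lambda>(i,j). \<Sum>u\<in>W. F i u * G u j)) =
     (\<Sum>\<pi>\<in>{\<pi>. \<pi> permutes {0..<k}}. signof \<pi> * (\<Prod>i=0..<k. \<Sum>u\<in>W. F i u * G u (\<pi> i)))"
  proof (subst det_def'[of _ k], simp, rule sum.cong[OF refl])
    fix \<pi> assume "\<pi> \<in> {\<pi>. \<pi> permutes {0..<k}}"
    then have "\<pi> i < k" if "i < k" for i using that permutes_in_image[of \<pi> "{0..<k}" i] by auto
    then show "signof \<pi> * (\<Prod>i=0..<k. Matrix.mat k k (\<lambda>(i,j). \<Sum>u\<in>W. F i u * G u j) $$ (i, \<pi> i)) =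
       signof \<pi> * (\<Prod>i=0..<k. \<Sum>u\<in>W. F i u * G u (\<pi> i))" by simp
  qed
  also have "\<dots> = (\<Sum>\<pi>\<in>{\<pi>. \<pi> permutes {0..<k}}. signof \<pi> *
       (\<Sum>f\<in>{0..<k} \<rightarrow>\<^sub>E W. \<Prod>i=0..<k. F i (f i) * G (f i) (\<pi> i)))"
    by (intro sum.cong refl, subst prod_sum_PiE) (use W in auto)
  also have "\<dots> = (\<Sum>f\<in>{0..<k} \<rightarrow>\<^sub>E W. \<Sum>\<pi>\<in>{\<pi>. \<pi> permutes {0..<k}}. signof \<pi> *
       (\<Prod>i=0..<k. F i (f i) * G (f i) (\<pi> i)))"
    by (simp add: sum_distrib_left) (rule sum.swap)
  also have "\<dots> = (\<Sum>f\<in>{0..<k} \<rightarrow>\<^sub>E W. (\<Prod>i<k. F i (f i)) *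
     Determinant.det (Matrix.mat k k (\<lambda>(i,j). G (f i) j)))"
  proof (rule sum.cong[OF refl])
    fix f
    show "(\<Sum>\<pi>\<in>{\<pi>. \<pi> permutes {0..<k}}. signof \<pi> * (\<Prod>i=0..<k. F i (f i) * G (f i) (\<pi> i))) =
      (\<Prod>i<k. F i (f i)) * Determinant.det (Matrix.mat k k (\<lambda>(i,j). G (f i) j))"
    proof (subst det_def'[of _ k], simp, unfold sum_distrib_left, rule sum.cong[OF refl])
      fix \<pi> assume "\<pi> \<in> {\<pi>. \<pi> permutes {0..<k}}"
      then have "\<pi> i < k" if "i < k" for i using that permutes_in_image[of \<pi> "{0..<k}" i] by auto
      then show "signof \<pi> * (\<Prod>i=0..<k. F i (f i) * G (f i) (\<pi> i)) =
        (\<Prod>i<k. F i (f i)) * (signof \<pi> * (\<Prod>i=0..<k. Matrix.mat k k (\<lambda>(i,j). G (f i) j) $$ (i, \<pi> i)))"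
        by (simp add: prod.distrib atLeast0LessThan mult_ac)
    qed
  qed
  finally show ?thesis .
qed

text \<open>An injective choice of columns is a $k$-subset of \<open>W\<close> together with a permutation.\<close>

lemma cauchy_binet:
  fixes F :: "nat \<Rightarrow> 'c::linorder \<Rightarrow> 'a::comm_ring_1" and G :: "'c \<Rightarrow> nat \<Rightarrow> 'a"
  assumes W: "finite W"
  shows "Determinant.det (Matrix.mat k k (\<lambda>(i,j). \<Sum>u\<in>W. F i u * G u j)) =
    (\<Sum>U\<in>{U. U \<subseteq> W \<and> card U = k}.
       Determinant.det (Matrix.mat k k (\<lambda>(i,j). F i (sorted_list_of_set U ! j))) *
       Determinant.det (Matrix.mat k k (\<lambda>(i,j). G (sorted_list_of_set U ! i) j)))"
proof -
  define \<Phi> where "\<Phi> = (\<lambda>f. (\<Prod>i<k. F i (f i)) * Determinant.det (Matrix.mat k k (\<lambda>(i,j). G (f i) j)))"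
  define I where "I = {f \<in> {0..<k} \<rightarrow>\<^sub>E W. inj_on f {0..<k}}"
  have fin: "finite ({0..<k} \<rightarrow>\<^sub>E W)" using W by (intro finite_PiE) auto
  have "(\<Sum>f\<in>{0..<k} \<rightarrow>\<^sub>E W. \<Phi> f) = (\<Sum>f\<in>I. \<Phi> f)"
  proof (rule sum.mono_neutral_right[OF fin])
    show "\<forall>f\<in>({0..<k} \<rightarrow>\<^sub>E W) - I. \<Phi> f = 0"
    proof
      fix f assume "f \<in> ({0..<k} \<rightarrow>\<^sub>E W) - I"
      then have "\<not> inj_on f {0..<k}" by (simp add: I_def)
      then obtain i j where ij: "i < k" "j < k" "i \<noteq> j" "f i = f j" unfolding inj_on_def by auto
      have "Determinant.det (Matrix.mat k k (\<lambda>(i,j). G (f i) j)) = 0"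
        by (rule det_identical_rows[of _ k i j]) (use ij in \<open>auto simp: Matrix.row_def\<close>)
      then show "\<Phi> f = 0" by (simp add: \<Phi>_def)
    qed
  qed (auto simp: I_def)
  also have "\<dots> = (\<Sum>U\<in>{U. U \<subseteq> W \<and> card U = k}. \<Sum>f\<in>{f\<in>I. f ` {0..<k} = U}. \<Phi> f)"
    by (rule sum.group[symmetric]) (use fin W in \<open>auto simp: I_def card_image\<close>)
  also have "\<dots> = (\<Sum>U\<in>{U. U \<subseteq> W \<and> card U = k}.
       Determinant.det (Matrix.mat k k (\<lambda>(i,j). F i (sorted_list_of_set U ! j))) *
       Determinant.det (Matrix.mat k k (\<lambda>(i,j). G (sorted_list_of_set U ! i) j)))"
  proof (rule sum.cong[OF refl])
    fix U assume "U \<in> {U. U \<subseteq> W \<and> card U = k}"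
    then have U: "U \<subseteq> W" "card U = k" "finite U" using W finite_subset by auto
    define e where "e = (\<lambda>i. sorted_list_of_set U ! i)"
    have e: "bij_betw e {0..<k} U" unfolding e_def
      using bij_betw_nth[of "sorted_list_of_set U" "{0..<k}" U] U by (simp add: atLeast0LessThan)
    define g where "g = inv_into {0..<k} e"
    have ge: "g (e i) = i" if "i < k" for i unfolding g_def
      using that e by (intro inv_into_f_f) (auto simp: bij_betw_def)
    have eg: "e (g u) = u" "g u < k" if "u \<in> U" for u
      using that e f_inv_into_f[of u e "{0..<k}"] inv_into_into[of u e "{0..<k}"]
      by (auto simp: g_def bij_betw_def)
    define mk where "mk = (\<lambda>\<pi>. restrict (\<lambda>i. e (\<pi> i)) {0..<k})"
    have "(\<Sum>f\<in>{f\<in>I. f ` {0..<k} = U}. \<Phi> f) = (\<Sum>\<pi>\<in>{\<pi>. \<pi> permutes {0..<k}}. \<Phi> (mk \<pi>))"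
    proof (rule sum.reindex_bij_witness[where j="\<lambda>f i. if i < k then g (f i) else i" and i=mk])
      fix f assume f: "f \<in> {f \<in> I. f ` {0..<k} = U}"
      then have fI: "inj_on f {0..<k}" "f ` {0..<k} = U" "f \<in> {0..<k} \<rightarrow>\<^sub>E W" by (auto simp: I_def)
      let ?p = "\<lambda>i. if i < k then g (f i) else i"
      show "mk ?p = f"
      proof
        fix i show "mk ?p i = f i"
        proof (cases "i < k")
          case True
          then have "f i \<in> U" using fI(2) by auto
          then show ?thesis using True eg(1) by (simp add: mk_def)
        next
          case False
          then show ?thesis using PiE_arb[OF fI(3), of i] by (simp add: mk_def)
        qed
      qed
      have "bij_betw ?p {0..<k} {0..<k}"
      proof (rule bij_betw_imageI)
        show "inj_on ?p {0..<k}"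
        proof (rule inj_onI)
          fix i j assume ij: "i \<in> {0..<k}" "j \<in> {0..<k}" "?p i = ?p j"
          then have "e (g (f i)) = e (g (f j))" by auto
          moreover have "f i \<in> U" "f j \<in> U" using ij fI by auto
          ultimately have "f i = f j" using eg by metis
          then show "i = j" using ij fI by (auto dest: inj_onD)
        qed
        then show "?p ` {0..<k} = {0..<k}"
          by (intro endo_inj_surj) (use fI(2) eg(2) in force)+
      qed
      then have "?p permutes {0..<k}" by (rule bij_imp_permutes) simp
      then show "?p \<in> {\<pi>. \<pi> permutes {0..<k}}" by (simp only: mem_Collect_eq)
      show "\<Phi> (mk ?p) = \<Phi> f" using \<open>mk ?p = f\<close> by simp
    next
      fix \<pi> assume p: "\<pi> \<in> {\<pi>. \<pi> permutes {0..<k}}"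
      then have pl: "\<pi> i < k" if "i < k" for i using that permutes_in_image[of \<pi> "{0..<k}" i] by auto
      have pi: "inj_on \<pi> {0..<k}" "\<pi> ` {0..<k} = {0..<k}"
        using p by (auto simp: permutes_inj_on permutes_image)
      show "(\<lambda>i. if i < k then g (mk \<pi> i) else i) = \<pi>"
      proof
        fix i show "(if i < k then g (mk \<pi> i) else i) = \<pi> i"
          using permutes_not_in[of \<pi> "{0..<k}" i] p pl[of i] ge[of "\<pi> i"] by (simp add: mk_def)
      qed
      have im: "mk \<pi> ` {0..<k} = U"
      proof -
        have "mk \<pi> ` {0..<k} = e ` (\<pi> ` {0..<k})" by (auto simp: mk_def image_iff)
        then show ?thesis using pi e by (simp add: bij_betw_def)
      qed
      have "inj_on (mk \<pi>) {0..<k}"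
      proof -
        have "inj_on (\<lambda>i. e (\<pi> i)) {0..<k}"
          using comp_inj_on[OF pi(1), of e] pi(2) e by (simp add: bij_betw_def o_def)
        then show ?thesis by (auto simp: inj_on_def mk_def)
      qed
      moreover have "mk \<pi> \<in> {0..<k} \<rightarrow>\<^sub>E W" using im U by (auto simp: mk_def)
      ultimately show "mk \<pi> \<in> {f \<in> I. f ` {0..<k} = U}" using im by (auto simp: I_def)
    qed
    also have "\<dots> = (\<Sum>\<pi>\<in>{\<pi>. \<pi> permutes {0..<k}}. (signof \<pi> * (\<Prod>i=0..<k. F i (e (\<pi> i)))) *
       Determinant.det (Matrix.mat k k (\<lambda>(i,j). G (e i) j)))"
    proof (rule sum.cong[OF refl])
      fix \<pi> assume p: "\<pi> \<in> {\<pi>. \<pi> permutes {0..<k}}"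
      then have pl: "\<pi> i < k" if "i < k" for i using that permutes_in_image[of \<pi> "{0..<k}" i] by auto
      have "Matrix.mat k k (\<lambda>(i,j). G (mk \<pi> i) j) =
         Matrix.mat k k (\<lambda>(i,j). Matrix.mat k k (\<lambda>(i,j). G (e i) j) $$ (\<pi> i, j))"
        by (rule eq_matI) (auto simp: mk_def pl)
      then have "Determinant.det (Matrix.mat k k (\<lambda>(i,j). G (mk \<pi> i) j)) =
         signof \<pi> * Determinant.det (Matrix.mat k k (\<lambda>(i,j). G (e i) j))"
        using det_permute_rows[of "Matrix.mat k k (\<lambda>(i,j). G (e i) j)" k \<pi>] p by simp
      moreover have "(\<Prod>i<k. F i (mk \<pi> i)) = (\<Prod>i=0..<k. F i (e (\<pi> i)))"
        by (auto simp: mk_def atLeast0LessThan intro!: prod.cong)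
      ultimately show "\<Phi> (mk \<pi>) = (signof \<pi> * (\<Prod>i=0..<k. F i (e (\<pi> i)))) *
       Determinant.det (Matrix.mat k k (\<lambda>(i,j). G (e i) j))" by (simp add: \<Phi>_def mult_ac)
    qed
    also have "\<dots> = Determinant.det (Matrix.mat k k (\<lambda>(i,j). F i (e j))) *
       Determinant.det (Matrix.mat k k (\<lambda>(i,j). G (e i) j))"
    proof -
      have "Determinant.det (Matrix.mat k k (\<lambda>(i,j). F i (e j))) =
        (\<Sum>\<pi>\<in>{\<pi>. \<pi> permutes {0..<k}}. signof \<pi> * (\<Prod>i=0..<k. F i (e (\<pi> i))))"
      proof (subst det_def'[of _ k], simp, rule sum.cong[OF refl])
        fix \<pi> assume "\<pi> \<in> {\<pi>. \<pi> permutes {0..<k}}"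
        then have "\<pi> i < k" if "i < k" for i using that permutes_in_image[of \<pi> "{0..<k}" i] by auto
        then show "signof \<pi> * (\<Prod>i=0..<k. Matrix.mat k k (\<lambda>(i,j). F i (e j)) $$ (i, \<pi> i)) =
          signof \<pi> * (\<Prod>i=0..<k. F i (e (\<pi> i)))" by simp
      qed
      then show ?thesis by (simp only: sum_distrib_right)
    qed
    finally show "(\<Sum>f\<in>{f\<in>I. f ` {0..<k} = U}. \<Phi> f) =
      Determinant.det (Matrix.mat k k (\<lambda>(i,j). F i (sorted_list_of_set U ! j))) *
       Determinant.det (Matrix.mat k k (\<lambda>(i,j). G (sorted_list_of_set U ! i) j))"
      by (simp add: e_def)
  qed
  finally show ?thesis using det_rows_sum_expand[OF W, of k F G] by (simp add: \<Phi>_def)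
qed

text \<open>\<open>path_sum T V l u v\<close> sums over the paths from \<open>u\<close> on level 0 to \<open>v\<close> on level
  \<open>l + 1\<close> that stay in \<open>V m\<close> on the levels \<open>1, \<dots>, l\<close>.\<close>

primrec path_sum :: "(nat \<Rightarrow> int \<Rightarrow> int \<Rightarrow> complex) \<Rightarrow> (nat \<Rightarrow> int set) \<Rightarrow> nat \<Rightarrow> int \<Rightarrow> int \<Rightarrow> complex" where
  "path_sum T V 0 u v = T 1 u v"
| "path_sum T V (Suc l) u v = (\<Sum>\<^sub>\<infinity>w\<in>V (Suc l). path_sum T V l u w * T (Suc (Suc l)) w v)"

text \<open>This is \<open>pos\<close> with arbitrary end points. In the induction over the levels
  the points chosen on the last interior level become end points.\<close>

definition path_pos :: "nat \<Rightarrow> (nat \<Rightarrow> int) \<Rightarrow> (nat \<Rightarrow> int) \<Rightarrow> (nat \<Rightarrow> int set) \<Rightarrow> nat \<Rightarrow> nat \<Rightarrow> int" where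
  "path_pos N a b U m j = (if m = 0 then a j else if m = N then b j else sorted_list_of_set (U m) ! j)"

text \<open>\<open>cauchy_binet\<close> is applied on the last interior level, and the chosen set
  \<open>A\<close> then serves as the end configuration of shorter paths; hence \<open>b\<close> is
  arbitrary in the induction. Levels are finite here, and infinite ones are reached later as limits
  of windows.\<close>

lemma iterated_cauchy_binet:
  assumes "\<And>m. m \<in> {1..l} \<Longrightarrow> finite (V m)"
  shows "Determinant.det (Matrix.mat k k (\<lambda>(i,j). path_sum T V l (a i) (b j))) =
    (\<Sum>U\<in>PiE {1..l} (\<lambda>m. {A. A \<subseteq> V m \<and> card A = k}). \<Prod>m=1..Suc l.
       Determinant.det (Matrix.mat k k (\<lambda>(i,j). T m (path_pos (Suc l) a b U (m - 1) i) (path_pos (Suc l) a b U m j))))"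
  using assms
proof (induction l arbitrary: b)
  case 0
  then show ?case by (simp add: path_pos_def)
next
  case (Suc l)
  define X where "X = (\<lambda>m. {A. A \<subseteq> V m \<and> card A = k})"
  define D where "D = (\<lambda>m a b. Determinant.det (Matrix.mat k k (\<lambda>(i,j). T m (a i) (b j :: int))))"
  have fV: "finite (V (Suc l))" using Suc.prems by auto
  have ins: "{1..Suc l} = insert (Suc l) {1..l}" by auto
  have "Determinant.det (Matrix.mat k k (\<lambda>(i,j). path_sum T V (Suc l) (a i) (b j))) =
     (\<Sum>A\<in>X (Suc l). Determinant.det (Matrix.mat k k (\<lambda>(i,j). path_sum T V l (a i) (sorted_list_of_set A ! j))) *
       D (Suc (Suc l)) (\<lambda>i. sorted_list_of_set A ! i) b)"
    unfolding X_def D_def path_sum.simps infsum_finite[OF fV] by (rule cauchy_binet[OF fV])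
  also have "\<dots> = (\<Sum>A\<in>X (Suc l). \<Sum>U\<in>PiE {1..l} X. (\<Prod>m=1..Suc l.
       D m (path_pos (Suc l) a (\<lambda>j. sorted_list_of_set A ! j) U (m - 1)) (path_pos (Suc l) a (\<lambda>j. sorted_list_of_set A ! j) U m))
       * D (Suc (Suc l)) (\<lambda>i. sorted_list_of_set A ! i) b)"
    by (subst Suc.IH) (use Suc.prems in \<open>auto simp: X_def D_def sum_distrib_right\<close>)
  also have "\<dots> = (\<Sum>(A,U)\<in>X (Suc l) \<times> PiE {1..l} X. \<Prod>m=1..Suc (Suc l).
       D m (path_pos (Suc (Suc l)) a b (U(Suc l := A)) (m - 1)) (path_pos (Suc (Suc l)) a b (U(Suc l := A)) m))"
    unfolding sum.cartesian_product
  proof (rule sum.cong[OF refl], clarify)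
    fix A U
    have "(\<Prod>m=1..Suc l.
       D m (path_pos (Suc l) a (\<lambda>j. sorted_list_of_set A ! j) U (m - 1)) (path_pos (Suc l) a (\<lambda>j. sorted_list_of_set A ! j) U m))
      = (\<Prod>m=1..Suc l.
       D m (path_pos (Suc (Suc l)) a b (U(Suc l := A)) (m - 1)) (path_pos (Suc (Suc l)) a b (U(Suc l := A)) m))"
      by (rule prod.cong[OF refl], rule arg_cong2[of _ _ _ _ "D _"]) (auto simp: path_pos_def fun_eq_iff)
    moreover have "D (Suc (Suc l)) (\<lambda>i. sorted_list_of_set A ! i) b =
      D (Suc (Suc l)) (path_pos (Suc (Suc l)) a b (U(Suc l := A)) (Suc (Suc l) - 1)) (path_pos (Suc (Suc l)) a b (U(Suc l := A)) (Suc (Suc l)))"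
      by (rule arg_cong2[of _ _ _ _ "D _"]) (auto simp: path_pos_def fun_eq_iff)
    ultimately show "(\<Prod>m=1..Suc l.
       D m (path_pos (Suc l) a (\<lambda>j. sorted_list_of_set A ! j) U (m - 1)) (path_pos (Suc l) a (\<lambda>j. sorted_list_of_set A ! j) U m))
       * D (Suc (Suc l)) (\<lambda>i. sorted_list_of_set A ! i) b = (\<Prod>m=1..Suc (Suc l).
       D m (path_pos (Suc (Suc l)) a b (U(Suc l := A)) (m - 1)) (path_pos (Suc (Suc l)) a b (U(Suc l := A)) m))"
      by (subst (2) prod.nat_ivl_Suc') (simp_all add: mult.commute)
  qed
  also have "\<dots> = (\<Sum>U\<in>(\<lambda>(A,U). U(Suc l := A)) ` (X (Suc l) \<times> PiE {1..l} X). \<Prod>m=1..Suc (Suc l).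
       D m (path_pos (Suc (Suc l)) a b U (m - 1)) (path_pos (Suc (Suc l)) a b U m))"
  proof (subst sum.reindex)
    show "inj_on (\<lambda>(A,U). U(Suc l := A)) (X (Suc l) \<times> PiE {1..l} X)"
      using inj_combinator[of "Suc l" "{1..l}" X] by simp
  qed (auto intro!: sum.cong)
  also have "(\<lambda>(A,U). U(Suc l := A)) ` (X (Suc l) \<times> PiE {1..l} X) = PiE {1..Suc l} X"
    unfolding ins by (rule PiE_insert_eq[symmetric])
  finally show ?case by (simp only: X_def D_def)
qed

section \<open>Unordered sums: exhaustion and dominated convergence\<close>

lemma has_sum_exhaustion:
  fixes f :: "'x \<Rightarrow> real"
  assumes fin: "\<And>L. finite (F L)" and mono: "incseq F" and un: "(\<Union>L. F L) = A"
    and nn: "\<And>x. x \<in> A \<Longrightarrow> 0 \<le> f x" and lim: "(\<lambda>L::nat. sum f (F L)) \<longlonglongrightarrow> s"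
  shows "(f has_sum s) A"
proof -
  \<comment> \<open>Every finite subset is eventually swallowed by the exhausting sets; with
    non-negativity this bounds all partial sums by the limit.\<close>
  have ev: "\<forall>\<^sub>F L in sequentially. G \<subseteq> F L" if "finite G" "G \<subseteq> A" for G
    using that
  proof (induction G)
    case (insert x G)
    then obtain L0 where "x \<in> F L0" using un by auto
    then have "\<forall>\<^sub>F L in sequentially. x \<in> F L"
      using incseqD[OF mono] by (auto simp: eventually_sequentially)
    then show ?case using insert by (auto elim: eventually_elim2)
  qed auto
  have filt: "filterlim F (finite_subsets_at_top A) sequentially"
    unfolding filterlim_finite_subsets_at_top
  proof (intro allI impI)
    fix X assume "finite X \<and> X \<subseteq> A"
    with ev[of X] show "\<forall>\<^sub>F L in sequentially. finite (F L) \<and> X \<subseteq> F L \<and> F L \<subseteq> A"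
      by (auto elim!: eventually_mono simp: fin un[symmetric])
  qed
  have inc: "incseq (\<lambda>L. sum f (F L))"
    using mono un by (auto intro!: incseq_SucI sum_mono2 fin nn dest: incseq_SucD)
  have "bdd_above (sum f ` {G. G \<subseteq> A \<and> finite G})"
  proof (rule bdd_aboveI2)
    fix G assume "G \<in> {G. G \<subseteq> A \<and> finite G}"
    then obtain L where L: "G \<subseteq> F L" using ev[of G] by (auto simp: eventually_sequentially)
    have "sum f G \<le> sum f (F L)" using L un by (intro sum_mono2 fin) (auto intro: nn)
    also have "\<dots> \<le> s" by (rule incseq_le[OF inc lim])
    finally show "sum f G \<le> s" .
  qed
  then have "f summable_on A" by (intro nonneg_bdd_above_summable_on nn)
  then have hs: "(f has_sum infsum f A) A" by simp
  then have "(\<lambda>L. sum f (F L)) \<longlonglongrightarrow> infsum f A"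
    unfolding has_sum_def by (rule filterlim_compose[OF _ filt])
  with lim have "infsum f A = s" using LIMSEQ_unique by blast
  with hs show ?thesis by simp
qed

text \<open>Dominated convergence for unordered sums: outside a suitable finite set the dominating
  sum is small, and inside it the limit is taken termwise.\<close>

lemma infsum_dominated_tendsto:
  fixes f :: "nat \<Rightarrow> 'x \<Rightarrow> 'b::banach"
  assumes lim: "\<And>x. x \<in> A \<Longrightarrow> (\<lambda>n. f n x) \<longlonglongrightarrow> g x"
    and bound: "\<And>n x. x \<in> A \<Longrightarrow> norm (f n x) \<le> h x" and h: "h summable_on A"
  shows "(\<lambda>n. \<Sum>\<^sub>\<infinity>x\<in>A. f n x) \<longlonglongrightarrow> (\<Sum>\<^sub>\<infinity>x\<in>A. g x)"
proof (rule LIMSEQ_I)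
  fix e :: real assume e: "0 < e"
  have gb: "norm (g x) \<le> h x" if "x \<in> A" for x
    by (rule LIMSEQ_le_const2[OF tendsto_norm[OF lim[OF that]]]) (use bound[OF that] in auto)
  \<comment> \<open>A tail of at most \<open>e/4\<close> for \<open>f n\<close>, another for
    \<open>g\<close>, and less than \<open>e/4\<close> from the finite part stay below
    \<open>e\<close>.\<close>
  obtain F where F: "finite F" "F \<subseteq> A" "dist (sum h F) (infsum h A) \<le> e/4"
    using infsum_finite_approximation[OF h, of "e/4"] e by auto
  have hF: "h summable_on (A - F)" using h summable_on_subset_banach by blast
  have hd: "infsum h A = sum h F + infsum h (A - F)"
    using infsum_Un_disjoint[of h F "A - F"] F hF by (simp add: Un_absorb1)
  have tail: "norm (infsum k (A - F)) \<le> e/4" "infsum k A = sum k F + infsum k (A - F)"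
    if k: "\<And>x. x \<in> A \<Longrightarrow> norm (k x) \<le> h x" for k :: "'x \<Rightarrow> 'b"
  proof -
    have ka: "(\<lambda>x. norm (k x)) summable_on (A - F)"
      using hF by (rule summable_on_comparison_test) (use k in auto)
    have "norm (infsum k (A - F)) \<le> (\<Sum>\<^sub>\<infinity>x\<in>A-F. norm (k x))" by (rule norm_infsum_bound[OF ka])
    also have "\<dots> \<le> infsum h (A - F)" by (rule infsum_mono[OF ka hF]) (use k in auto)
    also have "\<dots> \<le> e/4" using F(3) hd by (simp add: dist_real_def)
    finally show "norm (infsum k (A - F)) \<le> e/4" .
    show "infsum k A = sum k F + infsum k (A - F)"
      using infsum_Un_disjoint[of k F "A - F"] F abs_summable_summable[OF ka] by (simp add: Un_absorb1)
  qed
  have "(\<lambda>n. sum (f n) F) \<longlonglongrightarrow> sum g F" by (intro tendsto_sum lim) (use F in auto)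
  then obtain n0 where n0: "\<And>n. n \<ge> n0 \<Longrightarrow> norm (sum (f n) F - sum g F) < e/4"
    using e by (meson LIMSEQ_D divide_pos_pos zero_less_numeral)
  show "\<exists>n0. \<forall>n\<ge>n0. norm ((\<Sum>\<^sub>\<infinity>x\<in>A. f n x) - (\<Sum>\<^sub>\<infinity>x\<in>A. g x)) < e"
  proof (intro exI allI impI)
    fix n assume n: "n \<ge> n0"
    have "norm ((\<Sum>\<^sub>\<infinity>x\<in>A. f n x) - (\<Sum>\<^sub>\<infinity>x\<in>A. g x)) =
       norm ((sum (f n) F - sum g F) + (infsum (f n) (A - F) - infsum g (A - F)))"
      using tail(2)[of "f n", OF bound] tail(2)[of g, OF gb] by (simp add: algebra_simps)
    also have "\<dots> \<le> norm (sum (f n) F - sum g F) + (norm (infsum (f n) (A - F)) + norm (infsum g (A - F)))"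
      by (intro norm_triangle_le add_mono order_refl norm_triangle_ineq4)
    also have "\<dots> < e" using n0[OF n] tail(1)[of "f n", OF bound] tail(1)[of g, OF gb] e by simp
    finally show "norm ((\<Sum>\<^sub>\<infinity>x\<in>A. f n x) - (\<Sum>\<^sub>\<infinity>x\<in>A. g x)) < e" .
  qed
qed

lemma infsum_restrict:
  fixes f :: "'x \<Rightarrow> 'b::{comm_monoid_add, t2_space}"
  shows "(\<Sum>\<^sub>\<infinity>x\<in>A. f x) = (\<Sum>\<^sub>\<infinity>x. if x \<in> A then f x else 0)"
  by (rule infsum_cong_neutral) auto

section \<open>Path sums over infinite levels\<close>

definition cols_bounded :: "real \<Rightarrow> (int \<Rightarrow> int \<Rightarrow> complex) \<Rightarrow> bool" where
  "cols_bounded B T \<longleftrightarrow> (\<forall>v. (\<lambda>w. norm (T w v)) summable_on UNIV \<and> (\<Sum>\<^sub>\<infinity>w. norm (T w v)) \<le> B)"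

lemma cols_boundedD:
  assumes "cols_bounded B T"
  shows "(\<lambda>w. norm (T w v)) summable_on UNIV" "(\<Sum>\<^sub>\<infinity>w. norm (T w v)) \<le> B" "norm (T u v) \<le> B" "0 \<le> B"
proof -
  show s: "(\<lambda>w. norm (T w v)) summable_on UNIV" and b: "(\<Sum>\<^sub>\<infinity>w. norm (T w v)) \<le> B"
    using assms by (auto simp: cols_bounded_def)
  have "norm (T u v) \<le> (\<Sum>\<^sub>\<infinity>w. norm (T w v))" using finite_sum_le_infsum[OF s, of "{u}"] by simp
  with b show "norm (T u v) \<le> B" by simp
  then show "0 \<le> B" using norm_ge_zero order_trans by blast
qed

text \<open>The recursion sums over the row index of the last transition, so column sums are the
  norm that iterates. The bound does not depend on \<open>V\<close>, as domination over growing
  windows requires.\<close>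

lemma path_sum_bound:
  assumes "\<And>m. m \<in> {1..Suc l} \<Longrightarrow> cols_bounded B (T m)"
  shows "norm (path_sum T V l u v) \<le> B ^ Suc l"
  using assms
proof (induction l arbitrary: v)
  case 0
  then show ?case using cols_boundedD(3)[of B "T 1"] by simp
next
  case (Suc l)
  have c: "cols_bounded B (T (Suc (Suc l)))" using Suc.prems by simp
  have IH: "norm (path_sum T V l u w) \<le> B ^ Suc l" for w using Suc by simp
  have B0: "0 \<le> B" using cols_boundedD(4)[OF c] .
  have s: "(\<lambda>w. B ^ Suc l * norm (T (Suc (Suc l)) w v)) summable_on A" for A
    by (intro summable_on_cmult_right summable_on_subset_banach[OF cols_boundedD(1)[OF c]]) auto
  have le: "norm (path_sum T V l u w * T (Suc (Suc l)) w v) \<le> B ^ Suc l * norm (T (Suc (Suc l)) w v)" for w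
    using IH[of w] by (simp add: norm_mult mult_right_mono)
  have s2: "(\<lambda>w. norm (path_sum T V l u w * T (Suc (Suc l)) w v)) summable_on A" for A
    using s[of A] by (rule summable_on_comparison_test) (use le in auto)
  have "norm (path_sum T V (Suc l) u v) \<le> (\<Sum>\<^sub>\<infinity>w\<in>V (Suc l). norm (path_sum T V l u w * T (Suc (Suc l)) w v))"
    unfolding path_sum.simps by (rule norm_infsum_bound[OF s2])
  also have "\<dots> \<le> (\<Sum>\<^sub>\<infinity>w. B ^ Suc l * norm (T (Suc (Suc l)) w v))"
    by (rule infsum_mono_neutral[OF s2 s]) (use le B0 in auto)
  also have "\<dots> = B ^ Suc l * (\<Sum>\<^sub>\<infinity>w. norm (T (Suc (Suc l)) w v))" by (rule infsum_cmult_right')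
  also have "\<dots> \<le> B ^ Suc l * B" using cols_boundedD(2)[OF c] B0 by (intro mult_left_mono) auto
  finally show ?case by (simp add: mult.commute)
qed

lemma path_sum_summable:
  assumes "\<And>m. m \<in> {1..Suc (Suc l)} \<Longrightarrow> cols_bounded B (T m)"
  shows "(\<lambda>w. path_sum T V l u w * T (Suc (Suc l)) w v) summable_on A"
proof (rule abs_summable_summable)
  have c: "cols_bounded B (T (Suc (Suc l)))" using assms by simp
  have "(\<lambda>w. B ^ Suc l * norm (T (Suc (Suc l)) w v)) summable_on A"
    by (intro summable_on_cmult_right summable_on_subset_banach[OF cols_boundedD(1)[OF c]]) auto
  then show "(\<lambda>w. norm (path_sum T V l u w * T (Suc (Suc l)) w v)) summable_on A"
  proof (rule summable_on_comparison_test)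
    fix w
    have "norm (path_sum T V l u w) \<le> B ^ Suc l" by (rule path_sum_bound) (use assms in auto)
    then show "norm (path_sum T V l u w * T (Suc (Suc l)) w v) \<le> B ^ Suc l * norm (T (Suc (Suc l)) w v)"
      by (simp add: norm_mult mult_right_mono)
  qed auto
qed

text \<open>Finite windows make the Cauchy-Binet formula applicable; dominated convergence, level by
  level, removes them again.\<close>

lemma path_sum_window_tendsto:
  assumes "\<And>m. m \<in> {1..Suc l} \<Longrightarrow> cols_bounded B (T m)"
  shows "(\<lambda>L::nat. path_sum T (\<lambda>m. V m \<inter> {- int L..int L}) l u v) \<longlonglongrightarrow> path_sum T V l u v"
  using assms
proof (induction l arbitrary: v)
  case (Suc l)
  have c: "cols_bounded B (T (Suc (Suc l)))" using Suc.prems by simp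
  let ?V = "\<lambda>L m. V m \<inter> {- int L..int L}"
  have "(\<lambda>L. \<Sum>\<^sub>\<infinity>w. if w \<in> ?V L (Suc l) then path_sum T (?V L) l u w * T (Suc (Suc l)) w v else 0) \<longlonglongrightarrow>
     (\<Sum>\<^sub>\<infinity>w. if w \<in> V (Suc l) then path_sum T V l u w * T (Suc (Suc l)) w v else 0)"
  proof (rule infsum_dominated_tendsto)
    show "(\<lambda>w. B ^ Suc l * norm (T (Suc (Suc l)) w v)) summable_on UNIV"
      by (intro summable_on_cmult_right cols_boundedD(1)[OF c])
    fix L w
    have "norm (path_sum T (?V L) l u w) \<le> B ^ Suc l" by (rule path_sum_bound) (use Suc.prems in auto)
    then show "norm (if w \<in> ?V L (Suc l) then path_sum T (?V L) l u w * T (Suc (Suc l)) w v else 0)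
       \<le> B ^ Suc l * norm (T (Suc (Suc l)) w v)"
      using cols_boundedD(4)[OF c] by (auto simp: norm_mult mult_right_mono)
  next
    fix w
    have "(\<lambda>L. path_sum T (?V L) l u w * T (Suc (Suc l)) w v) \<longlonglongrightarrow> path_sum T V l u w * T (Suc (Suc l)) w v"
      using Suc by (intro tendsto_intros) auto
    moreover have "\<forall>\<^sub>F L in sequentially. path_sum T (?V L) l u w * T (Suc (Suc l)) w v =
      (if w \<in> {- int L..int L} then path_sum T (?V L) l u w * T (Suc (Suc l)) w v else 0)"
      using eventually_ge_at_top[of "nat \<bar>w\<bar>"] by eventually_elim auto
    ultimately have "(\<lambda>L. if w \<in> {- int L..int L} then path_sum T (?V L) l u w * T (Suc (Suc l)) w v else 0)
       \<longlonglongrightarrow> path_sum T V l u w * T (Suc (Suc l)) w v"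
      by (rule Lim_transform_eventually)
    then show "(\<lambda>L. if w \<in> ?V L (Suc l) then path_sum T (?V L) l u w * T (Suc (Suc l)) w v else 0)
       \<longlonglongrightarrow> (if w \<in> V (Suc l) then path_sum T V l u w * T (Suc (Suc l)) w v else 0)"
      by (cases "w \<in> V (Suc l)") auto
  qed
  then show ?case by (simp only: path_sum.simps infsum_restrict[of _ "V (Suc l)"] infsum_restrict[of _ "?V _ (Suc l)"])
qed simp

lemma tendsto_det:
  fixes A :: "nat \<Rightarrow> nat \<Rightarrow> nat \<Rightarrow> complex"
  assumes "\<And>i j. i < k \<Longrightarrow> j < k \<Longrightarrow> (\<lambda>L. A L i j) \<longlonglongrightarrow> C i j"
  shows "(\<lambda>L. Determinant.det (Matrix.mat k k (\<lambda>(i,j). A L i j))) \<longlonglongrightarrow> Determinant.det (Matrix.mat k k (\<lambda>(i,j). C i j))"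
proof -
  have e: "Determinant.det (Matrix.mat k k (\<lambda>(i,j). A i j)) =
     (\<Sum>\<pi>\<in>{\<pi>. \<pi> permutes {0..<k}}. signof \<pi> * (\<Prod>i=0..<k. A i (\<pi> i)))" for A :: "nat \<Rightarrow> nat \<Rightarrow> complex"
  proof (subst det_def'[of _ k], simp, rule sum.cong[OF refl])
    fix \<pi> assume "\<pi> \<in> {\<pi>. \<pi> permutes {0..<k}}"
    then have "\<pi> i < k" if "i < k" for i using that permutes_in_image[of \<pi> "{0..<k}" i] by auto
    then show "signof \<pi> * (\<Prod>i=0..<k. Matrix.mat k k (\<lambda>(i,j). A i j) $$ (i, \<pi> i)) =
       signof \<pi> * (\<Prod>i=0..<k. A i (\<pi> i))" by simp
  qed
  show ?thesis unfolding e
  proof (intro tendsto_sum tendsto_mult tendsto_const tendsto_prod)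
    fix \<pi> i assume "\<pi> \<in> {\<pi>. \<pi> permutes {0..<k}}" "i \<in> {0..<k}"
    then show "(\<lambda>L. A L i (\<pi> i)) \<longlonglongrightarrow> C i (\<pi> i)"
      using permutes_in_image[of \<pi> "{0..<k}" i] by (intro assms) auto
  qed
qed

definition path_configs :: "nat \<Rightarrow> nat \<Rightarrow> (nat \<Rightarrow> int set) \<Rightarrow> (nat \<times> int) set set" where
  "path_configs N k V = {X. X \<subseteq> sites N \<and> (\<forall>m\<in>{1..<N}. level m X \<subseteq> V m \<and> finite (level m X) \<and> card (level m X) = k)}"

definition path_weight :: "(nat \<Rightarrow> int \<Rightarrow> int \<Rightarrow> complex) \<Rightarrow> nat \<Rightarrow> nat \<Rightarrow> (nat \<Rightarrow> int) \<Rightarrow> (nat \<Rightarrow> int) \<Rightarrow> (nat \<times> int) set \<Rightarrow> complex" where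
  "path_weight T N k a b X = (\<Prod>m=1..N. Determinant.det (Matrix.mat k k
     (\<lambda>(i,j). T m (path_pos N a b (\<lambda>m. level m X) (m - 1) i) (path_pos N a b (\<lambda>m. level m X) m j))))"

lemma level_Sigma: "m \<in> I \<Longrightarrow> level m (Sigma I U) = U m"
  by (auto simp: level_def)

text \<open>A configuration is determined by the family of its levels, so the sum over sets of sites
  is the sum over the function space in \<open>iterated_cauchy_binet\<close>.\<close>

lemma sum_path_weight_window:
  assumes fin: "\<And>m. m \<in> {1..l} \<Longrightarrow> finite (V m)"
  shows "(\<Sum>X\<in>path_configs (Suc l) k V. path_weight T (Suc l) k a b X) =
    Determinant.det (Matrix.mat k k (\<lambda>(i,j). path_sum T V l (a i) (b j)))" (is ?sum)
   and "finite (path_configs (Suc l) k V)"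
proof -
  let ?E = "PiE {1..l} (\<lambda>m. {A. A \<subseteq> V m \<and> card A = k})"
  have eq: "{1..<Suc l} = {1..l}" by auto
  have inE: "(\<lambda>m\<in>{1..l}. level m X) \<in> ?E" "Sigma {1..l} (\<lambda>m\<in>{1..l}. level m X) = X"
    if "X \<in> path_configs (Suc l) k V" for X
    using that by (auto simp: path_configs_def sites_def level_def)
  have inC: "Sigma {1..l} U \<in> path_configs (Suc l) k V" "(\<lambda>m\<in>{1..l}. level m (Sigma {1..l} U)) = U"
    if U: "U \<in> ?E" for U
  proof -
    have Um: "U m \<subseteq> V m" "card (U m) = k" if "m \<in> {1..l}" for m using PiE_mem[OF U that] by auto
    have "finite (U m)" if "m \<in> {1..l}" for m by (rule finite_subset[OF Um(1)[OF that] fin[OF that]])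
    then have "level m (Sigma {1..l} U) \<subseteq> V m \<and> finite (level m (Sigma {1..l} U)) \<and> card (level m (Sigma {1..l} U)) = k"
      if "m \<in> {1..l}" for m using level_Sigma[OF that, of U] Um[OF that] that by simp
    moreover have "Sigma {1..l} U \<subseteq> sites (Suc l)" unfolding sites_def eq by (rule Sigma_mono) auto
    ultimately show "Sigma {1..l} U \<in> path_configs (Suc l) k V" unfolding path_configs_def eq by blast
    show "(\<lambda>m\<in>{1..l}. level m (Sigma {1..l} U)) = U"
    proof
      fix m show "(\<lambda>m\<in>{1..l}. level m (Sigma {1..l} U)) m = U m"
        using level_Sigma[of m "{1..l}" U] PiE_arb[OF U, of m] by (cases "m \<in> {1..l}") simp_all
    qed
  qed
  have "path_configs (Suc l) k V \<subseteq> (\<lambda>U. Sigma {1..l} U) ` ?E"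
  proof
    fix X assume X: "X \<in> path_configs (Suc l) k V"
    show "X \<in> (\<lambda>U. Sigma {1..l} U) ` ?E"
      by (rule image_eqI[where x="\<lambda>m\<in>{1..l}. level m X"], rule inE(2)[OF X, symmetric], rule inE(1)[OF X])
  qed
  moreover have "finite ?E" using fin by (intro finite_PiE) auto
  ultimately show "finite (path_configs (Suc l) k V)" by (rule finite_subset[OF _ finite_imageI])
  show ?sum
  proof (rule trans[OF _ iterated_cauchy_binet[OF fin, symmetric]],
      rule sum.reindex_bij_witness[where i="Sigma {1..l}" and j="\<lambda>X. \<lambda>m\<in>{1..l}. level m X"])
    fix X assume "X \<in> path_configs (Suc l) k V"
    show "(\<Prod>m = 1..Suc l. Determinant.det (Matrix.mat k k (\<lambda>(i,j).
        T m (path_pos (Suc l) a b (\<lambda>m\<in>{1..l}. level m X) (m - 1) i) (path_pos (Suc l) a b (\<lambda>m\<in>{1..l}. level m X) m j)))) =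
      path_weight T (Suc l) k a b X"
      unfolding path_weight_def
      by (intro prod.cong refl arg_cong[of _ _ Determinant.det] cong_mat) (auto simp: path_pos_def)
  qed (fact inE(2), fact inE(1), fact inC(2), fact inC(1))
qed

text \<open>Window sums are determinants of path sums, and these converge; as the weights are
  non-negative, convergence along windows is already summability. Being a limit of real numbers,
  \<open>D\<close> is real, which allows probabilities to be compared with complex
  determinants.\<close>

lemma path_weight_has_sum:
  fixes T :: "nat \<Rightarrow> int \<Rightarrow> int \<Rightarrow> complex" and V :: "nat \<Rightarrow> int set" and a b :: "nat \<Rightarrow> int"
    and k l :: nat
  assumes cb: "\<And>m. m \<in> {1..Suc l} \<Longrightarrow> cols_bounded B (T m)"
    and nn: "\<And>X. X \<in> path_configs (Suc l) k (\<lambda>_. UNIV) \<Longrightarrow> path_weight T (Suc l) k a b X \<in> \<real>\<^sub>\<ge>\<^sub>0"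
  defines "D \<equiv> Determinant.det (Matrix.mat k k (\<lambda>(i,j). path_sum T V l (a i) (b j)))"
  shows "((\<lambda>X. Re (path_weight T (Suc l) k a b X)) has_sum Re D) (path_configs (Suc l) k V)"
    and "D = of_real (Re D)"
proof -
  let ?V = "\<lambda>L::nat. \<lambda>m. V m \<inter> {- int L..int L}"
  let ?C = "\<lambda>V. path_configs (Suc l) k V"
  have sub: "?C V \<subseteq> ?C W" if "\<And>m. V m \<subseteq> W m" for V W
    using that unfolding path_configs_def by blast
  have fin: "finite (?C (?V L))" for L by (rule sum_path_weight_window) auto
  have S: "(\<Sum>X\<in>?C (?V L). path_weight T (Suc l) k a b X) =
    Determinant.det (Matrix.mat k k (\<lambda>(i,j). path_sum T (?V L) l (a i) (b j)))" for L
    by (rule sum_path_weight_window) auto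
  have limD: "(\<lambda>L. \<Sum>X\<in>?C (?V L). path_weight T (Suc l) k a b X) \<longlonglongrightarrow> D"
    unfolding S D_def by (intro tendsto_det path_sum_window_tendsto[OF cb])
  have re: "path_weight T (Suc l) k a b X = of_real (Re (path_weight T (Suc l) k a b X))" if "X \<in> ?C V" for X V
  proof -
    have "X \<in> ?C (\<lambda>_. UNIV)" using sub[of V "\<lambda>_. UNIV"] that by blast
    from nn[OF this] show ?thesis by (simp add: complex_nonneg_Reals_iff complex_eq_iff)
  qed
  show "((\<lambda>X. Re (path_weight T (Suc l) k a b X)) has_sum Re D) (?C V)"
  proof (rule has_sum_exhaustion[where F="\<lambda>L. ?C (?V L)"])
    show "incseq (\<lambda>L. ?C (?V L))" by (intro incseq_SucI sub) auto
    show "(\<Union>L. ?C (?V L)) = ?C V"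
    proof
      show "(\<Union>L. ?C (?V L)) \<subseteq> ?C V" using sub[of "?V _" V] by blast
      show "?C V \<subseteq> (\<Union>L. ?C (?V L))"
      proof
        fix X assume X: "X \<in> ?C V"
        then have f: "finite (\<Union>m\<in>{1..<Suc l}. level m X)" by (auto simp: path_configs_def)
        \<comment> \<open>A window containing the given configuration: \<open>L\<close> bounds the
          absolute values of all its positions, and the inserted 0 keeps the maximum defined when
          there are none.\<close>
        define L where "L = nat (Max (insert 0 (abs ` (\<Union>m\<in>{1..<Suc l}. level m X))))"
        have "u \<in> {- int L..int L}" if "m \<in> {1..<Suc l}" "u \<in> level m X" for m u
        proof -
          have "\<bar>u\<bar> \<le> Max (insert 0 (abs ` (\<Union>m\<in>{1..<Suc l}. level m X)))"
          proof (rule Max_ge)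
            show "\<bar>u\<bar> \<in> insert 0 (abs ` (\<Union>m\<in>{1..<Suc l}. level m X))" using that by blast
          qed (use f in simp)
          then show ?thesis unfolding L_def by auto
        qed
        then have "X \<in> ?C (?V L)" using X unfolding path_configs_def by auto
        then show "X \<in> (\<Union>L. ?C (?V L))" by blast
      qed
    qed
    show "0 \<le> Re (path_weight T (Suc l) k a b X)" if "X \<in> ?C V" for X
    proof -
      have "X \<in> ?C (\<lambda>_. UNIV)" using sub[of V "\<lambda>_. UNIV"] that by blast
      from nn[OF this] show ?thesis by (simp add: complex_nonneg_Reals_iff)
    qed
    show "(\<lambda>L. \<Sum>X\<in>?C (?V L). Re (path_weight T (Suc l) k a b X)) \<longlonglongrightarrow> Re D"
      using tendsto_Re[OF limD] by (simp add: Re_sum)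
  qed (rule fin)
  have "Im (\<Sum>X\<in>?C (?V L). path_weight T (Suc l) k a b X) = 0" for L
  proof -
    have "Im (path_weight T (Suc l) k a b X) = 0" if "X \<in> ?C (?V L)" for X
      using arg_cong[OF re[OF that], of Im] by simp
    then show ?thesis by (simp add: Im_sum)
  qed
  then have "Im D = 0" using tendsto_Im[OF limD] by (simp add: LIMSEQ_const_iff)
  then show "D = of_real (Re D)" by (simp add: complex_eq_iff)
qed

section \<open>The Eynard--Mehta theorem\<close>

text \<open>The Leibniz sum over permutations of the index set itself, so that sites can be adjoined
  or renamed without choosing an enumeration.\<close>

definition set_det :: "'a set \<Rightarrow> ('a \<Rightarrow> 'a \<Rightarrow> complex) \<Rightarrow> complex" where
  "set_det S M = (\<Sum>\<pi>\<in>{\<pi>. \<pi> permutes S}. of_int (sign \<pi>) * (\<Prod>s\<in>S. M s (\<pi> s)))"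

lemma set_det_cong:
  assumes "\<And>s t. s \<in> S \<Longrightarrow> t \<in> S \<Longrightarrow> M s t = M' s t"
  shows "set_det S M = set_det S M'"
  unfolding set_det_def using assms
  by (intro sum.cong refl arg_cong2[of _ _ _ _ "(*)"] prod.cong) (auto simp: permutes_in_image)

text \<open>Conjugating permutations with the enumeration preserves their signs, so the order of the
  list does not affect the value.\<close>

lemma set_det_list:
  assumes d: "distinct ss" and S: "set ss = S"
  shows "Determinant.det (Matrix.mat (length ss) (length ss) (\<lambda>(x,y). M (ss ! x) (ss ! y))) = set_det S M"
proof -
  let ?r = "length ss" and ?h = "\<lambda>i. ss ! i"
  have h: "bij_betw ?h {0..<?r} S" using bij_betw_nth[OF d refl S[symmetric]] by (simp add: atLeast0LessThan)
  then have inj: "inj_on ?h {0..<?r}" and im: "?h ` {0..<?r} = S" by (auto simp: bij_betw_def)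
  define g where "g = inv_into {0..<?r} ?h"
  have g: "bij_betw g S {0..<?r}" unfolding g_def by (rule bij_betw_inv_into[OF h])
  have gh: "g (?h i) = i" if "i \<in> {0..<?r}" for i unfolding g_def using inj that by simp
  have hg: "?h (g s) = s" if "s \<in> S" for s unfolding g_def using im that by (metis f_inv_into_f)
  have "Determinant.det (Matrix.mat ?r ?r (\<lambda>(x,y). M (ss ! x) (ss ! y))) =
    (\<Sum>\<pi>\<in>{\<pi>. \<pi> permutes {0..<?r}}. of_int (sign \<pi>) * (\<Prod>i=0..<?r. M (?h i) (?h (\<pi> i))))"
  proof (subst det_def'[of _ ?r], simp, rule sum.cong[OF refl])
    fix \<pi> assume "\<pi> \<in> {\<pi>. \<pi> permutes {0..<?r}}"
    then have "\<pi> i < ?r" if "i < ?r" for i using that permutes_in_image[of \<pi> "{0..<?r}" i] by auto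
    then show "signof \<pi> * (\<Prod>i=0..<?r. Matrix.mat ?r ?r (\<lambda>(x,y). M (ss ! x) (ss ! y)) $$ (i, \<pi> i)) =
       of_int (sign \<pi>) * (\<Prod>i=0..<?r. M (?h i) (?h (\<pi> i)))" by simp
  qed
  also have "\<dots> = set_det S M" unfolding set_det_def
  proof (rule sum.reindex_bij_witness[where i="map_permutation S g" and j="map_permutation {0..<?r} ?h"])
    fix \<pi> assume p: "\<pi> \<in> {\<pi>. \<pi> permutes {0..<?r}}"
    then show "map_permutation S g (map_permutation {0..<?r} ?h \<pi>) = \<pi>"
      by (intro map_permutation_compose_inv[OF h]) (use gh in auto)
    show "map_permutation {0..<?r} ?h \<pi> \<in> {\<pi>. \<pi> permutes S}"
      using map_permutation_permutes[OF h] p by blast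
    have "(\<Prod>s\<in>S. M s (map_permutation {0..<?r} ?h \<pi> s)) = (\<Prod>i=0..<?r. M (?h i) (?h (\<pi> i)))"
      by (subst prod.reindex_bij_betw[OF h, symmetric], rule prod.cong[OF refl], subst map_permutation_apply[OF inj]) auto
    then show "of_int (sign (map_permutation {0..<?r} ?h \<pi>)) * (\<Prod>s\<in>S. M s (map_permutation {0..<?r} ?h \<pi> s)) =
      of_int (sign \<pi>) * (\<Prod>i=0..<?r. M (?h i) (?h (\<pi> i)))"
      using sign_map_permutation[OF inj, of \<pi>] p by simp
  next
    fix \<pi> assume p: "\<pi> \<in> {\<pi>. \<pi> permutes S}"
    then show "map_permutation {0..<?r} ?h (map_permutation S g \<pi>) = \<pi>"
      by (intro map_permutation_compose_inv[OF g]) (use hg in auto)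
    show "map_permutation S g \<pi> \<in> {\<pi>. \<pi> permutes {0..<?r}}"
      using map_permutation_permutes[OF g] p by blast
  qed
  finally show ?thesis .
qed

lemma set_det_row_diff:
  assumes "finite S" "b \<in> S"
  shows "set_det S (M(b := (\<lambda>t. x t - y t))) = set_det S (M(b := x)) - set_det S (M(b := y))"
proof -
  have "(\<Prod>s\<in>S. (M(b := r)) s (\<pi> s)) = r (\<pi> b) * (\<Prod>s\<in>S-{b}. M s (\<pi> s))" for r \<pi>
    by (subst prod.remove[OF assms]) simp
  then show ?thesis
    by (simp add: set_det_def sum_subtractf[symmetric] algebra_simps)
qed

text \<open>Only permutations fixing \<open>b\<close> survive, and these are the permutations of
  \<open>D\<close>.\<close>

lemma set_det_unit_row:
  assumes "finite D" "b \<notin> D"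
  shows "set_det (insert b D) (M(b := (\<lambda>t. if t = b then 1 else 0))) = set_det D M"
proof -
  let ?M = "M(b := (\<lambda>t. if t = b then 1 else 0))"
  have "set_det (insert b D) ?M = (\<Sum>\<pi>\<in>{\<pi>. \<pi> permutes D}. of_int (sign \<pi>) * (\<Prod>s\<in>insert b D. ?M s (\<pi> s)))"
    unfolding set_det_def
  proof (rule sum.mono_neutral_right)
    show "finite {\<pi>. \<pi> permutes insert b D}" using assms by (intro finite_permutations) auto
    show "{\<pi>. \<pi> permutes D} \<subseteq> {\<pi>. \<pi> permutes insert b D}" by (auto intro: permutes_subset)
    show "\<forall>\<pi>\<in>{\<pi>. \<pi> permutes insert b D} - {\<pi>. \<pi> permutes D}. of_int (sign \<pi>) * (\<Prod>s\<in>insert b D. ?M s (\<pi> s)) = 0"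
    proof
      fix \<pi> assume p: "\<pi> \<in> {\<pi>. \<pi> permutes insert b D} - {\<pi>. \<pi> permutes D}"
      have "\<pi> b \<noteq> b"
      proof
        assume "\<pi> b = b"
        have "\<pi> permutes D"
        proof (rule permutes_superset)
          show "\<pi> permutes insert b D" using p by blast
          fix x assume "x \<in> insert b D - D"
          then have "x = b" by blast
          then show "\<pi> x = x" using \<open>\<pi> b = b\<close> by simp
        qed
        with p show False by blast
      qed
      then show "of_int (sign \<pi>) * (\<Prod>s\<in>insert b D. ?M s (\<pi> s)) = 0" using assms by simp
    qed
  qed
  also have "\<dots> = set_det D M" unfolding set_det_def
  proof (rule sum.cong[OF refl])
    fix \<pi> assume "\<pi> \<in> {\<pi>. \<pi> permutes D}"
    then have "\<pi> b = b" using assms permutes_not_in by fastforce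
    moreover have "(\<Prod>s\<in>D. ?M s (\<pi> s)) = (\<Prod>s\<in>D. M s (\<pi> s))" using assms by (intro prod.cong) auto
    ultimately show "of_int (sign \<pi>) * (\<Prod>s\<in>insert b D. ?M s (\<pi> s)) = of_int (sign \<pi>) * (\<Prod>s\<in>D. M s (\<pi> s))"
      using assms by simp
  qed
  finally show ?thesis .
qed

text \<open>For a determinantal process with kernel \<open>K\<close> and disjoint \<open>B\<close>
  and \<open>C\<close>, this is the probability that all sites of \<open>B\<close> are occupied and
  all sites of \<open>C\<close> are empty. The sites of \<open>C\<close> carry the rows of the
  complementary kernel \<open>1 - K\<close>.\<close>

definition mixed_minor :: "('a \<Rightarrow> 'a \<Rightarrow> complex) \<Rightarrow> 'a set \<Rightarrow> 'a set \<Rightarrow> complex" where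
  "mixed_minor K B C = set_det (B \<union> C) (\<lambda>s t. if s \<in> B then K s t else (if s = t then 1 else 0) - K s t)"

text \<open>Row \<open>b\<close> of \<open>K\<close> is the unit row minus row \<open>b\<close> of
  \<open>1 - K\<close>, and the unit row deletes \<open>b\<close> from the determinant. This mirrors
  the subtraction of events in inclusion-exclusion.\<close>

lemma mixed_minor_insert:
  assumes "finite B" "finite C" "b \<notin> B" "b \<notin> C"
  shows "mixed_minor K (insert b B) C = mixed_minor K B C - mixed_minor K B (insert b C)"
proof -
  define M where "M = (\<lambda>s t. if s \<in> B then K s t else (if s = t then 1 else 0) - K s t)"
  let ?D = "B \<union> C" and ?e = "\<lambda>t. if t = b then 1 else 0 :: complex"
  have "mixed_minor K (insert b B) C = set_det (insert b ?D) (M(b := (\<lambda>t. ?e t - (?e t - K b t))))"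
    unfolding mixed_minor_def M_def by (simp, rule set_det_cong) auto
  also have "\<dots> = set_det (insert b ?D) (M(b := ?e)) - set_det (insert b ?D) (M(b := (\<lambda>t. ?e t - K b t)))"
    using assms by (intro set_det_row_diff) auto
  also have "set_det (insert b ?D) (M(b := ?e)) = set_det ?D M"
    using assms by (intro set_det_unit_row) auto
  also have "set_det (insert b ?D) (M(b := (\<lambda>t. ?e t - K b t))) = set_det (insert b ?D) M"
    using assms by (intro set_det_cong) (auto simp: M_def)
  finally show ?thesis by (simp add: mixed_minor_def M_def)
qed

text \<open>Probabilities and mixed minors obey the same recursion in the occupied sites, so
  agreement on pure avoidance events propagates to all patterns.\<close>

lemma avoidance_imp_mixed_minor:
  assumes gap: "\<And>C. finite C \<Longrightarrow> C \<subseteq> E \<Longrightarrow> pr {} C = mixed_minor K {} C"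
    and step: "\<And>b B C. finite B \<Longrightarrow> finite C \<Longrightarrow> insert b (B \<union> C) \<subseteq> E \<Longrightarrow> b \<notin> B \<Longrightarrow> b \<notin> C \<Longrightarrow> B \<inter> C = {} \<Longrightarrow>
        pr (insert b B) C = pr B C - pr B (insert b C)"
    and "finite B" "finite C" "B \<union> C \<subseteq> E" "B \<inter> C = {}"
  shows "pr B C = mixed_minor K B C"
  using assms(3-)
proof (induction B arbitrary: C rule: finite_induct)
  case (insert b B)
  then show ?case using step[of B C b] mixed_minor_insert[of B C b K]
    by (auto simp: insert.IH)
qed (use gap in auto)

lemma mixed_minor_list:
  assumes "distinct ss" "set ss = B"
  shows "mixed_minor K B {} = Determinant.det (Matrix.mat (length ss) (length ss) (\<lambda>(x,y). K (ss ! x) (ss ! y)))"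
  unfolding set_det_list[OF assms] mixed_minor_def using assms by (auto intro: set_det_cong)

lemma mixed_minor_tendsto:
  assumes fin: "finite B" "finite C"
    and lim: "\<And>s t. s \<in> B \<union> C \<Longrightarrow> t \<in> B \<union> C \<Longrightarrow> (\<lambda>n. K n s t) \<longlonglongrightarrow> K' s t"
  shows "(\<lambda>n. mixed_minor (K n) B C) \<longlonglongrightarrow> mixed_minor K' B C"
  unfolding mixed_minor_def set_det_def
proof (intro tendsto_sum tendsto_mult tendsto_const tendsto_prod)
  fix \<pi> s assume "\<pi> \<in> {\<pi>. \<pi> permutes B \<union> C}" "s \<in> B \<union> C"
  then have "(\<lambda>n. K n s (\<pi> s)) \<longlonglongrightarrow> K' s (\<pi> s)"
    using permutes_in_image[of \<pi> "B \<union> C" s] by (intro lim) auto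
  then show "(\<lambda>n. if s \<in> B then K n s (\<pi> s) else (if s = \<pi> s then 1 else 0) - K n s (\<pi> s)) \<longlonglongrightarrow>
    (if s \<in> B then K' s (\<pi> s) else (if s = \<pi> s then 1 else 0) - K' s (\<pi> s))"
    by (auto intro!: tendsto_intros)
qed

section \<open>Finite-rank perturbations and first visits\<close>

lemma has_sum_finite_sum:
  fixes f :: "'s \<Rightarrow> 'x \<Rightarrow> complex"
  assumes "finite S" "\<And>s. s \<in> S \<Longrightarrow> (f s has_sum F s) A"
  shows "((\<lambda>x. \<Sum>s\<in>S. f s x) has_sum (\<Sum>s\<in>S. F s)) A"
  using assms by (induction S) (auto intro!: has_sum_add)

text \<open>The determinant of the block matrix with rows \<open>(A, \<Phi>)\<close> and
  \<open>(\<Psi>, Q)\<close> is computed twice. Elimination from the left with \<open>F\<close>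
  removes the block \<open>\<Phi>\<close> and replaces \<open>A\<close> by \<open>AS\<close>;
  elimination from the right with the inverse \<open>X\<close> of \<open>A\<close> also removes
  \<open>\<Phi>\<close> but leaves a Schur complement of size \<open>r\<close>.\<close>

lemma det_schur_rank_update:
  fixes A AS X \<Phi> F \<Psi> Q :: "complex mat"
  assumes car: "A \<in> carrier_mat k k" "AS \<in> carrier_mat k k" "X \<in> carrier_mat k k" "\<Phi> \<in> carrier_mat k r"
    "F \<in> carrier_mat k r" "\<Psi> \<in> carrier_mat r k" "Q \<in> carrier_mat r r"
    and E1: "A = AS + F * \<Psi>" and E2: "\<Phi> = F * Q" and detQ: "Determinant.det Q = 1" and inv: "A * X = 1\<^sub>m k"
  shows "Determinant.det AS = Determinant.det A * Determinant.det (Q - \<Psi> * X * \<Phi>)"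
proof -
  define G where "G = Q - \<Psi> * X * \<Phi>"
  have carG: "G \<in> carrier_mat r r" using car by (auto simp: G_def)
  have cFP: "F * \<Psi> \<in> carrier_mat k k" "X * \<Phi> \<in> carrier_mat k r" using car by auto
  let ?B = "four_block_mat A \<Phi> \<Psi> Q"
  let ?L = "four_block_mat (1\<^sub>m k) (- F) (0\<^sub>m r k) (1\<^sub>m r)"
  let ?R = "four_block_mat (1\<^sub>m k) (- (X * \<Phi>)) (0\<^sub>m r k) (1\<^sub>m r)"
  have cB: "?B \<in> carrier_mat (k + r) (k + r)" using car by (intro four_block_carrier_mat)
  have cL: "?L \<in> carrier_mat (k + r) (k + r)" "?R \<in> carrier_mat (k + r) (k + r)" by (intro four_block_carrier_mat; simp)+
  have nF: "- F \<in> carrier_mat k r" "- (X * \<Phi>) \<in> carrier_mat k r" using car cFP by auto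
  have detL: "Determinant.det ?L = 1" "Determinant.det ?R = 1"
    by (subst det_four_block_mat_lower_left_zero[OF one_carrier_mat nF(1) refl one_carrier_mat], simp)
       (subst det_four_block_mat_lower_left_zero[OF one_carrier_mat nF(2) refl one_carrier_mat], simp)
  have a: "1\<^sub>m k * A + - F * \<Psi> = AS"
  proof -
    have "- F * \<Psi> = - (F * \<Psi>)" using car by (intro uminus_mult_left_mat) auto
    moreover have "1\<^sub>m k * A = AS + F * \<Psi>" using left_mult_one_mat[OF car(1)] E1 by simp
    moreover have "AS + Y + - Y = AS" if "Y \<in> carrier_mat k k" for Y
      using car(2) that by (intro eq_matI) auto
    ultimately show ?thesis using cFP(1) by simp
  qed
  have b: "1\<^sub>m k * \<Phi> + - F * Q = 0\<^sub>m k r"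
  proof -
    have "- F * Q = - (F * Q)" using car by (intro uminus_mult_left_mat) auto
    moreover have "1\<^sub>m k * \<Phi> = F * Q" using left_mult_one_mat[OF car(4)] E2 by simp
    ultimately show ?thesis using car(5,7) by (intro eq_matI) auto
  qed
  have "?L * ?B = four_block_mat (1\<^sub>m k * A + - F * \<Psi>) (1\<^sub>m k * \<Phi> + - F * Q)
      (0\<^sub>m r k * A + 1\<^sub>m r * \<Psi>) (0\<^sub>m r k * \<Phi> + 1\<^sub>m r * Q)"
    by (rule mult_four_block_mat[OF one_carrier_mat nF(1) zero_carrier_mat one_carrier_mat car(1,4,6,7)])
  also have "\<dots> = four_block_mat AS (0\<^sub>m k r) \<Psi> Q" unfolding a b using car by simp
  finally have "Determinant.det ?L * Determinant.det ?B = Determinant.det AS * Determinant.det Q"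
    using det_mult[OF cL(1) cB] det_four_block_mat_upper_right_zero[OF car(2) refl car(6,7)] by simp
  then have D1: "Determinant.det ?B = Determinant.det AS" using detL detQ by simp
  have a2: "A * - (X * \<Phi>) + \<Phi> * 1\<^sub>m r = 0\<^sub>m k r"
  proof -
    have "A * - (X * \<Phi>) = - (A * (X * \<Phi>))" using car by (intro uminus_mult_right_mat) auto
    moreover have "A * (X * \<Phi>) = \<Phi>" using assoc_mult_mat[OF car(1,3,4)] inv left_mult_one_mat[OF car(4)] by simp
    ultimately show ?thesis using car(4) by (intro eq_matI) auto
  qed
  have b2: "\<Psi> * - (X * \<Phi>) + Q * 1\<^sub>m r = G"
  proof -
    have "\<Psi> * - (X * \<Phi>) = - (\<Psi> * (X * \<Phi>))" using car by (intro uminus_mult_right_mat) auto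
    moreover have "\<Psi> * (X * \<Phi>) = \<Psi> * X * \<Phi>" using assoc_mult_mat[OF car(6,3,4)] by simp
    moreover have "\<Psi> * X * \<Phi> \<in> carrier_mat r r" using car by auto
    moreover have "- Y + Q = Q - Y" if "Y \<in> carrier_mat r r" for Y
      using car(7) that by (intro eq_matI) auto
    ultimately show ?thesis using right_mult_one_mat[OF car(7)] by (simp add: G_def)
  qed
  have "?B * ?R = four_block_mat (A * 1\<^sub>m k + \<Phi> * 0\<^sub>m r k) (A * - (X * \<Phi>) + \<Phi> * 1\<^sub>m r)
      (\<Psi> * 1\<^sub>m k + Q * 0\<^sub>m r k) (\<Psi> * - (X * \<Phi>) + Q * 1\<^sub>m r)"
    by (rule mult_four_block_mat[OF car(1,4,6,7) one_carrier_mat nF(2) zero_carrier_mat one_carrier_mat])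
  also have "\<dots> = four_block_mat A (0\<^sub>m k r) \<Psi> G" unfolding a2 b2 using car by simp
  finally have "Determinant.det ?B * Determinant.det ?R = Determinant.det A * Determinant.det G"
    using det_mult[OF cB cL(2)] det_four_block_mat_upper_right_zero[OF car(1) refl car(6) carG] by simp
  then show ?thesis using D1 detL by (simp add: G_def)
qed

text \<open>\<open>P m l\<close> is the transition from level \<open>m\<close> to level
  \<open>l\<close>, in the application the Toeplitz matrix of a product symbol. Composition is
  demanded with one last step at a time, which is the shape of the recursion of
  \<open>path_sum\<close>.\<close>

locale transition_family =
  fixes T :: "nat \<Rightarrow> int \<Rightarrow> int \<Rightarrow> complex" and P :: "nat \<Rightarrow> nat \<Rightarrow> int \<Rightarrow> int \<Rightarrow> complex"
    and N k :: nat and a b :: "nat \<Rightarrow> int" and B :: real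
  assumes N: "1 \<le> N"
    and cb: "\<And>m. m \<in> {1..N} \<Longrightarrow> cols_bounded B (T m)"
    and P_step: "\<And>m u v. m < N \<Longrightarrow> P m (Suc m) u v = T (Suc m) u v"
    and P_comp: "\<And>m l u v. m < l \<Longrightarrow> l < N \<Longrightarrow> ((\<lambda>w. P m l u w * T (Suc l) w v) has_sum P m (Suc l) u v) UNIV"
begin

text \<open>Decomposition of the paths from level 0 at their first visit to \<open>S\<close>.\<close>

lemma first_visit:
  assumes S: "finite S" "\<And>s. s \<in> S \<Longrightarrow> 1 \<le> fst s" and "Suc l \<le> N"
  shows "P 0 (Suc l) u v = path_sum T (\<lambda>m. {w. (m, w) \<notin> S}) l u v +
    (\<Sum>s\<in>{s\<in>S. fst s \<le> l}. path_sum T (\<lambda>m. {w. (m, w) \<notin> S}) (fst s - 1) u (snd s) * P (fst s) (Suc l) (snd s) v)"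
  using assms(3)
proof (induction l arbitrary: v)
  case 0
  have e: "{s \<in> S. fst s \<le> 0} = {}" using S(2) by force
  show ?case unfolding e using P_step[of 0] 0 by simp
next
  case (Suc l)
  let ?V = "\<lambda>m. {w. (m, w) \<notin> S}"
  let ?ps = "path_sum T ?V" and ?T = "T (Suc (Suc l))"
  let ?S = "{s\<in>S. fst s \<le> l}"
  have fS: "finite ?S" using S by auto
  have c: "m \<in> {1..Suc (Suc l)} \<Longrightarrow> cols_bounded B (T m)" for m using Suc.prems by (intro cb) auto
  note sm = path_sum_summable[OF c, of l, simplified]
  have "((\<lambda>w. P 0 (Suc l) u w * ?T w v) has_sum P 0 (Suc (Suc l)) u v) UNIV"
    using Suc.prems by (intro P_comp) auto
  moreover have "((\<lambda>w. ?ps l u w * ?T w v + (\<Sum>s\<in>?S. ?ps (fst s - 1) u (snd s) * (P (fst s) (Suc l) (snd s) w * ?T w v)))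
    has_sum ((\<Sum>\<^sub>\<infinity>w. ?ps l u w * ?T w v) + (\<Sum>s\<in>?S. ?ps (fst s - 1) u (snd s) * P (fst s) (Suc (Suc l)) (snd s) v))) UNIV"
    using Suc.prems fS by (intro has_sum_add has_sum_infsum sm has_sum_finite_sum has_sum_cmult_right P_comp) auto
  moreover have "P 0 (Suc l) u w * ?T w v =
     ?ps l u w * ?T w v + (\<Sum>s\<in>?S. ?ps (fst s - 1) u (snd s) * (P (fst s) (Suc l) (snd s) w * ?T w v))" for w
    using Suc by (simp add: algebra_simps sum_distrib_left sum_distrib_right)
  ultimately have 1: "P 0 (Suc (Suc l)) u v =
     (\<Sum>\<^sub>\<infinity>w. ?ps l u w * ?T w v) + (\<Sum>s\<in>?S. ?ps (fst s - 1) u (snd s) * P (fst s) (Suc (Suc l)) (snd s) v)"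
    using has_sum_unique by force
  \<comment> \<open>Paths that avoided \<open>S\<close> below level \<open>Suc l\<close> split
    according to whether their point on that level lies in \<open>S\<close>; those that hit
    \<open>S\<close> there are the new first visits.\<close>
  define W where "W = {w. (Suc l, w) \<in> S}"
  have fW: "finite W" unfolding W_def
    using finite_vimageI[OF S(1), of "Pair (Suc l)"] by (simp add: inj_on_def vimage_def)
  have U: "UNIV = ?V (Suc l) \<union> W" "?V (Suc l) \<inter> W = {}" by (auto simp: W_def)
  have "(\<Sum>\<^sub>\<infinity>w. ?ps l u w * ?T w v) = (\<Sum>\<^sub>\<infinity>w\<in>?V (Suc l). ?ps l u w * ?T w v) + (\<Sum>\<^sub>\<infinity>w\<in>W. ?ps l u w * ?T w v)"
    unfolding U(1) by (rule infsum_Un_disjoint[OF sm sm U(2)])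
  then have 2: "(\<Sum>\<^sub>\<infinity>w. ?ps l u w * ?T w v) = ?ps (Suc l) u v + (\<Sum>w\<in>W. ?ps l u w * ?T w v)"
    using fW by simp
  have "{s\<in>S. fst s \<le> Suc l} = ?S \<union> Pair (Suc l) ` W" by (auto simp: W_def image_iff le_Suc_eq)
  moreover have "?S \<inter> Pair (Suc l) ` W = {}" by auto
  ultimately have 3: "(\<Sum>s\<in>{s\<in>S. fst s \<le> Suc l}. ?ps (fst s - 1) u (snd s) * P (fst s) (Suc (Suc l)) (snd s) v) =
    (\<Sum>s\<in>?S. ?ps (fst s - 1) u (snd s) * P (fst s) (Suc (Suc l)) (snd s) v) + (\<Sum>w\<in>W. ?ps l u w * ?T w v)"
    using fS fW Suc.prems by (simp add: sum.union_disjoint sum.reindex inj_on_def P_step)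
  show ?case unfolding 1 2 3 by simp
qed

lemma path_sum_UNIV: "Suc l \<le> N \<Longrightarrow> path_sum T (\<lambda>_. UNIV) l u v = P 0 (Suc l) u v"
  using first_visit[of "{}" l u v] by simp

text \<open>The Eynard-Mehta kernel in transposed form: transitions run from the second argument to
  the first, as in the kernel of the model.\<close>

definition em_kernel :: "(nat \<Rightarrow> nat \<Rightarrow> complex) \<Rightarrow> nat \<times> int \<Rightarrow> nat \<times> int \<Rightarrow> complex" where
  "em_kernel X = (\<lambda>(m, u) (m', u'). - (if m > m' then P m' m u' u else 0) +
     (\<Sum>j<k. \<Sum>i<k. P m' N u' (b j) * X j i * P 0 m (a i) u))"

text \<open>Both sides are the determinant of the block matrix with rows \<open>(A, \<Phi>)\<close>, \<open>(\<Psi>, 1 + Q)\<close>, where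
  \<open>A\<close> collects the transitions from start to end, \<open>\<Phi>\<close> those from the start to \<open>S\<close>, \<open>\<Psi>\<close> those
  from \<open>S\<close> to the end and \<open>Q\<close> those inside \<open>S\<close>.\<close>

lemma det_avoiding:
  assumes S: "finite S" "S \<subseteq> sites N"
    and inv: "Matrix.mat k k (\<lambda>(i,j). P 0 N (a i) (b j)) * Matrix.mat k k (\<lambda>(j,i). X j i) = 1\<^sub>m k"
  shows "Determinant.det (Matrix.mat k k (\<lambda>(i,j). path_sum T (\<lambda>m. {w. (m, w) \<notin> S}) (N - 1) (a i) (b j))) =
    Determinant.det (Matrix.mat k k (\<lambda>(i,j). P 0 N (a i) (b j))) * mixed_minor (em_kernel X) {} S"
proof -
  let ?ps = "path_sum T (\<lambda>m. {w. (m, w) \<notin> S})"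
  define ss where "ss = sort_key fst (SOME l. set l = S \<and> distinct l)"
  have "\<exists>l. set l = S \<and> distinct l" using finite_distinct_list[OF S(1)] by blast
  from someI_ex[OF this] have ss: "set ss = S" "distinct ss" "sorted (map fst ss)"
    unfolding ss_def by auto
  define r where "r = length ss"
  have ssi: "ss ! x \<in> S" "1 \<le> fst (ss ! x)" "fst (ss ! x) < N" if "x < r" for x
  proof -
    show "ss ! x \<in> S" using that ss(1) by (auto simp: r_def)
    with S(2) show "1 \<le> fst (ss ! x)" "fst (ss ! x) < N" by (auto simp: sites_def)
  qed
  have S1: "1 \<le> fst s" if "s \<in> S" for s using subsetD[OF S(2) that] by (auto simp: sites_def)
  have sums: "(\<Sum>s\<in>S. f s) = (\<Sum>x=0..<r. f (ss ! x))" for f :: "nat \<times> int \<Rightarrow> complex"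
    unfolding ss(1)[symmetric] r_def atLeast0LessThan
    by (subst sum_list_distinct_conv_sum_set[OF ss(2), symmetric]) (simp add: sum_list_sum_nth atLeast0LessThan)
  define A where "A = Matrix.mat k k (\<lambda>(i,j). P 0 N (a i) (b j))"
  define AS where "AS = Matrix.mat k k (\<lambda>(i,j). ?ps (N - 1) (a i) (b j))"
  define XX where "XX = Matrix.mat k k (\<lambda>(j,i). X j i)"
  define \<Phi> where "\<Phi> = Matrix.mat k r (\<lambda>(i,x). P 0 (fst (ss!x)) (a i) (snd (ss!x)))"
  define \<Phi>S where "\<Phi>S = Matrix.mat k r (\<lambda>(i,x). ?ps (fst (ss!x) - 1) (a i) (snd (ss!x)))"
  define \<Psi> where "\<Psi> = Matrix.mat r k (\<lambda>(x,j). P (fst (ss!x)) N (snd (ss!x)) (b j))"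
  define Q where "Q = Matrix.mat r r (\<lambda>(x,y). (if x = y then 1 else 0) +
     (if fst (ss!x) < fst (ss!y) then P (fst (ss!x)) (fst (ss!y)) (snd (ss!x)) (snd (ss!y)) else 0))"
  have car: "A \<in> carrier_mat k k" "AS \<in> carrier_mat k k" "XX \<in> carrier_mat k k" "\<Phi> \<in> carrier_mat k r"
    "\<Phi>S \<in> carrier_mat k r" "\<Psi> \<in> carrier_mat r k" "Q \<in> carrier_mat r r"
    by (simp_all add: A_def AS_def XX_def \<Phi>_def \<Phi>S_def \<Psi>_def Q_def)
  have E1: "A = AS + \<Phi>S * \<Psi>"
  proof (rule eq_matI)
    fix i j assume "i < dim_row (AS + \<Phi>S * \<Psi>)" "j < dim_col (AS + \<Phi>S * \<Psi>)"
    then have ij: "i < k" "j < k" using car by auto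
    have "fst s \<le> N - 1" if "s \<in> S" for s using subsetD[OF S(2) that] by (auto simp: sites_def)
    then have "{s \<in> S. fst s \<le> N - 1} = S" by auto
    then have "P 0 N (a i) (b j) = ?ps (N - 1) (a i) (b j) +
      (\<Sum>s\<in>S. ?ps (fst s - 1) (a i) (snd s) * P (fst s) N (snd s) (b j))"
      using first_visit[of S "N - 1" "a i" "b j", OF S(1) S1] N by simp
    then show "A $$ (i, j) = (AS + \<Phi>S * \<Psi>) $$ (i, j)"
      using ij by (simp add: A_def AS_def \<Phi>S_def \<Psi>_def scalar_prod_def sums)
  qed (use car in auto)
  have E2: "\<Phi> = \<Phi>S * Q"
  proof (rule eq_matI)
    fix i y assume "i < dim_row (\<Phi>S * Q)" "y < dim_col (\<Phi>S * Q)"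
    then have ij: "i < k" "y < r" using car by auto
    let ?l = "fst (ss!y) - 1"
    have l: "Suc ?l = fst (ss!y)" "Suc ?l \<le> N" using ssi[OF ij(2)] by auto
    have "(\<Sum>s\<in>{s\<in>S. fst s \<le> ?l}. ?ps (fst s - 1) (a i) (snd s) * P (fst s) (Suc ?l) (snd s) (snd (ss!y))) =
       (\<Sum>s\<in>S. if fst s < fst (ss!y) then ?ps (fst s - 1) (a i) (snd s) * P (fst s) (fst (ss!y)) (snd s) (snd (ss!y)) else 0)"
      using S(1) l by (subst sum.inter_filter) (auto intro!: sum.cong)
    then have "P 0 (fst (ss!y)) (a i) (snd (ss!y)) = ?ps (fst (ss!y) - 1) (a i) (snd (ss!y)) +
      (\<Sum>x=0..<r. if fst (ss!x) < fst (ss!y) then ?ps (fst (ss!x) - 1) (a i) (snd (ss!x)) * P (fst (ss!x)) (fst (ss!y)) (snd (ss!x)) (snd (ss!y)) else 0)"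
      using first_visit[of S ?l "a i" "snd (ss!y)", OF S(1) S1] l by (simp only: sums)
    also have "?ps (fst (ss!y) - 1) (a i) (snd (ss!y)) = (\<Sum>x=0..<r. if x = y then ?ps (fst (ss!x) - 1) (a i) (snd (ss!x)) else 0)"
      using ij by simp
    finally have "P 0 (fst (ss!y)) (a i) (snd (ss!y)) = (\<Sum>x=0..<r. ?ps (fst (ss!x) - 1) (a i) (snd (ss!x)) *
       ((if x = y then 1 else 0) + (if fst (ss!x) < fst (ss!y) then P (fst (ss!x)) (fst (ss!y)) (snd (ss!x)) (snd (ss!y)) else 0)))"
      unfolding sum.distrib[symmetric] by (rule trans) (auto intro!: sum.cong)
    then show "\<Phi> $$ (i, y) = (\<Phi>S * Q) $$ (i, y)"
      using ij by (simp add: \<Phi>_def \<Phi>S_def Q_def scalar_prod_def)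
  qed (use car in auto)
  have detQ: "Determinant.det Q = 1"
  proof -
    have up: "upper_triangular Q"
    proof (rule upper_triangularI)
      fix x y assume "y < x" "x < dim_row Q"
      then have "fst (ss ! y) \<le> fst (ss ! x)" "x < r" "y < r"
        using sorted_nth_mono[OF ss(3), of y x] car by (auto simp: r_def)
      then show "Q $$ (x, y) = 0" using \<open>y < x\<close> by (simp add: Q_def)
    qed
    have "diag_mat Q = replicate r 1" unfolding diag_mat_def using car
      by (auto simp: Q_def intro: nth_equalityI)
    then show ?thesis using det_upper_triangular[OF up car(7)] by simp
  qed
  define G where "G = Q - \<Psi> * XX * \<Phi>"
  have carG: "G \<in> carrier_mat r r" using car by (auto simp: G_def)
  have "A * XX = 1\<^sub>m k" using inv by (simp add: A_def XX_def)
  then have detAS: "Determinant.det AS = Determinant.det A * Determinant.det G"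
    unfolding G_def by (intro det_schur_rank_update[OF car E1 E2 detQ])
  \<comment> \<open>The transpose is due to the order of arguments of \<open>em_kernel\<close>,
    whose transitions start at the second one.\<close>
  have "transpose_mat G = Matrix.mat r r (\<lambda>(x,y). (if ss!x = ss!y then 1 else 0) - em_kernel X (ss!x) (ss!y))"
  proof (rule eq_matI)
    fix x y
    assume "x < dim_row (Matrix.mat r r (\<lambda>(x,y). (if ss!x = ss!y then 1 else 0) - em_kernel X (ss!x) (ss!y)))"
      "y < dim_col (Matrix.mat r r (\<lambda>(x,y). (if ss!x = ss!y then 1 else 0) - em_kernel X (ss!x) (ss!y)))"
    then have xy: "x < r" "y < r" by auto
    have 1: "(ss!x = ss!y) = (x = y)" using xy ss(2) by (simp add: r_def nth_eq_iff_index_eq)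
    have 2: "(\<Psi> * XX * \<Phi>) $$ (y, x) = (\<Sum>j<k. \<Sum>i<k. P (fst (ss!y)) N (snd (ss!y)) (b j) * X j i * P 0 (fst (ss!x)) (a i) (snd (ss!x)))"
    proof -
      have c: "\<Psi> * XX \<in> carrier_mat r k" using car by auto
      have e: "(\<Psi> * XX) $$ (y, i) = (\<Sum>j<k. P (fst (ss!y)) N (snd (ss!y)) (b j) * X j i)" if "i < k" for i
        using that xy car by (subst index_mult_mat) (auto simp: scalar_prod_def \<Psi>_def XX_def atLeast0LessThan)
      have "(Z * \<Phi>) $$ (y, x) = (\<Sum>i<k. Z $$ (y, i) * \<Phi> $$ (i, x))" if "Z \<in> carrier_mat r k" for Z
        using xy car(4) that by (subst index_mult_mat) (auto simp: scalar_prod_def atLeast0LessThan)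
      then have "(\<Psi> * XX * \<Phi>) $$ (y, x) = (\<Sum>i<k. (\<Psi> * XX) $$ (y, i) * \<Phi> $$ (i, x))" using c by blast
      also have "\<dots> = (\<Sum>i<k. \<Sum>j<k. P (fst (ss!y)) N (snd (ss!y)) (b j) * X j i * P 0 (fst (ss!x)) (a i) (snd (ss!x)))"
        using xy by (auto simp: e sum_distrib_right \<Phi>_def intro!: sum.cong)
      finally show ?thesis by (subst sum.swap) simp
    qed
    show "transpose_mat G $$ (x, y) = Matrix.mat r r (\<lambda>(x,y). (if ss!x = ss!y then 1 else 0) - em_kernel X (ss!x) (ss!y)) $$ (x, y)"
    proof -
      have c: "\<Psi> * XX * \<Phi> \<in> carrier_mat r r" using car by auto
      have "transpose_mat G $$ (x, y) = G $$ (y, x)" using carG xy by simp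
      also have "\<dots> = Q $$ (y, x) - (\<Psi> * XX * \<Phi>) $$ (y, x)"
        unfolding G_def using c xy by (intro index_minus_mat) auto
      also have "\<dots> = Matrix.mat r r (\<lambda>(x,y). (if ss!x = ss!y then 1 else 0) - em_kernel X (ss!x) (ss!y)) $$ (x, y)"
        unfolding 2 using xy 1 by (simp add: Q_def em_kernel_def split_beta)
      finally show ?thesis .
    qed
  qed (use carG in auto)
  then have "Determinant.det G = Determinant.det (Matrix.mat r r (\<lambda>(x,y). (if ss!x = ss!y then 1 else 0) - em_kernel X (ss!x) (ss!y)))"
    using det_transpose[OF carG] by simp
  also have "\<dots> = mixed_minor (em_kernel X) {} S"
    unfolding r_def by (subst set_det_list[OF ss(2,1)]) (simp add: mixed_minor_def)
  finally show ?thesis using detAS by (simp add: A_def AS_def)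
qed

end

section \<open>Finite sections of Toeplitz matrices\<close>

lemma int_split: "{0..} \<union> {..<0} = (UNIV :: int set)"
  by auto

text \<open>Everything is dominated by \<open>C * norm (x s) * norm (y t)\<close>. This is
  associativity of infinite matrix products in the form: summable row, bounded matrix, summable
  column.\<close>

lemma bilinear_swap:
  fixes x :: "'s \<Rightarrow> complex" and y :: "'t \<Rightarrow> complex" and M :: "'s \<Rightarrow> 't \<Rightarrow> complex"
  assumes x: "(\<lambda>s. norm (x s)) summable_on X" and y: "(\<lambda>t. norm (y t)) summable_on Y"
    and M: "\<And>s t. s \<in> X \<Longrightarrow> t \<in> Y \<Longrightarrow> norm (M s t) \<le> C"
  shows "(\<lambda>(s,t). norm (x s * M s t * y t)) summable_on X \<times> Y"
    and "(\<Sum>\<^sub>\<infinity>s\<in>X. x s * (\<Sum>\<^sub>\<infinity>t\<in>Y. M s t * y t)) = (\<Sum>\<^sub>\<infinity>(s,t)\<in>X \<times> Y. x s * M s t * y t)"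
    and "(\<Sum>\<^sub>\<infinity>t\<in>Y. (\<Sum>\<^sub>\<infinity>s\<in>X. x s * M s t) * y t) = (\<Sum>\<^sub>\<infinity>(s,t)\<in>X \<times> Y. x s * M s t * y t)"
proof -
  have "(\<lambda>(s,t). norm (x s) * norm (y t)) summable_on X \<times> Y"
    using Infinite_Sum.abs_summable_on_Sigma_iff[where f="\<lambda>(s,t). norm (x s) * norm (y t)" and A=X and B="\<lambda>_. Y"] x y
    by (simp add: case_prod_unfold infsum_cmult_right' summable_on_cmult_right summable_on_cmult_left
        abs_mult infsum_nonneg)
  then have "(\<lambda>(s,t). C * (norm (x s) * norm (y t))) summable_on X \<times> Y"
    unfolding case_prod_unfold by (rule summable_on_cmult_right)
  then show s: "(\<lambda>(s,t). norm (x s * M s t * y t)) summable_on X \<times> Y"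
  proof (rule summable_on_comparison_test)
    fix st assume "st \<in> X \<times> Y"
    then obtain s t where st: "st = (s, t)" "s \<in> X" "t \<in> Y" by auto
    have "norm (M s t) * (norm (x s) * norm (y t)) \<le> C * (norm (x s) * norm (y t))"
      using M st by (intro mult_right_mono) auto
    then show "(case st of (s,t) \<Rightarrow> norm (x s * M s t * y t)) \<le> (case st of (s,t) \<Rightarrow> C * (norm (x s) * norm (y t)))"
      using st by (simp add: norm_mult mult_ac)
  qed auto
  have s': "(\<lambda>st. x (fst st) * M (fst st) (snd st) * y (snd st)) summable_on X \<times> Y"
    by (rule abs_summable_summable) (use s in \<open>simp add: case_prod_unfold\<close>)
  have e1: "(\<Sum>\<^sub>\<infinity>s\<in>X. \<Sum>\<^sub>\<infinity>t\<in>Y. x s * M s t * y t) = (\<Sum>\<^sub>\<infinity>(s,t)\<in>X \<times> Y. x s * M s t * y t)"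
    using infsum_Sigma'_banach[of "\<lambda>s t. x s * M s t * y t" X "\<lambda>_. Y"] s' by (simp add: case_prod_unfold)
  then show "(\<Sum>\<^sub>\<infinity>s\<in>X. x s * (\<Sum>\<^sub>\<infinity>t\<in>Y. M s t * y t)) = (\<Sum>\<^sub>\<infinity>(s,t)\<in>X \<times> Y. x s * M s t * y t)"
    by (simp add: infsum_cmult_right'[symmetric] mult.assoc)
  have "(\<Sum>\<^sub>\<infinity>s\<in>X. \<Sum>\<^sub>\<infinity>t\<in>Y. x s * M s t * y t) = (\<Sum>\<^sub>\<infinity>t\<in>Y. \<Sum>\<^sub>\<infinity>s\<in>X. x s * M s t * y t)"
    by (rule infsum_swap_banach) (use s' in \<open>simp add: case_prod_unfold\<close>)
  then show "(\<Sum>\<^sub>\<infinity>t\<in>Y. (\<Sum>\<^sub>\<infinity>s\<in>X. x s * M s t) * y t) = (\<Sum>\<^sub>\<infinity>(s,t)\<in>X \<times> Y. x s * M s t * y t)"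
    unfolding e1 by (simp add: infsum_cmult_left'[symmetric])
qed

section \<open>Matrices with exponential decay off the diagonal\<close>

lemma geometric_int_summable:
  fixes q :: real
  assumes "0 \<le> q" "q < 1"
  shows "(\<lambda>k::int. q ^ nat \<bar>k - u\<bar>) summable_on A"
proof -
  have g: "(\<lambda>n::nat. q ^ n) summable_on UNIV"
    using assms by (intro summable_nonneg_imp_summable_on summable_geometric) auto
  have "(\<lambda>k::int. q ^ nat \<bar>k - u\<bar>) summable_on (range (\<lambda>n. u + int n))"
    by (subst summable_on_reindex) (use g in \<open>auto simp: inj_on_def o_def\<close>)
  moreover have "(\<lambda>k::int. q ^ nat \<bar>k - u\<bar>) summable_on (range (\<lambda>n. u - int n))"
    by (subst summable_on_reindex) (use g in \<open>auto simp: inj_on_def o_def\<close>)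
  moreover have "UNIV = range (\<lambda>n. u + int n) \<union> range (\<lambda>n. u - int n)"
  proof (intro equalityI subsetI)
    fix k :: int
    show "k \<in> range (\<lambda>n. u + int n) \<union> range (\<lambda>n. u - int n)"
    proof (cases "k \<ge> u")
      case True then show ?thesis by (intro UnI1 range_eqI[of _ _ "nat (k - u)"]) auto
    next
      case False then show ?thesis by (intro UnI2 range_eqI[of _ _ "nat (u - k)"]) auto
    qed
  qed auto
  ultimately have "(\<lambda>k::int. q ^ nat \<bar>k - u\<bar>) summable_on UNIV" using summable_on_union by metis
  then show ?thesis by (rule summable_on_subset_banach) auto
qed

text \<open>Translation invariance of the sum over all integers makes the bound uniform in
  \<open>u\<close> and \<open>A\<close>.\<close>

lemma geometric_int_infsum:
  fixes q :: real
  assumes "0 \<le> q" "q < 1"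
  shows "(\<Sum>\<^sub>\<infinity>k\<in>A. q ^ nat \<bar>k - u\<bar>) \<le> (\<Sum>\<^sub>\<infinity>k::int. q ^ nat \<bar>k\<bar>)"
proof -
  have "(\<Sum>\<^sub>\<infinity>k\<in>A. q ^ nat \<bar>k - u\<bar>) \<le> (\<Sum>\<^sub>\<infinity>k. q ^ nat \<bar>k - u\<bar>)"
    by (rule infsum_mono_neutral[OF geometric_int_summable geometric_int_summable]) (use assms in auto)
  also have "\<dots> = (\<Sum>\<^sub>\<infinity>k::int. q ^ nat \<bar>k\<bar>)"
    by (rule infsum_reindex_bij_witness[of _ "\<lambda>k. k + u" "\<lambda>k. k - u"]) auto
  finally show ?thesis .
qed

definition decays :: "real \<Rightarrow> real \<Rightarrow> (int \<Rightarrow> int \<Rightarrow> complex) \<Rightarrow> bool" where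
  "decays C q T \<longleftrightarrow> (\<forall>u v. norm (T u v) \<le> C * q ^ nat \<bar>u - v\<bar>)"

lemma decaysD: "decays C q T \<Longrightarrow> norm (T u v) \<le> C * q ^ nat \<bar>u - v\<bar>"
  by (simp add: decays_def)

lemma decays_const: "decays C q T \<Longrightarrow> 0 \<le> C"
  using decaysD[of C q T 0 0] by (metis abs_zero diff_self mult.right_neutral nat_0 norm_ge_zero order_trans power_0 cancel_comm_monoid_add_class.diff_cancel nat_zero_as_int)

lemma decays_bound:
  assumes "decays C q T" "0 \<le> q" "q < 1"
  shows "norm (T u v) \<le> C"
proof -
  have "norm (T u v) \<le> C * q ^ nat \<bar>u - v\<bar>" by (rule decaysD[OF assms(1)])
  also have "\<dots> \<le> C * 1" using assms decays_const[OF assms(1)] by (intro mult_left_mono power_le_one) auto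
  finally show ?thesis by simp
qed

lemma decays_mono:
  assumes "decays C q T" "C \<le> C'" "0 \<le> q" "q \<le> q'"
  shows "decays C' q' T"
  unfolding decays_def
proof (intro allI)
  fix u v
  have "norm (T u v) \<le> C * q ^ nat \<bar>u - v\<bar>" by (rule decaysD[OF assms(1)])
  also have "\<dots> \<le> C' * q' ^ nat \<bar>u - v\<bar>"
    using assms decays_const[OF assms(1)] by (intro mult_mono power_mono) auto
  finally show "norm (T u v) \<le> C' * q' ^ nat \<bar>u - v\<bar>" .
qed

lemma decays_transpose: "decays C q T \<Longrightarrow> decays C q (\<lambda>u v. T v u)"
  unfolding decays_def by (metis abs_minus_commute)

lemma decays_row:
  assumes "decays C q T" "0 \<le> q" "q < 1"
  shows "(\<lambda>v. norm (T u v)) summable_on A"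
    and "(\<Sum>\<^sub>\<infinity>v\<in>A. norm (T u v)) \<le> C * (\<Sum>\<^sub>\<infinity>k::int. q ^ nat \<bar>k\<bar>)"
proof -
  have le: "norm (T u v) \<le> C * q ^ nat \<bar>v - u\<bar>" for v
    using decaysD[OF assms(1), of u v] by (simp add: abs_minus_commute)
  have s: "(\<lambda>v. C * q ^ nat \<bar>v - u\<bar>) summable_on A"
    by (intro summable_on_cmult_right geometric_int_summable assms)
  show s': "(\<lambda>v. norm (T u v)) summable_on A"
    using s by (rule summable_on_comparison_test) (use le in auto)
  have "(\<Sum>\<^sub>\<infinity>v\<in>A. norm (T u v)) \<le> (\<Sum>\<^sub>\<infinity>v\<in>A. C * q ^ nat \<bar>v - u\<bar>)"
    by (rule infsum_mono[OF s' s le])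
  also have "\<dots> = C * (\<Sum>\<^sub>\<infinity>v\<in>A. q ^ nat \<bar>v - u\<bar>)" by (rule infsum_cmult_right')
  also have "\<dots> \<le> C * (\<Sum>\<^sub>\<infinity>k::int. q ^ nat \<bar>k\<bar>)"
    by (intro mult_left_mono geometric_int_infsum assms decays_const[OF assms(1)])
  finally show "(\<Sum>\<^sub>\<infinity>v\<in>A. norm (T u v)) \<le> C * (\<Sum>\<^sub>\<infinity>k::int. q ^ nat \<bar>k\<bar>)" .
qed

lemmas decays_col = decays_row[OF decays_transpose]

lemma norm_infsum_le_cmult:
  fixes f :: "'s \<Rightarrow> complex"
  assumes g: "g summable_on X" and le: "\<And>s. s \<in> X \<Longrightarrow> norm (f s) \<le> c * g s"
  shows "norm (\<Sum>\<^sub>\<infinity>s\<in>X. f s) \<le> c * (\<Sum>\<^sub>\<infinity>s\<in>X. g s)" "(\<lambda>s. norm (f s)) summable_on X"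
proof -
  have cg: "(\<lambda>s. c * g s) summable_on X" by (rule summable_on_cmult_right[OF g])
  then show s: "(\<lambda>s. norm (f s)) summable_on X"
    by (rule summable_on_comparison_test) (use le in auto)
  have "norm (\<Sum>\<^sub>\<infinity>s\<in>X. f s) \<le> (\<Sum>\<^sub>\<infinity>s\<in>X. norm (f s))" by (rule norm_infsum_bound[OF s])
  also have "\<dots> \<le> (\<Sum>\<^sub>\<infinity>s\<in>X. c * g s)" by (rule infsum_mono[OF s cg le])
  finally show "norm (\<Sum>\<^sub>\<infinity>s\<in>X. f s) \<le> c * (\<Sum>\<^sub>\<infinity>s\<in>X. g s)" by (simp add: infsum_cmult_right')
qed

text \<open>A matrix \<open>A = U D\<close> on the integers with \<open>U\<close> and \<open>D\<close> triangular with respect to the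
  splitting at 0; \<open>U'\<close> and \<open>D'\<close> are the inverses of \<open>U\<close> and \<open>D\<close>. Then \<open>half_inv\<close> is the
  inverse of \<open>A\<close> restricted to the non-negative indices, and \<open>inv_corr\<close> its difference from the
  restriction of \<open>A\<close>'s inverse \<open>full_inv\<close>.\<close>

locale wiener_hopf =
  fixes A U D' U' :: "int \<Rightarrow> int \<Rightarrow> complex" and C q :: real
  assumes q: "0 < q" "q < 1"
    and dec: "decays C q A" "decays C q U" "decays C q D'" "decays C q U'"
    and AD: "\<And>u l. ((\<lambda>k. A u k * D' k l) has_sum U u l) UNIV"
    and UU: "\<And>u v. ((\<lambda>l. U u l * U' l v) has_sum (if u = v then 1 else 0)) UNIV"
    and D0: "\<And>k l. k < 0 \<Longrightarrow> 0 \<le> l \<Longrightarrow> D' k l = 0"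
    and U0: "\<And>u l. 0 \<le> u \<Longrightarrow> l < 0 \<Longrightarrow> U u l = 0"
begin

definition "full_inv u v = (\<Sum>\<^sub>\<infinity>l. D' u l * U' l v)"
definition "half_inv u v = (\<Sum>\<^sub>\<infinity>l\<in>{0..}. D' u l * U' l v)"
definition "inv_corr u v = - (\<Sum>\<^sub>\<infinity>l\<in>{..<0}. D' u l * U' l v)"
definition "G = (\<Sum>\<^sub>\<infinity>k::int. q ^ nat \<bar>k\<bar>)"

lemma q0: "0 \<le> q" using q by simp

lemma C0: "0 \<le> C" using decays_const[OF dec(1)] .

lemma G0: "0 \<le> G" unfolding G_def using q by (intro infsum_nonneg) auto

lemma inner_bound:
  "(\<lambda>l. norm (D' u l * U' l v)) summable_on X" "norm (\<Sum>\<^sub>\<infinity>l\<in>X. D' u l * U' l v) \<le> C * (C * G)"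
proof -
  have le: "norm (D' u l * U' l v) \<le> C * norm (U' l v)" for l
    using decays_bound[OF dec(3) q0 q(2), of u l] by (simp add: norm_mult mult_right_mono)
  note 1 = norm_infsum_le_cmult[OF decays_col(1)[OF dec(4) q0 q(2)] le]
  show "(\<lambda>l. norm (D' u l * U' l v)) summable_on X" by (rule 1)
  show "norm (\<Sum>\<^sub>\<infinity>l\<in>X. D' u l * U' l v) \<le> C * (C * G)"
    using 1(1) decays_col(2)[OF dec(4) q0 q(2), of v X] C0 unfolding G_def
    by (meson order_trans mult_left_mono)
qed

lemma half_inv_eq: "half_inv u v = full_inv u v + inv_corr u v"
proof -
  have "(\<Sum>\<^sub>\<infinity>l\<in>{0..} \<union> {..<0}. D' u l * U' l v) = half_inv u v + (\<Sum>\<^sub>\<infinity>l\<in>{..<0}. D' u l * U' l v)"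
    unfolding half_inv_def
    by (rule infsum_Un_disjoint[OF abs_summable_summable[OF inner_bound(1)] abs_summable_summable[OF inner_bound(1)]]) auto
  then show ?thesis unfolding int_split full_inv_def inv_corr_def by simp
qed

lemma inv_bounds:
  "norm (full_inv u v) \<le> C * (C * G)" "norm (half_inv u v) \<le> C * (C * G)" "norm (inv_corr u v) \<le> C * (C * G)"
  unfolding full_inv_def half_inv_def inv_corr_def norm_minus_cancel by (rule inner_bound)+

text \<open>The intermediate index \<open>l\<close> is negative while \<open>u\<close> and
  \<open>v\<close> are not, so the detour through \<open>l\<close> has length
  \<open>u + v + 2 * \<bar>l\<bar>\<close>. One \<open>\<bar>l\<bar>\<close> pays for the summation
  over \<open>l\<close>, and \<open>u + v\<close> remains as decay away from the end at 0.\<close>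

lemma inv_corr_decay:
  assumes "0 \<le> u" "0 \<le> v"
  shows "norm (inv_corr u v) \<le> C * C * G * q ^ nat (u + v)"
proof -
  have "norm (D' u l * U' l v) \<le> (C * C * q ^ nat (u + v)) * q ^ nat \<bar>l - 0\<bar>" if "l \<in> {..<0}" for l
  proof -
    have "norm (D' u l * U' l v) \<le> (C * q ^ nat \<bar>u - l\<bar>) * (C * q ^ nat \<bar>l - v\<bar>)"
      unfolding norm_mult using q C0 by (intro mult_mono decaysD dec) auto
    also have "\<dots> = C * C * q ^ (nat \<bar>u - l\<bar> + nat \<bar>l - v\<bar>)" by (simp add: power_add)
    also have "\<dots> \<le> C * C * q ^ (nat (u + v) + nat \<bar>l - 0\<bar>)"
      using q C0 assms that by (intro mult_left_mono power_decreasing) auto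
    finally show ?thesis by (simp add: power_add)
  qed
  from norm_infsum_le_cmult(1)[where X="{..<0}", OF geometric_int_summable[OF q0 q(2)] this]
  have "norm (inv_corr u v) \<le> C * C * q ^ nat (u + v) * (\<Sum>\<^sub>\<infinity>l\<in>{..<0}. q ^ nat \<bar>l - 0\<bar>)"
    by (simp add: inv_corr_def)
  also have "\<dots> \<le> C * C * q ^ nat (u + v) * G" unfolding G_def
    using q C0 by (intro mult_left_mono geometric_int_infsum) auto
  finally show ?thesis by (simp add: mult_ac)
qed

lemma A_summable: "(\<lambda>k. norm (A u k * M k)) summable_on X" if "\<And>k. k \<in> X \<Longrightarrow> norm (M k) \<le> K"
proof -
  have le: "norm (A u k * M k) \<le> K * norm (A u k)" if "k \<in> X" for k
    using \<open>\<And>k. k \<in> X \<Longrightarrow> norm (M k) \<le> K\<close>[OF that] by (simp add: norm_mult mult.commute[of K] mult_left_mono)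
  show ?thesis by (rule norm_infsum_le_cmult(2)[OF decays_row(1)[OF dec(1) q0 q(2)] le])
qed

text \<open>Associativity: \<open>A * (D' * U') = (A * D') * U' = U * U' = 1\<close>.\<close>

lemma A_full_inv: "((\<lambda>k. A u k * full_inv k v) has_sum (if u = v then 1 else 0)) UNIV"
proof -
  have "(\<Sum>\<^sub>\<infinity>k. A u k * full_inv k v) = (\<Sum>\<^sub>\<infinity>l. (\<Sum>\<^sub>\<infinity>k. A u k * D' k l) * U' l v)"
    unfolding full_inv_def
    using bilinear_swap(2,3)[of "A u" UNIV "\<lambda>l. U' l v" UNIV D' C]
      decays_row(1)[OF dec(1) q0 q(2)] decays_col(1)[OF dec(4) q0 q(2)] decays_bound[OF dec(3) q0 q(2)] by simp
  also have "\<dots> = (\<Sum>\<^sub>\<infinity>l. U u l * U' l v)" using infsumI[OF AD] by simp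
  also have "\<dots> = (if u = v then 1 else 0)" by (rule infsumI[OF UU])
  finally have i: "(\<Sum>\<^sub>\<infinity>k. A u k * full_inv k v) = (if u = v then 1 else 0)" .
  have "(\<lambda>k. A u k * full_inv k v) summable_on UNIV"
    by (rule abs_summable_summable, rule A_summable, rule inv_bounds)
  then show ?thesis unfolding i[symmetric] by (rule has_sum_infsum)
qed

text \<open>Columns of \<open>D'\<close> with non-negative index have no negative part, so
  \<open>A * D' = U\<close> persists on the half-line; rows of \<open>U\<close> with non-negative
  index have none either, so \<open>U * U' = 1\<close> persists too.\<close>

lemma A_half_inv:
  assumes "0 \<le> u"
  shows "(\<Sum>\<^sub>\<infinity>k\<in>{0..}. A u k * half_inv k v) = (if u = v then 1 else 0)"
proof -
  have "(\<Sum>\<^sub>\<infinity>k\<in>{0..}. A u k * half_inv k v) = (\<Sum>\<^sub>\<infinity>l\<in>{0..}. (\<Sum>\<^sub>\<infinity>k\<in>{0..}. A u k * D' k l) * U' l v)"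
    unfolding half_inv_def
    using bilinear_swap(2,3)[of "A u" "{0..}" "\<lambda>l. U' l v" "{0..}" D' C]
      decays_row(1)[OF dec(1) q0 q(2)] decays_col(1)[OF dec(4) q0 q(2)] decays_bound[OF dec(3) q0 q(2)] by simp
  also have "\<dots> = (\<Sum>\<^sub>\<infinity>l\<in>{0..}. U u l * U' l v)"
  proof (rule infsum_cong)
    fix l :: int assume l: "l \<in> {0..}"
    have "(\<Sum>\<^sub>\<infinity>k\<in>{0..}. A u k * D' k l) = (\<Sum>\<^sub>\<infinity>k. A u k * D' k l)"
      by (rule infsum_cong_neutral) (use D0 l in auto)
    then show "(\<Sum>\<^sub>\<infinity>k\<in>{0..}. A u k * D' k l) * U' l v = U u l * U' l v" using infsumI[OF AD] by simp
  qed
  also have "\<dots> = (\<Sum>\<^sub>\<infinity>l. U u l * U' l v)"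
    by (rule infsum_cong_neutral) (use U0 assms in auto)
  also have "\<dots> = (if u = v then 1 else 0)" by (rule infsumI[OF UU])
  finally show ?thesis .
qed

text \<open>\<open>half_inv\<close> on the half-line and \<open>full_inv\<close> on the whole line
  are both right inverses of \<open>A\<close>. Hence the correction contributes exactly what the
  full inverse loses by dropping the negative indices. The error estimate for finite sections rests
  on this identity at each end.\<close>

lemma A_inv_corr:
  assumes "0 \<le> u"
  shows "(\<Sum>\<^sub>\<infinity>k\<in>{0..}. A u k * inv_corr k v) = (\<Sum>\<^sub>\<infinity>k\<in>{..<0}. A u k * full_inv k v)"
proof -
  have s1: "(\<lambda>k. A u k * full_inv k v) summable_on X" "(\<lambda>k. A u k * inv_corr k v) summable_on X" for X
    by (rule abs_summable_summable, rule A_summable, rule inv_bounds)+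
  have "(\<Sum>\<^sub>\<infinity>k\<in>{0..}. A u k * full_inv k v) + (\<Sum>\<^sub>\<infinity>k\<in>{0..}. A u k * inv_corr k v) =
    (\<Sum>\<^sub>\<infinity>k\<in>{0..}. A u k * half_inv k v)"
    using infsum_add[OF s1(1,2)] by (simp add: half_inv_eq distrib_left)
  also have "\<dots> = (\<Sum>\<^sub>\<infinity>k. A u k * full_inv k v)" using A_half_inv[OF assms] infsumI[OF A_full_inv] by simp
  also have "\<dots> = (\<Sum>\<^sub>\<infinity>k\<in>{0..} \<union> {..<0}. A u k * full_inv k v)" unfolding int_split ..
  also have "\<dots> = (\<Sum>\<^sub>\<infinity>k\<in>{0..}. A u k * full_inv k v) + (\<Sum>\<^sub>\<infinity>k\<in>{..<0}. A u k * full_inv k v)"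
    by (rule infsum_Un_disjoint[OF s1(1) s1(1)]) auto
  finally show ?thesis by simp
qed

end

section \<open>Determinantal processes\<close>

lemma space_config_space: "space (config_space E) = Pow E"
  unfolding config_space_def by (rule space_measure_of) auto

lemma config_space_event:
  assumes A: "finite A" "A \<subseteq> E" "B \<subseteq> A"
  shows "{X \<in> Pow E. X \<inter> A = B} \<in> sets (config_space E)"
proof -
  note spC = space_config_space[of E]
  have s1: "{X \<in> Pow E. s \<in> X} \<in> sets (config_space E)" if "s \<in> E" for s
    unfolding config_space_def using that by (subst sets_measure_of) auto
  have s0: "{X \<in> Pow E. s \<notin> X} \<in> sets (config_space E)" if "s \<in> E" for s
  proof -
    have "{X \<in> Pow E. s \<notin> X} = space (config_space E) - {X \<in> Pow E. s \<in> X}" by (auto simp: spC)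
    then show ?thesis using s1[OF that] by (metis sets.compl_sets)
  qed
  show ?thesis
  proof (cases "A = {}")
    case True
    then have "{X \<in> Pow E. X \<inter> A = B} = space (config_space E)" using A by (auto simp: spC)
    then show ?thesis by simp
  next
    case False
    have "{X \<in> Pow E. X \<inter> A = B} = (\<Inter>s\<in>A. {X \<in> Pow E. (s \<in> X) = (s \<in> B)})"
      using A False by auto
    also have "\<dots> \<in> sets (config_space E)"
    proof (rule sets.finite_INT[OF A(1) False])
      fix s assume "s \<in> A"
      then show "{X \<in> Pow E. (s \<in> X) = (s \<in> B)} \<in> sets (config_space E)"
        using s0[of s] s1[of s] A by (cases "s \<in> B") auto
    qed
    finally show ?thesis .
  qed
qed

text \<open>A random set is encoded by its real-valued indicator family, because the projective
  limit is taken over the Borel space of the reals; the set is recovered from the coordinates equal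
  to 1.\<close>

lemma pmf_kolmogorov:
  fixes p :: "'a set \<Rightarrow> 'a set pmf" and E :: "'a set"
  assumes supp: "\<And>J. finite J \<Longrightarrow> J \<subseteq> E \<Longrightarrow> set_pmf (p J) \<subseteq> Pow J"
    and cons: "\<And>J H. finite H \<Longrightarrow> H \<subseteq> E \<Longrightarrow> J \<subseteq> H \<Longrightarrow> map_pmf (\<lambda>B. B \<inter> J) (p H) = p J"
  obtains Q where "prob_space Q" "space Q = Pow E" "sets Q = sets (config_space E)"
    "\<And>A B. finite A \<Longrightarrow> A \<subseteq> E \<Longrightarrow> B \<subseteq> A \<Longrightarrow> measure Q {X \<in> space Q. X \<inter> A = B} = pmf (p A) B"
proof -
  define I :: "'a set \<Rightarrow> 'a set \<Rightarrow> 'a \<Rightarrow> real" where "I = (\<lambda>J B. \<lambda>i\<in>J. indicator B i)"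
  define P where "P = (\<lambda>J. distr (measure_pmf (p J)) (PiM J (\<lambda>_. borel::real measure)) (I J))"
  have I_meas: "I J \<in> measurable (measure_pmf q) (PiM J (\<lambda>_. borel))" for J and q :: "'a set pmf"
    by (simp add: I_def space_PiM)
  have IJ: "I J (B \<inter> J) = I J B" for J B by (auto simp: I_def indicator_def fun_eq_iff)
  have "prob_space (P J)" for J unfolding P_def
    by (rule prob_space.prob_space_distr[OF prob_space_measure_pmf I_meas])
  moreover have "P J = distr (P H) (PiM J (\<lambda>_. borel)) (\<lambda>f. restrict f J)"
    if JH: "J \<subseteq> H" "finite H" "H \<subseteq> E" for J H
  proof -
    have "distr (P H) (PiM J (\<lambda>_. borel)) (\<lambda>f. restrict f J) =
      distr (measure_pmf (p H)) (PiM J (\<lambda>_. borel)) ((\<lambda>f. restrict f J) \<circ> I H)"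
      unfolding P_def by (rule distr_distr[OF measurable_restrict_subset[OF JH(1)] I_meas])
    also have "(\<lambda>f. restrict f J) \<circ> I H = I J \<circ> (\<lambda>B. B \<inter> J)"
      using JH(1) by (auto simp: I_def fun_eq_iff indicator_def)
    also have "distr (measure_pmf (p H)) (PiM J (\<lambda>_. borel)) (I J \<circ> (\<lambda>B. B \<inter> J)) =
      distr (distr (measure_pmf (p H)) (count_space UNIV) (\<lambda>B. B \<inter> J)) (PiM J (\<lambda>_. borel)) (I J)"
      by (rule distr_distr[symmetric]) (auto simp: I_def space_PiM)
    also have "distr (measure_pmf (p H)) (count_space UNIV) (\<lambda>B. B \<inter> J) = measure_pmf (p J)"
      using cons[OF JH(2,3,1)] by (metis map_pmf_rep_eq)
    finally show "P J = distr (P H) (PiM J (\<lambda>_. borel)) (\<lambda>f. restrict f J)" unfolding P_def by (rule sym)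
  qed
  ultimately interpret pp: polish_projective E P
    unfolding polish_projective_def projective_family_def by blast
  \<comment> \<open>Coordinates other than 1 are read as absence of the point. This loses nothing:
    at each site the law of the coordinate is carried by 0 and 1.\<close>
  define F where "F = (\<lambda>\<omega>::'a \<Rightarrow> real. {s\<in>E. \<omega> s = 1})"
  have spL: "space pp.lim = space (PiM E (\<lambda>_. borel))" "sets pp.lim = sets (PiM E (\<lambda>_. borel))"
    by simp_all
  have F_meas: "F \<in> measurable pp.lim (config_space E)"
    unfolding config_space_def
  proof (rule measurable_sigma_sets)
    show "(\<lambda>s. {X \<in> Pow E. s \<in> X}) ` E \<subseteq> Pow (Pow E)" by auto
    show "F \<in> space pp.lim \<rightarrow> Pow E" by (auto simp: F_def)
    fix y assume "y \<in> (\<lambda>s. {X \<in> Pow E. s \<in> X}) ` E"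
    then obtain s where s: "s \<in> E" "y = {X \<in> Pow E. s \<in> X}" by auto
    have "F -` y \<inter> space pp.lim = {\<omega> \<in> space (PiM E (\<lambda>_. borel)). \<omega> s = 1}"
      using s by (auto simp: F_def)
    also have "\<dots> \<in> sets (PiM E (\<lambda>_. borel))" using s by measurable
    finally show "F -` y \<inter> space pp.lim \<in> sets pp.lim" by simp
  qed (rule sets_measure_of, auto)
  define Q where "Q = distr pp.lim (config_space E) F"
  note spC = space_config_space[of E]
  show thesis
  proof
    show "prob_space Q" unfolding Q_def by (rule pp.P.prob_space_distr[OF F_meas])
    show spQ: "space Q = Pow E" by (simp add: Q_def spC)
    show "sets Q = sets (config_space E)" by (simp add: Q_def)
    fix A B assume A: "finite A" "A \<subseteq> E" "B \<subseteq> A"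
    note ev = config_space_event[OF A]
    define Y where "Y = {\<omega> \<in> space (PiM A (\<lambda>_. borel::real measure)). {s\<in>A. \<omega> s = 1} = B}"
    have Y: "Y \<in> sets (PiM A (\<lambda>_. borel))"
    proof -
      have "Y = {\<omega> \<in> space (PiM A (\<lambda>_. borel::real measure)). \<forall>s\<in>A. (\<omega> s = 1) = (s \<in> B)}"
        using A by (auto simp: Y_def)
      also have "\<dots> \<in> sets (PiM A (\<lambda>_. borel))" using A by measurable
      finally show ?thesis .
    qed
    have "measure Q {X \<in> space Q. X \<inter> A = B} = measure pp.lim (F -` {X \<in> Pow E. X \<inter> A = B} \<inter> space pp.lim)"
      unfolding spQ unfolding Q_def by (rule measure_distr[OF F_meas ev])
    also have "F -` {X \<in> Pow E. X \<inter> A = B} \<inter> space pp.lim = pp.emb E A Y"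
      using A by (auto simp: F_def prod_emb_def Y_def space_PiM PiE_def extensional_def spL)
    also have "measure pp.lim \<dots> = measure (P A) Y" by (rule pp.measure_lim_emb[OF A(2,1) Y])
    also have "\<dots> = measure (measure_pmf (p A)) (I A -` Y \<inter> space (measure_pmf (p A)))"
      unfolding P_def by (rule measure_distr[OF I_meas Y])
    also have "\<dots> = measure (measure_pmf (p A)) {B}"
    proof (rule measure_prob_cong_0)
      fix X assume X: "X \<in> I A -` Y \<inter> space (measure_pmf (p A)) - {B}"
      show "pmf (p A) X = 0"
      proof (rule ccontr)
        assume "pmf (p A) X \<noteq> 0"
        then have "X \<subseteq> A" using supp[OF A(1,2)] by (auto simp: set_pmf_iff)
        moreover have "{s\<in>A. I A X s = 1} = B" using X by (simp add: Y_def)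
        ultimately have "X = B" by (auto simp: I_def indicator_def)
        with X show False by simp
      qed
    next
      fix X assume X: "X \<in> {B} - I A -` Y \<inter> space (measure_pmf (p A))"
      have "I A B \<in> Y" using A by (auto simp: Y_def I_def space_PiM indicator_def)
      with X show "pmf (p A) X = 0" by simp
    qed
    finally show "measure Q {X \<in> space Q. X \<inter> A = B} = pmf (p A) B" by (simp add: measure_pmf_single)
  qed
qed

text \<open>Convergence of the kernels gives convergence of the probabilities of all finite
  patterns. Non-negativity and consistency survive in the limit, so the limits form a projective
  family. Its extension is the limiting process, and patterns without empty sites give the
  determinantal formula.\<close>

lemma converges_to_determinantalI:
  fixes E :: "'a set"
  assumes pr: "\<And>n. n \<ge> 1 \<Longrightarrow> prob_space (P n)"
    and meas: "\<And>n A B. n \<ge> 1 \<Longrightarrow> finite A \<Longrightarrow> A \<subseteq> E \<Longrightarrow> B \<subseteq> A \<Longrightarrow> {X \<in> space (P n). X \<inter> A = B} \<in> sets (P n)"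
    and corr: "\<And>n A B. n \<ge> 1 \<Longrightarrow> finite A \<Longrightarrow> A \<subseteq> E \<Longrightarrow> B \<subseteq> A \<Longrightarrow>
      complex_of_real (measure (P n) {X \<in> space (P n). X \<inter> A = B}) = mixed_minor (K n) B (A - B)"
    and lim: "\<And>s t. s \<in> E \<Longrightarrow> t \<in> E \<Longrightarrow> (\<lambda>n. K n s t) \<longlonglongrightarrow> K' s t"
  shows "converges_to_determinantal E P K'"
proof -
  define w where "w = (\<lambda>A B. Re (mixed_minor K' B (A - B)))"
  define \<mu> where "\<mu> = (\<lambda>n A B. measure (P n) {X \<in> space (P n). X \<inter> A = B})"
  have conv: "(\<lambda>n. complex_of_real (\<mu> n A B)) \<longlonglongrightarrow> mixed_minor K' B (A - B)"
    if A: "finite A" "A \<subseteq> E" "B \<subseteq> A" for A B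
  proof (rule Lim_transform_eventually)
    show "(\<lambda>n. mixed_minor (K n) B (A - B)) \<longlonglongrightarrow> mixed_minor K' B (A - B)"
      using A by (intro mixed_minor_tendsto lim) (auto intro: finite_subset)
    show "\<forall>\<^sub>F n in sequentially. mixed_minor (K n) B (A - B) = complex_of_real (\<mu> n A B)"
      using eventually_ge_at_top[of 1] by eventually_elim (use corr A in \<open>auto simp: \<mu>_def\<close>)
  qed
  have real: "mixed_minor K' B (A - B) = of_real (w A B)" if A: "finite A" "A \<subseteq> E" "B \<subseteq> A" for A B
  proof -
    have "Im (mixed_minor K' B (A - B)) = 0" using tendsto_Im[OF conv[OF A]] by (simp add: LIMSEQ_const_iff)
    then show ?thesis by (simp add: w_def complex_eq_iff)
  qed
  have convw: "(\<lambda>n. \<mu> n A B) \<longlonglongrightarrow> w A B" if A: "finite A" "A \<subseteq> E" "B \<subseteq> A" for A B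
    using tendsto_Re[OF conv[OF A]] by (simp add: w_def)
  have w0: "0 \<le> w A B" if A: "finite A" "A \<subseteq> E" "B \<subseteq> A" for A B
    by (rule LIMSEQ_le_const[OF convw[OF A]]) (auto simp: \<mu>_def)
  \<comment> \<open>Consistency is additivity of \<open>P n\<close> over the traces on
    \<open>H\<close>; it passes to the limit because the sum is finite.\<close>
  have add: "w J B = (\<Sum>B'\<in>{B'\<in>Pow H. B' \<inter> J = B}. w H B')" if H: "finite H" "H \<subseteq> E" "J \<subseteq> H" "B \<subseteq> J" for J H B
  proof (rule LIMSEQ_unique)
    have fJ: "finite J" "J \<subseteq> E" using H finite_subset by auto
    show "(\<lambda>n. \<mu> n J B) \<longlonglongrightarrow> w J B" by (rule convw[OF fJ H(4)])
    have "(\<lambda>n. \<Sum>B'\<in>{B'\<in>Pow H. B' \<inter> J = B}. \<mu> n H B') \<longlonglongrightarrow> (\<Sum>B'\<in>{B'\<in>Pow H. B' \<inter> J = B}. w H B')"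
      using H by (intro tendsto_sum convw) auto
    then show "(\<lambda>n. \<mu> n J B) \<longlonglongrightarrow> (\<Sum>B'\<in>{B'\<in>Pow H. B' \<inter> J = B}. w H B')"
    proof (rule Lim_transform_eventually)
      show "\<forall>\<^sub>F n in sequentially. (\<Sum>B'\<in>{B'\<in>Pow H. B' \<inter> J = B}. \<mu> n H B') = \<mu> n J B"
        using eventually_ge_at_top[of 1]
      proof eventually_elim
        case (elim n)
        interpret prob_space "P n" by (rule pr[OF elim])
        have "\<mu> n J B = measure (P n) (\<Union>B'\<in>{B'\<in>Pow H. B' \<inter> J = B}. {X \<in> space (P n). X \<inter> H = B'})"
          unfolding \<mu>_def by (rule arg_cong[of _ _ "measure (P n)"]) (use H in auto)
        also have "\<dots> = (\<Sum>B'\<in>{B'\<in>Pow H. B' \<inter> J = B}. \<mu> n H B')"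
          unfolding \<mu>_def
          by (rule finite_measure_finite_Union) (use H elim in \<open>auto simp: disjoint_family_on_def intro!: meas\<close>)
        finally show ?case by simp
      qed
    qed
  qed
  \<comment> \<open>Total mass 1 is consistency with the empty window, whose minor is the empty
    determinant.\<close>
  have tot: "(\<Sum>B\<in>Pow A. w A B) = 1" if A: "finite A" "A \<subseteq> E" for A
  proof -
    have "w {} {} = (\<Sum>B\<in>{B'\<in>Pow A. B' \<inter> {} = {}}. w A B)" by (rule add) (use A in auto)
    moreover have "w {} {} = 1" by (simp add: w_def mixed_minor_def set_det_def)
    ultimately show ?thesis by (simp add: Pow_def)
  qed
  \<comment> \<open>Extended by 0 to sets not contained in \<open>A\<close>, since
    \<open>embed_pmf\<close> expects a density on the whole type.\<close>
  define f where "f = (\<lambda>A B. if B \<subseteq> A then w A B else 0)"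
  define p where "p = (\<lambda>A. embed_pmf (f A))"
  have f0: "0 \<le> f A B" if "finite A" "A \<subseteq> E" for A B using w0[OF that] by (simp add: f_def)
  have fint: "(\<integral>\<^sup>+B. ennreal (f A B) \<partial>count_space UNIV) = 1" if A: "finite A" "A \<subseteq> E" for A
  proof -
    have "(\<integral>\<^sup>+B. ennreal (f A B) \<partial>count_space UNIV) = (\<Sum>B\<in>Pow A. ennreal (f A B))"
      by (rule nn_integral_count_space'[of "Pow A"]) (use A in \<open>auto simp: f_def\<close>)
    also have "\<dots> = ennreal (\<Sum>B\<in>Pow A. f A B)" by (rule sum_ennreal) (use f0[OF A] in auto)
    also have "(\<Sum>B\<in>Pow A. f A B) = 1" using tot[OF A] by (simp add: f_def)
    finally show ?thesis by simp
  qed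
  have pf: "pmf (p A) B = f A B" if A: "finite A" "A \<subseteq> E" for A B
    unfolding p_def by (rule pmf_embed_pmf[OF f0[OF A] fint[OF A]])
  have supp: "set_pmf (p A) \<subseteq> Pow A" if A: "finite A" "A \<subseteq> E" for A
    by (auto simp: set_pmf_iff pf[OF A] f_def split: if_splits)
  have cons: "map_pmf (\<lambda>B. B \<inter> J) (p H) = p J" if H: "finite H" "H \<subseteq> E" "J \<subseteq> H" for J H
  proof (rule pmf_eqI)
    fix B
    have J: "finite J" "J \<subseteq> E" using H finite_subset by auto
    have "pmf (map_pmf (\<lambda>B. B \<inter> J) (p H)) B = measure (measure_pmf (p H)) ((\<lambda>B. B \<inter> J) -` {B})" by (rule pmf_map)
    also have "\<dots> = measure (measure_pmf (p H)) {B'\<in>Pow H. B' \<inter> J = B}"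
    proof (rule measure_prob_cong_0)
      fix X assume "X \<in> (\<lambda>B. B \<inter> J) -` {B} - {B'\<in>Pow H. B' \<inter> J = B}"
      then show "pmf (p H) X = 0" using pf[OF H(1,2)] by (auto simp: f_def)
    qed auto
    also have "\<dots> = (\<Sum>B'\<in>{B'\<in>Pow H. B' \<inter> J = B}. pmf (p H) B')"
      by (rule measure_measure_pmf_finite) (use H in auto)
    also have "\<dots> = (\<Sum>B'\<in>{B'\<in>Pow H. B' \<inter> J = B}. w H B')" using pf[OF H(1,2)] by (auto simp: f_def intro!: sum.cong)
    also have "\<dots> = f J B"
    proof (cases "B \<subseteq> J")
      case True then show ?thesis using add[OF H True] by (simp add: f_def)
    next
      case False
      then have "{B'\<in>Pow H. B' \<inter> J = B} = {}" by auto
      then show ?thesis using False by (simp only: f_def) simp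
    qed
    finally show "pmf (map_pmf (\<lambda>B. B \<inter> J) (p H)) B = pmf (p J) B" using pf[OF J] by simp
  qed
  obtain Q where Q: "prob_space Q" "space Q = Pow E" "sets Q = sets (config_space E)"
    "\<And>A B. finite A \<Longrightarrow> A \<subseteq> E \<Longrightarrow> B \<subseteq> A \<Longrightarrow> measure Q {X \<in> space Q. X \<inter> A = B} = pmf (p A) B"
    by (rule pmf_kolmogorov[of E p, OF supp cons]) (assumption | rule that)+
  have Qw: "measure Q {X \<in> space Q. X \<inter> A = B} = w A B" if "finite A" "A \<subseteq> E" "B \<subseteq> A" for A B
    using Q(4)[OF that] pf[OF that(1,2)] that by (simp add: f_def)
  show ?thesis unfolding converges_to_determinantal_def
  proof (intro exI conjI)
    show "determinantal_process E K' Q" unfolding determinantal_process_def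
    proof (intro conjI allI impI Q)
      fix ps :: "'a list" assume ps: "distinct ps" "set ps \<subseteq> E"
      have "{X \<in> space Q. set ps \<subseteq> X} = {X \<in> space Q. X \<inter> set ps = set ps}" by auto
      then have "complex_of_real (measure Q {X \<in> space Q. set ps \<subseteq> X}) = mixed_minor K' (set ps) {}"
        using Qw[of "set ps" "set ps"] real[of "set ps" "set ps"] ps by simp
      also have "\<dots> = Determinant.det (Matrix.mat (length ps) (length ps) (\<lambda>(a, b). K' (ps ! a) (ps ! b)))"
        by (rule mixed_minor_list[OF ps(1) refl])
      finally show "complex_of_real (measure Q {X \<in> space Q. set ps \<subseteq> X}) =
        Determinant.det (Matrix.mat (length ps) (length ps) (\<lambda>(a, b). K' (ps ! a) (ps ! b)))" .
    qed
    show "process_converges E P Q" unfolding process_converges_def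
      using convw Qw by (simp add: \<mu>_def)
  qed
qed

section \<open>Approximate inverses of finite sections\<close>

lemma l1_transform:
  fixes M :: "'s \<Rightarrow> 't \<Rightarrow> complex" and y :: "'t \<Rightarrow> complex"
  assumes y: "(\<lambda>t. norm (y t)) summable_on Y"
    and M: "\<And>t. t \<in> Y \<Longrightarrow> (\<lambda>s. norm (M s t)) summable_on X" "\<And>t. t \<in> Y \<Longrightarrow> (\<Sum>\<^sub>\<infinity>s\<in>X. norm (M s t)) \<le> B"
  shows "(\<lambda>s. norm (\<Sum>\<^sub>\<infinity>t\<in>Y. M s t * y t)) summable_on X"
proof -
  have "(\<lambda>t. norm (y t) * B) summable_on Y" by (rule summable_on_cmult_left[OF y])
  then have s1: "(\<lambda>t. norm (y t) * (\<Sum>\<^sub>\<infinity>s\<in>X. norm (M s t))) summable_on Y"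
    by (rule summable_on_comparison_test) (auto intro!: mult_left_mono mult_nonneg_nonneg M infsum_nonneg)
  have "(\<lambda>ts. norm ((\<lambda>(t,s). M s t * y t) ts)) summable_on Y \<times> X"
    unfolding Infinite_Sum.abs_summable_on_Sigma_iff
    using s1 M(1) by (simp add: norm_mult infsum_cmult_right' abs_mult infsum_nonneg summable_on_cmult_right
        mult.commute[of "norm (M _ _)"])
  then have "(\<lambda>(t,s). norm (M s t * y t)) summable_on Y \<times> X" by (simp add: case_prod_unfold)
  then have "(\<lambda>(s,t). norm (M s t * y t)) summable_on X \<times> Y"
    using summable_on_swap[of "\<lambda>(s,t). norm (M s t * y t)" X Y] by (simp add: case_prod_unfold)
  then have s2: "(\<lambda>s. \<Sum>\<^sub>\<infinity>t\<in>Y. norm (M s t * y t)) summable_on X" "\<And>s. s \<in> X \<Longrightarrow> (\<lambda>t. norm (M s t * y t)) summable_on Y"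
    by (rule summable_on_Sigma_banach, rule summable_on_SigmaD1)
  show ?thesis
    using s2(1) by (rule summable_on_comparison_test) (auto intro!: norm_infsum_bound s2(2))
qed

text \<open>If \<open>X\<close> is an exact left inverse and \<open>A * B = 1 + E\<close>, then
  \<open>X = B - X * E\<close>. For the largest modulus \<open>m\<close> of an entry of
  \<open>X\<close> this gives \<open>m \<le> b + m / 2\<close>, an a priori bound; putting it back
  into the same identity gives closeness to \<open>B\<close>.\<close>

lemma approximate_inverse:
  fixes X A B :: "'i \<Rightarrow> 'i \<Rightarrow> complex" and e b :: real
  assumes fin: "finite I"
    and XA: "\<And>u v. u \<in> I \<Longrightarrow> v \<in> I \<Longrightarrow> (\<Sum>k\<in>I. X u k * A k v) = (if u = v then 1 else 0)"
    and AB: "\<And>u v. u \<in> I \<Longrightarrow> v \<in> I \<Longrightarrow> norm ((\<Sum>k\<in>I. A u k * B k v) - (if u = v then 1 else 0)) \<le> e"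
    and B: "\<And>u v. u \<in> I \<Longrightarrow> v \<in> I \<Longrightarrow> norm (B u v) \<le> b" and small: "card I * e \<le> 1/2"
    and uv: "u \<in> I" "v \<in> I"
  shows "norm (X u v) \<le> 2 * b" "norm (X u v - B u v) \<le> 2 * b * (card I * e)"
proof -
  define E where "E = (\<lambda>u v. (\<Sum>k\<in>I. A u k * B k v) - (if u = v then 1 else 0))"
  have XB: "X u v = B u v - (\<Sum>k\<in>I. X u k * E k v)" if "u \<in> I" "v \<in> I" for u v
  proof -
    have "(\<Sum>k\<in>I. X u k * E k v) = (\<Sum>k\<in>I. \<Sum>l\<in>I. X u k * A k l * B l v) - (\<Sum>k\<in>I. if k = v then X u k else 0)"
      by (simp add: E_def algebra_simps sum_distrib_left sum_subtractf if_distrib[of "\<lambda>x. _ * x"] cong: if_cong)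
    also have "(\<Sum>k\<in>I. if k = v then X u k else 0) = X u v" using fin that by simp
    also have "(\<Sum>k\<in>I. \<Sum>l\<in>I. X u k * A k l * B l v) = (\<Sum>l\<in>I. (\<Sum>k\<in>I. X u k * A k l) * B l v)"
      by (subst sum.swap) (simp add: sum_distrib_right)
    also have "\<dots> = (\<Sum>l\<in>I. if u = l then B l v else 0)"
      by (rule sum.cong[OF refl]) (use XA that in simp)
    also have "\<dots> = B u v" using fin that by simp
    finally show ?thesis by simp
  qed
  \<comment> \<open>Finiteness of the index set provides a maximum, and the smallness assumption
    lets half of it be absorbed on the left.\<close>
  define m where "m = Max ((\<lambda>(u,v). norm (X u v)) ` (I \<times> I))"
  have mX: "norm (X u v) \<le> m" if "u \<in> I" "v \<in> I" for u v
    unfolding m_def using fin that by (intro Max_ge) (auto intro!: image_eqI[of _ _ "(u,v)"])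
  have err: "norm (\<Sum>k\<in>I. X u k * E k v) \<le> m * (card I * e)" if "u \<in> I" "v \<in> I" for u v
  proof -
    have "norm (\<Sum>k\<in>I. X u k * E k v) \<le> (\<Sum>k\<in>I. m * e)"
    proof (rule sum_norm_le)
      fix k assume k: "k \<in> I"
      have "0 \<le> m" using mX[OF that] norm_ge_zero order_trans by blast
      then show "norm (X u k * E k v) \<le> m * e" unfolding norm_mult
        using mX[OF that(1) k] AB[OF k that(2)] by (intro mult_mono) (auto simp: E_def)
    qed
    then show ?thesis by (simp add: mult_ac)
  qed
  have "m \<in> (\<lambda>(u,v). norm (X u v)) ` (I \<times> I)" unfolding m_def using fin uv by (intro Max_in) auto
  then obtain u0 v0 where 0: "u0 \<in> I" "v0 \<in> I" "m = norm (X u0 v0)" by auto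
  have m0: "0 \<le> m" using 0 by simp
  have "m \<le> norm (B u0 v0) + norm (\<Sum>k\<in>I. X u0 k * E k v0)"
    unfolding 0(3) XB[OF 0(1,2)] by (rule norm_triangle_ineq4)
  also have "\<dots> \<le> b + m * (1/2)"
    using B[OF 0(1,2)] err[OF 0(1,2)] mult_left_mono[OF small m0] by linarith
  finally have mb: "m \<le> 2 * b" by simp
  then show "norm (X u v) \<le> 2 * b" using mX[OF uv] by simp
  have e0: "0 \<le> card I * e" using AB[OF uv] norm_ge_zero order_trans by (metis mult_nonneg_nonneg of_nat_0_le_iff)
  have "norm (X u v - B u v) \<le> m * (card I * e)" using XB[OF uv] err[OF uv] by simp
  also have "\<dots> \<le> 2 * b * (card I * e)" using mb e0 by (intro mult_right_mono)
  finally show "norm (X u v - B u v) \<le> 2 * b * (card I * e)" .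
qed

text \<open>Shaped after the chain of facts collected at the end of
  \<open>section_error\<close>.\<close>

lemma norm_two_step:
  fixes x y :: complex and a b c d e t :: real
  shows "x = y \<Longrightarrow> norm y \<le> a + b \<Longrightarrow> a \<le> c \<Longrightarrow> c \<le> e \<Longrightarrow> b \<le> d \<Longrightarrow> d \<le> e \<Longrightarrow> t = e + e \<Longrightarrow> norm x \<le> t"
  by simp

text \<open>The second instance is the same matrix seen from the other end. \<open>same_inv\<close>
  expresses that two factorizations of one symbol give the same inverse on all integers; the
  periodicity assumptions translate the upper end \<open>p * n\<close> of the section back to
  0.\<close>

locale finite_section =
  bot: wiener_hopf A U D' U' C q +
  top: wiener_hopf "\<lambda>u v. A (- 1 - u) (- 1 - v)" UT DT' UT' C q
  for A U D' U' UT DT' UT' C q +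
  fixes p :: nat
  assumes p: "1 \<le> p"
    and same_inv: "\<And>u v. top.full_inv u v = bot.full_inv (- 1 - u) (- 1 - v)"
    and per_A: "\<And>u v k. A (u + int p * k) (v + int p * k) = A u v"
    and per_inv: "\<And>u v k. bot.full_inv (u + int p * k) (v + int p * k) = bot.full_inv u v"
begin

lemma le_section: "int n \<le> int (p * n)"
  using mult_le_mono1[OF p, of n] by (simp only: of_nat_le_iff mult_1)

lemma eventually_section: "\<forall>\<^sub>F n in sequentially. n0 \<le> n \<and> u < int (p * n) \<and> v < int (p * n)"
  using eventually_ge_at_top[of "n0 + nat u + nat v + 1"]
proof eventually_elim
  case (elim n)
  then have "n0 \<le> n" "u < int n" "v < int n" by auto
  then show ?case using le_section[of n] by (meson order_less_le_trans)
qed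

definition "approx n u v = bot.full_inv u v + bot.inv_corr u v + top.inv_corr (n - 1 - u) (n - 1 - v)"

lemma approx_bound: "norm (approx n u v) \<le> 3 * (C * (C * bot.G))"
  unfolding approx_def
  using bot.inv_bounds(1)[of u v] bot.inv_bounds(3)[of u v] top.inv_bounds(3)[of "n-1-u" "n-1-v"]
  by (intro norm_triangle_le[OF order_trans[OF add_right_mono[OF norm_triangle_ineq]]])
    auto

text \<open>On the section the full inverse loses its parts below 0 and from \<open>n\<close> on. By
  \<open>A_inv_corr\<close> each correction restores one of them, but as a sum over a half-line that
  reaches past the opposite end. Only these two overhangs remain; they lie at distance at least
  \<open>n\<close> from the end they correct, hence the power of \<open>q\<close>. The constant is
  the bound \<open>C * C * G\<close> of \<open>inv_corr_decay\<close> times the row sum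
  \<open>C * G\<close> of \<open>A\<close>, once for each end.\<close>

lemma section_error:
  assumes n: "n = int p * k" and u: "0 \<le> u" "u < n" and v: "0 \<le> v" "v < n"
  shows "norm ((\<Sum>w\<in>{0..<n}. A u w * approx n w v) - (if u = v then 1 else 0)) \<le>
     2 * (C * C * bot.G * (C * bot.G)) * q ^ nat n"
proof -
  let ?L = "\<lambda>w. A u w * bot.full_inv w v" and ?K = "\<lambda>w. A u w * bot.inv_corr w v"
    and ?H = "\<lambda>w. A u w * top.inv_corr (n - 1 - w) (n - 1 - v)"
  have s: "?L summable_on X" "?K summable_on X" "?H summable_on X" for X
    by (rule abs_summable_summable, rule bot.A_summable, rule bot.inv_bounds top.inv_bounds)+
  have split: "infsum f {0..<n} + (infsum f {..<0} + infsum f {n..}) = infsum f UNIV"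
    "infsum f {0..<n} + infsum f {n..} = infsum f {0..}"
    "infsum f {..<0} + infsum f {0..<n} = infsum f {..<n}"
    if f: "\<And>X. f summable_on X" for f :: "int \<Rightarrow> complex"
  proof -
    have e1: "{0..<n} \<union> {n..} = {0..}" and e2: "{..<0} \<union> {0..<n} = {..<n}" using u by auto
    show 1: "infsum f {0..<n} + infsum f {n..} = infsum f {0..}"
      unfolding e1[symmetric] by (rule infsum_Un_disjoint[OF f f, symmetric]) auto
    show "infsum f {..<0} + infsum f {0..<n} = infsum f {..<n}"
      unfolding e2[symmetric] by (rule infsum_Un_disjoint[OF f f, symmetric]) auto
    have "infsum f {0..} + infsum f {..<0} = infsum f UNIV"
      unfolding int_split[symmetric] by (rule infsum_Un_disjoint[OF f f, symmetric]) auto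
    then show "infsum f {0..<n} + (infsum f {..<0} + infsum f {n..}) = infsum f UNIV"
      unfolding 1[symmetric] by (simp only: ac_simps)
  qed
  \<comment> \<open>As \<open>n\<close> is a multiple of \<open>p\<close>, reversal of the section
    can be traded for the reflection at 0 that defines \<open>top\<close>.\<close>
  have A': "A (- 1 - (n - 1 - u)) (- 1 - w) = A u (n - 1 - w)" for w
    using per_A[of "- 1 - (n - 1 - u)" k "- 1 - w"] n by (simp add: algebra_simps)
  have L': "top.full_inv w (n - 1 - v) = bot.full_inv (n - 1 - w) v" for w
    using per_inv[of "- 1 - w" k "v - n"] n by (simp add: same_inv algebra_simps)
  \<comment> \<open>The upper correction equals the loss beyond \<open>n\<close>: reflect, apply
    \<open>A_inv_corr\<close> for \<open>top\<close>, and reflect back.\<close>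
  have "infsum ?H {..<n} = (\<Sum>\<^sub>\<infinity>w\<in>{0..}. A u (n - 1 - w) * top.inv_corr w (n - 1 - v))"
    by (rule infsum_reindex_bij_witness[of _ "\<lambda>w. n - 1 - w" "\<lambda>w. n - 1 - w"]) auto
  also have "\<dots> = (\<Sum>\<^sub>\<infinity>w\<in>{0..}. A (- 1 - (n - 1 - u)) (- 1 - w) * top.inv_corr w (n - 1 - v))"
    by (simp only: A')
  also have "\<dots> = (\<Sum>\<^sub>\<infinity>w\<in>{..<0}. A (- 1 - (n - 1 - u)) (- 1 - w) * top.full_inv w (n - 1 - v))"
    by (rule top.A_inv_corr) (use u in simp)
  also have "\<dots> = (\<Sum>\<^sub>\<infinity>w\<in>{..<0}. A u (n - 1 - w) * bot.full_inv (n - 1 - w) v)"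
    by (simp only: A' L')
  also have "\<dots> = infsum ?L {n..}"
    by (rule infsum_reindex_bij_witness[of _ "\<lambda>w. n - 1 - w" "\<lambda>w. n - 1 - w"]) auto
  finally have H: "infsum ?H {..<n} = infsum ?L {n..}" .
  have K: "infsum ?K {0..} = infsum ?L {..<0}" by (rule bot.A_inv_corr[OF u(1)])
  have L: "infsum ?L UNIV = (if u = v then 1 else 0)" by (rule infsumI[OF bot.A_full_inv])
  have "(\<Sum>w\<in>{0..<n}. A u w * approx n w v) = infsum ?L {0..<n} + infsum ?K {0..<n} + infsum ?H {0..<n}"
    by (simp add: approx_def distrib_left sum.distrib)
  moreover have "infsum ?L {0..<n} = (if u = v then 1 else 0) - (infsum ?L {..<0} + infsum ?L {n..})"
    unfolding eq_diff_eq using split(1)[of ?L, OF s(1)] L by (rule trans)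
  moreover have "infsum ?K {0..<n} = infsum ?L {..<0} - infsum ?K {n..}"
    unfolding eq_diff_eq using split(2)[of ?K, OF s(2)] K by (rule trans)
  moreover have "infsum ?H {0..<n} = infsum ?L {n..} - infsum ?H {..<0}"
    unfolding eq_diff_eq add.commute[of "infsum ?H {0..<n}"] using split(3)[of ?H, OF s(3)] H by (rule trans)
  ultimately have "(\<Sum>w\<in>{0..<n}. A u w * approx n w v) =
     (if u = v then 1 else 0) - (infsum ?L {..<0} + infsum ?L {n..}) + (infsum ?L {..<0} - infsum ?K {n..}) +
     (infsum ?L {n..} - infsum ?H {..<0})" by (simp only:)
  then have "(\<Sum>w\<in>{0..<n}. A u w * approx n w v) - (if u = v then 1 else 0) = - infsum ?K {n..} - infsum ?H {..<0}"
    by simp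
  moreover have "norm (- infsum ?K {n..} - infsum ?H {..<0}) \<le> norm (infsum ?K {n..}) + norm (infsum ?H {..<0})"
    using norm_triangle_ineq4[of "- infsum ?K {n..}" "infsum ?H {..<0}"] by simp
  moreover have "norm (infsum ?K {n..}) \<le> (C * C * bot.G * q ^ nat n) * (\<Sum>\<^sub>\<infinity>w\<in>{n..}. norm (A u w))"
  proof (rule norm_infsum_le_cmult(1)[OF decays_row(1)[OF bot.dec(1) bot.q0 bot.q(2)]])
    fix w assume w: "w \<in> {n..}"
    have "norm (bot.inv_corr w v) \<le> C * C * bot.G * q ^ nat (w + v)" using w u v by (intro bot.inv_corr_decay) auto
    also have "\<dots> \<le> C * C * bot.G * q ^ nat n"
      using w v bot.q bot.C0 bot.G0 by (intro mult_left_mono power_decreasing) auto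
    finally have "norm (bot.inv_corr w v) \<le> C * C * bot.G * q ^ nat n" .
    from mult_left_mono[OF this norm_ge_zero[of "A u w"]]
    show "norm (?K w) \<le> C * C * bot.G * q ^ nat n * norm (A u w)"
      by (simp only: norm_mult mult.commute[of _ "norm (A u w)"])
  qed
  moreover have "(C * C * bot.G * q ^ nat n) * (\<Sum>\<^sub>\<infinity>w\<in>{n..}. norm (A u w)) \<le> (C * C * bot.G * q ^ nat n) * (C * bot.G)"
    using decays_row(2)[OF bot.dec(1) bot.q0 bot.q(2)] bot.q bot.C0 bot.G0 unfolding bot.G_def
    by (intro mult_left_mono) auto
  moreover have "norm (infsum ?H {..<0}) \<le> (C * C * bot.G * q ^ nat n) * (\<Sum>\<^sub>\<infinity>w\<in>{..<0}. norm (A u w))"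
  proof (rule norm_infsum_le_cmult(1)[OF decays_row(1)[OF bot.dec(1) bot.q0 bot.q(2)]])
    fix w :: int assume w: "w \<in> {..<0}"
    have "norm (top.inv_corr (n - 1 - w) (n - 1 - v)) \<le> C * C * bot.G * q ^ nat ((n - 1 - w) + (n - 1 - v))"
      using w u v by (intro top.inv_corr_decay) auto
    also have "\<dots> \<le> C * C * bot.G * q ^ nat n"
      using w v bot.q bot.C0 bot.G0 by (intro mult_left_mono power_decreasing) auto
    finally have "norm (top.inv_corr (n - 1 - w) (n - 1 - v)) \<le> C * C * bot.G * q ^ nat n" .
    from mult_left_mono[OF this norm_ge_zero[of "A u w"]]
    show "norm (?H w) \<le> C * C * bot.G * q ^ nat n * norm (A u w)"
      by (simp only: norm_mult mult.commute[of _ "norm (A u w)"])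
  qed
  moreover have "(C * C * bot.G * q ^ nat n) * (\<Sum>\<^sub>\<infinity>w\<in>{..<0}. norm (A u w)) \<le> (C * C * bot.G * q ^ nat n) * (C * bot.G)"
    using decays_row(2)[OF bot.dec(1) bot.q0 bot.q(2)] bot.q bot.C0 bot.G0 unfolding bot.G_def
    by (intro mult_left_mono) auto
  moreover have "2 * (C * C * bot.G * (C * bot.G)) * q ^ nat n = (C * C * bot.G * q ^ nat n) * (C * bot.G) + (C * C * bot.G * q ^ nat n) * (C * bot.G)"
    by (simp add: algebra_simps)
  ultimately show ?thesis by (rule norm_two_step)
qed

context
  fixes X :: "nat \<Rightarrow> int \<Rightarrow> int \<Rightarrow> complex"
  assumes X: "\<And>n u v. 1 \<le> n \<Longrightarrow> u \<in> {0..<int (p * n)} \<Longrightarrow> v \<in> {0..<int (p * n)} \<Longrightarrow>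
    (\<Sum>w\<in>{0..<int (p * n)}. X n u w * A w v) = (if u = v then 1 else 0)"
begin

text \<open>The control is uniform over all entries, because the exponentially small section error
  beats the number \<open>p * n\<close> of summands.\<close>

lemma inverse_error:
  obtains n0 :: nat and e :: "nat \<Rightarrow> real" and c :: real where "e \<longlonglongrightarrow> 0"
    "\<And>n u v. n0 \<le> n \<Longrightarrow> u \<in> {0..<int (p * n)} \<Longrightarrow> v \<in> {0..<int (p * n)} \<Longrightarrow>
       norm (X n u v) \<le> c \<and> norm (X n u v - approx (int (p * n)) u v) \<le> e n"
proof -
  define b where "b = 3 * (C * (C * bot.G))"
  define r where "r = 2 * (C * C * bot.G * (C * bot.G))"
  define d where "d = (\<lambda>n. r * (real (p * n) * q ^ (p * n)))"
  have "(\<lambda>m. real m * q ^ m) \<longlonglongrightarrow> 0" using bot.q powser_times_n_limit_0[of q] by simp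
  moreover have "strict_mono (\<lambda>n. p * n)" using p by (auto simp: strict_mono_def)
  ultimately have "((\<lambda>m. real m * q ^ m) \<circ> (\<lambda>n. p * n)) \<longlonglongrightarrow> 0" by (rule LIMSEQ_subseq_LIMSEQ)
  then have d: "d \<longlonglongrightarrow> 0" unfolding d_def o_def by (rule tendsto_mult_right_zero)
  then have "\<forall>\<^sub>F n in sequentially. d n < 1/2" by (rule order_tendstoD) simp
  then obtain n1 where n1: "\<And>n. n1 \<le> n \<Longrightarrow> d n < 1/2" by (auto simp: eventually_sequentially)
  \<comment> \<open>The factors 2 come from \<open>approximate_inverse\<close>. Beyond
    \<open>max 1 n1\<close> the exact inverse is available and the error is below the threshold
    1/2.\<close>
  show thesis
  proof (rule that[of "\<lambda>n. 2 * b * d n" "max 1 n1" "2 * b"])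
    show "(\<lambda>n. 2 * b * d n) \<longlonglongrightarrow> 0" using d by (rule tendsto_mult_right_zero)
    fix n u v assume n: "max 1 n1 \<le> n" and uv: "u \<in> {0..<int (p * n)}" "v \<in> {0..<int (p * n)}"
    let ?I = "{0..<int (p * n)}"
    have card: "real (card ?I) * (r * q ^ (p * n)) = d n" by (simp add: d_def)
    have small: "real (card ?I) * (r * q ^ (p * n)) \<le> 1/2" unfolding card using n1[of n] n by simp
    have AB: "norm ((\<Sum>w\<in>?I. A u w * approx (int (p * n)) w v) - (if u = v then 1 else 0)) \<le> r * q ^ (p * n)"
      if "u \<in> ?I" "v \<in> ?I" for u v
    proof -
      have "0 \<le> u" "u < int (p * n)" "0 \<le> v" "v < int (p * n)" using that by (simp_all only: atLeastLessThan_iff)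
      from section_error[OF of_nat_mult this] show ?thesis unfolding r_def nat_int .
    qed
    have XA: "(\<Sum>w\<in>?I. X n u w * A w v) = (if u = v then 1 else 0)" if "u \<in> ?I" "v \<in> ?I" for u v
      by (rule X[OF _ that]) (use n in simp)
    have Bb: "norm (approx (int (p * n)) u v) \<le> b" for u v unfolding b_def by (rule approx_bound)
    have "norm (X n u v) \<le> 2 * b \<and> norm (X n u v - approx (int (p * n)) u v) \<le> 2 * b * (card ?I * (r * q ^ (p * n)))"
      by (rule conjI[OF approximate_inverse[OF finite_atLeastLessThan_int XA AB Bb small uv]])
    then show "norm (X n u v) \<le> 2 * b \<and> norm (X n u v - approx (int (p * n)) u v) \<le> 2 * b * d n"
      unfolding card .
  qed
qed

lemma corr_tendsto_0:
  "(\<lambda>n. bot.inv_corr (u + int (p * n)) (v + int (p * n))) \<longlonglongrightarrow> 0"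
  "(\<lambda>n. top.inv_corr (u + int (p * n)) (v + int (p * n))) \<longlonglongrightarrow> 0"
proof -
  have lim: "(\<lambda>n. C * C * bot.G * q ^ n) \<longlonglongrightarrow> 0"
    using bot.q by (intro tendsto_mult_right_zero LIMSEQ_power_zero) auto
  have ev: "\<forall>\<^sub>F n in sequentially. 0 \<le> u + int (p * n) \<and> 0 \<le> v + int (p * n) \<and> n \<le> nat (u + int (p * n) + (v + int (p * n)))"
    using eventually_ge_at_top[of "nat \<bar>u\<bar> + nat \<bar>v\<bar>"]
  proof eventually_elim
    case (elim n)
    obtain P where P: "P = int (p * n)" by simp
    have "int n \<le> P" unfolding P by (rule le_section)
    moreover have "\<bar>u\<bar> + \<bar>v\<bar> \<le> int n" using elim by auto
    ultimately have "0 \<le> u + P" "0 \<le> v + P" "int n \<le> u + P + (v + P)" by auto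
    then show ?case unfolding P[symmetric] by (simp add: le_nat_iff)
  qed
  show "(\<lambda>n. bot.inv_corr (u + int (p * n)) (v + int (p * n))) \<longlonglongrightarrow> 0"
  proof (rule Lim_null_comparison[OF _ lim], use ev in eventually_elim)
    case (elim n)
    have "norm (bot.inv_corr (u + int (p * n)) (v + int (p * n))) \<le> C * C * bot.G * q ^ nat (u + int (p * n) + (v + int (p * n)))"
      using elim by (intro bot.inv_corr_decay) auto
    also have "\<dots> \<le> C * C * bot.G * q ^ n"
      using elim bot.q bot.C0 bot.G0 by (intro mult_left_mono power_decreasing) auto
    finally show ?case .
  qed
  show "(\<lambda>n. top.inv_corr (u + int (p * n)) (v + int (p * n))) \<longlonglongrightarrow> 0"
  proof (rule Lim_null_comparison[OF _ lim], use ev in eventually_elim)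
    case (elim n)
    have "norm (top.inv_corr (u + int (p * n)) (v + int (p * n))) \<le> C * C * bot.G * q ^ nat (u + int (p * n) + (v + int (p * n)))"
      using elim by (intro top.inv_corr_decay) auto
    also have "\<dots> \<le> C * C * bot.G * q ^ n"
      using elim bot.q bot.C0 bot.G0 by (intro mult_left_mono power_decreasing) auto
    finally show ?case .
  qed
qed

text \<open>Close to one end the correction of the other end dies out, and the full inverse plus the
  surviving correction is \<open>half_inv\<close>.\<close>

lemma inverse_tendsto:
  assumes "0 \<le> u" "0 \<le> v"
  shows "(\<lambda>n. X n u v) \<longlonglongrightarrow> bot.half_inv u v"
    and "(\<lambda>n. X n (int (p * n) - 1 - u) (int (p * n) - 1 - v)) \<longlonglongrightarrow> top.half_inv u v"
proof -
  obtain n0 e c where e: "e \<longlonglongrightarrow> 0"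
    "\<And>n u v. n0 \<le> n \<Longrightarrow> u \<in> {0..<int (p * n)} \<Longrightarrow> v \<in> {0..<int (p * n)} \<Longrightarrow>
       norm (X n u v) \<le> c \<and> norm (X n u v - approx (int (p * n)) u v) \<le> e n"
    by (rule inverse_error) (rule that)
  have ev: "\<forall>\<^sub>F n in sequentially. n0 \<le> n \<and> u < int (p * n) \<and> v < int (p * n)"
    by (rule eventually_section)
  have "(\<lambda>n. X n u v - approx (int (p * n)) u v) \<longlonglongrightarrow> 0"
    by (rule Lim_null_comparison[OF _ e(1)], use ev in eventually_elim) (use e(2) assms in auto)
  moreover have "(\<lambda>n. approx (int (p * n)) u v) \<longlonglongrightarrow> bot.full_inv u v + bot.inv_corr u v + 0"
    unfolding approx_def using corr_tendsto_0(2)[of "- 1 - u" "- 1 - v"]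
    by (intro tendsto_add tendsto_const) (simp add: algebra_simps)
  ultimately show "(\<lambda>n. X n u v) \<longlonglongrightarrow> bot.half_inv u v"
    using tendsto_add[of "\<lambda>n. X n u v - approx (int (p * n)) u v" 0 _ "\<lambda>n. approx (int (p * n)) u v"]
    by (simp add: bot.half_inv_eq)
  let ?u = "\<lambda>n. int (p * n) - 1 - u" and ?v = "\<lambda>n. int (p * n) - 1 - v"
  have "(\<lambda>n. X n (?u n) (?v n) - approx (int (p * n)) (?u n) (?v n)) \<longlonglongrightarrow> 0"
    by (rule Lim_null_comparison[OF _ e(1)], use ev in eventually_elim) (use e(2) assms in auto)
  moreover have "approx (int (p * n)) (?u n) (?v n) = top.full_inv u v + bot.inv_corr (?u n) (?v n) + top.inv_corr u v" for n
    using per_inv[of "- 1 - u" "int n" "- 1 - v"] by (simp add: approx_def same_inv algebra_simps)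
  moreover have "(\<lambda>n. top.full_inv u v + bot.inv_corr (?u n) (?v n) + top.inv_corr u v) \<longlonglongrightarrow>
     top.full_inv u v + 0 + top.inv_corr u v"
    using corr_tendsto_0(1)[of "- 1 - u" "- 1 - v"]
    by (intro tendsto_add tendsto_const) (simp add: algebra_simps)
  ultimately show "(\<lambda>n. X n (?u n) (?v n)) \<longlonglongrightarrow> top.half_inv u v"
    using tendsto_add[of "\<lambda>n. X n (?u n) (?v n) - approx (int (p * n)) (?u n) (?v n)" 0 _ "\<lambda>n. approx (int (p * n)) (?u n) (?v n)"]
    by (simp add: top.half_inv_eq)
qed

text \<open>Dominated convergence with the uniform bound on the entries. \<open>h\<close> will be
  the identity for the lower end and the reversal of the section for the upper one.\<close>

lemma double_sum_tendsto:
  fixes h :: "nat \<Rightarrow> int \<Rightarrow> int"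
  assumes x: "(\<lambda>j. norm (x j)) summable_on {0..}" and y: "(\<lambda>i. norm (y i)) summable_on {0..}"
    and h: "\<And>n. bij_betw (h n) {0..<int (p * n)} {0..<int (p * n)}"
    and lim: "\<And>u v. 0 \<le> u \<Longrightarrow> 0 \<le> v \<Longrightarrow> (\<lambda>n. X n (h n u) (h n v)) \<longlonglongrightarrow> S u v"
  shows "(\<lambda>n. \<Sum>j\<in>{0..<int (p * n)}. \<Sum>i\<in>{0..<int (p * n)}. x j * X n (h n j) (h n i) * y i)
    \<longlonglongrightarrow> (\<Sum>\<^sub>\<infinity>(j,i)\<in>{0..} \<times> {0..}. x j * S j i * y i)"
proof -
  obtain n0 e c where e: "e \<longlonglongrightarrow> 0"
    "\<And>n u v. n0 \<le> n \<Longrightarrow> u \<in> {0..<int (p * n)} \<Longrightarrow> v \<in> {0..<int (p * n)} \<Longrightarrow>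
       norm (X n u v) \<le> c \<and> norm (X n u v - approx (int (p * n)) u v) \<le> e n"
    by (rule inverse_error) (rule that)
  \<comment> \<open>The dominating term contains \<open>norm (of_real c')\<close>, which equals
    \<open>c'\<close> only for a non-negative constant.\<close>
  define c' where "c' = max c 0"
  let ?I = "\<lambda>n. {0..<int (p * n)}"
  \<comment> \<open>Set to 0 outside the section, and also before \<open>n0\<close>, where no bound
    on the entries has been obtained.\<close>
  define f where "f = (\<lambda>n (j,i). if n0 \<le> n \<and> j \<in> ?I n \<and> i \<in> ?I n then x j * X n (h n j) (h n i) * y i else 0)"
  have "(\<lambda>n. \<Sum>\<^sub>\<infinity>t\<in>{0..} \<times> {0..}. f n t) \<longlonglongrightarrow> (\<Sum>\<^sub>\<infinity>t\<in>{0..} \<times> {0..}. (\<lambda>(j,i). x j * S j i * y i) t)"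
  proof (rule infsum_dominated_tendsto)
    show "(\<lambda>(j,i). norm (x j * of_real c' * y i)) summable_on {0..} \<times> {0..}"
      by (rule bilinear_swap(1)[OF x y, of "\<lambda>_ _. of_real c'" c']) (simp add: c'_def)
    fix n and t :: "int \<times> int" assume "t \<in> {0..} \<times> {0..}"
    obtain j i where t: "t = (j, i)" by (cases t)
    show "norm (f n t) \<le> (case t of (j,i) \<Rightarrow> norm (x j * of_real c' * y i))"
    proof (cases "n0 \<le> n \<and> j \<in> ?I n \<and> i \<in> ?I n")
      case True
      then have "h n j \<in> ?I n" "h n i \<in> ?I n" using h[of n] by (auto simp: bij_betw_def)
      then have "norm (X n (h n j) (h n i)) \<le> c'" using e(2)[of n] True by (fastforce simp: c'_def)
      then have "norm (x j) * norm (X n (h n j) (h n i)) * norm (y i) \<le> norm (x j) * c' * norm (y i)"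
        by (intro mult_right_mono mult_left_mono) auto
      then show ?thesis using True by (simp add: f_def t norm_mult c'_def)
    qed (auto simp: f_def t)
  next
    fix t :: "int \<times> int" assume tt: "t \<in> {0..} \<times> {0..}"
    obtain j i where t: "t = (j, i)" by (cases t)
    have ev: "\<forall>\<^sub>F n in sequentially. n0 \<le> n \<and> j < int (p * n) \<and> i < int (p * n)"
      by (rule eventually_section)
    have "(\<lambda>n. x j * X n (h n j) (h n i) * y i) \<longlonglongrightarrow> x j * S j i * y i"
      using tt t by (intro tendsto_intros lim) auto
    then have "(\<lambda>n. f n t) \<longlonglongrightarrow> x j * S j i * y i"
      by (rule Lim_transform_eventually, use ev in eventually_elim) (use tt t in \<open>auto simp: f_def\<close>)
    then show "(\<lambda>n. f n t) \<longlonglongrightarrow> (\<lambda>(j,i). x j * S j i * y i) t" by (simp add: t)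
  qed
  then have "(\<lambda>n. \<Sum>\<^sub>\<infinity>t\<in>{0..} \<times> {0..}. f n t) \<longlonglongrightarrow> (\<Sum>\<^sub>\<infinity>(j,i)\<in>{0..} \<times> {0..}. x j * S j i * y i)" by simp
  then show ?thesis
  proof (rule Lim_transform_eventually)
    show "\<forall>\<^sub>F n in sequentially. (\<Sum>\<^sub>\<infinity>t\<in>{0..} \<times> {0..}. f n t) =
      (\<Sum>j\<in>?I n. \<Sum>i\<in>?I n. x j * X n (h n j) (h n i) * y i)"
      using eventually_ge_at_top[of n0]
    proof eventually_elim
      case (elim n)
      have "(\<Sum>\<^sub>\<infinity>t\<in>{0..} \<times> {0..}. f n t) = (\<Sum>\<^sub>\<infinity>t\<in>?I n \<times> ?I n. f n t)"
        by (rule infsum_cong_neutral) (auto simp: f_def split: if_splits)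
      also have "\<dots> = (\<Sum>t\<in>?I n \<times> ?I n. f n t)" by (rule infsum_finite) simp
      also have "\<dots> = (\<Sum>j\<in>?I n. \<Sum>i\<in>?I n. f n (j, i))" by (simp add: sum.cartesian_product)
      also have "\<dots> = (\<Sum>j\<in>?I n. \<Sum>i\<in>?I n. x j * X n (h n j) (h n i) * y i)"
        using elim by (intro sum.cong refl) (simp add: f_def)
      finally show ?case .
    qed
  qed
qed

end

end

context wiener_hopf
begin

text \<open>The two outer vectors are coupled only through the index \<open>l\<close> between the
  triangular factors. The inner sums will become Toeplitz matrices of product symbols, and the sum
  over \<open>l\<close> the geometric series behind \<open>1 / (z - w)\<close>.\<close>

lemma half_inv_bilinear:
  assumes x: "(\<lambda>j. norm (x j)) summable_on {0..}" and y: "(\<lambda>i. norm (y i)) summable_on {0..}"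
  shows "(\<Sum>\<^sub>\<infinity>(j,i)\<in>{0..} \<times> {0..}. x j * half_inv j i * y i) =
    (\<Sum>\<^sub>\<infinity>l\<in>{0..}. (\<Sum>\<^sub>\<infinity>j\<in>{0..}. x j * D' j l) * (\<Sum>\<^sub>\<infinity>i\<in>{0..}. U' l i * y i))"
proof -
  have y': "(\<lambda>l. norm (\<Sum>\<^sub>\<infinity>i\<in>{0..}. U' l i * y i)) summable_on {0..}"
    by (rule l1_transform[OF y decays_col(1)[OF dec(4) q0 q(2)] decays_col(2)[OF dec(4) q0 q(2)]])
  have "(\<Sum>\<^sub>\<infinity>(j,i)\<in>{0..} \<times> {0..}. x j * half_inv j i * y i) = (\<Sum>\<^sub>\<infinity>j\<in>{0..}. x j * (\<Sum>\<^sub>\<infinity>i\<in>{0..}. half_inv j i * y i))"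
    using bilinear_swap(2)[OF x y inv_bounds(2)] by simp
  also have "\<dots> = (\<Sum>\<^sub>\<infinity>j\<in>{0..}. x j * (\<Sum>\<^sub>\<infinity>l\<in>{0..}. D' j l * (\<Sum>\<^sub>\<infinity>i\<in>{0..}. U' l i * y i)))"
  proof (rule infsum_cong, rule arg_cong[of _ _ "(*) _"])
    fix j
    show "(\<Sum>\<^sub>\<infinity>i\<in>{0..}. half_inv j i * y i) = (\<Sum>\<^sub>\<infinity>l\<in>{0..}. D' j l * (\<Sum>\<^sub>\<infinity>i\<in>{0..}. U' l i * y i))"
      unfolding half_inv_def
      using bilinear_swap(2,3)[OF decays_row(1)[OF dec(3) q0 q(2), of j "{0..}"] y, of U' C] decays_bound[OF dec(4) q0 q(2)] by simp
  qed
  also have "\<dots> = (\<Sum>\<^sub>\<infinity>l\<in>{0..}. (\<Sum>\<^sub>\<infinity>j\<in>{0..}. x j * D' j l) * (\<Sum>\<^sub>\<infinity>i\<in>{0..}. U' l i * y i))"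
    using bilinear_swap(2,3)[OF x y', of D' C] decays_bound[OF dec(3) q0 q(2)] by simp
  finally show ?thesis .
qed

end

section \<open>Matrix-valued symbols\<close>

lemma mat_inv_right:
  assumes A: "A \<in> carrier_mat p p" and inv: "invertible_mat A"
  shows "mat_inv A \<in> carrier_mat p p" "A * mat_inv A = 1\<^sub>m p" "mat_inv A * A = 1\<^sub>m p"
proof -
  obtain B where B: "A * B = 1\<^sub>m (dim_row A)" "B * A = 1\<^sub>m (dim_row B)"
    using inv by (auto simp: invertible_mat_def inverts_mat_def)
  have "dim_row (B * A) = dim_row B" "dim_col (A * B) = dim_col B" "dim_col (B * A) = p" using A by auto
  then have Bc: "B \<in> carrier_mat p p" using B A by (metis carrier_matD(1) carrier_mat_triv index_one_mat(2,3))
  have U: "A \<in> Units (ring_mat TYPE(complex) p (0::nat))"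
    unfolding Units_def ring_mat_def using A B Bc by auto
  then obtain C where C: "mat_inverse A = Some C" using mat_inverse(1)[OF A, of "0::nat"] by (cases "mat_inverse A") auto
  from mat_inverse(2)[OF A C] C
  show "mat_inv A \<in> carrier_mat p p" "A * mat_inv A = 1\<^sub>m p" "mat_inv A * A = 1\<^sub>m p" by auto
qed

lemma mat_left_inverse_unique:
  assumes "A \<in> carrier_mat p p" "B \<in> carrier_mat p p" "C \<in> carrier_mat p p" "B * A = 1\<^sub>m p" "A * C = (1\<^sub>m p :: complex mat)"
  shows "B = C"
proof -
  have "B = B * (A * C)" using assms by simp
  also have "\<dots> = (B * A) * C" using assms by (intro assoc_mult_mat[symmetric])
  finally show ?thesis using assms by simp
qed

text \<open>Cramer's rule: entries of the inverse are polynomials in the entries of the matrix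
  divided by the determinant, which is how holomorphy and limits pass to inverses.\<close>

lemma mat_inv_det:
  assumes A: "A \<in> carrier_mat p p" and inv: "invertible_mat A" and ij: "i < p" "j < p"
  shows "Determinant.det A \<noteq> 0" "mat_inv A $$ (i,j) = adj_mat A $$ (i,j) / Determinant.det A"
proof -
  note I = mat_inv_right[OF A inv]
  have "Determinant.det A * Determinant.det (mat_inv A) = 1"
    using det_mult[OF A I(1)] I(2) by simp
  then show d: "Determinant.det A \<noteq> 0" by auto
  have "A * ((1 / Determinant.det A) \<cdot>\<^sub>m adj_mat A) = 1\<^sub>m p"
    using adj_mat(1,2)[OF A] A d by (simp add: mult_smult_distrib[OF A adj_mat(1)[OF A]]) (auto intro!: eq_matI)
  then have "mat_inv A = (1 / Determinant.det A) \<cdot>\<^sub>m adj_mat A"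
    using I adj_mat(1)[OF A] by (intro mat_left_inverse_unique[OF A I(1)]) auto
  then show "mat_inv A $$ (i,j) = adj_mat A $$ (i,j) / Determinant.det A"
    using adj_mat(1)[OF A] ij by simp
qed

text \<open>Each factor and each inverse factor is written through the product and the other factor.
  On the circle these identities glue a one-sided factor to a function on the other side.\<close>

lemma mat_inv_mult_left:
  assumes c: "Z \<in> carrier_mat p p" "P \<in> carrier_mat p p" "Q \<in> carrier_mat p p"
    and i: "invertible_mat Z" "invertible_mat P" "invertible_mat Q" and Z: "Z = P * Q"
  shows "P = Z * mat_inv Q" "Q = mat_inv P * Z" "mat_inv P = Q * mat_inv Z" "mat_inv Q = mat_inv Z * P"
    "mat_inv Q * mat_inv P = mat_inv Z"
proof -
  note Zi = mat_inv_right[OF c(1) i(1)] and Pi = mat_inv_right[OF c(2) i(2)] and Qi = mat_inv_right[OF c(3) i(3)]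
  have "Z * mat_inv Q = P * (Q * mat_inv Q)" unfolding Z using c Qi by (intro assoc_mult_mat)
  then show "P = Z * mat_inv Q" using c Qi by simp
  have "mat_inv P * Z = (mat_inv P * P) * Q" unfolding Z using c Pi by (intro assoc_mult_mat[symmetric])
  then show "Q = mat_inv P * Z" using c Pi by simp
  have "P * (Q * mat_inv Z) = Z * mat_inv Z" unfolding Z using c Zi(1)[unfolded Z] by (intro assoc_mult_mat[symmetric])
  then have "P * (Q * mat_inv Z) = 1\<^sub>m p" using Zi by simp
  then show 3: "mat_inv P = Q * mat_inv Z"
    using c Zi by (intro mat_left_inverse_unique[OF c(2) Pi(1) _ Pi(3)]) auto
  have "(mat_inv Z * P) * Q = mat_inv Z * Z" unfolding Z using c Zi(1)[unfolded Z] by (intro assoc_mult_mat)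
  then have "(mat_inv Z * P) * Q = 1\<^sub>m p" using Zi by simp
  then show 4: "mat_inv Q = mat_inv Z * P"
    using c Zi by (intro mat_left_inverse_unique[OF c(3) _ Qi(1) _ Qi(2), symmetric]) auto
  have "mat_inv Q * mat_inv P = (mat_inv Z * P) * mat_inv P" using 4 by simp
  also have "\<dots> = mat_inv Z * (P * mat_inv P)" using c Zi Pi by (intro assoc_mult_mat)
  finally show "mat_inv Q * mat_inv P = mat_inv Z" using Pi Zi by simp
qed

text \<open>One scheme for every property of functions that is stable under constants, sums and
  products; it serves both holomorphy and having a limit at infinity.\<close>

lemma det_entries_closed:
  fixes F :: "'z \<Rightarrow> complex mat" and Prop :: "('z \<Rightarrow> complex) \<Rightarrow> bool"
  assumes cong: "\<And>f g. (\<And>z. z \<in> S \<Longrightarrow> f z = g z) \<Longrightarrow> Prop f \<Longrightarrow> Prop g"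
    and const: "\<And>c. Prop (\<lambda>_. c)" and add: "\<And>f g. Prop f \<Longrightarrow> Prop g \<Longrightarrow> Prop (\<lambda>z. f z + g z)"
    and mult: "\<And>f g. Prop f \<Longrightarrow> Prop g \<Longrightarrow> Prop (\<lambda>z. f z * g z)"
    and car: "\<And>z. z \<in> S \<Longrightarrow> F z \<in> carrier_mat n n"
    and F: "\<And>i j. i < n \<Longrightarrow> j < n \<Longrightarrow> Prop (\<lambda>z. F z $$ (i,j))"
  shows "Prop (\<lambda>z. Determinant.det (F z))"
proof (rule cong)
  show "(\<Sum>\<pi>\<in>{\<pi>. \<pi> permutes {0..<n}}. signof \<pi> * (\<Prod>i=0..<n. F z $$ (i, \<pi> i))) = Determinant.det (F z)" if "z \<in> S" for z
    by (rule det_def'[OF car[OF that], symmetric])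
  have s: "Prop (\<lambda>z. \<Sum>x\<in>X. f x z)" if "\<And>x. x \<in> X \<Longrightarrow> Prop (f x)" "finite X" for X and f :: "(nat \<Rightarrow> nat) \<Rightarrow> 'z \<Rightarrow> complex"
    using that(2,1) by (induction X rule: finite_induct) (auto intro: const add)
  have pr: "Prop (\<lambda>z. \<Prod>x\<in>X. f x z)" if "\<And>x. x \<in> X \<Longrightarrow> Prop (f x)" "finite X" for X and f :: "nat \<Rightarrow> 'z \<Rightarrow> complex"
    using that(2,1) by (induction X rule: finite_induct) (auto intro: const mult)
  show "Prop (\<lambda>z. \<Sum>\<pi>\<in>{\<pi>. \<pi> permutes {0..<n}}. signof \<pi> * (\<Prod>i=0..<n. F z $$ (i, \<pi> i)))"
  proof (intro s mult const pr F)
    fix \<pi> i assume "\<pi> \<in> {\<pi>. \<pi> permutes {0..<n}}" "i \<in> {0..<n}"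
    then show "i < n" "\<pi> i < n" using permutes_in_image[of \<pi> "{0..<n}" i] by auto
  qed (auto intro: finite_permutations)
qed

lemma adj_entries_closed:
  fixes F :: "'z \<Rightarrow> complex mat" and Prop :: "('z \<Rightarrow> complex) \<Rightarrow> bool"
  assumes cong: "\<And>f g. (\<And>z. z \<in> S \<Longrightarrow> f z = g z) \<Longrightarrow> Prop f \<Longrightarrow> Prop g"
    and const: "\<And>c. Prop (\<lambda>_. c)" and add: "\<And>f g. Prop f \<Longrightarrow> Prop g \<Longrightarrow> Prop (\<lambda>z. f z + g z)"
    and mult: "\<And>f g. Prop f \<Longrightarrow> Prop g \<Longrightarrow> Prop (\<lambda>z. f z * g z)"
    and car: "\<And>z. z \<in> S \<Longrightarrow> F z \<in> carrier_mat n n"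
    and F: "\<And>i j. i < n \<Longrightarrow> j < n \<Longrightarrow> Prop (\<lambda>z. F z $$ (i,j))" and ij: "i < n" "j < n"
  shows "Prop (\<lambda>z. adj_mat (F z) $$ (i,j))"
proof (rule cong)
  show "(-1) ^ (j + i) * Determinant.det (mat_delete (F z) j i) = adj_mat (F z) $$ (i,j)" if "z \<in> S" for z
    using car[OF that] ij by (simp add: adj_mat_def cofactor_def)
  have "Prop (\<lambda>z. Determinant.det (mat_delete (F z) j i))"
  proof (rule det_entries_closed[where S=S and n="n - 1" and Prop=Prop])
    show "mat_delete (F z) j i \<in> carrier_mat (n - 1) (n - 1)" if "z \<in> S" for z
      using car[OF that] by (rule mat_delete_carrier)
    fix a b assume ab: "a < n - 1" "b < n - 1"
    show "Prop (\<lambda>z. mat_delete (F z) j i $$ (a, b))"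
    proof (rule cong)
      have "(if a < j then a else Suc a) < n" "(if b < i then b else Suc b) < n" using ab by auto
      then show "Prop (\<lambda>z. F z $$ (if a < j then a else Suc a, if b < i then b else Suc b))" by (rule F)
      show "F z $$ (if a < j then a else Suc a, if b < i then b else Suc b) = mat_delete (F z) j i $$ (a, b)"
        if "z \<in> S" for z using car[OF that] ab by (simp add: mat_delete_def)
    qed
  qed (fact cong, fact const, fact add, fact mult)
  then show "Prop (\<lambda>z. (-1) ^ (j + i) * Determinant.det (mat_delete (F z) j i))"
    by (rule mult[OF const])
qed

text \<open>The determinant tends to 1 and so stays away from 0, hence the quotient in Cramer's rule
  converges. Existence of a limit supplies the boundedness near infinity exploited in
  \<open>minus_fcoef_vanish\<close>.\<close>

lemma mat_inv_tendsto_one: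
  fixes F :: "complex \<Rightarrow> complex mat"
  assumes car: "\<And>z. z \<in> S \<Longrightarrow> F z \<in> carrier_mat p p" and inv: "\<And>z. z \<in> S \<Longrightarrow> invertible_mat (F z)"
    and ev: "eventually (\<lambda>z. z \<in> S) H"
    and lim: "\<And>i j. i < p \<Longrightarrow> j < p \<Longrightarrow> ((\<lambda>z. F z $$ (i,j)) \<longlongrightarrow> 1\<^sub>m p $$ (i,j)) H" and ij: "i < p" "j < p"
  shows "\<exists>l. ((\<lambda>z. mat_inv (F z) $$ (i,j)) \<longlongrightarrow> l) H"
proof -
  have "\<exists>l. ((\<lambda>z. adj_mat (F z) $$ (i,j)) \<longlongrightarrow> l) H"
  proof (rule adj_entries_closed[where Prop="\<lambda>f. \<exists>l. (f \<longlongrightarrow> l) H" and S=S and n=p])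
    fix f g :: "complex \<Rightarrow> complex" assume fg: "\<And>z. z \<in> S \<Longrightarrow> f z = g z" "\<exists>l. (f \<longlongrightarrow> l) H"
    then obtain l where "(f \<longlongrightarrow> l) H" by blast
    then have "(g \<longlongrightarrow> l) H" by (rule Lim_transform_eventually) (use ev in eventually_elim, rule fg(1))
    then show "\<exists>l. (g \<longlongrightarrow> l) H" by blast
  next
    fix a b assume "a < p" "b < p" then show "\<exists>l. ((\<lambda>z. F z $$ (a,b)) \<longlongrightarrow> l) H" using lim by blast
  qed (use car ij in \<open>blast intro: tendsto_const tendsto_add tendsto_mult\<close>)+
  then obtain l where l: "((\<lambda>z. adj_mat (F z) $$ (i,j)) \<longlongrightarrow> l) H" by blast
  have d: "((\<lambda>z. Determinant.det (F z)) \<longlongrightarrow> 1) H"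
  proof -
    have "((\<lambda>z. \<Sum>\<pi>\<in>{\<pi>. \<pi> permutes {0..<p}}. signof \<pi> * (\<Prod>i=0..<p. F z $$ (i, \<pi> i))) \<longlongrightarrow>
      (\<Sum>\<pi>\<in>{\<pi>. \<pi> permutes {0..<p}}. signof \<pi> * (\<Prod>i=0..<p. 1\<^sub>m p $$ (i, \<pi> i)))) H"
    proof (intro tendsto_sum tendsto_mult tendsto_const tendsto_prod lim)
      fix \<pi> i assume "\<pi> \<in> {\<pi>. \<pi> permutes {0..<p}}" "i \<in> {0..<p}"
      then show "i < p" "\<pi> i < p" using permutes_in_image[of \<pi> "{0..<p}" i] by auto
    qed
    also have "(\<Sum>\<pi>\<in>{\<pi>. \<pi> permutes {0..<p}}. signof \<pi> * (\<Prod>i=0..<p. 1\<^sub>m p $$ (i, \<pi> i))) = (1::complex)"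
      using det_def'[of "1\<^sub>m p :: complex mat" p] by simp
    finally show ?thesis
      by (rule Lim_transform_eventually) (use ev in eventually_elim, rule det_def'[OF car, symmetric])
  qed
  have "((\<lambda>z. adj_mat (F z) $$ (i,j) / Determinant.det (F z)) \<longlongrightarrow> l / 1) H"
    by (intro tendsto_divide l d) simp
  then have "((\<lambda>z. mat_inv (F z) $$ (i,j)) \<longlongrightarrow> l / 1) H"
    by (rule Lim_transform_eventually) (use ev in eventually_elim, rule mat_inv_det(2)[OF car inv ij, symmetric])
  then show ?thesis by blast
qed

text \<open>The hypotheses of \<open>circle_mean_annulus\<close>, entrywise. With one radius equal
  to 1 they hold for factors that are only continuous on the unit circle.\<close>

definition regular_between :: "nat \<Rightarrow> real \<Rightarrow> real \<Rightarrow> (complex \<Rightarrow> complex mat) \<Rightarrow> bool" where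
  "regular_between p r1 r2 F \<longleftrightarrow>
     mat_continuous_on p {z. r1 \<le> norm z \<and> norm z \<le> r2} F \<and> mat_holomorphic_on p F {z. r1 < norm z \<and> norm z < r2}"

lemma mat_mult_entry:
  assumes "A \<in> carrier_mat p p" "B \<in> carrier_mat p p" "i < p" "j < p"
  shows "(A * B) $$ (i,j) = (\<Sum>r<p. A $$ (i,r) * B $$ (r,j))"
  using assms by (subst index_mult_mat) (auto simp: scalar_prod_def atLeast0LessThan)

lemma regular_between_mult:
  assumes "regular_between p r1 r2 F" "regular_between p r1 r2 G"
  shows "regular_between p r1 r2 (\<lambda>z. F z * G z)"
proof -
  let ?S = "{z::complex. r1 \<le> norm z \<and> norm z \<le> r2}" and ?I = "{z::complex. r1 < norm z \<and> norm z < r2}"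
  have sub: "?I \<subseteq> ?S" by auto
  have car: "F z \<in> carrier_mat p p" "G z \<in> carrier_mat p p" if "z \<in> ?S" for z
    using assms that by (auto simp: regular_between_def mat_continuous_on_def)
  have c: "continuous_on ?S (\<lambda>z. F z $$ (i,j))" "continuous_on ?S (\<lambda>z. G z $$ (i,j))" if "i < p" "j < p" for i j
    using assms that by (auto simp: regular_between_def mat_continuous_on_def)
  have h: "(\<lambda>z. F z $$ (i,j)) holomorphic_on ?I" "(\<lambda>z. G z $$ (i,j)) holomorphic_on ?I" if "i < p" "j < p" for i j
    using assms that by (auto simp: regular_between_def mat_holomorphic_on_def)
  have e: "(F z * G z) $$ (i,j) = (\<Sum>r<p. F z $$ (i,r) * G z $$ (r,j))" if "z \<in> ?S" "i < p" "j < p" for z i j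
    using mat_mult_entry[OF car[OF that(1)] that(2,3)] .
  show ?thesis unfolding regular_between_def mat_continuous_on_def mat_holomorphic_on_def
  proof (intro conjI ballI allI impI)
    fix i j assume ij: "i < p" "j < p"
    have "continuous_on ?S (\<lambda>z. \<Sum>r<p. F z $$ (i,r) * G z $$ (r,j))" using c ij by (intro continuous_intros) auto
    then show "continuous_on ?S (\<lambda>z. (F z * G z) $$ (i,j))"
      by (rule continuous_on_eq) (use e ij in simp)
    have "(\<lambda>z. \<Sum>r<p. F z $$ (i,r) * G z $$ (r,j)) holomorphic_on ?I" using h ij by (intro holomorphic_intros) auto
    then show "(\<lambda>z. (F z * G z) $$ (i,j)) holomorphic_on ?I"
      by (rule holomorphic_transform) (use e ij sub in auto)
  next
    fix z assume "z \<in> ?S" then show "F z * G z \<in> carrier_mat p p" using car by (blast intro: mult_carrier_mat)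
  next
    fix z assume "z \<in> ?I"
    then have "z \<in> ?S" using sub by blast
    then show "F z * G z \<in> carrier_mat p p" using car by (blast intro: mult_carrier_mat)
  qed
qed

lemma regular_between_holomorphic:
  assumes "mat_holomorphic_on p F S" "{z. r1 \<le> norm z \<and> norm z \<le> r2} \<subseteq> S"
  shows "regular_between p r1 r2 F"
  unfolding regular_between_def mat_continuous_on_def mat_holomorphic_on_def
proof (intro conjI ballI allI impI)
  fix i j assume ij: "i < p" "j < p"
  have h: "(\<lambda>z. F z $$ (i,j)) holomorphic_on S" using assms(1) ij by (auto simp: mat_holomorphic_on_def)
  show "continuous_on {z. r1 \<le> norm z \<and> norm z \<le> r2} (\<lambda>z. F z $$ (i,j))"
    using holomorphic_on_imp_continuous_on[OF h] assms(2) by (rule continuous_on_subset)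
  show "(\<lambda>z. F z $$ (i,j)) holomorphic_on {z. r1 < norm z \<and> norm z < r2}"
    by (rule holomorphic_on_subset[OF h]) (use assms(2) in force)
qed (use assms in \<open>force simp: mat_holomorphic_on_def\<close>)+

lemma mat_holomorphic_inv:
  assumes hol: "mat_holomorphic_on p F S" and inv: "\<And>z. z \<in> S \<Longrightarrow> invertible_mat (F z)"
  shows "mat_holomorphic_on p (\<lambda>z. mat_inv (F z)) S"
proof -
  have car: "F z \<in> carrier_mat p p" if "z \<in> S" for z using hol that by (auto simp: mat_holomorphic_on_def)
  have F: "(\<lambda>z. F z $$ (i,j)) holomorphic_on S" if "i < p" "j < p" for i j
    using hol that by (auto simp: mat_holomorphic_on_def)
  have cong: "g holomorphic_on S" if "\<And>z. z \<in> S \<Longrightarrow> f z = g z" "f holomorphic_on S" for f g :: "complex \<Rightarrow> complex"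
    using that by (metis holomorphic_transform)
  have det: "(\<lambda>z. Determinant.det (F z)) holomorphic_on S"
    by (rule det_entries_closed[where S=S and n=p and Prop="\<lambda>f. f holomorphic_on S"])
       (fact cong, auto intro: holomorphic_intros car F)
  show ?thesis unfolding mat_holomorphic_on_def
  proof (intro conjI ballI allI impI)
    fix z assume "z \<in> S" then show "mat_inv (F z) \<in> carrier_mat p p" using mat_inv_right(1) car inv by blast
  next
    fix i j assume ij: "i < p" "j < p"
    have "(\<lambda>z. adj_mat (F z) $$ (i,j)) holomorphic_on S"
      by (rule adj_entries_closed[where S=S and n=p and Prop="\<lambda>f. f holomorphic_on S"])
         (fact cong, auto intro: holomorphic_intros car F ij)
    then have "(\<lambda>z. adj_mat (F z) $$ (i,j) / Determinant.det (F z)) holomorphic_on S"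
      using det by (rule holomorphic_on_divide) (use mat_inv_det(1)[OF car inv ij] in blast)
    then show "(\<lambda>z. mat_inv (F z) $$ (i,j)) holomorphic_on S"
      by (rule holomorphic_transform) (use mat_inv_det(2)[OF car inv ij] in simp)
  qed
qed

section \<open>Fourier coefficients on shifted circles\<close>

lemma fcoef_annulus:
  assumes "0 < r1" "r1 \<le> r2" "continuous_on {z. r1 \<le> norm z \<and> norm z \<le> r2} f"
    "f holomorphic_on {z. r1 < norm z \<and> norm z < r2}"
  shows "circle_mean r1 (\<lambda>z. f z * z powi k) = circle_mean r2 (\<lambda>z. f z * z powi k)"
  using assms by (intro circle_mean_annulus continuous_intros holomorphic_intros holomorphic_on_power_int) auto

lemma fcoef_radius_bound:
  assumes R: "0 < R" and cont: "continuous_on (sphere 0 R) f" and B: "\<And>z. norm z = R \<Longrightarrow> norm (f z) \<le> B"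
    and eq: "fcoef f k = circle_mean R (\<lambda>z. f z * z powi (- k - 1))"
  shows "norm (fcoef f k) \<le> B * R powi (- k)"
proof -
  have "norm (fcoef f k) \<le> (B * R powi (- k - 1)) * R" unfolding eq
  proof (rule circle_mean_bound[OF R])
    show "continuous_on (sphere 0 R) (\<lambda>z. f z * z powi (- k - 1))"
      using cont R by (intro continuous_intros) auto
    show "norm (f z * z powi (- k - 1)) \<le> B * R powi (- k - 1)" if "norm z = R" for z
      unfolding norm_mult norm_power_int that using B[OF that] R by (intro mult_right_mono) auto
  qed
  also have "\<dots> = B * R powi (- k)" using R by (simp add: power_int_diff)
  finally show ?thesis .
qed

text \<open>Integration over the circle of radius \<open>R\<close>: \<open>R > 1\<close> gives decay
  for positive \<open>k\<close>, \<open>R < 1\<close> for negative \<open>k\<close>, and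
  \<open>min\<close> and \<open>max\<close> treat both at once.\<close>

lemma fcoef_decay:
  assumes R: "0 < R" and F: "regular_between p (min 1 R) (max 1 R) F"
  obtains B where "0 \<le> B" "\<And>i j k. i < p \<Longrightarrow> j < p \<Longrightarrow> norm (fcoef (\<lambda>z. F z $$ (i,j)) k) \<le> B * R powi (- k)"
proof -
  let ?S = "{z::complex. min 1 R \<le> norm z \<and> norm z \<le> max 1 R}"
  have cont: "continuous_on ?S (\<lambda>z. F z $$ (i,j))" if "i < p" "j < p" for i j
    using F that by (auto simp: regular_between_def mat_continuous_on_def)
  have hol: "(\<lambda>z. F z $$ (i,j)) holomorphic_on {z. min 1 R < norm z \<and> norm z < max 1 R}" if "i < p" "j < p" for i j
    using F that by (auto simp: regular_between_def mat_holomorphic_on_def)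
  have sub: "sphere 0 R \<subseteq> ?S" by auto
  have "\<exists>B\<ge>0. \<forall>z. norm z = R \<longrightarrow> norm (F z $$ ij) \<le> B" if ijm: "ij \<in> {..<p} \<times> {..<p}" for ij
  proof -
    obtain i j where ij: "ij = (i, j)" "i < p" "j < p" using ijm by (cases ij) auto
    have "bounded ((\<lambda>z. F z $$ (i,j)) ` sphere 0 R)"
      by (intro compact_imp_bounded compact_continuous_image continuous_on_subset[OF cont[OF ij(2,3)] sub] compact_sphere)
    then obtain B where "\<And>z. z \<in> sphere 0 R \<Longrightarrow> norm (F z $$ (i,j)) \<le> B" unfolding bounded_iff by blast
    then show ?thesis unfolding ij(1) by (intro exI[of _ "max B 0"]) (auto simp: le_max_iff_disj)
  qed
  then obtain B where B: "\<And>ij. ij \<in> {..<p} \<times> {..<p} \<Longrightarrow> 0 \<le> B ij \<and> (\<forall>z. norm z = R \<longrightarrow> norm (F z $$ ij) \<le> B ij)"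
    by metis
  define C where "C = (\<Sum>ij\<in>{..<p} \<times> {..<p}. B ij)"
  have C: "B (i,j) \<le> C" if "i < p" "j < p" for i j unfolding C_def
    by (rule member_le_sum) (use B that in auto)
  show thesis
  proof
    show "0 \<le> C" unfolding C_def using B by (intro sum_nonneg) auto
    fix i j k assume ij: "i < p" "j < p"
    show "norm (fcoef (\<lambda>z. F z $$ (i,j)) k) \<le> C * R powi (- k)"
    proof (rule fcoef_radius_bound[OF R continuous_on_subset[OF cont[OF ij] sub]])
      show "norm (F z $$ (i,j)) \<le> C" if "norm z = R" for z using B[of "(i,j)"] ij that C[OF ij] by force
      show "fcoef (\<lambda>z. F z $$ (i,j)) k = circle_mean R (\<lambda>z. F z $$ (i,j) * z powi (- k - 1))"
        unfolding fcoef_def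
      proof (cases "R \<le> 1")
        case True
        then show "circle_mean 1 (\<lambda>z. F z $$ (i,j) * z powi (- k - 1)) = circle_mean R (\<lambda>z. F z $$ (i,j) * z powi (- k - 1))"
          using fcoef_annulus[OF R True, of "\<lambda>z. F z $$ (i,j)" "- k - 1"] cont[OF ij] hol[OF ij] by (simp add: min_def max_def split: if_splits)
      next
        case False
        then show "circle_mean 1 (\<lambda>z. F z $$ (i,j) * z powi (- k - 1)) = circle_mean R (\<lambda>z. F z $$ (i,j) * z powi (- k - 1))"
          using fcoef_annulus[of 1 R "\<lambda>z. F z $$ (i,j)" "- k - 1"] cont[OF ij] hol[OF ij] by (simp add: min_def max_def)
      qed
    qed
  qed
qed

text \<open>The contour is pushed to infinity if \<open>s\<close> holds and to 0 otherwise; a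
  bounded integrand and the sign of \<open>k\<close> then force the coefficient to vanish.\<close>

lemma fcoef_vanish:
  assumes bd: "\<And>z. (1 \<le> norm z \<longleftrightarrow> s) \<or> norm z = 1 \<Longrightarrow> norm (f z) \<le> B"
    and eq: "\<And>R. 0 < R \<Longrightarrow> (if s then 1 \<le> R else R \<le> 1) \<Longrightarrow>
        continuous_on (sphere 0 R) f \<and> fcoef f k = circle_mean R (\<lambda>z. f z * z powi (- k - 1))"
    and k: "if s then 0 < k else k < 0"
  shows "fcoef f k = 0"
proof -
  have *: "norm (fcoef f k) \<le> B * t" if t: "0 < t" "t < 1" for t
  proof -
    \<comment> \<open>In both cases \<open>t\<close> tends to 0 and the bound becomes
      \<open>B * t ^ nat \<bar>k\<bar>\<close>.\<close>
    define R where "R = (if s then 1 / t else t)"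
    have R: "0 < R" "if s then 1 \<le> R else R \<le> 1" using t by (auto simp: R_def field_simps)
    have "norm (fcoef f k) \<le> B * R powi (- k)"
    proof (rule fcoef_radius_bound)
      show "norm (f z) \<le> B" if "norm z = R" for z
        by (rule bd) (use that R t in \<open>auto simp: R_def split: if_splits\<close>)
    qed (use R eq[OF R] in auto)
    also have "R powi (- k) = t ^ nat \<bar>k\<bar>"
      using k t by (auto simp: R_def power_int_def power_one_over inverse_eq_divide split: if_splits)
    also have "\<dots> \<le> t ^ 1" using k t by (intro power_decreasing) (auto split: if_splits)
    finally show ?thesis using bd[of 1] norm_ge_zero[of "f 1"] by (simp add: mult_left_mono order_trans)
  qed
  have "norm (fcoef f k) \<le> 0"
  proof (rule tendsto_lowerbound[where F="at_right 0"])
    show "((\<lambda>t::real. B * t) \<longlongrightarrow> 0) (at_right 0)" by (auto intro!: tendsto_eq_intros)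
    show "\<forall>\<^sub>F t in at_right 0. norm (fcoef f k) \<le> B * t"
      using eventually_at_right_less[of 0] eventually_at_right_real[of 0 1, simplified]
      by eventually_elim (use * in auto)
  qed simp
  then show ?thesis by simp
qed

text \<open>Geometric decay of the coefficients takes the place of analyticity near the circle,
  because no analytic continuation of a single factor is constructed.\<close>

definition circle_symbol :: "nat \<Rightarrow> (complex \<Rightarrow> complex mat) \<Rightarrow> bool" where
  "circle_symbol p F \<longleftrightarrow> mat_continuous_on p (sphere 0 1) F \<and>
     (\<exists>C q. 0 < q \<and> q < 1 \<and> (\<forall>i<p. \<forall>j<p. \<forall>k. norm (fcoef (\<lambda>z. F z $$ (i,j)) k) \<le> C * q ^ nat \<bar>k\<bar>))"

lemma circle_symbol_carrier: "circle_symbol p F \<Longrightarrow> norm z = 1 \<Longrightarrow> F z \<in> carrier_mat p p"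
  by (auto simp: circle_symbol_def mat_continuous_on_def)

lemma circle_symbol_continuous: "circle_symbol p F \<Longrightarrow> i < p \<Longrightarrow> j < p \<Longrightarrow> continuous_on (sphere 0 1) (\<lambda>z. F z $$ (i,j))"
  by (auto simp: circle_symbol_def mat_continuous_on_def)

lemma circle_symbol_summable:
  assumes "circle_symbol p F" "i < p" "j < p"
  shows "(\<lambda>k. norm (fcoef (\<lambda>z. F z $$ (i,j)) k)) summable_on UNIV"
proof -
  obtain C q where q: "0 < q" "q < 1" "\<And>k. norm (fcoef (\<lambda>z. F z $$ (i,j)) k) \<le> C * q ^ nat \<bar>k - 0\<bar>"
    using assms unfolding circle_symbol_def diff_zero by blast
  have "(\<lambda>k. C * q ^ nat \<bar>k - 0\<bar>) summable_on UNIV"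
    by (intro summable_on_cmult_right geometric_int_summable) (use q in auto)
  then show ?thesis by (rule summable_on_comparison_test) (use q in auto)
qed

section \<open>Entries and products of block Toeplitz matrices\<close>

lemma circ_int_entry:
  assumes "0 < r" "i < p" "j < p" "\<And>z. norm z = r \<Longrightarrow> F z $$ (i,j) = f z"
  shows "circ_int p r F $$ (i,j) = circle_mean r f"
proof -
  have "circ_int p r F $$ (i,j) = circle_mean r (\<lambda>z. F z $$ (i,j))"
    using assms by (simp add: circ_int_def circle_mean_def)
  also have "\<dots> = circle_mean r f" by (rule circle_mean_cong[OF assms(1,4)])
  finally show ?thesis .
qed

lemma fourier_coeff_entry:
  assumes "\<And>z. norm z = 1 \<Longrightarrow> F z \<in> carrier_mat p p" "i < p" "j < p"
  shows "fourier_coeff p F k $$ (i,j) = fcoef (\<lambda>z. F z $$ (i,j)) k"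
  unfolding fourier_coeff_def fcoef_def
proof (rule circ_int_entry)
  fix z :: complex assume z: "norm z = 1"
  have "1 / z powi (k + 1) = z powi (- k - 1)"
    using power_int_minus[of z "k + 1"] by (simp add: inverse_eq_divide)
  then show "((1 / z powi (k + 1)) \<cdot>\<^sub>m F z) $$ (i,j) = F z $$ (i,j) * z powi (- k - 1)"
    using assms(1)[OF z] assms(2,3) by (simp add: mult.commute)
qed (use assms in auto)

lemma mod_index_less: "1 \<le> p \<Longrightarrow> nat (u mod int p) < p"
  by (simp add: nat_less_iff)

lemma toeplitz_entry:
  assumes "1 \<le> p" "\<And>z. norm z = 1 \<Longrightarrow> F z \<in> carrier_mat p p"
  shows "toeplitz p F u v = fcoef (\<lambda>z. F z $$ (nat (u mod int p), nat (v mod int p))) (v div int p - u div int p)"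
  unfolding toeplitz_def by (rule fourier_coeff_entry) (use assms mod_index_less in auto)

lemma toeplitz_cong:
  assumes "1 \<le> p" "\<And>z. norm z = 1 \<Longrightarrow> F z = G z"
  shows "toeplitz p F = toeplitz p G"
proof (intro ext)
  fix u v
  have one_pos: "(0::real) < 1" by simp
  show "toeplitz p F u v = toeplitz p G u v" unfolding toeplitz_def fourier_coeff_def
    by (subst circ_int_entry[OF one_pos mod_index_less[OF assms(1)] mod_index_less[OF assms(1)] refl],
        rule circ_int_entry[symmetric]) (use assms mod_index_less in auto)
qed

lemma toeplitz_shift:
  assumes "1 \<le> p"
  shows "toeplitz p F (u + int p * k) (v + int p * k) = toeplitz p F u v"
  using assms by (simp add: toeplitz_def)

lemma toeplitz_decays:
  assumes p: "1 \<le> p" and F: "circle_symbol p F"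
  obtains C q where "0 < q" "q < 1" "decays C q (toeplitz p F)"
proof -
  obtain C q where q: "0 < q" "q < 1" "\<And>i j k. i < p \<Longrightarrow> j < p \<Longrightarrow> norm (fcoef (\<lambda>z. F z $$ (i,j)) k) \<le> C * q ^ nat \<bar>k\<bar>"
    using F unfolding circle_symbol_def by blast
  have C0: "0 \<le> C" using q(3)[of 0 0 0] p norm_ge_zero order_trans by (metis abs_zero less_le_trans mult.right_neutral nat_zero_as_int power_0 zero_less_one nat_int of_nat_0 One_nat_def zero_less_Suc)
  \<comment> \<open>The scalar distance is at most \<open>p\<close> times the block distance plus
    \<open>p\<close>. So the rate becomes the \<open>p\<close>-th root, and the additional
    \<open>p\<close> costs the factor \<open>1 / t ^ p\<close>.\<close>
  define t where "t = root p q"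
  have t: "0 < t" "t < 1" "t ^ p = q" using p q by (auto simp: t_def)
  show thesis
  proof
    show "0 < t" "t < 1" by fact+
    show "decays (C / t ^ p) t (toeplitz p F)" unfolding decays_def
    proof (intro allI)
      fix u v
      let ?d = "v div int p - u div int p"
      have "norm (toeplitz p F u v) \<le> C * q ^ nat \<bar>?d\<bar>"
        by (subst toeplitz_entry[OF p]) (use F circle_symbol_carrier q mod_index_less[OF p] in auto)
      also have "q ^ nat \<bar>?d\<bar> = t ^ (p * nat \<bar>?d\<bar>)" by (simp add: t(3)[symmetric] power_mult)
      also have "C * t ^ (p * nat \<bar>?d\<bar>) \<le> C / t ^ p * t ^ nat \<bar>u - v\<bar>"
      proof -
        have uv: "u = int p * (u div int p) + u mod int p" "v = int p * (v div int p) + v mod int p" by simp_all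
        have m: "0 \<le> u mod int p" "u mod int p < int p" "0 \<le> v mod int p" "v mod int p < int p" using p by auto
        have "u - v = (u mod int p - v mod int p) - int p * ?d" by (subst uv(1), subst uv(2)) (simp only: algebra_simps)
        then have "\<bar>u - v\<bar> \<le> \<bar>u mod int p - v mod int p\<bar> + \<bar>int p * ?d\<bar>" by simp
        also have "\<dots> \<le> int p + int p * \<bar>?d\<bar>" using m by (simp only: abs_mult)
        finally have "nat \<bar>u - v\<bar> \<le> nat (int p + int p * \<bar>?d\<bar>)" by (rule nat_mono)
        also have "\<dots> = p + p * nat \<bar>?d\<bar>" by (simp add: nat_add_distrib nat_mult_distrib)
        finally have "t ^ (p + p * nat \<bar>?d\<bar>) \<le> t ^ nat \<bar>u - v\<bar>" using t by (intro power_decreasing) auto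
        then have "t ^ (p * nat \<bar>?d\<bar>) \<le> t ^ nat \<bar>u - v\<bar> / t ^ p" using t q(1) by (simp add: power_add pos_le_divide_eq mult.commute)
        then show ?thesis using C0 mult_left_mono by fastforce
      qed
      finally show "norm (toeplitz p F u v) \<le> C / t ^ p * t ^ nat \<bar>u - v\<bar>" .
    qed
  qed
qed

text \<open>On each residue class modulo \<open>p\<close> the sum over \<open>w\<close> is a scalar
  convolution of Fourier coefficients; the \<open>p\<close> classes add up to the matrix product of
  the symbols.\<close>

lemma toeplitz_mult:
  assumes p: "1 \<le> p" and F: "circle_symbol p F" and G: "circle_symbol p G"
  shows "((\<lambda>w. toeplitz p F u w * toeplitz p G w v) has_sum toeplitz p (\<lambda>z. F z * G z) u v) UNIV"
proof -
  let ?i = "nat (u mod int p)" and ?j = "nat (v mod int p)" and ?x = "u div int p" and ?y = "v div int p"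
  have ij: "?i < p" "?j < p" using mod_index_less[OF p] by auto
  note carF = circle_symbol_carrier[OF F] and carG = circle_symbol_carrier[OF G]
  let ?f = "\<lambda>r z. F z $$ (?i,r)" and ?g = "\<lambda>r z. G z $$ (r,?j)"
  have cls: "((\<lambda>w. toeplitz p F u w * toeplitz p G w v) has_sum fcoef (\<lambda>z. ?f r z * ?g r z) (?y - ?x)) {w. w mod int p = int r}"
    if r: "r < p" for r
  proof -
    have "((\<lambda>l. fcoef (?f r) l * fcoef (?g r) (?y - ?x - l)) has_sum fcoef (\<lambda>z. ?f r z * ?g r z) (?y - ?x)) UNIV"
      using ij r by (intro fcoef_mult_has_sum circle_symbol_continuous[OF F] circle_symbol_summable[OF F] circle_symbol_continuous[OF G])
    also have "(\<lambda>l. fcoef (?f r) l * fcoef (?g r) (?y - ?x - l)) =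
       (\<lambda>l. toeplitz p F u (int p * (?x + l) + int r) * toeplitz p G (int p * (?x + l) + int r) v)"
    proof
      fix l
      have "(int p * (?x + l) + int r) mod int p = int r" "(int p * (?x + l) + int r) div int p = ?x + l"
        using r p by (simp_all)
      then show "fcoef (?f r) l * fcoef (?g r) (?y - ?x - l) =
        toeplitz p F u (int p * (?x + l) + int r) * toeplitz p G (int p * (?x + l) + int r) v"
        by (simp add: toeplitz_entry[OF p carF] toeplitz_entry[OF p carG] algebra_simps)
    qed
    finally have 1: "((\<lambda>l. toeplitz p F u (int p * (?x + l) + int r) * toeplitz p G (int p * (?x + l) + int r) v) has_sum
      fcoef (\<lambda>z. ?f r z * ?g r z) (?y - ?x)) UNIV" .
    have "bij_betw (\<lambda>l. int p * (?x + l) + int r) UNIV {w. w mod int p = int r}"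
    proof (rule bij_betwI[where g="\<lambda>w. w div int p - ?x"])
      fix w assume "w \<in> {w. w mod int p = int r}"
      then have "int r = w mod int p" by simp
      then show "int p * (?x + (w div int p - ?x)) + int r = w" by (simp only: add_diff_cancel_left' diff_add_cancel add.commute[of ?x]) simp
    qed (use r p in auto)
    from has_sum_reindex_bij_betw[OF this] 1 show ?thesis by blast
  qed
  have "((\<lambda>w. toeplitz p F u w * toeplitz p G w v) has_sum (\<Sum>r<p. fcoef (\<lambda>z. ?f r z * ?g r z) (?y - ?x))) (\<Union>r\<in>{..<p}. {w. w mod int p = int r})"
    by (rule sum_has_sum) (use cls in auto)
  moreover have "(\<Union>r\<in>{..<p}. {w. w mod int p = int r}) = UNIV"
  proof (intro equalityI subsetI)
    fix w :: int
    have "nat (w mod int p) < p" "w mod int p = int (nat (w mod int p))" using p mod_index_less[OF p] by auto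
    then show "w \<in> (\<Union>r\<in>{..<p}. {w. w mod int p = int r})" by blast
  qed auto
  moreover have "(\<Sum>r<p. fcoef (\<lambda>z. ?f r z * ?g r z) (?y - ?x)) = toeplitz p (\<lambda>z. F z * G z) u v"
  proof -
    have cont: "continuous_on (sphere 0 1) (\<lambda>z. ?f r z * ?g r z * z powi (- (?y - ?x) - 1))" if "r < p" for r
      using circle_symbol_continuous[OF F ij(1) that] circle_symbol_continuous[OF G that ij(2)]
      by (intro continuous_intros) auto
    have "toeplitz p (\<lambda>z. F z * G z) u v = fcoef (\<lambda>z. (F z * G z) $$ (?i,?j)) (?y - ?x)"
      using carF carG by (intro toeplitz_entry[OF p]) (auto intro: mult_carrier_mat)
    also have "\<dots> = circle_mean 1 (\<lambda>z. \<Sum>r<p. ?f r z * ?g r z * z powi (- (?y - ?x) - 1))"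
      unfolding fcoef_def
    proof (rule circle_mean_cong)
      fix z :: complex assume z: "norm z = 1"
      show "(F z * G z) $$ (?i,?j) * z powi (- (?y - ?x) - 1) = (\<Sum>r<p. ?f r z * ?g r z * z powi (- (?y - ?x) - 1))"
        by (simp only: mat_mult_entry[OF carF[OF z] carG[OF z] ij] sum_distrib_right)
    qed simp
    also have "\<dots> = (\<Sum>r<p. fcoef (\<lambda>z. ?f r z * ?g r z) (?y - ?x))"
      unfolding fcoef_def using cont by (intro circle_mean_sum) auto
    finally show ?thesis by simp
  qed
  ultimately show ?thesis by simp
qed

lemma toeplitz_one:
  assumes p: "1 \<le> p"
  shows "toeplitz p (\<lambda>_. 1\<^sub>m p) u v = (if u = v then 1 else 0)"
proof -
  let ?k = "v div int p - u div int p"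
  have "toeplitz p (\<lambda>_. 1\<^sub>m p) u v = circle_mean 1 (\<lambda>z. (if u mod int p = v mod int p then 1 else 0) * z powi (- ?k - 1))"
    using mod_index_less[OF p] p
    by (subst toeplitz_entry[OF p]) (auto simp: fcoef_def nat_eq_iff)
  also have "\<dots> = (if u mod int p = v mod int p then 1 else 0) * circle_mean 1 (\<lambda>z. z powi (- ?k - 1))"
    by (rule circle_mean_cmult) (auto intro!: continuous_intros)
  also have "circle_mean 1 (\<lambda>z. z powi (- ?k - 1)) = (if ?k = 0 then 1 else 0)"
    by (subst circle_mean_powi) auto
  also have "(if u mod int p = v mod int p then 1 else 0) * (if ?k = 0 then 1 else 0) = (if u = v then 1 else (0::complex))"
    by (auto, metis mult_div_mod_eq)
  finally show ?thesis .
qed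

text \<open>\<open>F\<close> extends the boundary values inwards and controls the negative indices;
  \<open>G\<close> extends them outwards and controls the others. They are linked only by their
  values on the circle.\<close>

lemma circle_symbolI:
  assumes r: "0 < r" "r < 1" "1 < R" and F: "regular_between p r 1 F" and G: "regular_between p 1 R G"
    and eq: "\<And>z. norm z = 1 \<Longrightarrow> F z = G z"
  shows "circle_symbol p F"
proof -
  obtain B1 where B1: "0 \<le> B1" "\<And>i j k. i < p \<Longrightarrow> j < p \<Longrightarrow> norm (fcoef (\<lambda>z. F z $$ (i,j)) k) \<le> B1 * r powi (- k)"
    by (rule fcoef_decay[of r p F]) (use r F in auto)
  obtain B2 where B2: "0 \<le> B2" "\<And>i j k. i < p \<Longrightarrow> j < p \<Longrightarrow> norm (fcoef (\<lambda>z. G z $$ (i,j)) k) \<le> B2 * R powi (- k)"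
    by (rule fcoef_decay[of R p G]) (use r G in auto)
  have FG: "fcoef (\<lambda>z. F z $$ (i,j)) k = fcoef (\<lambda>z. G z $$ (i,j)) k" for i j k
    unfolding fcoef_def by (rule circle_mean_cong) (use eq in auto)
  define q where "q = max r (1 / R)"
  have q: "0 < q" "q < 1" using r by (auto simp: q_def)
  have "norm (fcoef (\<lambda>z. F z $$ (i,j)) k) \<le> (B1 + B2) * q ^ nat \<bar>k\<bar>" if ij: "i < p" "j < p" for i j k
  proof (cases "k \<ge> 0")
    case True
    have "norm (fcoef (\<lambda>z. F z $$ (i,j)) k) \<le> B2 * R powi (- k)" unfolding FG by (rule B2(2)[OF ij])
    also have "R powi (- k) = (1 / R) ^ nat \<bar>k\<bar>" using True r by (auto simp: power_int_def power_one_over inverse_eq_divide)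
    also have "B2 * (1 / R) ^ nat \<bar>k\<bar> \<le> (B1 + B2) * q ^ nat \<bar>k\<bar>"
      using B1(1) B2(1) r q by (intro mult_mono power_mono) (auto simp: q_def)
    finally show ?thesis .
  next
    case False
    have "norm (fcoef (\<lambda>z. F z $$ (i,j)) k) \<le> B1 * r powi (- k)" by (rule B1(2)[OF ij])
    also have "r powi (- k) = r ^ nat \<bar>k\<bar>" using False r by (auto simp: power_int_def)
    also have "B1 * r ^ nat \<bar>k\<bar> \<le> (B1 + B2) * q ^ nat \<bar>k\<bar>"
      using B1(1) B2(1) r q by (intro mult_mono power_mono) (auto simp: q_def)
    finally show ?thesis .
  qed
  moreover have "mat_continuous_on p (sphere 0 1) F"
  proof -
    have c: "mat_continuous_on p {z. r \<le> norm z \<and> norm z \<le> 1} F" using F by (simp add: regular_between_def)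
    have sub: "sphere 0 1 \<subseteq> {z::complex. r \<le> norm z \<and> norm z \<le> 1}" using r by auto
    show ?thesis unfolding mat_continuous_on_def
      using c sub by (auto simp: mat_continuous_on_def intro: continuous_on_subset[OF _ sub])
  qed
  ultimately show ?thesis unfolding circle_symbol_def using q by blast
qed

section \<open>Triangularity of one-sided factors\<close>

lemma regular_plus:
  assumes "mat_holomorphic_on p G {z. norm z < 1}" "mat_continuous_on p {z. norm z \<le> 1} G"
  shows "regular_between p r 1 G"
proof -
  have s: "{z::complex. r \<le> norm z \<and> norm z \<le> 1} \<subseteq> {z. norm z \<le> 1}" "{z::complex. r < norm z \<and> norm z < 1} \<subseteq> {z. norm z < 1}" by auto
  show ?thesis unfolding regular_between_def mat_holomorphic_on_def mat_continuous_on_def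
  proof (intro conjI ballI allI impI)
    fix i j assume ij: "i < p" "j < p"
    show "continuous_on {z. r \<le> norm z \<and> norm z \<le> 1} (\<lambda>z. G z $$ (i,j))"
      by (rule continuous_on_subset[OF _ s(1)]) (use assms ij in \<open>auto simp: mat_continuous_on_def\<close>)
    show "(\<lambda>z. G z $$ (i,j)) holomorphic_on {z. r < norm z \<and> norm z < 1}"
      by (rule holomorphic_on_subset[OF _ s(2)]) (use assms ij in \<open>auto simp: mat_holomorphic_on_def\<close>)
  qed (use assms in \<open>auto simp: mat_continuous_on_def mat_holomorphic_on_def\<close>)
qed

lemma regular_minus:
  assumes "mat_holomorphic_on p G {z. 1 < norm z}" "mat_continuous_on p {z. 1 \<le> norm z} G"
  shows "regular_between p 1 r G"
proof -
  have s: "{z::complex. 1 \<le> norm z \<and> norm z \<le> r} \<subseteq> {z. 1 \<le> norm z}" "{z::complex. 1 < norm z \<and> norm z < r} \<subseteq> {z. 1 < norm z}" by auto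
  show ?thesis unfolding regular_between_def mat_holomorphic_on_def mat_continuous_on_def
  proof (intro conjI ballI allI impI)
    fix i j assume ij: "i < p" "j < p"
    show "continuous_on {z. 1 \<le> norm z \<and> norm z \<le> r} (\<lambda>z. G z $$ (i,j))"
      by (rule continuous_on_subset[OF _ s(1)]) (use assms ij in \<open>auto simp: mat_continuous_on_def\<close>)
    show "(\<lambda>z. G z $$ (i,j)) holomorphic_on {z. 1 < norm z \<and> norm z < r}"
      by (rule holomorphic_on_subset[OF _ s(2)]) (use assms ij in \<open>auto simp: mat_holomorphic_on_def\<close>)
  qed (use assms in \<open>auto simp: mat_continuous_on_def mat_holomorphic_on_def\<close>)
qed

lemma plus_fcoef_vanish:
  assumes G: "mat_holomorphic_on p G {z. norm z < 1}" "mat_continuous_on p {z. norm z \<le> 1} G"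
    and ij: "i < p" "j < p" and k: "k < 0"
  shows "fcoef (\<lambda>z. G z $$ (i,j)) k = 0"
proof -
  have "{z::complex. norm z \<le> 1} = cball 0 1" by auto
  then have c: "continuous_on (cball 0 1) (\<lambda>z. G z $$ (i,j))" using G ij by (auto simp: mat_continuous_on_def)
  have "bounded ((\<lambda>z. G z $$ (i,j)) ` cball 0 1)"
    by (intro compact_imp_bounded compact_continuous_image c compact_cball)
  then obtain B where "\<And>z. z \<in> cball 0 1 \<Longrightarrow> norm (G z $$ (i,j)) \<le> B" unfolding bounded_iff by blast
  then have B: "\<And>z. norm z \<le> 1 \<Longrightarrow> norm (G z $$ (i,j)) \<le> B" by simp
  show ?thesis
  proof (rule fcoef_vanish[where s=False and B=B])
    fix R :: real assume R: "0 < R" "if False then 1 \<le> R else R \<le> 1"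
    have "regular_between p R 1 G" by (rule regular_plus[OF G])
    then have "fcoef (\<lambda>z. G z $$ (i,j)) k = circle_mean R (\<lambda>z. G z $$ (i,j) * z powi (- k - 1))"
      unfolding fcoef_def using R ij
      by (intro fcoef_annulus[symmetric]) (auto simp: regular_between_def mat_continuous_on_def mat_holomorphic_on_def)
    moreover have "continuous_on (sphere 0 R) (\<lambda>z. G z $$ (i,j))"
      by (rule continuous_on_subset[OF c]) (use R in auto)
    ultimately show "continuous_on (sphere 0 R) (\<lambda>z. G z $$ (i,j)) \<and>
      fcoef (\<lambda>z. G z $$ (i,j)) k = circle_mean R (\<lambda>z. G z $$ (i,j) * z powi (- k - 1))" by blast
  qed (use B k in auto)
qed

text \<open>Boundedness on the closed exterior comes from the limit near infinity and from
  compactness on the remaining shell; then the contour goes to infinity.\<close>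

lemma minus_fcoef_vanish:
  assumes G: "mat_holomorphic_on p G {z. 1 < norm z}" "mat_continuous_on p {z. 1 \<le> norm z} G"
    and ij: "i < p" "j < p" and l: "((\<lambda>z. G z $$ (i,j)) \<longlongrightarrow> l) at_infinity" and k: "0 < k"
  shows "fcoef (\<lambda>z. G z $$ (i,j)) k = 0"
proof -
  have c: "continuous_on {z. 1 \<le> norm z} (\<lambda>z. G z $$ (i,j))" using G ij by (auto simp: mat_continuous_on_def)
  have "\<forall>\<^sub>F z in at_infinity. dist (G z $$ (i,j)) l < 1" using l by (rule tendstoD) simp
  then obtain b where b: "\<And>z. b \<le> norm z \<Longrightarrow> dist (G z $$ (i,j)) l < 1" by (auto simp: eventually_at_infinity)
  have cmp: "compact {z::complex. 1 \<le> norm z \<and> norm z \<le> b}"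
  proof -
    have "{z::complex. 1 \<le> norm z \<and> norm z \<le> b} = cball 0 b \<inter> {z. 1 \<le> norm z}" by auto
    moreover have "closed {z::complex. 1 \<le> norm z}" by (intro closed_Collect_le continuous_intros)
    ultimately show ?thesis by (simp add: compact_Int_closed)
  qed
  have "bounded ((\<lambda>z. G z $$ (i,j)) ` {z. 1 \<le> norm z \<and> norm z \<le> b})"
    by (intro compact_imp_bounded compact_continuous_image cmp continuous_on_subset[OF c]) auto
  then obtain B where B: "\<And>z. z \<in> {z. 1 \<le> norm z \<and> norm z \<le> b} \<Longrightarrow> norm (G z $$ (i,j)) \<le> B" unfolding bounded_iff by blast
  have bd: "norm (G z $$ (i,j)) \<le> max B (norm l + 1)" if "1 \<le> norm z" for z
  proof (cases "norm z \<le> b")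
    case True then show ?thesis using B[of z] that by auto
  next
    case False
    then have "norm (G z $$ (i,j) - l) < 1" using b[of z] by (simp add: dist_norm)
    then show ?thesis using norm_triangle_ineq2[of "G z $$ (i,j)" l] by simp
  qed
  show ?thesis
  proof (rule fcoef_vanish[where s=True and B="max B (norm l + 1)"])
    fix R :: real assume R: "0 < R" "if True then 1 \<le> R else R \<le> 1"
    have "regular_between p 1 R G" by (rule regular_minus[OF G])
    then have "fcoef (\<lambda>z. G z $$ (i,j)) k = circle_mean R (\<lambda>z. G z $$ (i,j) * z powi (- k - 1))"
      unfolding fcoef_def using R ij
      by (intro fcoef_annulus) (auto simp: regular_between_def mat_continuous_on_def mat_holomorphic_on_def)
    moreover have "continuous_on (sphere 0 R) (\<lambda>z. G z $$ (i,j))"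
      by (rule continuous_on_subset[OF c]) (use R in auto)
    ultimately show "continuous_on (sphere 0 R) (\<lambda>z. G z $$ (i,j)) \<and>
      fcoef (\<lambda>z. G z $$ (i,j)) k = circle_mean R (\<lambda>z. G z $$ (i,j) * z powi (- k - 1))" by blast
  qed (use bd k in auto)
qed

lemma toeplitz_vanish:
  assumes p: "1 \<le> p" and car: "\<And>z. norm z = 1 \<Longrightarrow> F z \<in> carrier_mat p p"
    and F: "\<And>i j. i < p \<Longrightarrow> j < p \<Longrightarrow> fcoef (\<lambda>z. F z $$ (i,j)) (v div int p - u div int p) = 0"
  shows "toeplitz p F u v = 0"
  by (subst toeplitz_entry[OF p car]) (use F mod_index_less[OF p] in auto)

text \<open>The shift of the end points by \<open>p * M\<close> is absorbed into the symbol, so the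
  matrix between the end points has equal row and column ranges.\<close>

lemma toeplitz_scale:
  assumes p: "1 \<le> p" and car: "\<And>z. norm z = 1 \<Longrightarrow> F z \<in> carrier_mat p p"
  shows "toeplitz p (\<lambda>z. (z powi (- M)) \<cdot>\<^sub>m F z) u v = toeplitz p F u (int p * M + v)"
proof -
  let ?i = "nat (u mod int p)" and ?j = "nat (v mod int p)" and ?k = "v div int p - u div int p"
  have d: "(int p * M + v) mod int p = v mod int p" "(int p * M + v) div int p - u div int p = ?k + M"
    using p by auto
  have "toeplitz p (\<lambda>z. (z powi (- M)) \<cdot>\<^sub>m F z) u v = fcoef (\<lambda>z. ((z powi (- M)) \<cdot>\<^sub>m F z) $$ (?i,?j)) ?k"
    using car by (intro toeplitz_entry[OF p]) auto
  also have "\<dots> = fcoef (\<lambda>z. F z $$ (?i,?j)) (?k + M)" unfolding fcoef_def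
  proof (rule circle_mean_cong)
    fix z :: complex assume z: "norm z = 1"
    then have "z \<noteq> 0" by auto
    then have "z powi (- M) * z powi (- ?k - 1) = z powi (- (?k + M) - 1)"
      by (simp add: power_int_add[symmetric] algebra_simps)
    then show "((z powi (- M)) \<cdot>\<^sub>m F z) $$ (?i,?j) * z powi (- ?k - 1) = F z $$ (?i,?j) * z powi (- (?k + M) - 1)"
      using car[OF z] mod_index_less[OF p] by (simp add: mult_ac)
  qed simp
  also have "\<dots> = toeplitz p F u (int p * M + v)"
    by (subst toeplitz_entry[OF p car]) (simp_all only: d)
  finally show ?thesis .
qed

section \<open>The reproducing kernel\<close>

lemma sum_blocks:
  fixes f :: "nat \<Rightarrow> 'a::comm_monoid_add"
  shows "(\<Sum>i<p * n. f i) = (\<Sum>a<n. \<Sum>s<p. f (p * a + s))"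
proof (induction n)
  case (Suc n)
  have "{..<p * Suc n} = {..<p * n} \<union> (\<lambda>s. p * n + s) ` {..<p}"
  proof (intro equalityI subsetI)
    fix x assume "x \<in> {..<p * Suc n}"
    then show "x \<in> {..<p * n} \<union> (\<lambda>s. p * n + s) ` {..<p}"
      by (cases "x < p * n") (auto intro!: image_eqI[of _ _ "x - p * n"])
  qed auto
  then have "(\<Sum>i<p * Suc n. f i) = (\<Sum>i<p * n. f i) + (\<Sum>i\<in>(\<lambda>s. p * n + s) ` {..<p}. f i)"
    by (simp only:) (rule sum.union_disjoint, auto)
  also have "(\<Sum>i\<in>(\<lambda>s. p * n + s) ` {..<p}. f i) = (\<Sum>s<p. f (p * n + s))"
    by (subst sum.reindex) (auto simp: inj_on_def)
  finally show ?case by (simp add: Suc.IH)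
qed simp

lemma block_index: "a < n \<Longrightarrow> s < p \<Longrightarrow> p * a + s < p * (n::nat)"
  by (metis add_less_cancel_left less_le_trans mult_Suc_right mult_le_mono2 Suc_leI add.commute)

lemma bivariate_eval:
  fixes q :: "complex poly poly"
  assumes "degree q \<le> n - 1" "\<And>a. degree (coeff q a) \<le> n - 1" "1 \<le> n"
  shows "poly (poly q [:z:]) w = (\<Sum>a<n. \<Sum>b<n. coeff (coeff q a) b * z ^ a * w ^ b)"
proof -
  have n: "{..n - 1} = {..<n}" using assms(3) by auto
  have 1: "poly r x = (\<Sum>b<n. coeff r b * x ^ b)" if "degree r \<le> n - 1" for r :: "'b::comm_semiring_1 poly" and x
    unfolding n[symmetric] poly_altdef
    by (rule sum.mono_neutral_left) (use that in \<open>auto simp: coeff_eq_0\<close>)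
  have "poly (poly q [:z:]) w = poly (\<Sum>a<n. coeff q a * [:z:] ^ a) w" by (simp only: 1[OF assms(1)])
  also have "\<dots> = (\<Sum>a<n. poly (coeff q a) w * z ^ a)" by (simp add: poly_sum)
  also have "\<dots> = (\<Sum>a<n. \<Sum>b<n. coeff (coeff q a) b * z ^ a * w ^ b)"
    by (simp add: 1[OF assms(2)] sum_distrib_left mult_ac)
  finally show ?thesis .
qed

text \<open>The powers of \<open>w\<close> are reversed on purpose: together with \<open>w^c\<close>
  and \<open>1 / w^(M + n)\<close> the power \<open>w^(n - 1 - b)\<close> extracts the Fourier
  coefficient of index \<open>M + b - c\<close>. Thus block row \<open>b\<close> of the coefficients
  meets block column \<open>M + b\<close> of the Toeplitz matrix.\<close>

definition flat_coeff :: "nat \<Rightarrow> nat \<Rightarrow> complex poly poly mat \<Rightarrow> nat \<Rightarrow> nat \<Rightarrow> complex" where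
  "flat_coeff p n R J I = coeff (coeff (R $$ (J mod p, I mod p)) (I div p)) (n - 1 - J div p)"

definition poly_degrees :: "nat \<Rightarrow> nat \<Rightarrow> complex poly poly mat \<Rightarrow> bool" where
  "poly_degrees p n R \<longleftrightarrow> R \<in> carrier_mat p p \<and>
     (\<forall>i<p. \<forall>j<p. degree (R $$ (i, j)) \<le> n - 1 \<and> (\<forall>a. degree (coeff (R $$ (i, j)) a) \<le> n - 1))"

lemma eval_mat2_entry:
  assumes R: "poly_degrees p n R" and n: "1 \<le> n" and rs: "r < p" "s < p"
  shows "eval_mat2 R z w $$ (r,s) = (\<Sum>b<n. \<Sum>a<n. w ^ (n - 1 - b) * flat_coeff p n R (p * b + r) (p * a + s) * z ^ a)"
proof -
  have "eval_mat2 R z w $$ (r,s) = poly (poly (R $$ (r,s)) [:z:]) w"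
    using R rs by (auto simp: eval_mat2_def poly_degrees_def)
  also have "\<dots> = (\<Sum>a<n. \<Sum>b<n. coeff (coeff (R $$ (r,s)) a) b * z ^ a * w ^ b)"
    using R rs n by (intro bivariate_eval) (auto simp: poly_degrees_def)
  also have "\<dots> = (\<Sum>a<n. \<Sum>b<n. coeff (coeff (R $$ (r,s)) a) (n - Suc b) * z ^ a * w ^ (n - Suc b))"
    by (rule sum.cong[OF refl], rule sum.nat_diff_reindex[symmetric])
  also have "\<dots> = (\<Sum>a<n. \<Sum>b<n. w ^ (n - 1 - b) * flat_coeff p n R (p * b + r) (p * a + s) * z ^ a)"
    using rs by (simp add: flat_coeff_def mult_ac)
  finally show ?thesis by (subst sum.swap)
qed

lemma eval_mat2_carrier: "poly_degrees p n R \<Longrightarrow> eval_mat2 R z w \<in> carrier_mat p p"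
  by (auto simp: eval_mat2_def poly_degrees_def)

lemma flat_coeff_inject:
  assumes R: "poly_degrees p n R" "poly_degrees p n R'" and n: "1 \<le> n"
    and eq: "\<And>J I. J < p * n \<Longrightarrow> I < p * n \<Longrightarrow> flat_coeff p n R J I = flat_coeff p n R' J I"
  shows "R = R'"
proof (rule eq_matI)
  fix r s assume "r < dim_row R'" "s < dim_col R'"
  then have rs: "r < p" "s < p" using R by (auto simp: poly_degrees_def)
  have "coeff (coeff (R $$ (r,s)) a) b = coeff (coeff (R' $$ (r,s)) a) b" for a b
  proof (cases "a < n \<and> b < n")
    case True
    have "flat_coeff p n R (p * (n - 1 - b) + r) (p * a + s) = flat_coeff p n R' (p * (n - 1 - b) + r) (p * a + s)"
      by (rule eq; rule block_index) (use True rs in auto)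
    then show ?thesis using True rs by (simp add: flat_coeff_def)
  next
    case False
    have "coeff (coeff (S $$ (r,s)) a) b = 0" if S: "poly_degrees p n S" for S
    proof (cases "a < n")
      case True
      have "degree (coeff (S $$ (r,s)) a) \<le> n - 1" using S rs by (auto simp: poly_degrees_def)
      then have "degree (coeff (S $$ (r,s)) a) < b" using False True n by linarith
      then show ?thesis by (rule coeff_eq_0)
    next
      case False
      have "degree (S $$ (r,s)) \<le> n - 1" using S rs by (auto simp: poly_degrees_def)
      then have "degree (S $$ (r,s)) < a" using False n by linarith
      then have "coeff (S $$ (r,s)) a = 0" by (rule coeff_eq_0)
      then show ?thesis by simp
    qed
    then show ?thesis using R by simp
  qed
  then show "R $$ (r,s) = R' $$ (r,s)" by (intro poly_eqI)
qed (use R in \<open>auto simp: poly_degrees_def\<close>)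

lemma circle_mean_double_sum:
  assumes "0 < r" "finite S" "finite S'" "\<And>s s'. s \<in> S \<Longrightarrow> s' \<in> S' \<Longrightarrow> continuous_on (sphere 0 r) (f s s')"
  shows "circle_mean r (\<lambda>z. \<Sum>s\<in>S. \<Sum>s'\<in>S'. f s s' z) = (\<Sum>s\<in>S. \<Sum>s'\<in>S'. circle_mean r (f s s'))"
  using assms by (subst circle_mean_sum) (auto intro!: continuous_on_sum sum.cong circle_mean_sum)

lemma fcoef_shift_power:
  assumes "\<And>z. norm z = 1 \<Longrightarrow> g z = f z * z powi m"
  shows "circle_mean 1 g = fcoef f (- m - 1)"
  unfolding fcoef_def by (rule circle_mean_cong) (use assms in auto)

text \<open>With \<open>A\<close> the finite block Toeplitz matrix and \<open>X\<close> the flattened coefficients of \<open>R\<close>, the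
  reproducing integral applied to \<open>P\<close> is \<open>P A X\<close>.\<close>

lemma reproducing_integral:
  assumes p: "1 \<le> p" and n: "1 \<le> n" and \<Phi>: "circle_symbol p \<Phi>" and R: "poly_degrees p n R"
    and P: "P \<in> carrier_mat p p" "\<And>i j. i < p \<Longrightarrow> j < p \<Longrightarrow> degree (P $$ (i,j)) \<le> n - 1" and is': "i < p" "s < p"
  shows "circ_int p 1 (\<lambda>w. (1 / w powi (M + int n)) \<cdot>\<^sub>m (eval_mat P w * \<Phi> w * eval_mat2 R z w)) $$ (i,s) =
    (\<Sum>c<n. \<Sum>t<p. coeff (P $$ (i,t)) c * (\<Sum>a<n.
       (\<Sum>J<p * n. toeplitz p \<Phi> (int (p * c + t)) (int p * M + int J) * flat_coeff p n R J (p * a + s)) * z ^ a))"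
proof -
  have one: "(0::real) < 1" by simp
  note car\<Phi> = circle_symbol_carrier[OF \<Phi>]
  have carP: "eval_mat P w \<in> carrier_mat p p" for w using P(1) by auto
  have n': "{..n - 1} = {..<n}" using n by auto
  have ent: "poly (P $$ (i,t)) w = (\<Sum>c<n. coeff (P $$ (i,t)) c * w ^ c)" if "t < p" for t w
    unfolding n'[symmetric] poly_altdef
    by (rule sum.mono_neutral_left) (use P(2)[OF is'(1) that] in \<open>auto simp: coeff_eq_0\<close>)
  define Y where "Y = (\<lambda>t r c b. coeff (P $$ (i,t)) c * (\<Sum>a<n. flat_coeff p n R (p * b + r) (p * a + s) * z ^ a))"
  define g where "g = (\<lambda>t r c b w. Y t r c b * (\<Phi> w $$ (t,r) * w powi (int c + int (n - 1 - b) - M - int n)))"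
  have cg: "continuous_on (sphere 0 1) (g t r c b)" if "t < p" "r < p" for t r c b
    unfolding g_def using circle_symbol_continuous[OF \<Phi> that] by (intro continuous_intros) auto
  have swap4: "(\<Sum>r<p. \<Sum>t<p. \<Sum>c<n. \<Sum>b<n. f r t c b) = (\<Sum>c<n. \<Sum>t<p. \<Sum>b<n. \<Sum>r<p. f r t c b)"
    for f :: "nat \<Rightarrow> nat \<Rightarrow> nat \<Rightarrow> nat \<Rightarrow> complex"
  proof -
    have "(\<Sum>r<p. \<Sum>t<p. \<Sum>c<n. \<Sum>b<n. f r t c b) = (\<Sum>r<p. \<Sum>c<n. \<Sum>t<p. \<Sum>b<n. f r t c b)"
      by (rule sum.cong[OF refl], rule sum.swap)
    also have "\<dots> = (\<Sum>c<n. \<Sum>r<p. \<Sum>t<p. \<Sum>b<n. f r t c b)" by (rule sum.swap)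
    also have "\<dots> = (\<Sum>c<n. \<Sum>t<p. \<Sum>r<p. \<Sum>b<n. f r t c b)" by (rule sum.cong[OF refl], rule sum.swap)
    also have "\<dots> = (\<Sum>c<n. \<Sum>t<p. \<Sum>b<n. \<Sum>r<p. f r t c b)"
      by (rule sum.cong[OF refl], rule sum.cong[OF refl], rule sum.swap)
    finally show ?thesis .
  qed
  have dist4: "k * (\<Sum>r<p. \<Sum>t<p. \<Sum>c<n. \<Sum>b<n. f r t c b) = (\<Sum>r<p. \<Sum>t<p. \<Sum>c<n. \<Sum>b<n. k * f r t c b)"
    for k :: complex and f by (simp only: sum_distrib_left)
  have "circ_int p 1 (\<lambda>w. (1 / w powi (M + int n)) \<cdot>\<^sub>m (eval_mat P w * \<Phi> w * eval_mat2 R z w)) $$ (i,s) =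
    circle_mean 1 (\<lambda>w. \<Sum>r<p. \<Sum>t<p. \<Sum>c<n. \<Sum>b<n. g t r c b w)"
  proof (rule circ_int_entry[OF one is'])
    fix w :: complex assume w: "norm w = 1"
    then have w0: "w \<noteq> 0" by auto
    have c1: "eval_mat P w * \<Phi> w \<in> carrier_mat p p" using carP car\<Phi>[OF w] by (rule mult_carrier_mat)
    have "((1 / w powi (M + int n)) \<cdot>\<^sub>m (eval_mat P w * \<Phi> w * eval_mat2 R z w)) $$ (i,s) =
      (1 / w powi (M + int n)) * (eval_mat P w * \<Phi> w * eval_mat2 R z w) $$ (i,s)"
      using mult_carrier_mat[OF c1 eval_mat2_carrier[OF R]] is' by (metis index_smult_mat(1) carrier_matD)
    also have "(eval_mat P w * \<Phi> w * eval_mat2 R z w) $$ (i,s) = (\<Sum>r<p. (\<Sum>t<p. eval_mat P w $$ (i,t) * \<Phi> w $$ (t,r)) * eval_mat2 R z w $$ (r,s))"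
      unfolding mat_mult_entry[OF c1 eval_mat2_carrier[OF R] is']
      by (intro sum.cong refl, subst mat_mult_entry[OF carP car\<Phi>[OF w] is'(1)]) auto
    also have "\<dots> = (\<Sum>r<p. \<Sum>t<p. \<Sum>c<n. \<Sum>b<n. coeff (P $$ (i,t)) c * w ^ c * \<Phi> w $$ (t,r) *
       (w ^ (n - 1 - b) * (\<Sum>a<n. flat_coeff p n R (p * b + r) (p * a + s) * z ^ a)))"
    proof (rule sum.cong[OF refl])
      fix r assume "r \<in> {..<p}"
      then have r: "r < p" by simp
      have e: "eval_mat2 R z w $$ (r,s) = (\<Sum>b<n. w ^ (n - 1 - b) * (\<Sum>a<n. flat_coeff p n R (p * b + r) (p * a + s) * z ^ a))"
        by (simp only: eval_mat2_entry[OF R n r is'(2)] sum_distrib_left mult.assoc)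
      show "(\<Sum>t<p. eval_mat P w $$ (i,t) * \<Phi> w $$ (t,r)) * eval_mat2 R z w $$ (r,s) =
        (\<Sum>t<p. \<Sum>c<n. \<Sum>b<n. coeff (P $$ (i,t)) c * w ^ c * \<Phi> w $$ (t,r) *
          (w ^ (n - 1 - b) * (\<Sum>a<n. flat_coeff p n R (p * b + r) (p * a + s) * z ^ a)))"
      proof -
        have dist: "(\<Sum>t<p. (\<Sum>c<n. f t c) * h t) * (\<Sum>b<n. B b) = (\<Sum>t<p. \<Sum>c<n. \<Sum>b<n. f t c * h t * B b)"
          for f :: "nat \<Rightarrow> nat \<Rightarrow> complex" and h B
          by (simp only: sum_distrib_right) (simp only: sum_distrib_left)
        show ?thesis unfolding e dist[symmetric] using P(1) is' by (simp add: ent)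
      qed
    qed
    also have "(1 / w powi (M + int n)) * \<dots> = (\<Sum>r<p. \<Sum>t<p. \<Sum>c<n. \<Sum>b<n. g t r c b w)"
      unfolding dist4
    proof (intro sum.cong refl)
      fix r t c b
      have "w powi (int c + int (n - 1 - b) - M - int n) = w ^ c * w ^ (n - 1 - b) / w powi (M + int n)"
        using w0 by (simp add: power_int_add power_int_diff diff_diff_eq)
      then have "g t r c b w = coeff (P $$ (i,t)) c * (\<Sum>a<n. flat_coeff p n R (p * b + r) (p * a + s) * z ^ a) *
         (\<Phi> w $$ (t,r) * (w ^ c * w ^ (n - 1 - b) / w powi (M + int n)))" by (simp only: g_def Y_def)
      also have "\<dots> = 1 / w powi (M + int n) * (coeff (P $$ (i,t)) c * w ^ c * \<Phi> w $$ (t,r) *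
          (w ^ (n - 1 - b) * (\<Sum>a<n. flat_coeff p n R (p * b + r) (p * a + s) * z ^ a)))" by simp
      finally show "1 / w powi (M + int n) * (coeff (P $$ (i,t)) c * w ^ c * \<Phi> w $$ (t,r) *
          (w ^ (n - 1 - b) * (\<Sum>a<n. flat_coeff p n R (p * b + r) (p * a + s) * z ^ a))) = g t r c b w" ..
    qed
    finally show "((1 / w powi (M + int n)) \<cdot>\<^sub>m (eval_mat P w * \<Phi> w * eval_mat2 R z w)) $$ (i,s) =
      (\<Sum>r<p. \<Sum>t<p. \<Sum>c<n. \<Sum>b<n. g t r c b w)" .
  qed
  also have "\<dots> = (\<Sum>r<p. \<Sum>t<p. \<Sum>c<n. \<Sum>b<n. circle_mean 1 (g t r c b))"
    using cg by (subst circle_mean_double_sum[OF one]) (auto intro!: continuous_on_sum sum.cong circle_mean_double_sum)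
  also have "\<dots> = (\<Sum>r<p. \<Sum>t<p. \<Sum>c<n. \<Sum>b<n. Y t r c b * toeplitz p \<Phi> (int (p * c + t)) (int p * M + int (p * b + r)))"
  proof (intro sum.cong refl)
    fix r t c b assume "r \<in> {..<p}" "t \<in> {..<p}" "c \<in> {..<n}" "b \<in> {..<n}"
    then have b: "r < p" "t < p" "c < n" "b < n" by auto
    have "circle_mean 1 (g t r c b) = Y t r c b * circle_mean 1 (\<lambda>w. \<Phi> w $$ (t,r) * w powi (int c + int (n - 1 - b) - M - int n))"
      unfolding g_def using circle_symbol_continuous[OF \<Phi> b(2,1)] by (intro circle_mean_cmult continuous_intros) auto
    also have "circle_mean 1 (\<lambda>w. \<Phi> w $$ (t,r) * w powi (int c + int (n - 1 - b) - M - int n)) = fcoef (\<lambda>z. \<Phi> z $$ (t,r)) (M + int b - int c)"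
      using b by (subst fcoef_shift_power[OF refl]) (simp add: of_nat_diff algebra_simps)
    also have "fcoef (\<lambda>z. \<Phi> z $$ (t,r)) (M + int b - int c) = toeplitz p \<Phi> (int (p * c + t)) (int p * M + int (p * b + r))"
    proof -
      have e: "int p * M + int (p * b + r) = int p * (M + int b) + int r" "int (p * c + t) = int p * int c + int t"
        by (simp_all add: algebra_simps)
      have "(int p * (M + int b) + int r) div int p = M + int b" "(int p * (M + int b) + int r) mod int p = int r"
        "(int p * int c + int t) div int p = int c" "(int p * int c + int t) mod int p = int t" using b by auto
      then show ?thesis unfolding e by (simp only: toeplitz_entry[OF p car\<Phi>] nat_int)
    qed
    finally show "circle_mean 1 (g t r c b) = Y t r c b * toeplitz p \<Phi> (int (p * c + t)) (int p * M + int (p * b + r))" .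
  qed
  also have "\<dots> = (\<Sum>c<n. \<Sum>t<p. \<Sum>b<n. \<Sum>r<p. Y t r c b * toeplitz p \<Phi> (int (p * c + t)) (int p * M + int (p * b + r)))"
    by (rule swap4)
  also have "\<dots> = (\<Sum>c<n. \<Sum>t<p. coeff (P $$ (i,t)) c * (\<Sum>a<n.
       (\<Sum>J<p * n. toeplitz p \<Phi> (int (p * c + t)) (int p * M + int J) * flat_coeff p n R J (p * a + s)) * z ^ a))"
  proof (intro sum.cong refl)
    fix c t
    let ?T = "\<lambda>J. toeplitz p \<Phi> (int (p * c + t)) (int p * M + int J)"
    have "(\<Sum>b<n. \<Sum>r<p. Y t r c b * ?T (p * b + r)) = (\<Sum>J<p * n. coeff (P $$ (i,t)) c * (\<Sum>a<n. flat_coeff p n R J (p * a + s) * z ^ a) * ?T J)"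
      by (simp only: sum_blocks Y_def)
    also have "\<dots> = (\<Sum>J<p * n. \<Sum>a<n. coeff (P $$ (i,t)) c * (?T J * flat_coeff p n R J (p * a + s) * z ^ a))"
      by (simp add: sum_distrib_left sum_distrib_right mult_ac)
    also have "\<dots> = coeff (P $$ (i,t)) c * (\<Sum>a<n. (\<Sum>J<p * n. ?T J * flat_coeff p n R J (p * a + s)) * z ^ a)"
      by (subst sum.swap) (simp add: sum_distrib_left sum_distrib_right)
    finally show "(\<Sum>b<n. \<Sum>r<p. Y t r c b * ?T (p * b + r)) =
      coeff (P $$ (i,t)) c * (\<Sum>a<n. (\<Sum>J<p * n. ?T J * flat_coeff p n R J (p * a + s)) * z ^ a)" .
  qed
  finally show ?thesis .
qed

text \<open>Existence: the entries of the two-sided inverse, placed according to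
  \<open>flat_coeff\<close>, reproduce. Uniqueness: testing on monomials shows that the coefficients
  of any reproducing kernel form a right inverse, which must equal the left inverse
  \<open>X\<close>. Hence \<open>THE\<close> picks out this kernel.\<close>

lemma rep_kernel_flat:
  assumes p: "1 \<le> p" and n: "1 \<le> n" and \<Phi>: "circle_symbol p \<Phi>"
    and AX: "\<And>i j. i < p * n \<Longrightarrow> j < p * n \<Longrightarrow>
      (\<Sum>k<p * n. toeplitz p \<Phi> (int i) (int p * M + int k) * X k j) = (if i = j then 1 else 0)"
    and XA: "\<And>i j. i < p * n \<Longrightarrow> j < p * n \<Longrightarrow>
      (\<Sum>k<p * n. X i k * toeplitz p \<Phi> (int k) (int p * M + int j)) = (if i = j then 1 else 0)"
  shows "poly_degrees p n (rep_kernel p M \<Phi> n)"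
    and "\<And>J I. J < p * n \<Longrightarrow> I < p * n \<Longrightarrow> flat_coeff p n (rep_kernel p M \<Phi> n) J I = X J I"
proof -
  let ?T = "\<lambda>i k. toeplitz p \<Phi> (int i) (int p * M + int k)"
  \<comment> \<open>\<open>n - 1 - b\<close> undoes the reversal of the powers of \<open>w\<close>
    in \<open>flat_coeff\<close>.\<close>
  define R where "R = Matrix.mat p p (\<lambda>(r,s). \<Sum>a<n. monom (\<Sum>b<n. monom (X (p * (n - 1 - b) + r) (p * a + s)) b) a)"
  have cR: "coeff (coeff (R $$ (r,s)) a) b = (if a < n \<and> b < n then X (p * (n - 1 - b) + r) (p * a + s) else 0)"
    if "r < p" "s < p" for r s a b
    using that by (simp add: R_def coeff_sum)
  have Rd: "poly_degrees p n R" unfolding poly_degrees_def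
  proof (intro conjI allI impI)
    show "R \<in> carrier_mat p p" by (simp add: R_def)
    fix r s a assume rs: "r < p" "s < p"
    show "degree (R $$ (r,s)) \<le> n - 1"
      by (rule degree_le) (use cR[OF rs] n in \<open>auto intro!: poly_eqI\<close>)
    show "degree (coeff (R $$ (r,s)) a) \<le> n - 1"
      by (rule degree_le) (use cR[OF rs] n in auto)
  qed
  have Rflat: "flat_coeff p n R J I = X J I" if JI: "J < p * n" "I < p * n" for J I
  proof -
    have p0: "0 < p" using p by simp
    have d: "J div p < n" "I div p < n" using JI p0 by (simp_all add: less_mult_imp_div_less mult.commute)
    have "flat_coeff p n R J I = X (p * (n - 1 - (n - 1 - J div p)) + J mod p) (p * (I div p) + I mod p)"
      unfolding flat_coeff_def using p0 d by (subst cR) auto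
    also have "n - 1 - (n - 1 - J div p) = J div p" using d by simp
    finally show ?thesis by simp
  qed
  have rep: "is_rep_kernel p M \<Phi> n R" unfolding is_rep_kernel_def
  proof (intro conjI ballI impI allI)
    show "R \<in> carrier_mat p p" "\<And>i j. i < p \<Longrightarrow> j < p \<Longrightarrow> degree (R $$ (i,j)) \<le> n - 1"
      "\<And>i j a. i < p \<Longrightarrow> j < p \<Longrightarrow> degree (coeff (R $$ (i,j)) a) \<le> n - 1"
      using Rd by (auto simp: poly_degrees_def)
    fix P :: "complex poly mat" and z
    assume P: "P \<in> carrier_mat p p" "\<forall>i<p. \<forall>j<p. degree (P $$ (i, j)) \<le> n - 1"
    show "circ_int p 1 (\<lambda>w. (1 / w powi (M + int n)) \<cdot>\<^sub>m (eval_mat P w * \<Phi> w * eval_mat2 R z w)) = eval_mat P z"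
    proof (rule eq_matI)
      fix i s assume "i < dim_row (eval_mat P z)" "s < dim_col (eval_mat P z)"
      then have i_s: "i < p" "s < p" using P(1) by auto
      have "circ_int p 1 (\<lambda>w. (1 / w powi (M + int n)) \<cdot>\<^sub>m (eval_mat P w * \<Phi> w * eval_mat2 R z w)) $$ (i,s) =
        (\<Sum>c<n. \<Sum>t<p. coeff (P $$ (i,t)) c * (\<Sum>a<n. (\<Sum>J<p * n. ?T (p * c + t) J * flat_coeff p n R J (p * a + s)) * z ^ a))"
        using P(2) by (intro reproducing_integral[OF p n \<Phi> Rd P(1) _ i_s]) auto
      also have "\<dots> = (\<Sum>c<n. \<Sum>t<p. coeff (P $$ (i,t)) c * (if t = s then z ^ c else 0))"
      proof (intro sum.cong refl arg_cong[of _ _ "(*) _"])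
        fix c t assume "c \<in> {..<n}" "t \<in> {..<p}"
        then have ct: "c < n" "t < p" by auto
        have "(\<Sum>a<n. (\<Sum>J<p * n. ?T (p * c + t) J * flat_coeff p n R J (p * a + s)) * z ^ a) =
          (\<Sum>a<n. if a = c then (if t = s then z ^ c else 0) else 0)"
        proof (rule sum.cong[OF refl])
          fix a assume "a \<in> {..<n}"
          then have a: "a < n" by simp
          have "(\<Sum>J<p * n. ?T (p * c + t) J * flat_coeff p n R J (p * a + s)) = (\<Sum>J<p * n. ?T (p * c + t) J * X J (p * a + s))"
            by (rule sum.cong[OF refl]) (use Rflat block_index[OF a i_s(2)] in simp)
          also have "\<dots> = (if p * c + t = p * a + s then 1 else 0)"
            by (rule AX[OF block_index[OF ct] block_index[OF a i_s(2)]])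
          also have "p * c + t = p * a + s \<longleftrightarrow> a = c \<and> t = s"
          proof
            assume e: "p * c + t = p * a + s"
            have "(p * c + t) div p = c" "(p * a + s) div p = a" using ct i_s by auto
            then have "a = c" using e by simp
            then show "a = c \<and> t = s" using e by simp
          qed auto
          finally show "(\<Sum>J<p * n. ?T (p * c + t) J * flat_coeff p n R J (p * a + s)) * z ^ a =
            (if a = c then (if t = s then z ^ c else 0) else 0)" by simp
        qed
        then show "(\<Sum>a<n. (\<Sum>J<p * n. ?T (p * c + t) J * flat_coeff p n R J (p * a + s)) * z ^ a) = (if t = s then z ^ c else 0)"
          using ct by simp
      qed
      also have "\<dots> = (\<Sum>c<n. coeff (P $$ (i,s)) c * z ^ c)"
        using i_s by (simp add: if_distrib[of "\<lambda>x. _ * x"] cong: if_cong)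
      also have "\<dots> = poly (P $$ (i,s)) z"
      proof -
        have n': "{..n - 1} = {..<n}" using n by auto
        show ?thesis unfolding n'[symmetric] poly_altdef
          by (rule sum.mono_neutral_right) (use P(2) i_s in \<open>auto simp: coeff_eq_0\<close>)
      qed
      also have "\<dots> = eval_mat P z $$ (i,s)" using P(1) i_s by simp
      finally show "circ_int p 1 (\<lambda>w. (1 / w powi (M + int n)) \<cdot>\<^sub>m (eval_mat P w * \<Phi> w * eval_mat2 R z w)) $$ (i,s) = eval_mat P z $$ (i,s)" .
    qed (use P in \<open>auto simp: circ_int_def\<close>)
  qed
  have uniq: "S = R" if S: "is_rep_kernel p M \<Phi> n S" for S
  proof -
    have Sd: "poly_degrees p n S" using S by (auto simp: is_rep_kernel_def poly_degrees_def)
    have AS: "(\<Sum>J<p * n. ?T I J * flat_coeff p n S J I') = (if I = I' then 1 else 0)" if I: "I < p * n" "I' < p * n" for I I'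
    proof -
      have p0: "0 < p" using p by simp
      define c t a0 s where c: "c = I div p" "t = I mod p" "a0 = I' div p" "s = I' mod p"
      have b: "c < n" "t < p" "a0 < n" "s < p" using I p0 by (simp_all add: c less_mult_imp_div_less mult.commute)
      have II: "I = p * c + t" "I' = p * a0 + s" by (simp_all add: c)
      \<comment> \<open>A monomial in column \<open>t\<close> singles out row
        \<open>I = p * c + t\<close> of the product of the Toeplitz matrix with the
        coefficients.\<close>
      define P where "P = Matrix.mat p p (\<lambda>(i::nat,u). if u = t then monom (1::complex) c else 0)"
      have P: "P \<in> carrier_mat p p" by (simp add: P_def)
      have Pd: "degree (P $$ (i,j)) \<le> n - 1" if "i < p" "j < p" for i j
        using that b(1) by (auto simp: P_def degree_monom_eq)
      have "(\<Sum>a<n. (\<Sum>J<p * n. ?T I J * flat_coeff p n S J (p * a + s)) * z ^ a) = (\<Sum>a<n. (if a = c \<and> t = s then 1 else 0) * z ^ a)" for z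
      proof -
        have "poly (P $$ (0,s)) z = eval_mat P z $$ (0,s)" using P p0 b by simp
        also have "\<dots> = circ_int p 1 (\<lambda>w. (1 / w powi (M + int n)) \<cdot>\<^sub>m (eval_mat P w * \<Phi> w * eval_mat2 S z w)) $$ (0,s)"
          using S P Pd by (simp add: is_rep_kernel_def)
        also have "\<dots> = (\<Sum>d<n. \<Sum>u<p. coeff (P $$ (0,u)) d * (\<Sum>a<n. (\<Sum>J<p * n. ?T (p * d + u) J * flat_coeff p n S J (p * a + s)) * z ^ a))"
          by (rule reproducing_integral[OF p n \<Phi> Sd P Pd p0 b(4)])
        also have "\<dots> = (\<Sum>d<n. \<Sum>u<p. if u = t then (if d = c then (\<Sum>a<n. (\<Sum>J<p * n. ?T I J * flat_coeff p n S J (p * a + s)) * z ^ a) else 0) else 0)"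
          using p0 by (intro sum.cong refl) (auto simp: P_def II)
        also have "\<dots> = (\<Sum>a<n. (\<Sum>J<p * n. ?T I J * flat_coeff p n S J (p * a + s)) * z ^ a)"
          using b by simp
        finally have "(\<Sum>a<n. (\<Sum>J<p * n. ?T I J * flat_coeff p n S J (p * a + s)) * z ^ a) = poly (P $$ (0,s)) z" ..
        also have "\<dots> = (if s = t then z ^ c else 0)" using p0 b by (simp add: P_def poly_monom)
        also have "\<dots> = (\<Sum>a<n. if a = c then (if s = t then z ^ c else 0) else 0)" using b by simp
        also have "\<dots> = (\<Sum>a<n. (if a = c \<and> t = s then 1 else 0) * z ^ a)" by (intro sum.cong) auto
        finally show ?thesis .
      qed
      moreover have "{..<n} = {..n - 1}" using n by auto
      \<comment> \<open>Two polynomials in \<open>z\<close> that agree for every \<open>z\<close>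
        have equal coefficients.\<close>
      ultimately have "\<forall>a\<le>n - 1. (\<Sum>J<p * n. ?T I J * flat_coeff p n S J (p * a + s)) = (if a = c \<and> t = s then 1 else 0)"
        by (subst polyfun_eq_coeffs[symmetric]) simp
      then have "(\<Sum>J<p * n. ?T I J * flat_coeff p n S J (p * a0 + s)) = (if a0 = c \<and> t = s then 1 else 0)" using b by simp
      moreover have "a0 = c \<and> t = s \<longleftrightarrow> I = I'" using c by (metis mult_div_mod_eq)
      ultimately show ?thesis unfolding II(2) by simp
    qed
    have "flat_coeff p n S K I' = X K I'" if K: "K < p * n" "I' < p * n" for K I'
    proof -
      have "(\<Sum>I<p * n. X K I * (\<Sum>J<p * n. ?T I J * flat_coeff p n S J I')) = (\<Sum>I<p * n. if I = I' then X K I else 0)"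
        using AS K by (intro sum.cong) auto
      moreover have "(\<Sum>I<p * n. X K I * (\<Sum>J<p * n. ?T I J * flat_coeff p n S J I')) = (\<Sum>J<p * n. (\<Sum>I<p * n. X K I * ?T I J) * flat_coeff p n S J I')"
        unfolding sum_distrib_left sum_distrib_right by (subst sum.swap) (simp add: mult.assoc)
      moreover have "\<dots> = (\<Sum>J<p * n. if K = J then flat_coeff p n S J I' else 0)"
        using XA K by (intro sum.cong) auto
      ultimately show ?thesis using K by simp
    qed
    then show "S = R" using Rflat by (intro flat_coeff_inject[OF Sd Rd n]) auto
  qed
  have "rep_kernel p M \<Phi> n = R" unfolding rep_kernel_def using rep uniq by (rule the_equality)
  then show "poly_degrees p n (rep_kernel p M \<Phi> n)"
    "\<And>J I. J < p * n \<Longrightarrow> I < p * n \<Longrightarrow> flat_coeff p n (rep_kernel p M \<Phi> n) J I = X J I"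
    using Rd Rflat by auto
qed

text \<open>The integrand is a finite sum of products of a function of \<open>w\<close> and a
  function of \<open>z\<close>. Each single integral is a Fourier coefficient of an outer symbol,
  that is, an entry of its Toeplitz matrix.\<close>

lemma finite_kernel_integral:
  assumes p: "1 \<le> p" and n: "1 \<le> n" and F: "circle_symbol p F" and G: "circle_symbol p G"
    and R: "poly_degrees p n R" and ij: "i < p" "j < p"
  shows "circ_int p 1 (\<lambda>w. circ_int p 1 (\<lambda>z. (w powi x' / (z powi (x + 1) * w powi (M + int n))) \<cdot>\<^sub>m
       (F w * eval_mat2 R z w * G z))) $$ (i,j) =
    (\<Sum>J<p * n. \<Sum>I<p * n. toeplitz p F (int p * x' + int i) (int p * M + int J) * flat_coeff p n R J I *
       toeplitz p G (int I) (int p * x + int j))"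
proof -
  have one: "(0::real) < 1" by simp
  have p0: "0 < p" using p by simp
  note carF = circle_symbol_carrier[OF F] and carG = circle_symbol_carrier[OF G]
  define U where "U = (\<lambda>J w. F w $$ (i, J mod p) * w powi (x' - M - int n + int (n - 1 - J div p)))"
  define V where "V = (\<lambda>I z. G z $$ (I mod p, j) * z powi (int (I div p) - x - 1))"
  have cU: "continuous_on (sphere 0 1) (U J)" for J
    unfolding U_def using circle_symbol_continuous[OF F ij(1), of "J mod p"] p0 by (intro continuous_intros) auto
  have cV: "continuous_on (sphere 0 1) (V J)" for J
    unfolding V_def using circle_symbol_continuous[OF G _ ij(2), of "J mod p"] p0 by (intro continuous_intros) auto
  have entry: "((w powi x' / (z powi (x + 1) * w powi (M + int n))) \<cdot>\<^sub>m (F w * eval_mat2 R z w * G z)) $$ (i,j) =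
    (\<Sum>J<p * n. \<Sum>I<p * n. (U J w * flat_coeff p n R J I) * V I z)" if w: "norm w = 1" and z: "norm z = 1" for w z
  proof -
    have nz: "w \<noteq> 0" "z \<noteq> 0" using w z by auto
    let ?k = "w powi x' / (z powi (x + 1) * w powi (M + int n))"
    note cE = eval_mat2_carrier[OF R]
    have c1: "F w * eval_mat2 R z w \<in> carrier_mat p p" using carF[OF w] cE by (rule mult_carrier_mat)
    have "(?k \<cdot>\<^sub>m (F w * eval_mat2 R z w * G z)) $$ (i,j) = ?k * (F w * eval_mat2 R z w * G z) $$ (i,j)"
      using mult_carrier_mat[OF c1 carG[OF z]] ij by (metis index_smult_mat(1) carrier_matD)
    also have "(F w * eval_mat2 R z w * G z) $$ (i,j) = (\<Sum>s<p. (\<Sum>r<p. F w $$ (i,r) * eval_mat2 R z w $$ (r,s)) * G z $$ (s,j))"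
      unfolding mat_mult_entry[OF c1 carG[OF z] ij]
      by (intro sum.cong refl, subst mat_mult_entry[OF carF[OF w] cE ij(1)]) auto
    also have "\<dots> = (\<Sum>s<p. \<Sum>r<p. \<Sum>b<n. \<Sum>a<n. F w $$ (i,r) * w ^ (n - 1 - b) * flat_coeff p n R (p * b + r) (p * a + s) * (z ^ a * G z $$ (s,j)))"
      unfolding sum_distrib_right
      by (intro sum.cong refl) (simp add: eval_mat2_entry[OF R n] sum_distrib_left sum_distrib_right mult_ac)
    also have "\<dots> = (\<Sum>b<n. \<Sum>r<p. \<Sum>a<n. \<Sum>s<p. F w $$ (i,r) * w ^ (n - 1 - b) * flat_coeff p n R (p * b + r) (p * a + s) * (z ^ a * G z $$ (s,j)))"
      (is "?l = ?r")
    proof -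
      have "?l = (\<Sum>r<p. \<Sum>s<p. \<Sum>b<n. \<Sum>a<n. F w $$ (i,r) * w ^ (n - 1 - b) * flat_coeff p n R (p * b + r) (p * a + s) * (z ^ a * G z $$ (s,j)))"
        by (rule sum.swap)
      also have "\<dots> = (\<Sum>r<p. \<Sum>b<n. \<Sum>s<p. \<Sum>a<n. F w $$ (i,r) * w ^ (n - 1 - b) * flat_coeff p n R (p * b + r) (p * a + s) * (z ^ a * G z $$ (s,j)))"
        by (rule sum.cong[OF refl], rule sum.swap)
      also have "\<dots> = (\<Sum>r<p. \<Sum>b<n. \<Sum>a<n. \<Sum>s<p. F w $$ (i,r) * w ^ (n - 1 - b) * flat_coeff p n R (p * b + r) (p * a + s) * (z ^ a * G z $$ (s,j)))"
        by (rule sum.cong[OF refl], rule sum.cong[OF refl], rule sum.swap)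
      also have "\<dots> = ?r" by (rule sum.swap)
      finally show ?thesis .
    qed
    also have "\<dots> = (\<Sum>J<p * n. \<Sum>I<p * n. F w $$ (i,J mod p) * w ^ (n - 1 - J div p) * flat_coeff p n R J I * (z ^ (I div p) * G z $$ (I mod p,j)))"
      unfolding sum_blocks by (intro sum.cong refl) simp
    also have "?k * \<dots> = (\<Sum>J<p * n. \<Sum>I<p * n. (U J w * flat_coeff p n R J I) * V I z)"
      unfolding sum_distrib_left
    proof (intro sum.cong refl)
      fix J I
      have 1: "w powi (x' - M - int n + int (n - 1 - J div p)) = w powi x' / w powi (M + int n) * w ^ (n - 1 - J div p)"
        using nz by (simp add: power_int_add power_int_diff)
      have 2: "z powi (int (I div p) - x - 1) = z ^ (I div p) / z powi (x + 1)"
        using nz by (simp add: power_int_diff power_int_add diff_diff_eq)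
      show "?k * (F w $$ (i,J mod p) * w ^ (n - 1 - J div p) * flat_coeff p n R J I * (z ^ (I div p) * G z $$ (I mod p,j))) =
        (U J w * flat_coeff p n R J I) * V I z"
        unfolding U_def V_def 1 2 by (simp add: mult_ac)
    qed
    finally show ?thesis .
  qed
  have inner: "circ_int p 1 (\<lambda>z. (w powi x' / (z powi (x + 1) * w powi (M + int n))) \<cdot>\<^sub>m (F w * eval_mat2 R z w * G z)) $$ (i,j) =
    (\<Sum>J<p * n. \<Sum>I<p * n. (flat_coeff p n R J I * circle_mean 1 (V I)) * U J w)" if w: "norm w = 1" for w
  proof -
    have "circ_int p 1 (\<lambda>z. (w powi x' / (z powi (x + 1) * w powi (M + int n))) \<cdot>\<^sub>m (F w * eval_mat2 R z w * G z)) $$ (i,j) =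
      circle_mean 1 (\<lambda>z. \<Sum>J<p * n. \<Sum>I<p * n. (U J w * flat_coeff p n R J I) * V I z)"
      by (rule circ_int_entry[OF one ij]) (rule entry[OF w])
    also have "\<dots> = (\<Sum>J<p * n. \<Sum>I<p * n. circle_mean 1 (\<lambda>z. (U J w * flat_coeff p n R J I) * V I z))"
      using cV by (intro circle_mean_double_sum[OF one] continuous_intros) auto
    also have "\<dots> = (\<Sum>J<p * n. \<Sum>I<p * n. (flat_coeff p n R J I * circle_mean 1 (V I)) * U J w)"
      by (intro sum.cong refl, subst circle_mean_cmult[OF one cV]) simp
    finally show ?thesis .
  qed
  have "circ_int p 1 (\<lambda>w. circ_int p 1 (\<lambda>z. (w powi x' / (z powi (x + 1) * w powi (M + int n))) \<cdot>\<^sub>m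
       (F w * eval_mat2 R z w * G z))) $$ (i,j) =
     circle_mean 1 (\<lambda>w. \<Sum>J<p * n. \<Sum>I<p * n. (flat_coeff p n R J I * circle_mean 1 (V I)) * U J w)"
    by (rule circ_int_entry[OF one ij]) (rule inner)
  also have "\<dots> = (\<Sum>J<p * n. \<Sum>I<p * n. circle_mean 1 (\<lambda>w. (flat_coeff p n R J I * circle_mean 1 (V I)) * U J w))"
    using cU by (intro circle_mean_double_sum[OF one] continuous_intros) auto
  also have "\<dots> = (\<Sum>J<p * n. \<Sum>I<p * n. circle_mean 1 (U J) * flat_coeff p n R J I * circle_mean 1 (V I))"
    by (intro sum.cong refl, subst circle_mean_cmult[OF one cU]) simp
  also have "\<dots> = (\<Sum>J<p * n. \<Sum>I<p * n. toeplitz p F (int p * x' + int i) (int p * M + int J) * flat_coeff p n R J I *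
       toeplitz p G (int I) (int p * x + int j))"
  proof (intro sum.cong refl arg_cong2[of _ _ _ _ "(*)"])
    fix J assume "J \<in> {..<p * n}"
    then have J: "J div p < n" using p0 by (simp add: less_mult_imp_div_less mult.commute)
    have d: "(int p * x' + int i) div int p = x'" "(int p * x' + int i) mod int p = int i"
      "(int p * M + int J) div int p = M + int (J div p)" "(int p * M + int J) mod int p = int (J mod p)"
      using ij p0 by (auto simp: zdiv_int zmod_int)
    have "circle_mean 1 (U J) = fcoef (\<lambda>z. F z $$ (i, J mod p)) (- (x' - M - int n + int (n - 1 - J div p)) - 1)"
      by (rule fcoef_shift_power) (simp add: U_def)
    also have "- (x' - M - int n + int (n - 1 - J div p)) - 1 = M + int (J div p) - x'" using J by (simp add: of_nat_diff)
    finally show "circle_mean 1 (U J) = toeplitz p F (int p * x' + int i) (int p * M + int J)"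
      by (simp only: toeplitz_entry[OF p carF] d nat_int)
  next
    fix I
    have d: "(int p * x + int j) div int p = x" "(int p * x + int j) mod int p = int j"
      "int I div int p = int (I div p)" "int I mod int p = int (I mod p)"
      using ij p0 by (auto simp: zdiv_int zmod_int)
    have "circle_mean 1 (V I) = fcoef (\<lambda>z. G z $$ (I mod p, j)) (- (int (I div p) - x - 1) - 1)"
      by (rule fcoef_shift_power) (simp add: V_def)
    also have "- (int (I div p) - x - 1) - 1 = x - int (I div p)" by simp
    finally show "circle_mean 1 (V I) = toeplitz p G (int I) (int p * x + int j)"
      by (simp only: toeplitz_entry[OF p carG] d nat_int)
  qed
  finally show ?thesis .
qed

section \<open>The double contour integrals\<close>

text \<open>Termwise integration is justified on the inner circle with \<open>w\<close> fixed and
  then on the outer circle, with the product bound \<open>H k * E k\<close> behind both.\<close>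

lemma circle_mean_double_has_sum:
  fixes h e :: "nat \<Rightarrow> complex \<Rightarrow> complex" and H E :: "nat \<Rightarrow> real"
  assumes r: "0 < r1" "0 < r2"
    and h: "\<And>k. continuous_on (sphere 0 r1) (h k)" "\<And>k w. norm w = r1 \<Longrightarrow> norm (h k w) \<le> H k"
    and e: "\<And>k. continuous_on (sphere 0 r2) (e k)" "\<And>k z. norm z = r2 \<Longrightarrow> norm (e k z) \<le> E k"
    and HE: "(\<lambda>k. H k * E k) summable_on UNIV" and E0: "\<And>k. 0 \<le> E k" and H0: "\<And>k. 0 \<le> H k"
  shows "((\<lambda>k. circle_mean r1 (h k) * circle_mean r2 (e k)) has_sum
     circle_mean r1 (\<lambda>w. circle_mean r2 (\<lambda>z. \<Sum>\<^sub>\<infinity>k. h k w * e k z))) UNIV"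
proof -
  have "((\<lambda>k. circle_mean r1 (\<lambda>w. circle_mean r2 (e k) * h k w)) has_sum
     circle_mean r1 (\<lambda>w. \<Sum>\<^sub>\<infinity>k. circle_mean r2 (e k) * h k w)) UNIV"
  proof (rule circle_mean_has_sum[OF r(1)])
    show "(\<lambda>k. H k * E k * r2) summable_on UNIV" by (rule summable_on_cmult_left[OF HE])
    show "continuous_on (sphere 0 r1) (\<lambda>w. circle_mean r2 (e k) * h k w)" for k
      by (intro continuous_intros h)
    fix k w assume w: "norm (w::complex) = r1"
    have "norm (circle_mean r2 (e k)) \<le> E k * r2" by (rule circle_mean_bound[OF r(2) e])
    then have "norm (circle_mean r2 (e k)) * norm (h k w) \<le> (E k * r2) * H k"
      using h(2)[OF w] r E0 by (intro mult_mono) auto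
    then show "norm (circle_mean r2 (e k) * h k w) \<le> H k * E k * r2" by (simp add: norm_mult mult_ac)
  qed
  moreover have "circle_mean r1 (\<lambda>w. circle_mean r2 (e k) * h k w) = circle_mean r1 (h k) * circle_mean r2 (e k)" for k
    by (subst circle_mean_cmult[OF r(1) h(1)]) simp
  moreover have "circle_mean r1 (\<lambda>w. \<Sum>\<^sub>\<infinity>k. circle_mean r2 (e k) * h k w) =
    circle_mean r1 (\<lambda>w. circle_mean r2 (\<lambda>z. \<Sum>\<^sub>\<infinity>k. h k w * e k z))"
  proof (rule circle_mean_cong[OF r(1)])
    fix w :: complex assume w: "norm w = r1"
    have "((\<lambda>k. circle_mean r2 (\<lambda>z. h k w * e k z)) has_sum circle_mean r2 (\<lambda>z. \<Sum>\<^sub>\<infinity>k. h k w * e k z)) UNIV"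
    proof (rule circle_mean_has_sum[OF r(2) _ _ HE])
      show "continuous_on (sphere 0 r2) (\<lambda>z. h k w * e k z)" for k by (intro continuous_intros e)
      show "norm (h k w * e k z) \<le> H k * E k" if "norm z = r2" for k z
        unfolding norm_mult using h(2)[OF w] e(2)[OF that] H0 by (intro mult_mono) auto
    qed
    moreover have "circle_mean r2 (\<lambda>z. h k w * e k z) = circle_mean r2 (e k) * h k w" for k
      by (subst circle_mean_cmult[OF r(2) e(1)]) simp
    ultimately show "(\<Sum>\<^sub>\<infinity>k. circle_mean r2 (e k) * h k w) = circle_mean r2 (\<lambda>z. \<Sum>\<^sub>\<infinity>k. h k w * e k z)"
      by (simp add: infsumI)
  qed
  ultimately show ?thesis by simp
qed

lemma geometric_kernel:
  fixes w z :: complex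
  assumes "norm z < norm w"
  shows "(\<Sum>\<^sub>\<infinity>k. w powi (- int k - 1) * z ^ k) = 1 / (w - z)"
proof -
  have w: "w \<noteq> 0" using assms by auto
  have n: "norm (z / w) < 1" using assms w by (simp add: norm_divide)
  have s: "(\<lambda>k. (z / w) ^ k) sums (1 / (1 - z / w))" by (rule geometric_sums[OF n])
  have "summable (\<lambda>k. norm ((z / w) ^ k))" unfolding norm_power by (rule summable_geometric) (use n in simp)
  from norm_summable_imp_has_sum[OF this s]
  have "((\<lambda>k. (1 / w) * (z / w) ^ k) has_sum (1 / w) * (1 / (1 - z / w))) UNIV" by (rule has_sum_cmult_right)
  moreover have "(1 / w) * (z / w) ^ k = w powi (- int k - 1) * z ^ k" for k
    using w by (simp add: power_int_diff power_int_minus power_divide field_simps)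
  moreover have "(1 / w) * (1 / (1 - z / w)) = 1 / (w - z)" using w by (simp add: field_simps)
  ultimately show ?thesis by (simp add: infsumI)
qed

lemma bounded_on_sphere:
  fixes f :: "complex \<Rightarrow> complex"
  assumes "continuous_on (sphere 0 r) f"
  obtains B where "0 \<le> B" "\<And>z. norm z = r \<Longrightarrow> norm (f z) \<le> (B::real)"
proof -
  have "bounded (f ` sphere 0 r)" by (intro compact_imp_bounded compact_continuous_image assms compact_sphere)
  then obtain B where "\<And>z. z \<in> sphere 0 r \<Longrightarrow> norm (f z) \<le> B" unfolding bounded_iff by blast
  then have "\<And>z. norm z = r \<Longrightarrow> norm (f z) \<le> max B 0" by (auto simp: le_max_iff_disj)
  then show thesis by (intro that[of "max B 0"]) auto
qed

text \<open>Geometric expansion of \<open>1 / (w - z)\<close> with ratio \<open>a / b\<close>. The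
  two versions differ in the order of integration: the outer integral of the bottom kernel runs over
  the larger circle, that of the top kernel over the smaller one.\<close>

lemma double_circle_has_sum:
  assumes ab: "0 < a" "a < b" and f: "continuous_on (sphere 0 b) f" and g: "continuous_on (sphere 0 a) g"
  shows "((\<lambda>k. circle_mean b (\<lambda>w. f w * w powi (- int k - 1)) * circle_mean a (\<lambda>z. g z * z ^ k)) has_sum
     circle_mean b (\<lambda>w. circle_mean a (\<lambda>z. f w * g z / (w - z)))) UNIV"
    and "((\<lambda>k. circle_mean a (\<lambda>z. g z * z ^ k) * circle_mean b (\<lambda>w. f w * w powi (- int k - 1))) has_sum
     circle_mean a (\<lambda>z. circle_mean b (\<lambda>w. g z * f w / (w - z)))) UNIV"
proof -
  have b: "0 < b" using ab by simp
  obtain Bf where Bf: "0 \<le> Bf" "\<And>w. norm w = b \<Longrightarrow> norm (f w) \<le> Bf" by (rule bounded_on_sphere[OF f]) blast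
  obtain Bg where Bg: "0 \<le> Bg" "\<And>w. norm w = a \<Longrightarrow> norm (g w) \<le> Bg" by (rule bounded_on_sphere[OF g]) blast
  let ?h = "\<lambda>k w. f w * w powi (- int k - 1)" and ?e = "\<lambda>k z. g z * z ^ k"
  let ?H = "\<lambda>k. Bf * b powi (- int k - 1)" and ?E = "\<lambda>k. Bg * a ^ k"
  have ch: "continuous_on (sphere 0 b) (?h k)" for k using f b by (intro continuous_intros) auto
  have ce: "continuous_on (sphere 0 a) (?e k)" for k using g by (intro continuous_intros)
  have bh: "norm (?h k w) \<le> ?H k" if "norm w = b" for k w
    unfolding norm_mult norm_power_int that using Bf(2)[OF that] b by (intro mult_right_mono) auto
  have be: "norm (?e k z) \<le> ?E k" if "norm z = a" for k z
    unfolding norm_mult norm_power that using Bg(2)[OF that] ab by (intro mult_right_mono) auto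
  have H0: "0 \<le> ?H k" and E0: "0 \<le> ?E k" for k using Bf Bg ab b by auto
  have HE: "(\<lambda>k. ?H k * ?E k) summable_on UNIV"
  proof -
    have "summable (\<lambda>k. (a / b) ^ k)" by (rule summable_geometric) (use ab in auto)
    then have "(\<lambda>k. (a / b) ^ k) summable_on UNIV" using ab by (intro summable_nonneg_imp_summable_on) auto
    then have "(\<lambda>k. Bf * Bg / b * (a / b) ^ k) summable_on UNIV" by (rule summable_on_cmult_right)
    moreover have "Bf * Bg / b * (a / b) ^ k = ?H k * ?E k" for k
      using b by (simp add: power_int_diff power_int_minus power_divide field_simps)
    ultimately show ?thesis by simp
  qed
  have EH: "(\<lambda>k. ?E k * ?H k) summable_on UNIV" using HE by (simp add: mult.commute)
  have ker: "(\<Sum>\<^sub>\<infinity>k. ?h k w * ?e k z) = f w * g z / (w - z)" if "norm w = b" "norm z = a" for w z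
  proof -
    have "(\<Sum>\<^sub>\<infinity>k. ?h k w * ?e k z) = (\<Sum>\<^sub>\<infinity>k. f w * g z * (w powi (- int k - 1) * z ^ k))"
      by (rule infsum_cong) (simp only: mult_ac)
    also have "\<dots> = f w * g z * (1 / (w - z))" unfolding infsum_cmult_right' using that ab by (subst geometric_kernel) auto
    finally show ?thesis by simp
  qed
  have e1: "circle_mean b (\<lambda>w. circle_mean a (\<lambda>z. \<Sum>\<^sub>\<infinity>k. ?h k w * ?e k z)) = circle_mean b (\<lambda>w. circle_mean a (\<lambda>z. f w * g z / (w - z)))"
    by (intro circle_mean_cong ab(1) b ker)
  show "((\<lambda>k. circle_mean b (?h k) * circle_mean a (?e k)) has_sum circle_mean b (\<lambda>w. circle_mean a (\<lambda>z. f w * g z / (w - z)))) UNIV"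
    unfolding e1[symmetric] by (rule circle_mean_double_has_sum[OF b ab(1) ch bh ce be HE E0 H0])
  have e2: "circle_mean a (\<lambda>z. circle_mean b (\<lambda>w. \<Sum>\<^sub>\<infinity>k. ?e k z * ?h k w)) = circle_mean a (\<lambda>z. circle_mean b (\<lambda>w. g z * f w / (w - z)))"
    using ker by (intro circle_mean_cong ab(1) b) (simp only: mult.commute)
  show "((\<lambda>k. circle_mean a (?e k) * circle_mean b (?h k)) has_sum circle_mean a (\<lambda>z. circle_mean b (\<lambda>w. g z * f w / (w - z)))) UNIV"
    unfolding e2[symmetric] by (rule circle_mean_double_has_sum[OF ab(1) b ce be ch bh EH H0 E0])
qed

text \<open>\<open>\<sigma>\<close> enumerates block indices: all non-negative ones for the bottom
  kernel, all negative ones for the top kernel. A sum over scalar indices thus becomes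
  \<open>p\<close> sums over blocks.\<close>

lemma residue_class_has_sum:
  fixes f :: "int \<Rightarrow> complex"
  assumes p: "1 \<le> p" and s: "\<And>r. r < p \<Longrightarrow> ((\<lambda>k::nat. f (int p * \<sigma> k + int r)) has_sum s r) UNIV"
    and inj: "inj \<sigma>" and B: "\<And>w. w \<in> B \<longleftrightarrow> w div int p \<in> range \<sigma>"
  shows "(f has_sum (\<Sum>r<p. s r)) B"
proof -
  have "(f has_sum (\<Sum>r<p. s r)) (\<Union>r\<in>{..<p}. {w \<in> B. w mod int p = int r})"
  proof (rule sum_has_sum)
    fix r assume r: "r \<in> {..<p}"
    have "bij_betw (\<lambda>k. int p * \<sigma> k + int r) UNIV {w \<in> B. w mod int p = int r}"
      unfolding bij_betw_def
    proof (intro conjI equalityI subsetI)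
      show "inj (\<lambda>k. int p * \<sigma> k + int r)" using inj p by (auto simp: inj_def)
      fix w assume "w \<in> range (\<lambda>k. int p * \<sigma> k + int r)"
      then show "w \<in> {w \<in> B. w mod int p = int r}" using r p by (auto simp: B)
    next
      fix w assume w: "w \<in> {w \<in> B. w mod int p = int r}"
      then obtain k where k: "w div int p = \<sigma> k" by (auto simp: B)
      have "w = int p * (w div int p) + w mod int p" by simp
      then have "w = int p * \<sigma> k + int r" using k w by simp
      then show "w \<in> range (\<lambda>k. int p * \<sigma> k + int r)" by blast
    qed
    from has_sum_reindex_bij_betw[OF this, of f] s[of r] r
    show "(f has_sum s r) {w \<in> B. w mod int p = int r}" by simp
  qed auto
  moreover have "(\<Union>r\<in>{..<p}. {w \<in> B. w mod int p = int r}) = B"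
  proof (intro equalityI subsetI)
    fix w assume w: "w \<in> B"
    have "nat (w mod int p) < p" "w mod int p = int (nat (w mod int p))" using p mod_index_less[OF p] by auto
    then show "w \<in> (\<Union>r\<in>{..<p}. {w \<in> B. w mod int p = int r})" using w by blast
  qed auto
  ultimately show ?thesis by simp
qed

section \<open>Entries of the iterated integrals\<close>

lemma regular_continuous_sphere:
  assumes "regular_between p r1 r2 F" "r1 \<le> r" "r \<le> r2" "i < p" "j < p"
  shows "continuous_on (sphere 0 r) (\<lambda>z. F z $$ (i,j))" "\<And>z. norm z = r \<Longrightarrow> F z \<in> carrier_mat p p"
proof -
  have "continuous_on {z. r1 \<le> norm z \<and> norm z \<le> r2} (\<lambda>z. F z $$ (i,j))"
    using assms by (auto simp: regular_between_def mat_continuous_on_def)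
  then show "continuous_on (sphere 0 r) (\<lambda>z. F z $$ (i,j))"
    by (rule continuous_on_subset) (use assms in auto)
  show "\<And>z. norm z = r \<Longrightarrow> F z \<in> carrier_mat p p" using assms by (auto simp: regular_between_def mat_continuous_on_def)
qed

lemma fcoef_regular:
  assumes F: "regular_between p r1 r2 F" and r: "0 < r1" "r1 \<le> r2" and 1: "r1 = 1 \<or> r2 = 1" and R: "R = r1 \<or> R = r2"
    and ij: "i < p" "j < p"
  shows "circle_mean R (\<lambda>z. F z $$ (i,j) * z powi k) = fcoef (\<lambda>z. F z $$ (i,j)) (- k - 1)"
proof -
  have "circle_mean r1 (\<lambda>z. F z $$ (i,j) * z powi k) = circle_mean r2 (\<lambda>z. F z $$ (i,j) * z powi k)"
    using F ij by (intro fcoef_annulus r) (auto simp: regular_between_def mat_continuous_on_def mat_holomorphic_on_def)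
  then show ?thesis using 1 R by (auto simp: fcoef_def)
qed

lemma kernel_continuous:
  assumes "0 < r1" "0 < r2" "r1 \<noteq> r2"
  shows "continuous_on (sphere 0 r1 \<times> sphere 0 r2) (\<lambda>(w,z). w powi k / (z powi l * (z - w)) :: complex)"
proof -
  have nz: "fst t \<noteq> 0" "snd t \<noteq> 0" "snd t - fst t \<noteq> 0" if "t \<in> sphere 0 r1 \<times> sphere 0 r2" for t :: "complex \<times> complex"
    using that assms by auto
  have "continuous_on (sphere 0 r1 \<times> sphere 0 r2) (\<lambda>t::complex \<times> complex. fst t powi k)"
    by (intro continuous_on_powi continuous_on_fst[OF continuous_on_id] nz)
  moreover have "continuous_on (sphere 0 r1 \<times> sphere 0 r2) (\<lambda>t::complex \<times> complex. snd t powi l)"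
    by (intro continuous_on_powi continuous_on_snd[OF continuous_on_id] nz)
  ultimately have "continuous_on (sphere 0 r1 \<times> sphere 0 r2) (\<lambda>t::complex \<times> complex. fst t powi k / (snd t powi l * (snd t - fst t)))"
    by (intro continuous_on_divide continuous_on_mult continuous_on_diff continuous_on_fst[OF continuous_on_id]
        continuous_on_snd[OF continuous_on_id]) (use nz in \<open>simp_all only: mult_eq_0_iff power_int_eq_0_iff, blast+\<close>)
  then show ?thesis by (simp add: case_prod_unfold)
qed

text \<open>Linearity of the outer integral is available for continuous integrands, so each inner
  integral must depend continuously on the outer variable.\<close>

lemma circle_mean_param_continuous:
  assumes r: "0 < r" and h: "continuous_on (S \<times> sphere 0 r) (\<lambda>(w,z). h w z)"
  shows "continuous_on S (\<lambda>w::complex. circle_mean r (h w))"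
proof -
  let ?e = "\<lambda>t. of_real r * exp (2 * of_real pi * \<i> * of_real t) :: complex"
  have "continuous_on (S \<times> cbox (0::real) 1) (\<lambda>wt. (\<lambda>(w,z). h w z) (fst wt, ?e (snd wt)))"
    by (rule continuous_on_compose2[OF h]) (use r in \<open>auto intro!: continuous_intros simp: norm_mult\<close>)
  then have "continuous_on (S \<times> cbox (0::real) 1) (\<lambda>(w,t). h w (?e t) * ?e t)"
    unfolding case_prod_unfold by (auto intro!: continuous_intros)
  from integral_continuous_on_param[OF this] show ?thesis
    unfolding circle_mean_integral[OF r] by simp
qed

lemma iterated_integral_entry:
  assumes r: "0 < r1" "0 < r2" and ij: "i < p" "j < p"
    and c: "continuous_on (sphere 0 r1 \<times> sphere 0 r2) (\<lambda>(w,z). c w z)"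
    and L: "\<And>i j. i < p \<Longrightarrow> j < p \<Longrightarrow> continuous_on (sphere 0 r1) (\<lambda>w. L w $$ (i,j))" "\<And>w. norm w = r1 \<Longrightarrow> L w \<in> carrier_mat p p"
    and R: "\<And>i j. i < p \<Longrightarrow> j < p \<Longrightarrow> continuous_on (sphere 0 r2) (\<lambda>z. R z $$ (i,j))" "\<And>z. norm z = r2 \<Longrightarrow> R z \<in> carrier_mat p p"
    and fac: "\<And>w z. norm w = r1 \<Longrightarrow> norm z = r2 \<Longrightarrow> H w z = L w * R z"
  shows "circ_int p r1 (\<lambda>w. circ_int p r2 (\<lambda>z. c w z \<cdot>\<^sub>m H w z)) $$ (i,j) =
    (\<Sum>r<p. circle_mean r1 (\<lambda>w. circle_mean r2 (\<lambda>z. c w z * (L w $$ (i,r) * R z $$ (r,j)))))"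
proof -
  have jc: "continuous_on (sphere 0 r1 \<times> sphere 0 r2) (\<lambda>(w,z). c w z * (L w $$ (i,r) * R z $$ (r,j)))" if "r < p" for r
    using c unfolding case_prod_unfold
    by (intro continuous_intros continuous_on_compose2[OF L(1)[OF ij(1) that]] continuous_on_compose2[OF R(1)[OF that ij(2)]]) auto
  have zc: "continuous_on (sphere 0 r2) (\<lambda>z. c w z * (L w $$ (i,r) * R z $$ (r,j)))" if "r < p" "norm w = r1" for r w
  proof -
    have "continuous_on (sphere 0 r2) (\<lambda>z. (\<lambda>(w,z). c w z * (L w $$ (i,r) * R z $$ (r,j))) (w, z))"
      by (rule continuous_on_compose2[OF jc[OF that(1)]]) (use that in \<open>auto intro!: continuous_intros\<close>)
    then show ?thesis by simp
  qed
  have "circ_int p r1 (\<lambda>w. circ_int p r2 (\<lambda>z. c w z \<cdot>\<^sub>m H w z)) $$ (i,j) =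
    circle_mean r1 (\<lambda>w. \<Sum>r<p. circle_mean r2 (\<lambda>z. c w z * (L w $$ (i,r) * R z $$ (r,j))))"
  proof (rule circ_int_entry[OF r(1) ij])
    fix w :: complex assume w: "norm w = r1"
    have "circ_int p r2 (\<lambda>z. c w z \<cdot>\<^sub>m H w z) $$ (i,j) = circle_mean r2 (\<lambda>z. \<Sum>r<p. c w z * (L w $$ (i,r) * R z $$ (r,j)))"
    proof (rule circ_int_entry[OF r(2) ij])
      fix z :: complex assume z: "norm z = r2"
      have "L w * R z \<in> carrier_mat p p" using L(2)[OF w] R(2)[OF z] by (rule mult_carrier_mat)
      then show "(c w z \<cdot>\<^sub>m H w z) $$ (i,j) = (\<Sum>r<p. c w z * (L w $$ (i,r) * R z $$ (r,j)))"
        using ij mat_mult_entry[OF L(2)[OF w] R(2)[OF z] ij] carrier_matD[OF L(2)[OF w]] carrier_matD[OF R(2)[OF z]]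
        by (simp add: fac[OF w z] sum_distrib_left)
    qed
    also have "\<dots> = (\<Sum>r<p. circle_mean r2 (\<lambda>z. c w z * (L w $$ (i,r) * R z $$ (r,j))))"
      using zc[OF _ w] by (intro circle_mean_sum r(2)) auto
    finally show "circ_int p r2 (\<lambda>z. c w z \<cdot>\<^sub>m H w z) $$ (i,j) = (\<Sum>r<p. circle_mean r2 (\<lambda>z. c w z * (L w $$ (i,r) * R z $$ (r,j))))" .
  qed
  also have "\<dots> = (\<Sum>r<p. circle_mean r1 (\<lambda>w. circle_mean r2 (\<lambda>z. c w z * (L w $$ (i,r) * R z $$ (r,j)))))"
    by (intro circle_mean_sum r(1) circle_mean_param_continuous[OF r(2)] jc) auto
  finally show ?thesis .
qed

text \<open>The double integrals of the limiting kernels as half-line sums; \<open>L\<close> and \<open>R\<close> are the factors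
  depending on \<open>w\<close> and on \<open>z\<close>.\<close>

lemma bottom_integral:
  assumes p: "1 \<le> p" and ab: "0 < a" "a < 1" "1 < b"
    and L: "regular_between p 1 b L" and R: "regular_between p a 1 R" and ij: "i < p" "j < p"
    and fac: "\<And>w z. norm w = b \<Longrightarrow> norm z = a \<Longrightarrow> H w z = L w * R z"
  shows "((\<lambda>l. toeplitz p L (int p * x' + int i) l * toeplitz p R l (int p * x + int j)) has_sum
    - circ_int p b (\<lambda>w. circ_int p a (\<lambda>z. (w powi x' / (z powi (x + 1) * (z - w))) \<cdot>\<^sub>m H w z)) $$ (i,j)) {0..}"
proof -
  \<comment> \<open>The factor \<open>- 1\<close> turns \<open>1 / (w - z)\<close>, which has the
    convergent expansion, into the \<open>1 / (z - w)\<close> of the kernel.\<close>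
  let ?f = "\<lambda>r w. (- 1) * w powi x' * L w $$ (i,r)" and ?g = "\<lambda>r z. z powi (- x - 1) * R z $$ (r,j)"
  have b: "0 < b" "a < b" using ab by auto
  have ca: "1 \<le> b" "b \<le> b" "a \<le> a" "a \<le> 1" "(1::real) \<le> 1" using ab by auto
  have cL: "continuous_on (sphere 0 b) (\<lambda>w. L w $$ (i,j))" if "i < p" "j < p" for i j
    by (rule regular_continuous_sphere(1)[OF L ca(1,2) that])
  have cR: "continuous_on (sphere 0 a) (\<lambda>w. R w $$ (i,j))" if "i < p" "j < p" for i j
    by (rule regular_continuous_sphere(1)[OF R ca(3,4) that])
  note carL = regular_continuous_sphere(2)[OF L ca(1,2) ij] regular_continuous_sphere(2)[OF L ca(5,1) ij]
  note carR = regular_continuous_sphere(2)[OF R ca(3,4) ij] regular_continuous_sphere(2)[OF R ca(4,5) ij]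
  have cf: "continuous_on (sphere 0 b) (?f r)" if "r < p" for r
    using cL[OF ij(1) that] b by (intro continuous_intros) auto
  have cg: "continuous_on (sphere 0 a) (?g r)" if "r < p" for r
    using cR[OF that ij(2)] ab by (intro continuous_intros) auto
  define s where "s = (\<lambda>r. circle_mean b (\<lambda>w. circle_mean a (\<lambda>z. ?f r w * ?g r z / (w - z))))"
  have "((\<lambda>l. toeplitz p L (int p * x' + int i) l * toeplitz p R l (int p * x + int j)) has_sum (\<Sum>r<p. - s r)) {0..}"
  proof (rule residue_class_has_sum[OF p, where \<sigma>=int])
    fix r assume r: "r < p"
    have "((\<lambda>k. circle_mean b (\<lambda>w. ?f r w * w powi (- int k - 1)) * circle_mean a (\<lambda>z. ?g r z * z ^ k)) has_sum s r) UNIV"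
      unfolding s_def by (rule double_circle_has_sum(1)[OF ab(1) b(2) cf[OF r] cg[OF r]])
    moreover have "circle_mean b (\<lambda>w. ?f r w * w powi (- int k - 1)) * circle_mean a (\<lambda>z. ?g r z * z ^ k) =
      - (toeplitz p L (int p * x' + int i) (int p * int k + int r) * toeplitz p R (int p * int k + int r) (int p * x + int j))" for k
    proof -
      have "circle_mean b (\<lambda>w. ?f r w * w powi (- int k - 1)) = circle_mean b (\<lambda>w. (- 1) * (L w $$ (i,r) * w powi (x' - int k - 1)))"
      proof (rule circle_mean_cong[OF b(1)])
        fix w :: complex assume "norm w = b"
        then have "w \<noteq> 0" using b by auto
        then have "w powi x' * w powi (- int k - 1) = w powi (x' - int k - 1)"
          by (simp add: power_int_add[symmetric] algebra_simps)
        then show "?f r w * w powi (- int k - 1) = (- 1) * (L w $$ (i,r) * w powi (x' - int k - 1))" by (metis mult.assoc mult.commute)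
      qed
      also have "\<dots> = (- 1) * circle_mean b (\<lambda>w. L w $$ (i,r) * w powi (x' - int k - 1))"
        using cL[OF ij(1) r] b by (intro circle_mean_cmult continuous_intros) auto
      also have "circle_mean b (\<lambda>w. L w $$ (i,r) * w powi (x' - int k - 1)) = fcoef (\<lambda>z. L z $$ (i,r)) (- (x' - int k - 1) - 1)"
        by (rule fcoef_regular[OF L]) (use ab ij r in auto)
      also have "\<dots> = toeplitz p L (int p * x' + int i) (int p * int k + int r)"
        using ij r p carL(2) by (subst toeplitz_entry[OF p]) (auto simp: algebra_simps)
      finally have 1: "circle_mean b (\<lambda>w. ?f r w * w powi (- int k - 1)) = (- 1) * toeplitz p L (int p * x' + int i) (int p * int k + int r)" .
      have "circle_mean a (\<lambda>z. ?g r z * z ^ k) = circle_mean a (\<lambda>z. R z $$ (r,j) * z powi (int k - x - 1))"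
      proof (rule circle_mean_cong[OF ab(1)])
        fix w :: complex assume "norm w = a"
        then have "w \<noteq> 0" using ab by auto
        then have "w powi (- x - 1) * w ^ k = w powi (int k - x - 1)"
          using power_int_add[of w "- x - 1" "int k"] by (simp add: algebra_simps)
        then show "?g r w * w ^ k = R w $$ (r,j) * w powi (int k - x - 1)" by (metis mult.assoc mult.commute)
      qed
      also have "\<dots> = fcoef (\<lambda>z. R z $$ (r,j)) (- (int k - x - 1) - 1)"
        by (rule fcoef_regular[OF R]) (use ab ij r in auto)
      also have "\<dots> = toeplitz p R (int p * int k + int r) (int p * x + int j)"
        using ij r p carR(2) by (subst toeplitz_entry[OF p]) (auto simp: algebra_simps)
      finally show ?thesis using 1 by simp
    qed
    ultimately have "((\<lambda>k. - (toeplitz p L (int p * x' + int i) (int p * int k + int r) *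
       toeplitz p R (int p * int k + int r) (int p * x + int j))) has_sum s r) UNIV" by simp
    then show "((\<lambda>k. toeplitz p L (int p * x' + int i) (int p * int k + int r) *
       toeplitz p R (int p * int k + int r) (int p * x + int j)) has_sum - s r) UNIV"
      by (subst has_sum_uminus[symmetric]) simp
  next
    fix w :: int
    have "w div int p \<in> range int \<longleftrightarrow> 0 \<le> w div int p" by (metis rangeE rangeI of_nat_0_le_iff zero_le_imp_eq_int)
    then show "w \<in> {0..} \<longleftrightarrow> w div int p \<in> range int" using p by (simp add: pos_imp_zdiv_nonneg_iff)
  qed (auto intro: inj_of_nat)
  moreover have "circ_int p b (\<lambda>w. circ_int p a (\<lambda>z. (w powi x' / (z powi (x + 1) * (z - w))) \<cdot>\<^sub>m H w z)) $$ (i,j) =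
    (\<Sum>r<p. circle_mean b (\<lambda>w. circle_mean a (\<lambda>z. (w powi x' / (z powi (x + 1) * (z - w))) * (L w $$ (i,r) * R z $$ (r,j)))))"
  proof (rule iterated_integral_entry[OF b(1) ab(1) ij _ cL carL(1) cR carR(1) fac])
    show "continuous_on (sphere 0 b \<times> sphere 0 a) (\<lambda>(w,z). w powi x' / (z powi (x + 1) * (z - w)) :: complex)"
      by (rule kernel_continuous) (use ab in auto)
  qed
  moreover have "(\<Sum>r<p. circle_mean b (\<lambda>w. circle_mean a (\<lambda>z. (w powi x' / (z powi (x + 1) * (z - w))) * (L w $$ (i,r) * R z $$ (r,j))))) = (\<Sum>r<p. s r)"
    unfolding s_def
  proof (intro sum.cong refl circle_mean_cong b(1) ab(1))
    fix r and w z :: complex assume wz: "norm w = b" "norm z = a"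
    then have nz: "z \<noteq> 0" "w - z \<noteq> 0" using ab by auto
    have zp: "z powi (x + 1) \<noteq> 0" "z - w \<noteq> 0" using nz by auto
    have e: "z powi (- x - 1) = 1 / z powi (x + 1)" using power_int_minus[of z "x + 1"] by (simp add: inverse_eq_divide)
    have "1 / (Z * (z - w)) = (- 1) * (1 / Z) / (w - z)" if "Z \<noteq> 0" for Z using that nz zp by (simp add: field_simps)
    from this[OF zp(1)] have "1 / (z powi (x + 1) * (z - w)) = (- 1) * z powi (- x - 1) / (w - z)" unfolding e .
    then have "w powi x' / (z powi (x + 1) * (z - w)) = w powi x' * ((- 1) * z powi (- x - 1) / (w - z))"
      by (metis times_divide_eq_right mult.right_neutral)
    then show "w powi x' / (z powi (x + 1) * (z - w)) * (L w $$ (i,r) * R z $$ (r,j)) = ?f r w * ?g r z / (w - z)"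
      by (simp add: mult_ac)
  qed
  ultimately show ?thesis by (simp add: sum_negf)
qed

lemma top_integral:
  assumes p: "1 \<le> p" and ab: "0 < a" "a < 1" "1 < b"
    and L: "regular_between p a 1 L" and R: "regular_between p 1 b R" and ij: "i < p" "j < p"
    and fac: "\<And>w z. norm w = a \<Longrightarrow> norm z = b \<Longrightarrow> H w z = L w * R z"
  shows "((\<lambda>l. toeplitz p L (int p * x' + int i) (int p * M + l) * toeplitz p R (int p * M + l) (int p * x + int j)) has_sum
    circ_int p a (\<lambda>w. circ_int p b (\<lambda>z. (w powi (x' - M) / (z powi (x - M + 1) * (z - w))) \<cdot>\<^sub>m H w z)) $$ (i,j)) {..<0}"
proof -
  let ?g = "\<lambda>r w. w powi (x' - M) * L w $$ (i,r)" and ?f = "\<lambda>r z. z powi (M - x - 1) * R z $$ (r,j)"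
  have b: "0 < b" "a < b" using ab by auto
  have ca: "1 \<le> b" "b \<le> b" "a \<le> a" "a \<le> 1" "(1::real) \<le> 1" using ab by auto
  have cL: "continuous_on (sphere 0 a) (\<lambda>w. L w $$ (i,j))" if "i < p" "j < p" for i j
    by (rule regular_continuous_sphere(1)[OF L ca(3,4) that])
  have cR: "continuous_on (sphere 0 b) (\<lambda>w. R w $$ (i,j))" if "i < p" "j < p" for i j
    by (rule regular_continuous_sphere(1)[OF R ca(1,2) that])
  note carR = regular_continuous_sphere(2)[OF R ca(1,2) ij] regular_continuous_sphere(2)[OF R ca(5,1) ij]
  note carL = regular_continuous_sphere(2)[OF L ca(3,4) ij] regular_continuous_sphere(2)[OF L ca(4,5) ij]
  have cf: "continuous_on (sphere 0 b) (?f r)" if "r < p" for r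
    using cR[OF that ij(2)] b by (intro continuous_intros) auto
  have cg: "continuous_on (sphere 0 a) (?g r)" if "r < p" for r
    using cL[OF ij(1) that] ab by (intro continuous_intros) auto
  define s where "s = (\<lambda>r. circle_mean a (\<lambda>w. circle_mean b (\<lambda>z. ?g r w * ?f r z / (z - w))))"
  \<comment> \<open>The negative block indices are \<open>- 1 - k\<close>. The term
    \<open>w ^ k * z powi (- int k - 1)\<close> of the expansion of \<open>1 / (z - w)\<close> then
    belongs to block \<open>M - 1 - k\<close>.\<close>
  let ?\<sigma> = "\<lambda>k. - 1 - int k"
  have "((\<lambda>l. toeplitz p L (int p * x' + int i) (int p * M + l) * toeplitz p R (int p * M + l) (int p * x + int j)) has_sum (\<Sum>r<p. s r)) {..<0}"
  proof (rule residue_class_has_sum[OF p, where \<sigma>="?\<sigma>"])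
    fix r assume r: "r < p"
    have "((\<lambda>k. circle_mean a (\<lambda>w. ?g r w * w ^ k) * circle_mean b (\<lambda>z. ?f r z * z powi (- int k - 1))) has_sum s r) UNIV"
      unfolding s_def by (rule double_circle_has_sum(2)[OF ab(1) b(2) cf[OF r] cg[OF r]])
    moreover have "circle_mean a (\<lambda>w. ?g r w * w ^ k) * circle_mean b (\<lambda>z. ?f r z * z powi (- int k - 1)) =
      toeplitz p L (int p * x' + int i) (int p * M + (int p * ?\<sigma> k + int r)) * toeplitz p R (int p * M + (int p * ?\<sigma> k + int r)) (int p * x + int j)" for k
    proof -
      have e: "int p * M + (int p * ?\<sigma> k + int r) = int p * (M - 1 - int k) + int r" by (simp add: algebra_simps)
      have dm: "(int p * (M - 1 - int k) + int r) div int p = M - 1 - int k" "(int p * (M - 1 - int k) + int r) mod int p = int r"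
        using r p by auto
      have dj: "(int p * x + int j) div int p = x" "(int p * x + int j) mod int p = int j"
        "(int p * x' + int i) div int p = x'" "(int p * x' + int i) mod int p = int i" using ij by auto
      have "circle_mean b (\<lambda>w. ?f r w * w powi (- int k - 1)) = circle_mean b (\<lambda>w. R w $$ (r,j) * w powi (M - x - int k - 2))"
      proof (rule circle_mean_cong[OF b(1)])
        fix w :: complex assume "norm w = b"
        then have "w \<noteq> 0" using b by auto
        then have "w powi (M - x - 1) * w powi (- int k - 1) = w powi (M - x - int k - 2)"
          by (simp add: power_int_add[symmetric] algebra_simps)
        then show "?f r w * w powi (- int k - 1) = R w $$ (r,j) * w powi (M - x - int k - 2)" by (metis mult.assoc mult.commute)
      qed
      also have "\<dots> = fcoef (\<lambda>z. R z $$ (r,j)) (- (M - x - int k - 2) - 1)"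
        by (rule fcoef_regular[OF R]) (use ab ij r in auto)
      also have "\<dots> = toeplitz p R (int p * (M - 1 - int k) + int r) (int p * x + int j)"
        by (simp only: toeplitz_entry[OF p carR(2)] dm dj nat_int) (simp add: algebra_simps)
      finally have 1: "circle_mean b (\<lambda>w. ?f r w * w powi (- int k - 1)) = toeplitz p R (int p * (M - 1 - int k) + int r) (int p * x + int j)" .
      have "circle_mean a (\<lambda>z. ?g r z * z ^ k) = circle_mean a (\<lambda>z. L z $$ (i,r) * z powi (x' - M + int k))"
      proof (rule circle_mean_cong[OF ab(1)])
        fix w :: complex assume "norm w = a"
        then have "w \<noteq> 0" using ab by auto
        then have "w powi (x' - M) * w ^ k = w powi (x' - M + int k)"
          using power_int_add[of w "x' - M" "int k"] by simp
        then show "?g r w * w ^ k = L w $$ (i,r) * w powi (x' - M + int k)" by (metis mult.assoc mult.commute)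
      qed
      also have "\<dots> = fcoef (\<lambda>z. L z $$ (i,r)) (- (x' - M + int k) - 1)"
        by (rule fcoef_regular[OF L]) (use ab ij r in auto)
      also have "\<dots> = toeplitz p L (int p * x' + int i) (int p * (M - 1 - int k) + int r)"
        by (simp only: toeplitz_entry[OF p carL(2)] dm dj nat_int) (simp add: algebra_simps)
      finally show ?thesis using 1 unfolding e by simp
    qed
    ultimately show "((\<lambda>k. toeplitz p L (int p * x' + int i) (int p * M + (int p * ?\<sigma> k + int r)) *
      toeplitz p R (int p * M + (int p * ?\<sigma> k + int r)) (int p * x + int j)) has_sum s r) UNIV" by simp
  next
    fix w :: int
    have "w div int p \<in> range ?\<sigma> \<longleftrightarrow> w div int p < 0"
    proof
      assume "w div int p < 0"
      then show "w div int p \<in> range ?\<sigma>" by (intro range_eqI[of _ _ "nat (- 1 - w div int p)"]) simp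
    qed auto
    then show "w \<in> {..<0} \<longleftrightarrow> w div int p \<in> range ?\<sigma>" using p by (simp add: pos_imp_zdiv_neg_iff)
  qed (auto simp: inj_def)
  moreover have "circ_int p a (\<lambda>w. circ_int p b (\<lambda>z. (w powi (x' - M) / (z powi (x - M + 1) * (z - w))) \<cdot>\<^sub>m H w z)) $$ (i,j) =
    (\<Sum>r<p. circle_mean a (\<lambda>w. circle_mean b (\<lambda>z. (w powi (x' - M) / (z powi (x - M + 1) * (z - w))) * (L w $$ (i,r) * R z $$ (r,j)))))"
  proof (rule iterated_integral_entry[OF ab(1) b(1) ij _ cL carL(1) cR carR(1) fac])
    show "continuous_on (sphere 0 a \<times> sphere 0 b) (\<lambda>(w,z). w powi (x' - M) / (z powi (x - M + 1) * (z - w)) :: complex)"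
      by (rule kernel_continuous) (use ab in auto)
  qed
  moreover have "(\<Sum>r<p. circle_mean a (\<lambda>w. circle_mean b (\<lambda>z. (w powi (x' - M) / (z powi (x - M + 1) * (z - w))) * (L w $$ (i,r) * R z $$ (r,j))))) = (\<Sum>r<p. s r)"
    unfolding s_def
  proof (intro sum.cong refl circle_mean_cong b(1) ab(1))
    fix r and w z :: complex assume wz: "norm w = a" "norm z = b"
    then have nz: "z \<noteq> 0" "z - w \<noteq> 0" using ab by auto
    have "1 / (z powi (x - M + 1) * (z - w)) = z powi (M - x - 1) / (z - w)"
      using nz power_int_minus[of z "x - M + 1"] by (simp add: field_simps)
    then have "w powi (x' - M) / (z powi (x - M + 1) * (z - w)) = w powi (x' - M) * (z powi (M - x - 1) / (z - w))"
      by (metis times_divide_eq_right mult.right_neutral)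
    then show "w powi (x' - M) / (z powi (x - M + 1) * (z - w)) * (L w $$ (i,r) * R z $$ (r,j)) = ?g r w * ?f r z / (z - w)"
      by (simp add: mult_ac)
  qed
  ultimately show ?thesis by simp
qed

section \<open>The model\<close>

lemma invertible_mat_det:
  fixes A :: "complex mat"
  assumes A: "A \<in> carrier_mat p p" and d: "Determinant.det A \<noteq> 0"
  shows "invertible_mat A"
proof -
  have "A \<in> Units (ring_mat TYPE(complex) p (0::nat))" using det_non_zero_imp_unit[OF A d] .
  then obtain B where B: "B \<in> carrier_mat p p" "B * A = 1\<^sub>m p" "A * B = 1\<^sub>m p"
    unfolding Units_def ring_mat_def by auto
  then show ?thesis using A by (auto simp: invertible_mat_def inverts_mat_def)
qed

lemma invertible_mat_mult:
  assumes p: "1 \<le> p" and A: "A \<in> carrier_mat p p" "invertible_mat A" and B: "B \<in> carrier_mat p p" "invertible_mat (B :: complex mat)"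
  shows "invertible_mat (A * B)"
proof (rule invertible_mat_det[of _ p])
  have i: "0 < p" using p by simp
  show "A * B \<in> carrier_mat p p" using A B by auto
  show "Determinant.det (A * B) \<noteq> 0"
    unfolding det_mult[OF A(1) B(1)] using mat_inv_det(1)[OF A i i] mat_inv_det(1)[OF B i i] by simp
qed

lemma mat_holomorphic_mult:
  assumes F: "mat_holomorphic_on p F S" and G: "mat_holomorphic_on p G S"
  shows "mat_holomorphic_on p (\<lambda>z. F z * G z) S"
  unfolding mat_holomorphic_on_def
proof (intro conjI ballI allI impI)
  show "F z * G z \<in> carrier_mat p p" if "z \<in> S" for z
    using F G that by (auto simp: mat_holomorphic_on_def)
  fix i j assume ij: "i < p" "j < p"
  have "(\<lambda>z. \<Sum>r<p. F z $$ (i,r) * G z $$ (r,j)) holomorphic_on S"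
    using F G ij by (intro holomorphic_on_sum holomorphic_on_mult) (auto simp: mat_holomorphic_on_def)
  then show "(\<lambda>z. (F z * G z) $$ (i,j)) holomorphic_on S"
    by (rule holomorphic_transform) (use F G ij in \<open>auto simp: mat_mult_entry mat_holomorphic_on_def\<close>)
qed

lemma mat_holomorphic_cong:
  assumes "mat_holomorphic_on p F S" "\<And>z. z \<in> S \<Longrightarrow> F z = G z"
  shows "mat_holomorphic_on p G S"
  using assms unfolding mat_holomorphic_on_def by (metis (mono_tags, lifting) holomorphic_transform)

lemma annulus_regular:
  assumes "mat_holomorphic_on p F (annulus \<rho>)" "\<rho> < r1" "r2 < 1 / \<rho>"
  shows "regular_between p r1 r2 F"
  by (rule regular_between_holomorphic[OF assms(1)]) (use assms(2,3) in \<open>auto simp: annulus_def\<close>)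

lemma annulus_circle_symbol:
  assumes F: "mat_holomorphic_on p F (annulus \<rho>)" and \<rho>: "0 < \<rho>" "\<rho> < 1"
  shows "circle_symbol p F"
proof -
  have "1 < 1 / \<rho>" using \<rho> by simp
  then obtain R where R: "1 < R" "R < 1 / \<rho>" using dense by blast
  obtain r where r: "\<rho> < r" "r < 1" using \<rho> dense by blast
  show ?thesis
    by (rule circle_symbolI[of r R p F F]) (use annulus_regular[OF F] r R \<rho> in auto)
qed

lemma foldr_mat_mult:
  assumes "set xs \<subseteq> carrier_mat p p" "B \<in> carrier_mat p p"
  shows "foldr (*) xs (1\<^sub>m p) \<in> carrier_mat p p" "foldr (*) xs B = foldr (*) xs (1\<^sub>m p) * (B :: complex mat)"
proof -
  have "foldr (*) xs (1\<^sub>m p) \<in> carrier_mat p p \<and> foldr (*) xs B = foldr (*) xs (1\<^sub>m p) * B"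
    using assms by (induction xs) (auto simp: assoc_mult_mat[of _ p p _ p _ p])
  then show "foldr (*) xs (1\<^sub>m p) \<in> carrier_mat p p" "foldr (*) xs B = foldr (*) xs (1\<^sub>m p) * B" by auto
qed

lemma prod_nonneg_Reals:
  fixes f :: "'i \<Rightarrow> complex"
  assumes "\<And>i. i \<in> S \<Longrightarrow> f i \<in> \<real>\<^sub>\<ge>\<^sub>0"
  shows "prod f S \<in> \<real>\<^sub>\<ge>\<^sub>0"
  using assms by (induction S rule: infinite_finite_induct) auto

lemma nn_integral_has_sum:
  fixes f :: "'x \<Rightarrow> real"
  assumes s: "(f has_sum s) A" and nn: "\<And>x. x \<in> A \<Longrightarrow> 0 \<le> f x"
  shows "(\<integral>\<^sup>+x. ennreal (f x) \<partial>count_space A) = ennreal s"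
proof -
  have "(\<lambda>x. norm (f x)) summable_on A"
    using has_sum_imp_summable[OF s] by (rule summable_on_cong[THEN iffD1, rotated]) (use nn in auto)
  then have "Infinite_Set_Sum.abs_summable_on f A" by (rule abs_summable_equivalent[THEN iffD1])
  then show ?thesis using nn s
    by (simp add: nn_integral_conv_infsetsum infsetsum_infsum infsumI)
qed

locale toeplitz_model =
  fixes p N :: nat and M :: int and \<rho> :: real and \<phi> :: "nat \<Rightarrow> complex \<Rightarrow> complex mat"
  assumes p: "1 \<le> p" and N: "1 \<le> N" and \<rho>: "0 < \<rho>" "\<rho> < 1"
    and hol: "\<And>m. m \<in> {1..N} \<Longrightarrow> mat_holomorphic_on p (\<phi> m) (annulus \<rho>)"
    and inv: "\<And>m z. m \<in> {1..N} \<Longrightarrow> z \<in> annulus \<rho> \<Longrightarrow> invertible_mat (\<phi> m z)"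
    and minors: "\<And>m. m \<in> {1..N} \<Longrightarrow> minors_nonneg (toeplitz p (\<phi> m))"
    and norm_pos: "\<And>n. n \<ge> 1 \<Longrightarrow> norm_const p M N \<phi> n > 0"
begin

abbreviation "\<phi>\<phi> \<equiv> symbol_prod p \<phi>"
abbreviation "TT m \<equiv> toeplitz p (\<phi> m)"
abbreviation "PP m l \<equiv> toeplitz p (\<phi>\<phi> m l)"
abbreviation "endpoint \<equiv> (\<lambda>j::nat. int p * M + int j)"

lemma circle_annulus: "norm z = 1 \<Longrightarrow> z \<in> annulus \<rho>"
  using \<rho> by (auto simp: annulus_def)

lemma symbol_carrier: "m \<in> {1..N} \<Longrightarrow> z \<in> annulus \<rho> \<Longrightarrow> \<phi> m z \<in> carrier_mat p p"
  using hol by (auto simp: mat_holomorphic_on_def)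

lemma symbol_prod_empty: "\<phi>\<phi> m m z = 1\<^sub>m p"
  by (simp add: symbol_prod_def)

lemma symbol_prod_Suc:
  assumes "m \<le> l" "l < N" "z \<in> annulus \<rho>"
  shows "\<phi>\<phi> m (Suc l) z = \<phi>\<phi> m l z * \<phi> (Suc l) z"
proof -
  have e: "[m + 1..<Suc l + 1] = [m + 1..<l + 1] @ [Suc l]" using assms by simp
  have 1: "\<phi> (Suc l) z \<in> carrier_mat p p" using assms by (intro symbol_carrier) auto
  have 2: "set (map (\<lambda>m. \<phi> m z) [m + 1..<l + 1]) \<subseteq> carrier_mat p p" using assms by (auto intro!: symbol_carrier)
  show ?thesis unfolding symbol_prod_def e using foldr_mat_mult(2)[OF 2 1] 1 by simp
qed

lemma symbol_prod_holomorphic: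
  assumes "m \<le> l" "l \<le> N"
  shows "mat_holomorphic_on p (\<phi>\<phi> m l) (annulus \<rho>)"
  using assms
proof (induction l rule: dec_induct)
  case base
  then show ?case by (simp add: symbol_prod_empty mat_holomorphic_on_def)
next
  case (step l)
  have "mat_holomorphic_on p (\<lambda>z. \<phi>\<phi> m l z * \<phi> (Suc l) z) (annulus \<rho>)"
    using step by (intro mat_holomorphic_mult hol) auto
  then show ?case
    by (rule mat_holomorphic_cong) (use step in \<open>auto simp: symbol_prod_Suc\<close>)
qed

lemma symbol_prod_carrier: "m \<le> l \<Longrightarrow> l \<le> N \<Longrightarrow> z \<in> annulus \<rho> \<Longrightarrow> \<phi>\<phi> m l z \<in> carrier_mat p p"
  using symbol_prod_holomorphic by (auto simp: mat_holomorphic_on_def)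

lemma symbol_prod_invertible:
  assumes "m \<le> l" "l \<le> N" "z \<in> annulus \<rho>"
  shows "invertible_mat (\<phi>\<phi> m l z)"
  using assms
proof (induction l rule: dec_induct)
  case base
  show ?case unfolding symbol_prod_empty by (rule invertible_mat_det[of _ p]) auto
next
  case (step l)
  then show ?case by (simp add: symbol_prod_Suc) (intro invertible_mat_mult[OF p] symbol_prod_carrier symbol_carrier inv, auto)
qed

lemma symbol_prod_circle: "m \<le> l \<Longrightarrow> l \<le> N \<Longrightarrow> circle_symbol p (\<phi>\<phi> m l)"
  using annulus_circle_symbol[OF symbol_prod_holomorphic \<rho>] .

lemma transition_step: "m < N \<Longrightarrow> PP m (Suc m) = TT (Suc m)"
  using symbol_prod_Suc[of m m] symbol_carrier[of "Suc m"]
  by (intro toeplitz_cong[OF p]) (simp add: symbol_prod_empty circle_annulus left_mult_one_mat[of _ p p])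

lemma transition_comp:
  assumes "m < l" "l < N"
  shows "((\<lambda>w. PP m l u w * TT (Suc l) w v) has_sum PP m (Suc l) u v) UNIV"
proof -
  have "PP m (Suc l) = toeplitz p (\<lambda>z. \<phi>\<phi> m l z * \<phi> (Suc l) z)"
    using assms by (intro toeplitz_cong[OF p] symbol_prod_Suc) (auto simp: circle_annulus)
  moreover have "circle_symbol p (\<phi> (Suc l))" using assms by (intro annulus_circle_symbol[OF hol \<rho>]) auto
  ultimately show ?thesis using toeplitz_mult[OF p symbol_prod_circle, of m l] assms by simp
qed

lemma cols_bounded_symbols: obtains B where "\<And>m. m \<in> {1..N} \<Longrightarrow> cols_bounded B (TT m)"
proof -
  have "\<exists>B. cols_bounded B (TT m)" if m: "m \<in> {1..N}" for m
  proof -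
    obtain C q where q: "0 < q" "q < 1" and d: "decays C q (TT m)"
      using toeplitz_decays[OF p annulus_circle_symbol[OF hol[OF m] \<rho>]] .
    show ?thesis using decays_col[OF d] q unfolding cols_bounded_def by (metis less_imp_le)
  qed
  then obtain Bf where Bf: "\<And>m. m \<in> {1..N} \<Longrightarrow> cols_bounded (Bf m) (TT m)" by metis
  have "cols_bounded (Max (Bf ` {1..N})) (TT m)" if m: "m \<in> {1..N}" for m
  proof -
    have "Bf m \<le> Max (Bf ` {1..N})" using m by (intro Max_ge) auto
    then show ?thesis using Bf[OF m] unfolding cols_bounded_def by (metis order_trans)
  qed
  then show ?thesis by (rule that)
qed

lemma transition_family: obtains B where "transition_family TT PP N B"
proof -
  obtain B where B: "\<And>m. m \<in> {1..N} \<Longrightarrow> cols_bounded B (TT m)" using cols_bounded_symbols by blast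
  have "transition_family TT PP N B"
    by (unfold_locales) (use N B transition_step transition_comp in auto)
  then show ?thesis by (rule that)
qed

section \<open>Partition function and avoidance probabilities\<close>

abbreviation "wt n \<equiv> path_weight TT N (p * n) int endpoint"

lemma configs_path: "configs p N n = path_configs N (p * n) (\<lambda>_. UNIV)"
  by (simp add: configs_def path_configs_def)

lemma weight_path: "weight p M N \<phi> n X = Re (wt n X)"
  by (simp add: weight_def path_weight_def pos_def path_pos_def)

text \<open>The increasing labelling of levels and end points makes every factor a minor with
  increasing rows and columns, to which \<open>minors_nonneg\<close> applies.\<close>

lemma path_weight_nonneg:
  assumes "X \<in> configs p N n"
  shows "wt n X \<in> \<real>\<^sub>\<ge>\<^sub>0"
  unfolding path_weight_def
proof (rule prod_nonneg_Reals)
  fix m assume m: "m \<in> {1..N}"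
  have mono: "strict_mono_on {..<p * n} (path_pos N int endpoint (\<lambda>m. level m X) l)" if l: "l \<le> N" for l
  proof (cases "l = 0 \<or> l = N")
    case False
    then have "l \<in> {1..<N}" using l by auto
    then have "finite (level l X)" "card (level l X) = p * n" using assms by (auto simp: configs_def)
    then have "length (sorted_list_of_set (level l X)) = p * n" by simp
    moreover have "sorted_wrt (<) (sorted_list_of_set (level l X))" by (rule strict_sorted_list_of_set)
    ultimately show ?thesis using False by (auto simp: strict_mono_on_def path_pos_def sorted_wrt_iff_nth_less)
  qed (auto simp: strict_mono_on_def path_pos_def)
  show "Determinant.det (Matrix.mat (p * n) (p * n) (\<lambda>(i, j). TT m (path_pos N int endpoint (\<lambda>m. level m X) (m - 1) i)
      (path_pos N int endpoint (\<lambda>m. level m X) m j))) \<in> \<real>\<^sub>\<ge>\<^sub>0"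
    using minors[OF m] mono[of "m - 1"] mono[of m] m unfolding minors_nonneg_def by auto
qed

lemma weight_nonneg: "X \<in> configs p N n \<Longrightarrow> 0 \<le> weight p M N \<phi> n X"
  using path_weight_nonneg by (simp add: weight_path complex_nonneg_Reals_iff)

abbreviation "end_mat n \<equiv> Matrix.mat (p * n) (p * n) (\<lambda>(i,j). PP 0 N (int i) (endpoint j))"

text \<open>Forbidding the sites of \<open>S\<close> restricts each level to a subset, which is the
  form that \<open>path_weight_has_sum\<close> accepts.\<close>

lemma weight_avoiding:
  defines "D \<equiv> \<lambda>n S. Determinant.det (Matrix.mat (p * n) (p * n) (\<lambda>(i,j). path_sum TT (\<lambda>m. {w. (m, w) \<notin> S}) (N - 1) (int i) (endpoint j)))"
  shows "(weight p M N \<phi> n has_sum Re (D n S)) {X \<in> configs p N n. X \<inter> S = {}}"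
    and "D n S = of_real (Re (D n S))"
proof -
  obtain B where B: "\<And>m. m \<in> {1..N} \<Longrightarrow> cols_bounded B (TT m)" using cols_bounded_symbols by blast
  have N': "Suc (N - 1) = N" using N by simp
  have e: "{X \<in> configs p N n. X \<inter> S = {}} = path_configs N (p * n) (\<lambda>m. {w. (m, w) \<notin> S})"
    by (auto simp: configs_def path_configs_def level_def sites_def)
  note hs = path_weight_has_sum[of "N - 1" B TT "p * n" int endpoint "\<lambda>m. {w. (m, w) \<notin> S}", unfolded N',
    folded configs_path]
  show "(weight p M N \<phi> n has_sum Re (D n S)) {X \<in> configs p N n. X \<inter> S = {}}"
    unfolding e D_def using hs(1)[OF B path_weight_nonneg] by (simp add: weight_path[abs_def])
  show "D n S = of_real (Re (D n S))" unfolding D_def using hs(2)[OF B path_weight_nonneg] .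
qed

text \<open>The case without forbidden sites. Positivity of the normalizing constant therefore
  yields invertibility of the matrix between the end points.\<close>

lemma norm_const_det: "Determinant.det (end_mat n) = of_real (norm_const p M N \<phi> n)"
proof -
  obtain B where "transition_family TT PP N B" using transition_family .
  then interpret em: transition_family TT PP N "p * n" int endpoint B .
  have N': "Suc (N - 1) = N" using N by simp
  have e: "path_sum TT (\<lambda>m. {w. (m, w) \<notin> {}}) (N - 1) u v = PP 0 N u v" for u v
    using em.path_sum_UNIV[of "N - 1" u v] N' by simp
  from weight_avoiding[of n "{}"] show ?thesis unfolding e norm_const_def by (simp add: infsumI)
qed

lemma end_mat_det: "n \<ge> 1 \<Longrightarrow> Determinant.det (end_mat n) \<noteq> 0"
  using norm_pos[of n] by (simp add: norm_const_det)

definition "inv_coeff n = (\<lambda>j i. mat_inv (end_mat n) $$ (j, i))"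

lemma inv_coeff:
  assumes n: "n \<ge> 1"
  shows "end_mat n * Matrix.mat (p * n) (p * n) (\<lambda>(j,i). inv_coeff n j i) = 1\<^sub>m (p * n)"
    and "\<And>i j. i < p * n \<Longrightarrow> j < p * n \<Longrightarrow>
      (\<Sum>k<p * n. PP 0 N (int i) (endpoint k) * inv_coeff n k j) = (if i = j then 1 else 0)"
    and "\<And>i j. i < p * n \<Longrightarrow> j < p * n \<Longrightarrow>
      (\<Sum>k<p * n. inv_coeff n i k * PP 0 N (int k) (endpoint j)) = (if i = j then 1 else 0)"
proof -
  have c: "end_mat n \<in> carrier_mat (p * n) (p * n)" by simp
  note I = mat_inv_right[OF c invertible_mat_det[OF c end_mat_det[OF n]]]
  have e: "Matrix.mat (p * n) (p * n) (\<lambda>(j,i). inv_coeff n j i) = mat_inv (end_mat n)"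
    using I(1) by (intro eq_matI) (auto simp: inv_coeff_def)
  show "end_mat n * Matrix.mat (p * n) (p * n) (\<lambda>(j,i). inv_coeff n j i) = 1\<^sub>m (p * n)"
    unfolding e by (rule I(2))
  fix i j assume ij: "i < p * n" "j < p * n"
  show "(\<Sum>k<p * n. PP 0 N (int i) (endpoint k) * inv_coeff n k j) = (if i = j then 1 else 0)"
    using mat_mult_entry[OF c I(1) ij, unfolded I(2)] ij by (simp add: inv_coeff_def)
  show "(\<Sum>k<p * n. inv_coeff n i k * PP 0 N (int k) (endpoint j)) = (if i = j then 1 else 0)"
    using mat_mult_entry[OF I(1) c ij, unfolded I(3)] ij by (simp add: inv_coeff_def)
qed

definition em_corr :: "nat \<Rightarrow> nat \<times> int \<Rightarrow> nat \<times> int \<Rightarrow> complex" where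
  "em_corr n = transition_family.em_kernel PP N (p * n) int endpoint (inv_coeff n)"

lemma em_corr_altdef: "em_corr n = (\<lambda>(m, u) (m', u'). - (if m > m' then PP m' m u' u else 0) +
     (\<Sum>j<p * n. \<Sum>i<p * n. PP m' N u' (endpoint j) * inv_coeff n j i * PP 0 m (int i) u))"
proof -
  obtain B where "transition_family TT PP N B" using transition_family .
  then interpret em: transition_family TT PP N "p * n" int endpoint B .
  show ?thesis unfolding em_corr_def em.em_kernel_def ..
qed

text \<open>The weight of the avoiding configurations is a determinant of path sums, from which
  \<open>det_avoiding\<close> splits off the normalizing constant. A real number divided by this
  positive constant is real, and so is the minor.\<close>

lemma avoidance_has_sum:
  assumes n: "n \<ge> 1" and S: "finite S" "S \<subseteq> sites N"
  shows "(weight p M N \<phi> n has_sum norm_const p M N \<phi> n * Re (mixed_minor (em_corr n) {} S)) {X \<in> configs p N n. X \<inter> S = {}}"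
    and "mixed_minor (em_corr n) {} S = of_real (Re (mixed_minor (em_corr n) {} S))"
proof -
  obtain B where "transition_family TT PP N B" using transition_family .
  then interpret em: transition_family TT PP N "p * n" int endpoint B .
  note d = em.det_avoiding[OF S inv_coeff(1)[OF n], folded em_corr_def, unfolded norm_const_det]
  show "(weight p M N \<phi> n has_sum norm_const p M N \<phi> n * Re (mixed_minor (em_corr n) {} S)) {X \<in> configs p N n. X \<inter> S = {}}"
    using weight_avoiding(1)[of n S] unfolding d by simp
  have "of_real (norm_const p M N \<phi> n) * mixed_minor (em_corr n) {} S \<in> \<real>"
    using weight_avoiding(2)[of n S] unfolding d by (metis Reals_of_real)
  then have "Im (mixed_minor (em_corr n) {} S) = 0" using norm_pos[OF n] by (simp add: complex_is_Real_iff)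
  then show "mixed_minor (em_corr n) {} S = of_real (Re (mixed_minor (em_corr n) {} S))" by (simp add: complex_eq_iff)
qed

lemma model_sets: "space (model p M N \<phi> n) = configs p N n" "sets (model p M N \<phi> n) = Pow (configs p N n)"
  by (simp_all add: model_def space_point_measure sets_point_measure)

lemma model_avoidance:
  assumes n: "n \<ge> 1" and S: "finite S" "S \<subseteq> sites N"
  shows "emeasure (model p M N \<phi> n) {X \<in> configs p N n. X \<inter> S = {}} = ennreal (Re (mixed_minor (em_corr n) {} S))"
proof -
  let ?A = "{X \<in> configs p N n. X \<inter> S = {}}" and ?f = "\<lambda>X. weight p M N \<phi> n X / norm_const p M N \<phi> n"
  note Z = norm_pos[OF n]
  have "emeasure (model p M N \<phi> n) ?A = (\<integral>\<^sup>+X. ennreal (?f X) * indicator ?A X \<partial>count_space (configs p N n))"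
    unfolding model_def point_measure_def by (subst emeasure_density) auto
  also have "\<dots> = (\<integral>\<^sup>+X. ennreal (?f X) \<partial>count_space ?A)"
    by (subst nn_integral_restrict_space[symmetric]) (auto simp: restrict_count_space Int_absorb1 intro!: arg_cong2[of _ _ _ _ nn_integral] arg_cong[of _ _ count_space])
  also have "\<dots> = ennreal (Re (mixed_minor (em_corr n) {} S))"
  proof (rule nn_integral_has_sum)
    have "((\<lambda>X. weight p M N \<phi> n X * (1 / norm_const p M N \<phi> n)) has_sum
        norm_const p M N \<phi> n * Re (mixed_minor (em_corr n) {} S) * (1 / norm_const p M N \<phi> n)) ?A"
      by (rule has_sum_cmult_left[OF avoidance_has_sum(1)[OF n S]])
    then show "(?f has_sum Re (mixed_minor (em_corr n) {} S)) ?A" using Z by simp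
  qed (use weight_nonneg Z in auto)
  finally show ?thesis .
qed

lemma model_prob:
  assumes n: "n \<ge> 1"
  shows "prob_space (model p M N \<phi> n)"
proof (rule prob_spaceI)
  have "emeasure (model p M N \<phi> n) (configs p N n) = ennreal (Re (mixed_minor (em_corr n) {} {}))"
    using model_avoidance[OF n, of "{}"] by simp
  also have "mixed_minor (em_corr n) {} {} = 1" by (simp add: mixed_minor_def set_det_def)
  finally show "emeasure (model p M N \<phi> n) (space (model p M N \<phi> n)) = 1" by (simp add: model_sets)
qed

text \<open>Avoidance probabilities are minors of \<open>1 - K\<close>. Occupied sites are then
  introduced one at a time by subtracting events, in step with
  \<open>mixed_minor_insert\<close>.\<close>

lemma model_correlations:
  assumes n: "n \<ge> 1" and A: "finite A" "A \<subseteq> sites N" "B \<subseteq> A"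
  shows "complex_of_real (measure (model p M N \<phi> n) {X \<in> configs p N n. X \<inter> A = B}) = mixed_minor (em_corr n) B (A - B)"
proof -
  interpret prob_space "model p M N \<phi> n" by (rule model_prob[OF n])
  define pr where "pr B C = complex_of_real (measure (model p M N \<phi> n) {X \<in> configs p N n. B \<subseteq> X \<and> X \<inter> C = {}})" for B C
  have "pr B (A - B) = mixed_minor (em_corr n) B (A - B)"
  proof (rule avoidance_imp_mixed_minor[of "sites N"])
    fix C :: "(nat \<times> int) set" assume C: "finite C" "C \<subseteq> sites N"
    have "measure (model p M N \<phi> n) {X \<in> configs p N n. X \<inter> C = {}} = Re (mixed_minor (em_corr n) {} C)"
    proof -
      \<comment> \<open>\<open>ennreal\<close> cuts negative numbers off at 0, so the sign must be
        known before the real value is read off.\<close>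
      have 1: "0 \<le> norm_const p M N \<phi> n * Re (mixed_minor (em_corr n) {} C)"
        by (rule has_sum_nonneg[OF avoidance_has_sum(1)[OF n C]]) (use weight_nonneg in auto)
      show ?thesis using model_avoidance[OF n C] 1 norm_pos[OF n]
        by (simp add: measure_def zero_le_mult_iff)
    qed
    then show "pr {} C = mixed_minor (em_corr n) {} C"
      using avoidance_has_sum(2)[OF n C] by (simp add: pr_def)
  next
    fix b B C
    let ?E = "\<lambda>B C. {X \<in> configs p N n. B \<subseteq> X \<and> X \<inter> C = {}}"
    have m: "?E B C \<in> sets (model p M N \<phi> n)" for B C by (auto simp: model_sets)
    have "?E (insert b B) C = ?E B C - ?E B (insert b C)" by auto
    then have "measure (model p M N \<phi> n) (?E (insert b B) C) = measure (model p M N \<phi> n) (?E B C) - measure (model p M N \<phi> n) (?E B (insert b C))"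
      by (simp only:) (rule finite_measure_Diff[OF m m], auto)
    then show "pr (insert b B) C = pr B C - pr B (insert b C)" by (simp add: pr_def)
  qed (use A finite_subset in auto)
  moreover have "{X \<in> configs p N n. B \<subseteq> X \<and> X \<inter> (A - B) = {}} = {X \<in> configs p N n. X \<inter> A = B}"
    using A(3) by auto
  ultimately show ?thesis by (simp add: pr_def)
qed

section \<open>Identification of the kernel\<close>

lemma transition_block_entry:
  assumes "m' < m" "m \<le> N"
  shows "transition_block p \<phi> m x m' x' $$ (nat (u' mod int p), nat (u mod int p)) =
    fcoef (\<lambda>z. \<phi>\<phi> m' m z $$ (nat (u' mod int p), nat (u mod int p))) (x - x')"
proof -
  have one: "(0::real) < 1" by simp
  have "transition_block p \<phi> m x m' x' = circ_int p 1 (\<lambda>z. (z powi (x' - x) / z) \<cdot>\<^sub>m \<phi>\<phi> m' m z)"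
    using assms by (simp add: transition_block_def)
  also have "\<dots> $$ (nat (u' mod int p), nat (u mod int p)) =
    circle_mean 1 (\<lambda>z. \<phi>\<phi> m' m z $$ (nat (u' mod int p), nat (u mod int p)) * z powi (- (x - x') - 1))"
  proof (rule circ_int_entry[OF one mod_index_less[OF p] mod_index_less[OF p]])
    fix z :: complex assume z: "norm z = 1"
    then have z0: "z \<noteq> 0" by auto
    have c: "\<phi>\<phi> m' m z \<in> carrier_mat p p" using assms circle_annulus[OF z] by (intro symbol_prod_carrier) auto
    show "((z powi (x' - x) / z) \<cdot>\<^sub>m \<phi>\<phi> m' m z) $$ (nat (u' mod int p), nat (u mod int p)) =
       \<phi>\<phi> m' m z $$ (nat (u' mod int p), nat (u mod int p)) * z powi (- (x - x') - 1)"
      using c mod_index_less[OF p] z0 by (simp add: power_int_diff)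
  qed
  finally show ?thesis by (simp add: fcoef_def)
qed

lemma transition_block_toeplitz:
  assumes "m' < m" "m \<le> N"
  shows "transition_block p \<phi> m (u div int p) m' (u' div int p) $$ (nat (u' mod int p), nat (u mod int p)) = PP m' m u' u"
  unfolding transition_block_entry[OF assms]
  by (rule toeplitz_entry[OF p, symmetric]) (use assms circle_annulus in \<open>auto intro!: symbol_prod_carrier\<close>)

lemma transition_block_dim: "transition_block p \<phi> m x m' x' \<in> carrier_mat p p"
  by (simp add: transition_block_def circ_int_def)

text \<open>The coefficients of the reproducing kernel are the entries of the inverse matrix, so the
  double integral is the double sum of the Eynard-Mehta kernel. For \<open>n \<ge> 1\<close>, degree
  at most \<open>n - 1\<close> leaves room for exactly \<open>n\<close> coefficients.\<close>

lemma K_fin_em_corr: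
  assumes n: "n \<ge> 1" and s: "s \<in> sites N" "s' \<in> sites N"
  shows "K_fin p M N \<phi> n s s' = em_corr n s s'"
proof -
  obtain m u m' u' where mu: "s = (m, u)" "s' = (m', u')" and m: "1 \<le> m" "m < N" "1 \<le> m'" "m' < N"
    using s by (auto simp: sites_def)
  let ?i = "nat (u' mod int p)" and ?j = "nat (u mod int p)"
  have ij: "?i < p" "?j < p" using mod_index_less[OF p] by auto
  have e: "int p * (u' div int p) + int ?i = u'" "int p * (u div int p) + int ?j = u" using p by auto
  note cs = symbol_prod_circle[of 0 N]
  note rk = rep_kernel_flat[OF p n cs inv_coeff(2,3)[OF n]]
  have F: "circle_symbol p (\<phi>\<phi> m' N)" and G: "circle_symbol p (\<phi>\<phi> 0 m)"
    using m by (auto intro: symbol_prod_circle)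
  have "K_fin p M N \<phi> n s s' = - (transition_block p \<phi> m (u div int p) m' (u' div int p) $$ (?i, ?j)) +
     circ_int p 1 (\<lambda>w. circ_int p 1 (\<lambda>z. (w powi (u' div int p) / (z powi (u div int p + 1) * w powi (M + int n))) \<cdot>\<^sub>m
       (\<phi>\<phi> m' N w * eval_mat2 (rep_kernel p M (\<phi>\<phi> 0 N) n) z w * \<phi>\<phi> 0 m z))) $$ (?i, ?j)"
    using transition_block_dim[of m "u div int p" m' "u' div int p"] ij
    by (simp add: K_fin_def kernel_of_blocks_def mu circ_int_def)
  also have "circ_int p 1 (\<lambda>w. circ_int p 1 (\<lambda>z. (w powi (u' div int p) / (z powi (u div int p + 1) * w powi (M + int n))) \<cdot>\<^sub>m
       (\<phi>\<phi> m' N w * eval_mat2 (rep_kernel p M (\<phi>\<phi> 0 N) n) z w * \<phi>\<phi> 0 m z))) $$ (?i, ?j) =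
     (\<Sum>J<p * n. \<Sum>I<p * n. PP m' N u' (endpoint J) * flat_coeff p n (rep_kernel p M (\<phi>\<phi> 0 N) n) J I * PP 0 m (int I) u)"
    using finite_kernel_integral[OF p n F G _ ij, of "rep_kernel p M (\<phi>\<phi> 0 N) n" "u' div int p" "u div int p" M] rk(1) unfolding e by simp
  also have "\<dots> = (\<Sum>J<p * n. \<Sum>I<p * n. PP m' N u' (endpoint J) * inv_coeff n J I * PP 0 m (int I) u)"
    using rk(2) by (intro sum.cong refl) simp
  also have "transition_block p \<phi> m (u div int p) m' (u' div int p) $$ (?i, ?j) = (if m > m' then PP m' m u' u else 0)"
    using transition_block_toeplitz[of m' m u u'] m ij by (simp add: transition_block_def)
  finally show ?thesis by (simp add: em_corr_altdef mu)
qed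

end

section \<open>Wiener--Hopf factors\<close>

lemma circle_symbol_cong:
  assumes F: "circle_symbol p F" and eq: "\<And>z. norm z = 1 \<Longrightarrow> F z = G z"
  shows "circle_symbol p G"
proof -
  have "fcoef (\<lambda>z. F z $$ (i,j)) k = fcoef (\<lambda>z. G z $$ (i,j)) k" for i j k
    unfolding fcoef_def by (rule circle_mean_cong) (use eq in auto)
  moreover have "mat_continuous_on p (sphere 0 1) G"
    unfolding mat_continuous_on_def
  proof (intro conjI ballI allI impI)
    show "G z \<in> carrier_mat p p" if "z \<in> sphere 0 1" for z
      using circle_symbol_carrier[OF F, of z] eq[of z] that by simp
    show "continuous_on (sphere 0 1) (\<lambda>z. G z $$ (i,j))" if "i < p" "j < p" for i j
      using circle_symbol_continuous[OF F that]
      by (rule continuous_on_cong[THEN iffD1, OF refl, rotated]) (use eq in auto)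
  qed
  ultimately show ?thesis using F unfolding circle_symbol_def by simp
qed

lemma smult_entry: "A \<in> carrier_mat p p \<Longrightarrow> i < p \<Longrightarrow> j < p \<Longrightarrow> (c \<cdot>\<^sub>m A) $$ (i,j) = c * A $$ (i,j)"
  by simp

text \<open>Multiplication by \<open>z powi m\<close> shifts the coefficients by \<open>m\<close>,
  which costs at most the factor \<open>1 / q ^ nat \<bar>m\<bar>\<close> in the constant.\<close>

lemma circle_symbol_scale:
  assumes F: "circle_symbol p F"
  shows "circle_symbol p (\<lambda>z. (z powi m) \<cdot>\<^sub>m F z)"
proof -
  obtain C q where q: "0 < q" "q < 1" and
    d: "\<And>i j k. i < p \<Longrightarrow> j < p \<Longrightarrow> norm (fcoef (\<lambda>z. F z $$ (i,j)) k) \<le> C * q ^ nat \<bar>k\<bar>"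
    using F unfolding circle_symbol_def by blast
  have "norm (fcoef (\<lambda>z. ((z powi m) \<cdot>\<^sub>m F z) $$ (i,j)) k) \<le> C / q ^ nat \<bar>m\<bar> * q ^ nat \<bar>k\<bar>" if ij: "i < p" "j < p" for i j k
  proof -
    have "fcoef (\<lambda>z. ((z powi m) \<cdot>\<^sub>m F z) $$ (i,j)) k = fcoef (\<lambda>z. F z $$ (i,j)) (k - m)"
      unfolding fcoef_def
    proof (rule circle_mean_cong)
      fix z :: complex assume z: "norm z = 1"
      then have "z \<noteq> 0" by auto
      then show "((z powi m) \<cdot>\<^sub>m F z) $$ (i,j) * z powi (- k - 1) = F z $$ (i,j) * z powi (- (k - m) - 1)"
        using circle_symbol_carrier[OF F z] ij by (simp add: power_int_diff power_int_minus power_int_add field_simps)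
    qed simp
    moreover have "C * q ^ nat \<bar>k - m\<bar> \<le> C / q ^ nat \<bar>m\<bar> * q ^ nat \<bar>k\<bar>"
    proof -
      have "0 \<le> C" using order_trans[OF norm_ge_zero d[OF ij, of 0]] by simp
      moreover have "q ^ nat \<bar>k - m\<bar> * q ^ nat \<bar>m\<bar> \<le> q ^ nat \<bar>k\<bar>"
        unfolding power_add[symmetric] by (rule power_decreasing) (use q in auto)
      ultimately show ?thesis using q by (simp add: pos_le_divide_eq mult.assoc mult_left_mono)
    qed
    ultimately show ?thesis using d[OF ij, of "k - m"] by simp
  qed
  moreover have "mat_continuous_on p (sphere 0 1) (\<lambda>z. (z powi m) \<cdot>\<^sub>m F z)"
    unfolding mat_continuous_on_def
  proof (intro conjI ballI allI impI)
    fix i j assume ij: "i < p" "j < p"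
    have "continuous_on (sphere 0 1) (\<lambda>z. z powi m * F z $$ (i,j))"
      using circle_symbol_continuous[OF F ij] by (intro continuous_intros) auto
    then show "continuous_on (sphere 0 1) (\<lambda>z. ((z powi m) \<cdot>\<^sub>m F z) $$ (i,j))"
      by (rule continuous_on_cong[THEN iffD1, OF refl, rotated])
        (use smult_entry[OF circle_symbol_carrier[OF F] ij] in auto)
  qed (use circle_symbol_carrier[OF F] in auto)
  ultimately show ?thesis unfolding circle_symbol_def using q by blast
qed

text \<open>A plus factor is given inside the circle; outside, the product formula replaces it by an
  expression in the symbol and the minus factor, which lives there. Minus factors and inverses are
  treated alike, and the disjunction covers both orders of the factorization.\<close>

lemma circle_symbol_inverse_factors:
  assumes Z: "mat_holomorphic_on p Z (annulus \<rho>)" "\<And>z. z \<in> annulus \<rho> \<Longrightarrow> invertible_mat (Z z)"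
    and \<rho>: "0 < \<rho>" "\<rho> < 1" and P: "plus_factor p P" and Q: "minus_factor p M Q"
    and fac: "(\<forall>z. norm z = 1 \<longrightarrow> Z z = P z * Q z) \<or> (\<forall>z. norm z = 1 \<longrightarrow> Z z = Q z * P z)"
  shows "circle_symbol p P" "circle_symbol p (\<lambda>z. mat_inv (P z))" "circle_symbol p Q" "circle_symbol p (\<lambda>z. mat_inv (Q z))"
proof -
  have "1 < 1 / \<rho>" using \<rho> by simp
  then obtain R where R: "1 < R" "R < 1 / \<rho>" using dense by blast
  obtain r where r: "\<rho> < r" "r < 1" using \<rho> dense by blast
  have r0: "0 < r" using r \<rho> by simp
  note Zi = mat_holomorphic_inv[OF Z]
  have rZ: "regular_between p r 1 Z" "regular_between p 1 R Z" "regular_between p r 1 (\<lambda>z. mat_inv (Z z))" "regular_between p 1 R (\<lambda>z. mat_inv (Z z))"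
    using annulus_regular[OF Z(1)] annulus_regular[OF Zi] r R by auto
  have rP: "regular_between p r 1 P" "regular_between p r 1 (\<lambda>z. mat_inv (P z))"
    using P by (auto simp: plus_factor_def intro!: regular_plus)
  have rQ: "regular_between p 1 R Q" "regular_between p 1 R (\<lambda>z. mat_inv (Q z))"
    using Q by (auto simp: minus_factor_def intro!: regular_minus)
  have ann: "z \<in> annulus \<rho>" if "norm z = 1" for z using that \<rho> by (auto simp: annulus_def)
  have c: "Z z \<in> carrier_mat p p" "P z \<in> carrier_mat p p" "Q z \<in> carrier_mat p p" "invertible_mat (Z z)" "invertible_mat (P z)" "invertible_mat (Q z)"
    if "norm z = 1" for z
    using that Z ann[OF that] P Q by (auto simp: mat_holomorphic_on_def plus_factor_def minus_factor_def mat_continuous_on_def)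
  note I = circle_symbolI[OF r0 r(2) R(1)]
  \<comment> \<open>The variant for a function \<open>G\<close> given on the outer side, with
    \<open>F\<close> as its inward extension.\<close>
  have I': "circle_symbol p G" if "regular_between p r 1 F" "regular_between p 1 R G" "\<And>z. norm z = 1 \<Longrightarrow> G z = F z" for F G
    by (rule circle_symbol_cong[OF I[OF that(1,2)]]) (use that(3) in auto)
  from fac show "circle_symbol p P" "circle_symbol p (\<lambda>z. mat_inv (P z))" "circle_symbol p Q" "circle_symbol p (\<lambda>z. mat_inv (Q z))"
  proof -
    have "circle_symbol p P \<and> circle_symbol p (\<lambda>z. mat_inv (P z)) \<and> circle_symbol p Q \<and> circle_symbol p (\<lambda>z. mat_inv (Q z))"
    using fac proof
      assume f: "\<forall>z. norm z = 1 \<longrightarrow> Z z = P z * Q z"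
      have f': "P z = Z z * mat_inv (Q z)" "Q z = mat_inv (P z) * Z z" "mat_inv (P z) = Q z * mat_inv (Z z)" "mat_inv (Q z) = mat_inv (Z z) * P z"
        if z: "norm z = 1" for z
        using mat_inv_mult_left[OF c(1)[OF z] c(2)[OF z] c(3)[OF z] c(4)[OF z] c(5)[OF z] c(6)[OF z]] f z by blast+
      show ?thesis
        using I[OF rP(1) regular_between_mult[OF rZ(2) rQ(2)] f'(1)] I[OF rP(2) regular_between_mult[OF rQ(1) rZ(4)] f'(3)]
          I'[OF regular_between_mult[OF rP(2) rZ(1)] rQ(1) f'(2)] I'[OF regular_between_mult[OF rZ(3) rP(1)] rQ(2) f'(4)] by blast
    next
      assume f: "\<forall>z. norm z = 1 \<longrightarrow> Z z = Q z * P z"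
      have f': "Q z = Z z * mat_inv (P z)" "P z = mat_inv (Q z) * Z z" "mat_inv (Q z) = P z * mat_inv (Z z)" "mat_inv (P z) = mat_inv (Z z) * Q z"
        if z: "norm z = 1" for z
        using mat_inv_mult_left[OF c(1)[OF z] c(3)[OF z] c(2)[OF z] c(4)[OF z] c(6)[OF z] c(5)[OF z]] f z by blast+
      show ?thesis
        using I[OF rP(1) regular_between_mult[OF rQ(2) rZ(2)] f'(2)] I[OF rP(2) regular_between_mult[OF rZ(4) rQ(1)] f'(4)]
          I'[OF regular_between_mult[OF rZ(1) rP(2)] rQ(1) f'(1)] I'[OF regular_between_mult[OF rP(1) rZ(3)] rQ(2) f'(3)] by blast
    qed
    then show "circle_symbol p P" "circle_symbol p (\<lambda>z. mat_inv (P z))" "circle_symbol p Q" "circle_symbol p (\<lambda>z. mat_inv (Q z))" by auto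
  qed
qed

lemma div_signs: "1 \<le> p \<Longrightarrow> 0 \<le> u \<Longrightarrow> 0 \<le> u div int p" "1 \<le> p \<Longrightarrow> u < 0 \<Longrightarrow> u div int p < 0"
  by (simp_all add: pos_imp_zdiv_nonneg_iff pos_imp_zdiv_neg_iff)

lemma plus_factor_vanish:
  assumes p: "1 \<le> p" and P: "plus_factor p P" and uv: "0 \<le> u" "v < (0::int)"
  shows "toeplitz p P u v = 0" "toeplitz p (\<lambda>z. mat_inv (P z)) u v = 0"
proof -
  have k: "v div int p - u div int p < 0"
    using div_signs(1)[OF p uv(1)] div_signs(2)[OF p uv(2)] by linarith
  have "toeplitz p G u v = 0" if "mat_holomorphic_on p G {z. norm z < 1}" "mat_continuous_on p {z. norm z \<le> 1} G" for G
    by (rule toeplitz_vanish[OF p _ plus_fcoef_vanish[OF that _ _ k]]) (use that in \<open>auto simp: mat_continuous_on_def\<close>)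
  then show "toeplitz p P u v = 0" "toeplitz p (\<lambda>z. mat_inv (P z)) u v = 0"
    using P by (auto simp: plus_factor_def)
qed

lemma mat_inv_smult:
  fixes A :: "complex mat"
  assumes A: "A \<in> carrier_mat p p" "invertible_mat A" and c: "c \<noteq> 0"
  shows "invertible_mat (c \<cdot>\<^sub>m A)" "mat_inv (c \<cdot>\<^sub>m A) = inverse c \<cdot>\<^sub>m mat_inv A"
proof -
  note I = mat_inv_right[OF A]
  have cA: "c \<cdot>\<^sub>m A \<in> carrier_mat p p" "inverse c \<cdot>\<^sub>m mat_inv A \<in> carrier_mat p p" using A I by auto
  have e: "(c \<cdot>\<^sub>m A) * (inverse c \<cdot>\<^sub>m mat_inv A) = 1\<^sub>m p" "(inverse c \<cdot>\<^sub>m mat_inv A) * (c \<cdot>\<^sub>m A) = 1\<^sub>m p"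
    using A I c by (auto simp: mult_smult_distrib[of _ p p _ p] mult_smult_assoc_mat[of _ p p _ p] smult_smult_assoc)
  show i: "invertible_mat (c \<cdot>\<^sub>m A)" unfolding invertible_mat_def inverts_mat_def
    using cA e by (metis carrier_matD square_mat.simps)
  show "mat_inv (c \<cdot>\<^sub>m A) = inverse c \<cdot>\<^sub>m mat_inv A"
    by (rule mat_left_inverse_unique[OF cA(1) mat_inv_right(1)[OF cA(1) i] cA(2) mat_inv_right(3)[OF cA(1) i] e(1)])
qed

lemma mat_scale_regular:
  assumes F: "mat_holomorphic_on p F {z. 1 < norm z}" "mat_continuous_on p {z. 1 \<le> norm z} F"
  shows "mat_holomorphic_on p (\<lambda>z. (z powi k) \<cdot>\<^sub>m F z) {z. 1 < norm z}"
    "mat_continuous_on p {z. 1 \<le> norm z} (\<lambda>z. (z powi k) \<cdot>\<^sub>m F z)"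
proof -
  have c: "F z \<in> carrier_mat p p" if "1 \<le> norm z" for z using F that by (auto simp: mat_continuous_on_def)
  have c': "F z \<in> carrier_mat p p" if "1 < norm z" for z using c that by simp
  show "mat_holomorphic_on p (\<lambda>z. (z powi k) \<cdot>\<^sub>m F z) {z. 1 < norm z}"
    unfolding mat_holomorphic_on_def
  proof (intro conjI ballI allI impI)
    fix i j assume ij: "i < p" "j < p"
    have "(\<lambda>z. z powi k * F z $$ (i,j)) holomorphic_on {z. 1 < norm z}"
      using F(1) ij by (intro holomorphic_intros) (auto simp: mat_holomorphic_on_def)
    then show "(\<lambda>z. ((z powi k) \<cdot>\<^sub>m F z) $$ (i,j)) holomorphic_on {z. 1 < norm z}"
      by (rule holomorphic_transform) (use smult_entry[OF c' ij] in auto)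
  qed (use c' in auto)
  show "mat_continuous_on p {z. 1 \<le> norm z} (\<lambda>z. (z powi k) \<cdot>\<^sub>m F z)"
    unfolding mat_continuous_on_def
  proof (intro conjI ballI allI impI)
    fix i j assume ij: "i < p" "j < p"
    have "continuous_on {z. 1 \<le> norm z} (\<lambda>z. z powi k * F z $$ (i,j))"
      using F(2) ij by (intro continuous_intros) (auto simp: mat_continuous_on_def)
    then show "continuous_on {z. 1 \<le> norm z} (\<lambda>z. ((z powi k) \<cdot>\<^sub>m F z) $$ (i,j))"
      by (rule continuous_on_cong[THEN iffD1, OF refl, rotated]) (use smult_entry[OF c ij] in auto)
  qed (use c in auto)
qed

text \<open>\<open>z^(-M)\<close> normalizes the factor to tend to 1, and a function that is
  holomorphic outside the circle with a limit at infinity has no coefficients of positive index. For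
  the inverse, \<open>mat_inv_tendsto_one\<close> provides the limit.\<close>

lemma minus_factor_vanish:
  assumes p: "1 \<le> p" and Q: "minus_factor p M Q" and uv: "u < 0" "0 \<le> (v::int)"
  shows "toeplitz p (\<lambda>z. (z powi (- M)) \<cdot>\<^sub>m Q z) u v = 0"
    "toeplitz p (\<lambda>z. (z powi M) \<cdot>\<^sub>m mat_inv (Q z)) u v = 0"
proof -
  have k: "0 < v div int p - u div int p"
    using div_signs(2)[OF p uv(1)] div_signs(1)[OF p uv(2)] by linarith
  have hQ: "mat_holomorphic_on p Q {z. 1 < norm z}" "mat_continuous_on p {z. 1 \<le> norm z} Q"
    "mat_holomorphic_on p (\<lambda>z. mat_inv (Q z)) {z. 1 < norm z}" "mat_continuous_on p {z. 1 \<le> norm z} (\<lambda>z. mat_inv (Q z))"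
    using Q by (auto simp: minus_factor_def)
  have cQ: "Q z \<in> carrier_mat p p" "mat_inv (Q z) \<in> carrier_mat p p" "invertible_mat (Q z)" if "1 \<le> norm z" for z
    using hQ Q that by (auto simp: mat_continuous_on_def minus_factor_def)
  have ev: "\<forall>\<^sub>F z::complex in at_infinity. z \<in> {z. 1 \<le> norm z}"
    by (auto simp: eventually_at_infinity)
  have van: "toeplitz p G u v = 0"
    if "mat_holomorphic_on p G {z. 1 < norm z}" "mat_continuous_on p {z. 1 \<le> norm z} G"
      "\<And>i j. i < p \<Longrightarrow> j < p \<Longrightarrow> \<exists>l. ((\<lambda>z. G z $$ (i,j)) \<longlongrightarrow> l) at_infinity" for G
  proof (rule toeplitz_vanish[OF p])
    show "fcoef (\<lambda>z. G z $$ (i,j)) (v div int p - u div int p) = 0" if "i < p" "j < p" for i j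
      using \<open>\<And>i j. i < p \<Longrightarrow> j < p \<Longrightarrow> \<exists>l. ((\<lambda>z. G z $$ (i,j)) \<longlongrightarrow> l) at_infinity\<close>[OF that]
        minus_fcoef_vanish[OF \<open>mat_holomorphic_on p G _\<close> \<open>mat_continuous_on p _ G\<close> that _ k] by blast
  qed (use that(2) in \<open>auto simp: mat_continuous_on_def\<close>)
  have lim: "((\<lambda>z. ((z powi (- M)) \<cdot>\<^sub>m Q z) $$ (i,j)) \<longlongrightarrow> 1\<^sub>m p $$ (i,j)) at_infinity" if ij: "i < p" "j < p" for i j
  proof (rule Lim_transform_eventually)
    show "((\<lambda>z. z powi (- M) * Q z $$ (i, j)) \<longlongrightarrow> 1\<^sub>m p $$ (i, j)) at_infinity" using Q ij by (auto simp: minus_factor_def)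
    show "\<forall>\<^sub>F z in at_infinity. z powi (- M) * Q z $$ (i, j) = ((z powi (- M)) \<cdot>\<^sub>m Q z) $$ (i,j)"
      using ev by eventually_elim (use smult_entry[OF cQ(1) ij] in auto)
  qed
  show "toeplitz p (\<lambda>z. (z powi (- M)) \<cdot>\<^sub>m Q z) u v = 0"
    by (rule van[OF mat_scale_regular[OF hQ(1,2)]]) (use lim in blast)
  have inv: "invertible_mat ((z powi (- M)) \<cdot>\<^sub>m Q z)" "mat_inv ((z powi (- M)) \<cdot>\<^sub>m Q z) = (z powi M) \<cdot>\<^sub>m mat_inv (Q z)" if "1 \<le> norm z" for z
  proof -
    have "z \<noteq> 0" using that by auto
    then show "invertible_mat ((z powi (- M)) \<cdot>\<^sub>m Q z)" "mat_inv ((z powi (- M)) \<cdot>\<^sub>m Q z) = (z powi M) \<cdot>\<^sub>m mat_inv (Q z)"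
      using mat_inv_smult[OF cQ(1)[OF that] cQ(3)[OF that], of "z powi (- M)"] by (auto simp: power_int_minus)
  qed
  show "toeplitz p (\<lambda>z. (z powi M) \<cdot>\<^sub>m mat_inv (Q z)) u v = 0"
  proof (rule van[OF mat_scale_regular[OF hQ(3,4)]])
    fix i j assume ij: "i < p" "j < p"
    have "\<exists>l. ((\<lambda>z. mat_inv ((z powi (- M)) \<cdot>\<^sub>m Q z) $$ (i,j)) \<longlongrightarrow> l) at_infinity"
    proof (rule mat_inv_tendsto_one[OF _ _ ev lim ij])
      fix z :: complex assume "z \<in> {z. 1 \<le> norm z}"
      then have z: "1 \<le> norm z" by simp
      show "(z powi (- M)) \<cdot>\<^sub>m Q z \<in> carrier_mat p p" using cQ(1)[OF z] by simp
      show "invertible_mat ((z powi (- M)) \<cdot>\<^sub>m Q z)" by (rule inv(1)[OF z])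
    qed
    then obtain l where l: "((\<lambda>z. mat_inv ((z powi (- M)) \<cdot>\<^sub>m Q z) $$ (i,j)) \<longlongrightarrow> l) at_infinity" ..
    have "\<forall>\<^sub>F z in at_infinity. mat_inv ((z powi (- M)) \<cdot>\<^sub>m Q z) $$ (i,j) = ((z powi M) \<cdot>\<^sub>m mat_inv (Q z)) $$ (i,j)"
      using ev by eventually_elim (simp only: mem_Collect_eq inv(2))
    with l have "((\<lambda>z. ((z powi M) \<cdot>\<^sub>m mat_inv (Q z)) $$ (i,j)) \<longlongrightarrow> l) at_infinity"
      by (rule Lim_transform_eventually)
    then show "\<exists>l. ((\<lambda>z. ((z powi M) \<cdot>\<^sub>m mat_inv (Q z)) $$ (i,j)) \<longlongrightarrow> l) at_infinity" ..
  qed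
qed

section \<open>Reflection and common decay rates\<close>

lemma has_sum_reflect:
  fixes f :: "int \<Rightarrow> 'a::{comm_monoid_add, topological_space}"
  shows "((\<lambda>k. f (- 1 - k)) has_sum s) A \<longleftrightarrow> (f has_sum s) ((\<lambda>k. - 1 - k) ` A)"
  by (subst has_sum_reindex) (auto simp: inj_on_def o_def)

lemma reflect_sets: "(\<lambda>k. - 1 - k) ` UNIV = (UNIV :: int set)" "(\<lambda>k. - 1 - k) ` {0..} = {..<(0::int)}"
  by (auto intro!: image_eqI[of _ _ "- 1 - _"])

lemma decays_reflect: "decays C q T \<Longrightarrow> decays C q (\<lambda>u v. T (- 1 - u) (- 1 - v))"
  unfolding decays_def
proof (intro allI)
  fix u v :: int assume "\<forall>u v. norm (T u v) \<le> C * q ^ nat \<bar>u - v\<bar>"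
  from this[rule_format, of "- 1 - u" "- 1 - v"] show "norm (T (- 1 - u) (- 1 - v)) \<le> C * q ^ nat \<bar>u - v\<bar>"
    by (simp add: abs_minus_commute)
qed

text \<open>The locales use one pair \<open>C\<close>, \<open>q\<close> for all matrices and both
  ends; decay bounds are monotone in both constants, so maxima do.\<close>

lemma common_decay:
  assumes "finite S" "\<And>T. T \<in> S \<Longrightarrow> \<exists>C q. 0 < q \<and> q < 1 \<and> decays C q T"
  shows "\<exists>C q. 0 < q \<and> q < 1 \<and> (\<forall>T\<in>S. decays C q T)"
  using assms
proof (induction S rule: finite_induct)
  case empty
  show ?case by (rule exI, rule exI[of _ "1/2"]) auto
next
  case (insert T S)
  obtain C q where 1: "0 < q" "q < 1" "\<forall>T\<in>S. decays C q T" using insert.IH insert.prems by blast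
  obtain C' q' where 2: "0 < q'" "q' < 1" "decays C' q' T" using insert.prems by blast
  have "decays (max C C') (max q q') T'" if "T' \<in> insert T S" for T'
    using that 1 2 decays_mono[of C q T' "max C C'" "max q q'"] decays_mono[of C' q' T "max C C'" "max q q'"] by auto
  then show ?case using 1 2 by (intro exI[of _ "max C C'"] exI[of _ "max q q'"]) auto
qed

lemma toeplitz_mult_circle:
  assumes p: "1 \<le> p" and F: "circle_symbol p F" and G: "circle_symbol p G"
    and eq: "\<And>z. norm z = 1 \<Longrightarrow> F z * G z = H z"
  shows "((\<lambda>w. toeplitz p F u w * toeplitz p G w v) has_sum toeplitz p H u v) UNIV"
  using toeplitz_mult[OF p F G, of u v] toeplitz_cong[OF p, of "\<lambda>z. F z * G z" H] eq by simp

lemma has_sum_half: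
  assumes "(f has_sum s) (UNIV :: int set)" "\<And>k. k \<notin> S \<Longrightarrow> f k = 0"
  shows "(f has_sum s) S"
  using has_sum_cong_neutral[of UNIV S f f s] assms by auto

lemma smult_cancel_circle:
  fixes z :: complex
  assumes "norm z = 1" "A \<in> carrier_mat p p" "B \<in> carrier_mat p p"
  shows "((z powi (- M)) \<cdot>\<^sub>m A) * ((z powi M) \<cdot>\<^sub>m B) = A * B"
    "((z powi M) \<cdot>\<^sub>m A) * ((z powi (- M)) \<cdot>\<^sub>m B) = A * B"
    "((z powi M) \<cdot>\<^sub>m A) * B = (z powi M) \<cdot>\<^sub>m (A * B)"
    "A * ((z powi M) \<cdot>\<^sub>m B) = (z powi M) \<cdot>\<^sub>m (A * B)"
proof -
  have z: "z \<noteq> 0" using assms(1) by auto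
  have 1: "(c \<cdot>\<^sub>m A) * (d \<cdot>\<^sub>m B) = (c * d) \<cdot>\<^sub>m (A * B)" for c d :: complex
  proof -
    have "(c \<cdot>\<^sub>m A) * (d \<cdot>\<^sub>m B) = d \<cdot>\<^sub>m (c \<cdot>\<^sub>m (A * B))"
      using assms by (simp add: mult_smult_distrib[of _ p p _ p] mult_smult_assoc_mat[of _ p p _ p])
    also have "\<dots> = (c * d) \<cdot>\<^sub>m (A * B)" by (intro eq_matI) auto
    finally show ?thesis .
  qed
  have 2: "(1::complex) \<cdot>\<^sub>m (A * B) = A * B" by (intro eq_matI) auto
  show "((z powi (- M)) \<cdot>\<^sub>m A) * ((z powi M) \<cdot>\<^sub>m B) = A * B" "((z powi M) \<cdot>\<^sub>m A) * ((z powi (- M)) \<cdot>\<^sub>m B) = A * B"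
    unfolding 1 using z 2 by (simp_all add: power_int_minus)
  show "((z powi M) \<cdot>\<^sub>m A) * B = (z powi M) \<cdot>\<^sub>m (A * B)" "A * ((z powi M) \<cdot>\<^sub>m B) = (z powi M) \<cdot>\<^sub>m (A * B)"
    using assms by (simp_all add: mult_smult_distrib[of _ p p _ p] mult_smult_assoc_mat[of _ p p _ p])
qed

locale factored_model = toeplitz_model +
  fixes \<phi>p \<phi>m \<psi>p \<psi>m :: "complex \<Rightarrow> complex mat" and a b :: real
  assumes plus: "plus_factor p \<phi>p" "plus_factor p \<psi>p"
    and minus: "minus_factor p M \<phi>m" "minus_factor p M \<psi>m"
    and factor: "\<And>z. norm z = 1 \<Longrightarrow> symbol_prod p \<phi> 0 N z = \<phi>p z * \<phi>m z"
      "\<And>z. norm z = 1 \<Longrightarrow> symbol_prod p \<phi> 0 N z = \<psi>m z * \<psi>p z"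
    and ab: "\<rho> < a" "a < 1" "1 < b" "b < 1 / \<rho>"
begin

abbreviation "\<Phi> \<equiv> symbol_prod p \<phi> 0 N"

lemma \<Phi>: "mat_holomorphic_on p \<Phi> (annulus \<rho>)" "\<And>z. z \<in> annulus \<rho> \<Longrightarrow> invertible_mat (\<Phi> z)"
  using symbol_prod_holomorphic[of 0 N] symbol_prod_invertible[of 0 N] by auto

lemma circle_symbols:
  "circle_symbol p \<phi>p" "circle_symbol p (\<lambda>z. mat_inv (\<phi>p z))" "circle_symbol p \<phi>m" "circle_symbol p (\<lambda>z. mat_inv (\<phi>m z))"
  "circle_symbol p \<psi>p" "circle_symbol p (\<lambda>z. mat_inv (\<psi>p z))" "circle_symbol p \<psi>m" "circle_symbol p (\<lambda>z. mat_inv (\<psi>m z))"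
  using circle_symbol_inverse_factors[OF \<Phi> \<rho> plus(1) minus(1)] circle_symbol_inverse_factors[OF \<Phi> \<rho> plus(2) minus(2)] factor
  by auto

lemmas circle_symbols_scaled = circle_symbols[THEN circle_symbol_scale]

lemma factor_carrier:
  assumes "norm z = 1"
  shows "\<Phi> z \<in> carrier_mat p p" "\<phi>p z \<in> carrier_mat p p" "\<phi>m z \<in> carrier_mat p p" "\<psi>p z \<in> carrier_mat p p" "\<psi>m z \<in> carrier_mat p p"
    "mat_inv (\<phi>p z) \<in> carrier_mat p p" "mat_inv (\<phi>m z) \<in> carrier_mat p p" "mat_inv (\<psi>p z) \<in> carrier_mat p p" "mat_inv (\<psi>m z) \<in> carrier_mat p p"
    "mat_inv (\<Phi> z) \<in> carrier_mat p p"
  using circle_symbols[THEN circle_symbol_carrier, OF assms] \<Phi> circle_annulus[OF assms] mat_inv_right(1)[of "\<Phi> z" p]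
  by (auto simp: mat_holomorphic_on_def)

lemma factor_invertible:
  assumes "norm z = 1"
  shows "invertible_mat (\<Phi> z)" "invertible_mat (\<phi>p z)" "invertible_mat (\<phi>m z)" "invertible_mat (\<psi>p z)" "invertible_mat (\<psi>m z)"
  using \<Phi> circle_annulus[OF assms] assms plus minus by (auto simp: plus_factor_def minus_factor_def)

lemma factor_identities:
  assumes z: "norm z = 1"
  shows "\<Phi> z * mat_inv (\<phi>m z) = \<phi>p z" "mat_inv (\<phi>m z) * mat_inv (\<phi>p z) = mat_inv (\<Phi> z)" "\<phi>p z * mat_inv (\<phi>p z) = 1\<^sub>m p"
    "\<Phi> z * mat_inv (\<psi>p z) = \<psi>m z" "mat_inv (\<psi>p z) * mat_inv (\<psi>m z) = mat_inv (\<Phi> z)" "\<psi>m z * mat_inv (\<psi>m z) = 1\<^sub>m p"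
proof -
  note bot = mat_inv_mult_left[OF factor_carrier(1,2,3)[OF z] factor_invertible(1,2,3)[OF z] factor(1)[OF z]]
    and top = mat_inv_mult_left[OF factor_carrier(1,5,4)[OF z] factor_invertible(1,5,4)[OF z] factor(2)[OF z]]
  show "\<Phi> z * mat_inv (\<phi>m z) = \<phi>p z" "\<Phi> z * mat_inv (\<psi>p z) = \<psi>m z"
    by (rule bot(1)[symmetric], rule top(1)[symmetric])
  show "mat_inv (\<phi>m z) * mat_inv (\<phi>p z) = mat_inv (\<Phi> z)" "mat_inv (\<psi>p z) * mat_inv (\<psi>m z) = mat_inv (\<Phi> z)"
    by (rule bot(5), rule top(5))
  show "\<phi>p z * mat_inv (\<phi>p z) = 1\<^sub>m p" by (rule mat_inv_right(2)[OF factor_carrier(2)[OF z] factor_invertible(2)[OF z]])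
  show "\<psi>m z * mat_inv (\<psi>m z) = 1\<^sub>m p" by (rule mat_inv_right(2)[OF factor_carrier(5)[OF z] factor_invertible(5)[OF z]])
qed

text \<open>\<open>TU\<close>, \<open>TD'\<close> and \<open>TU'\<close> come from the factorization
  for the bottom, \<open>SU\<close>, \<open>SD'\<close> and \<open>SU'\<close> from that for the
  top; \<open>TA\<close> and \<open>TI\<close> are common to both. The powers of \<open>z\<close>
  sit on the minus factors, so that every factor is triangular with respect to the sign of its
  indices.\<close>

abbreviation "TA \<equiv> toeplitz p (\<lambda>z. (z powi (- M)) \<cdot>\<^sub>m \<Phi> z)"
abbreviation "TU \<equiv> toeplitz p \<phi>p"
abbreviation "TD' \<equiv> toeplitz p (\<lambda>z. (z powi M) \<cdot>\<^sub>m mat_inv (\<phi>m z))"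
abbreviation "TU' \<equiv> toeplitz p (\<lambda>z. mat_inv (\<phi>p z))"
abbreviation "SU \<equiv> toeplitz p (\<lambda>z. (z powi (- M)) \<cdot>\<^sub>m \<psi>m z)"
abbreviation "SD' \<equiv> toeplitz p (\<lambda>z. mat_inv (\<psi>p z))"
abbreviation "SU' \<equiv> toeplitz p (\<lambda>z. (z powi M) \<cdot>\<^sub>m mat_inv (\<psi>m z))"
abbreviation "TI \<equiv> toeplitz p (\<lambda>z. (z powi M) \<cdot>\<^sub>m mat_inv (\<Phi> z))"
text \<open>The upper end of the section becomes a lower end under the reflection $u \mapsto -1-u$. This
  exchanges the roles of the plus and minus factors, which is why the top kernel needs the second
  factorization.\<close>

abbreviation reflect :: "(int \<Rightarrow> int \<Rightarrow> complex) \<Rightarrow> int \<Rightarrow> int \<Rightarrow> complex" where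
  "reflect T \<equiv> (\<lambda>u v. T (- 1 - u) (- 1 - v))"

lemma scaled_\<Phi>: "circle_symbol p (\<lambda>z. (z powi (- M)) \<cdot>\<^sub>m \<Phi> z)"
  by (rule circle_symbol_scale[OF symbol_prod_circle]) auto

lemma products:
  "((\<lambda>k. TA u k * TD' k l) has_sum TU u l) UNIV"
  "((\<lambda>l. TU u l * TU' l v) has_sum (if u = v then 1 else 0)) UNIV"
  "((\<lambda>l. TD' u l * TU' l v) has_sum TI u v) UNIV"
  "((\<lambda>k. TA u k * SD' k l) has_sum SU u l) UNIV"
  "((\<lambda>l. SU u l * SU' l v) has_sum (if u = v then 1 else 0)) UNIV"
  "((\<lambda>l. SD' u l * SU' l v) has_sum TI u v) UNIV"
proof -
  note S = smult_cancel_circle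
  note c = factor_carrier and i = factor_identities
  show "((\<lambda>k. TA u k * TD' k l) has_sum TU u l) UNIV"
    by (rule toeplitz_mult_circle[OF p scaled_\<Phi> circle_symbols_scaled(4)]) (simp only: S(1)[OF _ c(1,7)] i(1))
  show "((\<lambda>l. TU u l * TU' l v) has_sum (if u = v then 1 else 0)) UNIV"
    unfolding toeplitz_one[OF p, symmetric]
    by (rule toeplitz_mult_circle[OF p circle_symbols(1,2)]) (simp only: i(3))
  show "((\<lambda>l. TD' u l * TU' l v) has_sum TI u v) UNIV"
    by (rule toeplitz_mult_circle[OF p circle_symbols_scaled(4) circle_symbols(2)]) (simp only: S(3)[OF _ c(7,6)] i(2))
  show "((\<lambda>k. TA u k * SD' k l) has_sum SU u l) UNIV"
    by (rule toeplitz_mult_circle[OF p scaled_\<Phi> circle_symbols(6)]) (simp only: S(3)[OF _ c(1,8)] i(4))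
  show "((\<lambda>l. SU u l * SU' l v) has_sum (if u = v then 1 else 0)) UNIV"
    unfolding toeplitz_one[OF p, symmetric]
    by (rule toeplitz_mult_circle[OF p circle_symbols_scaled(7,8)]) (simp only: S(1)[OF _ c(5,9)] i(6))
  show "((\<lambda>l. SD' u l * SU' l v) has_sum TI u v) UNIV"
    by (rule toeplitz_mult_circle[OF p circle_symbols(6) circle_symbols_scaled(8)]) (simp only: S(4)[OF _ c(8,9)] i(5))
qed

lemma reflected_has_sum: "(f has_sum s) (UNIV :: int set) \<Longrightarrow> ((\<lambda>k. f (- 1 - k)) has_sum (s::complex)) UNIV"
  by (simp add: has_sum_reflect reflect_sets)

text \<open>Both products of inverse factors give \<open>TI\<close>, the Toeplitz matrix of
  \<open>z^M\<close> times the inverse symbol, and this is \<open>same_inv\<close>. After reflection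
  \<open>SD'\<close> and \<open>SU\<close> have the triangularity that \<open>TD'\<close> and
  \<open>TU\<close> have at the lower end.\<close>

lemma finite_section:
  obtains C q where "finite_section TA TU TD' TU' (reflect SU) (reflect SD') (reflect SU') C q p"
proof -
  have dec: "\<exists>C q. 0 < q \<and> q < 1 \<and> decays C q (toeplitz p F)" if "circle_symbol p F" for F
    using toeplitz_decays[OF p that] by metis
  note ds = dec[OF scaled_\<Phi>] circle_symbols(1,2,6)[THEN dec] circle_symbols_scaled(4,7,8)[THEN dec]
  have "\<exists>C q. 0 < q \<and> q < 1 \<and> (\<forall>T\<in>{TA, TU, TD', TU', SU, SD', SU'}. decays C q T)"
    by (rule common_decay, simp, elim insertE emptyE; simp only: ds)
  then obtain C q where q: "0 < q" "q < 1" and d: "decays C q TA" "decays C q TU" "decays C q TD'" "decays C q TU'"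
    "decays C q SU" "decays C q SD'" "decays C q SU'" by auto
  have bot: "wiener_hopf TA TU TD' TU' C q"
  proof
    show "((\<lambda>k. TA u k * TD' k l) has_sum TU u l) UNIV" for u l by (rule products(1))
    show "((\<lambda>l. TU u l * TU' l v) has_sum (if u = v then 1 else 0)) UNIV" for u v by (rule products(2))
    show "TD' k l = 0" if "k < 0" "0 \<le> l" for k l by (rule minus_factor_vanish(2)[OF p minus(1) that])
    show "TU u l = 0" if "0 \<le> u" "l < 0" for u l by (rule plus_factor_vanish(1)[OF p plus(1) that])
  qed (rule q d)+
  have top: "wiener_hopf (reflect TA) (reflect SU) (reflect SD') (reflect SU') C q"
  proof
    show "((\<lambda>k. TA (- 1 - u) (- 1 - k) * SD' (- 1 - k) (- 1 - l)) has_sum SU (- 1 - u) (- 1 - l)) UNIV" for u l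
      by (rule reflected_has_sum[OF products(4)])
    show "((\<lambda>l. SU (- 1 - u) (- 1 - l) * SU' (- 1 - l) (- 1 - v)) has_sum (if u = v then 1 else 0)) UNIV" for u v
      using reflected_has_sum[OF products(5)[of "- 1 - u" "- 1 - v"]] by simp
    show "SD' (- 1 - k) (- 1 - l) = 0" if "k < 0" "0 \<le> l" for k l
      using plus_factor_vanish(2)[OF p plus(2)] that by simp
    show "SU (- 1 - u) (- 1 - l) = 0" if "0 \<le> u" "l < 0" for u l
      using minus_factor_vanish(1)[OF p minus(2)] that by simp
  qed (rule q d[THEN decays_reflect])+
  interpret bot: wiener_hopf TA TU TD' TU' C q by (rule bot)
  interpret top: wiener_hopf "reflect TA" "reflect SU" "reflect SD'" "reflect SU'" C q by (rule top)
  have b: "bot.full_inv u v = TI u v" for u v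
    unfolding bot.full_inv_def by (rule infsumI[OF products(3)])
  have t: "top.full_inv u v = TI (- 1 - u) (- 1 - v)" for u v
    unfolding top.full_inv_def by (rule infsumI[OF reflected_has_sum[OF products(6)]])
  have "finite_section TA TU TD' TU' (reflect SU) (reflect SD') (reflect SU') C q p"
  proof
    show "top.full_inv u v = bot.full_inv (- 1 - u) (- 1 - v)" for u v by (simp only: b t)
    show "TA (u + int p * k) (v + int p * k) = TA u v" for u v k by (rule toeplitz_shift[OF p])
    show "bot.full_inv (u + int p * k) (v + int p * k) = bot.full_inv u v" for u v k
      unfolding b by (rule toeplitz_shift[OF p])
  qed (rule p)
  then show ?thesis by (rule that)
qed

section \<open>Limits of the kernels\<close>

definition "int_inv n u v = inv_coeff n (nat u) (nat v)"

lemma sum_int: "(\<Sum>j<k. f (int j)) = (\<Sum>j\<in>{0..<int k}. f j)"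
proof -
  have "{0..<int k} = int ` {..<k}" using image_int_atLeastLessThan[of 0 k] by (simp add: lessThan_atLeast0)
  then show ?thesis by (simp add: sum.reindex)
qed

lemma TA_entry: "TA u v = PP 0 N u (int p * M + v)"
  by (rule toeplitz_scale[OF p factor_carrier(1)])

lemma int_inv:
  assumes n: "1 \<le> n" and uv: "u \<in> {0..<int (p * n)}" "v \<in> {0..<int (p * n)}"
  shows "(\<Sum>w\<in>{0..<int (p * n)}. int_inv n u w * TA w v) = (if u = v then 1 else 0)"
proof -
  have "(\<Sum>w\<in>{0..<int (p * n)}. int_inv n u w * TA w v) = (\<Sum>k<p * n. inv_coeff n (nat u) k * PP 0 N (int k) (endpoint (nat v)))"
    unfolding sum_int[symmetric] using uv by (simp add: int_inv_def TA_entry)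
  also have "\<dots> = (if nat u = nat v then 1 else 0)"
    using uv by (intro inv_coeff(3)[OF n]) (auto simp: nat_less_iff)
  finally show ?thesis using uv by (simp add: eq_nat_nat_iff)
qed

lemma em_corr_int: "em_corr n (m, u) (m', u') = - (if m > m' then PP m' m u' u else 0) +
   (\<Sum>j\<in>{0..<int (p * n)}. \<Sum>i\<in>{0..<int (p * n)}. PP m' N u' (int p * M + j) * int_inv n j i * PP 0 m i u)"
  unfolding em_corr_altdef sum_int[symmetric] by (simp add: int_inv_def)

lemma transition_summable:
  assumes "m \<le> l" "l \<le> N"
  shows "(\<lambda>j. norm (PP m l u (int p * M + j))) summable_on A" "(\<lambda>i. norm (PP m l i u)) summable_on A"
    "(\<lambda>j. norm (PP m l u (int p * M + (- 1 - j)))) summable_on {0..}" "(\<lambda>i. norm (PP m l (- 1 - i) u)) summable_on {0..}"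
proof -
  obtain C q where q: "0 < q" "q < 1" and d: "decays C q (PP m l)" using toeplitz_decays[OF p symbol_prod_circle[OF assms]] .
  have q0: "0 \<le> q" using q by simp
  have "(\<lambda>j. norm (PP m l u j)) summable_on (\<lambda>j. int p * M + j) ` UNIV" by (rule decays_row(1)[OF d q0 q(2)])
  then have r: "(\<lambda>j. norm (PP m l u (int p * M + j))) summable_on UNIV"
    by (subst (asm) summable_on_reindex) (auto simp: o_def)
  then show "(\<lambda>j. norm (PP m l u (int p * M + j))) summable_on A" for A by (rule summable_on_subset_banach) auto
  have c: "(\<lambda>i. norm (PP m l i u)) summable_on UNIV" by (rule decays_col(1)[OF d q0 q(2)])
  then show "(\<lambda>i. norm (PP m l i u)) summable_on A" for A by (rule summable_on_subset_banach) auto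
  have R: "(\<lambda>j. f (- 1 - j)) summable_on {0..}" if f: "f summable_on UNIV" for f :: "int \<Rightarrow> real"
  proof -
    have "f summable_on (\<lambda>k. - 1 - k) ` {0..}" by (rule summable_on_subset_banach[OF f]) auto
    then show ?thesis by (subst (asm) summable_on_reindex) (auto simp: o_def inj_on_def)
  qed
  show "(\<lambda>j. norm (PP m l u (int p * M + (- 1 - j)))) summable_on {0..}" by (rule R[OF r])
  show "(\<lambda>i. norm (PP m l (- 1 - i) u)) summable_on {0..}" by (rule R[OF c])
qed

lemma scaled_row: "m \<le> N \<Longrightarrow> PP m N u (int p * M + j) = toeplitz p (\<lambda>z. (z powi (- M)) \<cdot>\<^sub>m \<phi>\<phi> m N z) u j"
  by (rule toeplitz_scale[OF p, symmetric]) (auto intro: symbol_prod_carrier circle_annulus)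

text \<open>The transitions to the end and from the start combine with the triangular inverses into
  the product symbols that form the integrands of the limiting kernels.\<close>

lemma outer_products:
  assumes m: "m \<le> N" "m' \<le> N"
  shows "((\<lambda>j. PP m' N u' (int p * M + j) * TD' j l) has_sum toeplitz p (\<lambda>z. \<phi>\<phi> m' N z * mat_inv (\<phi>m z)) u' l) UNIV"
    and "((\<lambda>i. TU' l i * PP 0 m i u) has_sum toeplitz p (\<lambda>z. mat_inv (\<phi>p z) * \<phi>\<phi> 0 m z) l u) UNIV"
    and "((\<lambda>j. PP m' N u' (int p * M + j) * SD' j l) has_sum toeplitz p (\<lambda>z. \<phi>\<phi> m' N z * mat_inv (\<psi>p z)) u' (int p * M + l)) UNIV"
    and "((\<lambda>i. SU' l i * PP 0 m i u) has_sum toeplitz p (\<lambda>z. mat_inv (\<psi>m z) * \<phi>\<phi> 0 m z) (int p * M + l) u) UNIV"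
proof -
  note S = smult_cancel_circle and c = factor_carrier
  have cm: "\<phi>\<phi> m' N z \<in> carrier_mat p p" "\<phi>\<phi> 0 m z \<in> carrier_mat p p" if "norm z = 1" for z
    using m circle_annulus[OF that] by (auto intro: symbol_prod_carrier)
  have s: "circle_symbol p (\<phi>\<phi> m' N)" "circle_symbol p (\<phi>\<phi> 0 m)" using m by (auto intro: symbol_prod_circle)
  show "((\<lambda>j. PP m' N u' (int p * M + j) * TD' j l) has_sum toeplitz p (\<lambda>z. \<phi>\<phi> m' N z * mat_inv (\<phi>m z)) u' l) UNIV"
    unfolding scaled_row[OF m(2)]
    by (rule toeplitz_mult_circle[OF p circle_symbol_scale[OF s(1)] circle_symbols_scaled(4)]) (simp only: S(1)[OF _ cm(1) c(7)])
  show "((\<lambda>i. TU' l i * PP 0 m i u) has_sum toeplitz p (\<lambda>z. mat_inv (\<phi>p z) * \<phi>\<phi> 0 m z) l u) UNIV"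
    by (rule toeplitz_mult_circle[OF p circle_symbols(2) s(2)]) (rule refl)
  have e: "toeplitz p (\<lambda>z. \<phi>\<phi> m' N z * mat_inv (\<psi>p z)) u' (int p * M + l) =
    toeplitz p (\<lambda>z. (z powi (- M)) \<cdot>\<^sub>m (\<phi>\<phi> m' N z * mat_inv (\<psi>p z))) u' l"
    by (rule toeplitz_scale[OF p, symmetric]) (rule mult_carrier_mat[OF cm(1) c(8)], assumption+)
  show "((\<lambda>j. PP m' N u' (int p * M + j) * SD' j l) has_sum toeplitz p (\<lambda>z. \<phi>\<phi> m' N z * mat_inv (\<psi>p z)) u' (int p * M + l)) UNIV"
    unfolding scaled_row[OF m(2)] e
    by (rule toeplitz_mult_circle[OF p circle_symbol_scale[OF s(1)] circle_symbols(6)]) (simp only: S(3)[OF _ cm(1) c(8)])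
  \<comment> \<open>Scaling by \<open>z^M\<close> moves the column by \<open>- p * M\<close>;
    translating both indices by \<open>p * M\<close> moves this shift to the row, where
    \<open>top_integral\<close> expects it.\<close>
  have "toeplitz p (\<lambda>z. (z powi (- (- M))) \<cdot>\<^sub>m (mat_inv (\<psi>m z) * \<phi>\<phi> 0 m z)) l u =
      toeplitz p (\<lambda>z. mat_inv (\<psi>m z) * \<phi>\<phi> 0 m z) l (int p * (- M) + u)"
    by (rule toeplitz_scale[OF p]) (rule mult_carrier_mat[OF c(9) cm(2)], assumption+)
  also have "\<dots> = toeplitz p (\<lambda>z. mat_inv (\<psi>m z) * \<phi>\<phi> 0 m z) (l + int p * M) ((int p * (- M) + u) + int p * M)"
    by (rule toeplitz_shift[OF p, symmetric])
  finally have e: "toeplitz p (\<lambda>z. (z powi M) \<cdot>\<^sub>m (mat_inv (\<psi>m z) * \<phi>\<phi> 0 m z)) l u =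
      toeplitz p (\<lambda>z. mat_inv (\<psi>m z) * \<phi>\<phi> 0 m z) (int p * M + l) u" by (simp add: algebra_simps)
  show "((\<lambda>i. SU' l i * PP 0 m i u) has_sum toeplitz p (\<lambda>z. mat_inv (\<psi>m z) * \<phi>\<phi> 0 m z) (int p * M + l) u) UNIV"
    unfolding e[symmetric]
    by (rule toeplitz_mult_circle[OF p circle_symbols_scaled(8) s(2)]) (simp only: S(3)[OF _ c(9) cm(2)])
qed

lemma factor_regular:
  "regular_between p r 1 (\<lambda>z. mat_inv (\<phi>p z))" "regular_between p r 1 (\<lambda>z. mat_inv (\<psi>p z))"
  "regular_between p 1 r (\<lambda>z. mat_inv (\<phi>m z))" "regular_between p 1 r (\<lambda>z. mat_inv (\<psi>m z))"
  using plus minus by (auto simp: plus_factor_def minus_factor_def intro!: regular_plus regular_minus)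

lemma prod_regular:
  assumes "m \<le> l" "l \<le> N"
  shows "regular_between p a 1 (\<phi>\<phi> m l)" "regular_between p 1 b (\<phi>\<phi> m l)"
  using annulus_regular[OF symbol_prod_holomorphic[OF assms]] ab \<rho> by auto

lemma radii: "a \<noteq> 0" "0 < a" "\<And>z. norm z = a \<Longrightarrow> z \<in> annulus \<rho>" "\<And>z. norm z = b \<Longrightarrow> z \<in> annulus \<rho>"
  using ab \<rho> by (auto simp: annulus_def intro: less_trans)

lemma sphere_carrier:
  "norm z = a \<Longrightarrow> mat_inv (\<phi>p z) \<in> carrier_mat p p" "norm z = a \<Longrightarrow> mat_inv (\<psi>p z) \<in> carrier_mat p p"
  "norm z = b \<Longrightarrow> mat_inv (\<phi>m z) \<in> carrier_mat p p" "norm z = b \<Longrightarrow> mat_inv (\<psi>m z) \<in> carrier_mat p p"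
  using plus minus ab by (auto simp: plus_factor_def minus_factor_def mat_continuous_on_def)

lemma mat_mult_regroup:
  fixes A B C D :: "complex mat"
  assumes "A \<in> carrier_mat p p" "B \<in> carrier_mat p p" "C \<in> carrier_mat p p" "D \<in> carrier_mat p p"
  shows "A * B * C * D = (A * B) * (C * D)"
  using assms by (metis assoc_mult_mat mult_carrier_mat)

lemma K_bottom_limit:
  assumes s: "s \<in> sites N" "s' \<in> sites N"
  shows "(\<lambda>n. em_corr n s s') \<longlonglongrightarrow> K_bottom p N \<phi> \<phi>p \<phi>m a b s s'"
proof -
  obtain m u m' u' where mu: "s = (m, u)" "s' = (m', u')" and m: "1 \<le> m" "m < N" "1 \<le> m'" "m' < N"
    using s by (auto simp: sites_def)
  have mN: "m \<le> N" "m' \<le> N" using m by auto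
  let ?i = "nat (u' mod int p)" and ?j = "nat (u mod int p)"
  have ij: "?i < p" "?j < p" using mod_index_less[OF p] by auto
  have e: "int p * (u' div int p) + int ?i = u'" "int p * (u div int p) + int ?j = u" using p by auto
  let ?x = "\<lambda>j. PP m' N u' (int p * M + j)" and ?y = "\<lambda>i. PP 0 m i u"
  obtain C q where "finite_section TA TU TD' TU' (reflect SU) (reflect SD') (reflect SU') C q p" using finite_section .
  then interpret fs: finite_section TA TU TD' TU' "reflect SU" "reflect SD'" "reflect SU'" C q p .
  have xs: "(\<lambda>j. norm (?x j)) summable_on {0..}" "(\<lambda>i. norm (?y i)) summable_on {0..}"
    using transition_summable m by auto
  let ?L = "toeplitz p (\<lambda>z. \<phi>\<phi> m' N z * mat_inv (\<phi>m z))" and ?R = "toeplitz p (\<lambda>z. mat_inv (\<phi>p z) * \<phi>\<phi> 0 m z)"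
  let ?I = "circ_int p b (\<lambda>w. circ_int p a (\<lambda>z. (w powi (u' div int p) / (z powi (u div int p + 1) * (z - w))) \<cdot>\<^sub>m
       (\<phi>\<phi> m' N w * mat_inv (\<phi>m w) * mat_inv (\<phi>p z) * \<phi>\<phi> 0 m z)))"
  have "(\<lambda>n. \<Sum>j\<in>{0..<int (p * n)}. \<Sum>i\<in>{0..<int (p * n)}. ?x j * int_inv n j i * ?y i) \<longlonglongrightarrow>
      (\<Sum>\<^sub>\<infinity>(j,i)\<in>{0..} \<times> {0..}. ?x j * fs.bot.half_inv j i * ?y i)"
    using fs.double_sum_tendsto[of int_inv ?x ?y "\<lambda>n u. u" fs.bot.half_inv, OF int_inv xs _ fs.inverse_tendsto(1)[OF int_inv]]
    by (simp add: bij_betw_def)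
  also have "(\<Sum>\<^sub>\<infinity>(j,i)\<in>{0..} \<times> {0..}. ?x j * fs.bot.half_inv j i * ?y i) =
      (\<Sum>\<^sub>\<infinity>l\<in>{0..}. (\<Sum>\<^sub>\<infinity>j\<in>{0..}. ?x j * TD' j l) * (\<Sum>\<^sub>\<infinity>i\<in>{0..}. TU' l i * ?y i))"
    by (rule fs.bot.half_inv_bilinear[OF xs])
  also have "\<dots> = (\<Sum>\<^sub>\<infinity>l\<in>{0..}. ?L u' l * ?R l u)"
  proof (rule infsum_cong)
    \<comment> \<open>For this \<open>l\<close> the entries of \<open>TD'\<close> with negative row
      and those of \<open>TU'\<close> with negative column vanish, so the half-line sums are full
      sums and \<open>outer_products\<close> applies.\<close>
    fix l :: int assume l: "l \<in> {0..}"
    have "(\<Sum>\<^sub>\<infinity>j\<in>{0..}. ?x j * TD' j l) = ?L u' l"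
      by (rule infsumI, rule has_sum_half[OF outer_products(1)[OF mN]])
        (use minus_factor_vanish(2)[OF p minus(1)] l in auto)
    moreover have "(\<Sum>\<^sub>\<infinity>i\<in>{0..}. TU' l i * ?y i) = ?R l u"
      by (rule infsumI, rule has_sum_half[OF outer_products(2)[OF mN]])
        (use plus_factor_vanish(2)[OF p plus(1)] l in auto)
    ultimately show "(\<Sum>\<^sub>\<infinity>j\<in>{0..}. ?x j * TD' j l) * (\<Sum>\<^sub>\<infinity>i\<in>{0..}. TU' l i * ?y i) = ?L u' l * ?R l u" by simp
  qed
  also have "\<dots> = - ?I $$ (?i, ?j)"
  proof (rule infsumI)
    have "((\<lambda>l. ?L (int p * (u' div int p) + int ?i) l * ?R l (int p * (u div int p) + int ?j)) has_sum - ?I $$ (?i, ?j)) {0..}"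
    proof (rule bottom_integral[OF p radii(2) ab(2,3) _ _ ij])
      show "regular_between p 1 b (\<lambda>z. \<phi>\<phi> m' N z * mat_inv (\<phi>m z))" using mN by (intro regular_between_mult prod_regular factor_regular) auto
      show "regular_between p a 1 (\<lambda>z. mat_inv (\<phi>p z) * \<phi>\<phi> 0 m z)" using mN by (intro regular_between_mult prod_regular factor_regular) auto
      show "\<phi>\<phi> m' N w * mat_inv (\<phi>m w) * mat_inv (\<phi>p z) * \<phi>\<phi> 0 m z = (\<phi>\<phi> m' N w * mat_inv (\<phi>m w)) * (mat_inv (\<phi>p z) * \<phi>\<phi> 0 m z)"
        if "norm w = b" "norm z = a" for w z
        using that mN by (intro mat_mult_regroup sphere_carrier symbol_prod_carrier radii) auto
    qed
    then show "((\<lambda>l. ?L u' l * ?R l u) has_sum - ?I $$ (?i, ?j)) {0..}" unfolding e .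
  qed
  finally have lim: "(\<lambda>n. \<Sum>j\<in>{0..<int (p * n)}. \<Sum>i\<in>{0..<int (p * n)}. ?x j * int_inv n j i * ?y i) \<longlonglongrightarrow> - ?I $$ (?i, ?j)" .
  have K: "K_bottom p N \<phi> \<phi>p \<phi>m a b s s' = - (if m > m' then PP m' m u' u else 0) + - ?I $$ (?i, ?j)"
    using transition_block_toeplitz[of m' m u u'] transition_block_dim[of m "u div int p" m' "u' div int p"] m ij
    by (simp add: K_bottom_def kernel_of_blocks_def mu circ_int_def) (simp add: transition_block_def circ_int_def)
  show ?thesis unfolding K unfolding mu em_corr_int by (intro tendsto_add tendsto_const lim)
qed

text \<open>Shifting the heights by \<open>p * n\<close> and counting the summation indices from the
  upper end cancel by block periodicity of the transitions. Only the inverse matrix still depends on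
  \<open>n\<close>, and its entries near the upper end converge.\<close>

lemma K_top_limit:
  assumes s: "(m, u) \<in> sites N" "(m', u') \<in> sites N"
  shows "(\<lambda>n. em_corr n (m, u + int p * int n) (m', u' + int p * int n)) \<longlonglongrightarrow> K_top p M N \<phi> \<psi>p \<psi>m a b (m, u) (m', u')"
proof -
  have m: "1 \<le> m" "m < N" "1 \<le> m'" "m' < N" using s by (auto simp: sites_def)
  then have mN: "m \<le> N" "m' \<le> N" by auto
  let ?i = "nat (u' mod int p)" and ?j = "nat (u mod int p)"
  have ij: "?i < p" "?j < p" using mod_index_less[OF p] by auto
  have e: "int p * (u' div int p) + int ?i = u'" "int p * (u div int p) + int ?j = u" using p by auto
  let ?x = "\<lambda>j. PP m' N u' (int p * M + (- 1 - j))" and ?y = "\<lambda>i. PP 0 m (- 1 - i) u"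
  obtain C q where "finite_section TA TU TD' TU' (reflect SU) (reflect SD') (reflect SU') C q p" using finite_section .
  then interpret fs: finite_section TA TU TD' TU' "reflect SU" "reflect SD'" "reflect SU'" C q p .
  have xs: "(\<lambda>j. norm (?x j)) summable_on {0..}" "(\<lambda>i. norm (?y i)) summable_on {0..}"
    using transition_summable(3,4) m by auto
  let ?L = "toeplitz p (\<lambda>z. \<phi>\<phi> m' N z * mat_inv (\<psi>p z))" and ?R = "toeplitz p (\<lambda>z. mat_inv (\<psi>m z) * \<phi>\<phi> 0 m z)"
  let ?I = "circ_int p a (\<lambda>w. circ_int p b (\<lambda>z. (w powi (u' div int p - M) / (z powi (u div int p - M + 1) * (z - w))) \<cdot>\<^sub>m
       (\<phi>\<phi> m' N w * mat_inv (\<psi>p w) * mat_inv (\<psi>m z) * \<phi>\<phi> 0 m z)))"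
  \<comment> \<open>Counting from the upper end: 0 is sent to the last index
    \<open>p * n - 1\<close> of the section.\<close>
  let ?h = "\<lambda>n u. int (p * n) - 1 - u"
  have h: "bij_betw (?h n) {0..<int (p * n)} {0..<int (p * n)}" for n
    by (rule bij_betw_byWitness[of _ "?h n"]) auto
  have "(\<lambda>n. \<Sum>j\<in>{0..<int (p * n)}. \<Sum>i\<in>{0..<int (p * n)}. ?x j * int_inv n (?h n j) (?h n i) * ?y i) \<longlonglongrightarrow>
      (\<Sum>\<^sub>\<infinity>(j,i)\<in>{0..} \<times> {0..}. ?x j * fs.top.half_inv j i * ?y i)"
    using fs.double_sum_tendsto[of int_inv ?x ?y ?h fs.top.half_inv, OF int_inv xs h fs.inverse_tendsto(2)[OF int_inv]] .
  also have "(\<Sum>\<^sub>\<infinity>(j,i)\<in>{0..} \<times> {0..}. ?x j * fs.top.half_inv j i * ?y i) =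
      (\<Sum>\<^sub>\<infinity>l\<in>{0..}. (\<Sum>\<^sub>\<infinity>j\<in>{0..}. ?x j * SD' (- 1 - j) (- 1 - l)) * (\<Sum>\<^sub>\<infinity>i\<in>{0..}. SU' (- 1 - l) (- 1 - i) * ?y i))"
    by (rule fs.top.half_inv_bilinear[OF xs])
  also have "\<dots> = (\<Sum>\<^sub>\<infinity>l\<in>{0..}. ?L u' (int p * M + (- 1 - l)) * ?R (int p * M + (- 1 - l)) u)"
  proof (rule infsum_cong)
    fix l :: int assume l: "l \<in> {0..}"
    have "(\<Sum>\<^sub>\<infinity>j\<in>{0..}. ?x j * SD' (- 1 - j) (- 1 - l)) = ?L u' (int p * M + (- 1 - l))"
      by (rule infsumI, rule has_sum_half[OF reflected_has_sum[OF outer_products(3)[OF mN]]])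
        (use plus_factor_vanish(2)[OF p plus(2)] l in auto)
    moreover have "(\<Sum>\<^sub>\<infinity>i\<in>{0..}. SU' (- 1 - l) (- 1 - i) * ?y i) = ?R (int p * M + (- 1 - l)) u"
      by (rule infsumI, rule has_sum_half[OF reflected_has_sum[OF outer_products(4)[OF mN]]])
        (use minus_factor_vanish(2)[OF p minus(2)] l in auto)
    ultimately show "(\<Sum>\<^sub>\<infinity>j\<in>{0..}. ?x j * SD' (- 1 - j) (- 1 - l)) * (\<Sum>\<^sub>\<infinity>i\<in>{0..}. SU' (- 1 - l) (- 1 - i) * ?y i) =
      ?L u' (int p * M + (- 1 - l)) * ?R (int p * M + (- 1 - l)) u" by simp
  qed
  also have "\<dots> = ?I $$ (?i, ?j)"
  proof (rule infsumI)
    have "((\<lambda>l. ?L (int p * (u' div int p) + int ?i) (int p * M + l) * ?R (int p * M + l) (int p * (u div int p) + int ?j)) has_sum ?I $$ (?i, ?j)) {..<0}"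
    proof (rule top_integral[OF p radii(2) ab(2,3) _ _ ij])
      show "regular_between p a 1 (\<lambda>z. \<phi>\<phi> m' N z * mat_inv (\<psi>p z))" using mN by (intro regular_between_mult prod_regular factor_regular) auto
      show "regular_between p 1 b (\<lambda>z. mat_inv (\<psi>m z) * \<phi>\<phi> 0 m z)" using mN by (intro regular_between_mult prod_regular factor_regular) auto
      show "\<phi>\<phi> m' N w * mat_inv (\<psi>p w) * mat_inv (\<psi>m z) * \<phi>\<phi> 0 m z = (\<phi>\<phi> m' N w * mat_inv (\<psi>p w)) * (mat_inv (\<psi>m z) * \<phi>\<phi> 0 m z)"
        if "norm w = a" "norm z = b" for w z
        using that mN by (intro mat_mult_regroup sphere_carrier symbol_prod_carrier radii) auto
    qed
    then show "((\<lambda>l. ?L u' (int p * M + (- 1 - l)) * ?R (int p * M + (- 1 - l)) u) has_sum ?I $$ (?i, ?j)) {0..}"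
      unfolding e
      by (rule iffD2[OF has_sum_reflect[where A="{0..}" and f="\<lambda>l. ?L u' (int p * M + l) * ?R (int p * M + l) u", unfolded reflect_sets]])
  qed
  finally have lim: "(\<lambda>n. \<Sum>j\<in>{0..<int (p * n)}. \<Sum>i\<in>{0..<int (p * n)}. ?x j * int_inv n (?h n j) (?h n i) * ?y i) \<longlonglongrightarrow> ?I $$ (?i, ?j)" .
  have K: "K_top p M N \<phi> \<psi>p \<psi>m a b (m, u) (m', u') = - (if m > m' then PP m' m u' u else 0) + ?I $$ (?i, ?j)"
    using transition_block_toeplitz[of m' m u u'] transition_block_dim[of m "u div int p" m' "u' div int p"] m ij
    by (simp add: K_top_def kernel_of_blocks_def circ_int_def) (simp add: transition_block_def circ_int_def)
  \<comment> \<open>Both sums are reversed by \<open>?h\<close>, and translation of both arguments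
    by \<open>p * n\<close> leaves every transition unchanged.\<close>
  have E: "em_corr n (m, u + int p * int n) (m', u' + int p * int n) = - (if m > m' then PP m' m u' u else 0) +
     (\<Sum>j\<in>{0..<int (p * n)}. \<Sum>i\<in>{0..<int (p * n)}. ?x j * int_inv n (?h n j) (?h n i) * ?y i)" for n
  proof -
    let ?f = "\<lambda>j i. PP m' N (u' + int p * int n) (int p * M + j) * int_inv n j i * PP 0 m i (u + int p * int n)"
    have x: "?x j = PP m' N (u' + int p * int n) (int p * M + ?h n j)" for j
      using toeplitz_shift[OF p, of "\<phi>\<phi> m' N" u' "int n" "int p * M + (- 1 - j)"] by (simp add: algebra_simps)
    have y: "?y i = PP 0 m (?h n i) (u + int p * int n)" for i
      using toeplitz_shift[OF p, of "\<phi>\<phi> 0 m" "- 1 - i" "int n" u] by (simp add: algebra_simps)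
    have "(\<Sum>j\<in>{0..<int (p * n)}. \<Sum>i\<in>{0..<int (p * n)}. ?x j * int_inv n (?h n j) (?h n i) * ?y i) =
      (\<Sum>j\<in>{0..<int (p * n)}. \<Sum>i\<in>{0..<int (p * n)}. ?f (?h n j) (?h n i))"
      unfolding x y ..
    also have "\<dots> = (\<Sum>j\<in>{0..<int (p * n)}. \<Sum>i\<in>{0..<int (p * n)}. ?f (?h n j) i)"
      by (rule sum.cong[OF refl], rule sum.reindex_bij_betw[OF h])
    also have "\<dots> = (\<Sum>j\<in>{0..<int (p * n)}. \<Sum>i\<in>{0..<int (p * n)}. ?f j i)"
      by (rule sum.reindex_bij_betw[OF h])
    finally show ?thesis unfolding em_corr_int toeplitz_shift[OF p] by simp
  qed
  show ?thesis unfolding K unfolding E by (intro tendsto_add tendsto_const lim)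
qed

end

section \<open>The process seen from the top\<close>

lemma set_det_image:
  assumes S: "finite S" and inj: "inj \<sigma>"
  shows "set_det (\<sigma> ` S) M = set_det S (\<lambda>s t. M (\<sigma> s) (\<sigma> t))"
proof -
  obtain ss where ss: "set ss = S" "distinct ss" using finite_distinct_list[OF S] by blast
  have d: "distinct (map \<sigma> ss)" "set (map \<sigma> ss) = \<sigma> ` S"
    using ss inj by (auto simp: distinct_map intro: inj_on_subset)
  have "set_det (\<sigma> ` S) M = Determinant.det (Matrix.mat (length ss) (length ss) (\<lambda>(x,y). M (map \<sigma> ss ! x) (map \<sigma> ss ! y)))"
    using set_det_list[OF d, of M] by simp
  also have "\<dots> = Determinant.det (Matrix.mat (length ss) (length ss) (\<lambda>(x,y). M (\<sigma> (ss ! x)) (\<sigma> (ss ! y))))"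
    by (rule arg_cong[of _ _ Determinant.det]) (auto intro!: eq_matI)
  also have "\<dots> = set_det S (\<lambda>s t. M (\<sigma> s) (\<sigma> t))"
    by (rule set_det_list[OF ss(2,1), of "\<lambda>s t. M (\<sigma> s) (\<sigma> t)"])
  finally show ?thesis .
qed

lemma mixed_minor_image:
  assumes fin: "finite B" "finite C" and inj: "inj \<sigma>"
  shows "mixed_minor K (\<sigma> ` B) (\<sigma> ` C) = mixed_minor (\<lambda>s t. K (\<sigma> s) (\<sigma> t)) B C"
proof -
  have e: "\<sigma> s \<in> \<sigma> ` B \<longleftrightarrow> s \<in> B" "\<sigma> s = \<sigma> t \<longleftrightarrow> s = t" for s t using inj by (auto simp: inj_def)
  have "finite (B \<union> C)" using fin by simp
  from set_det_image[OF this inj] show ?thesis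
    unfolding mixed_minor_def image_Un[symmetric] by (simp add: e cong: if_cong)
qed

abbreviation shift_up :: "int \<Rightarrow> nat \<times> int \<Rightarrow> nat \<times> int" where
  "shift_up h \<equiv> \<lambda>(m, u). (m, u + h)"

lemma inj_shift_up: "inj (shift_up h)"
  by (auto simp: inj_def)

lemma shift_up_sites: "shift_up h s \<in> sites N \<longleftrightarrow> s \<in> sites N"
  by (auto simp: sites_def split: prod.split)

lemma shift_down_mem: "s \<in> shift_down h X \<longleftrightarrow> shift_up h s \<in> X"
  by (cases s) (force simp: shift_down_def)

lemma shift_down_event:
  assumes "B \<subseteq> A"
  shows "shift_down h X \<inter> A = B \<longleftrightarrow> X \<inter> shift_up h ` A = shift_up h ` B"
proof -
  have "shift_down h X \<inter> A = B \<longleftrightarrow> (\<forall>s\<in>A. s \<in> shift_down h X \<longleftrightarrow> s \<in> B)" using assms by blast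
  also have "\<dots> \<longleftrightarrow> (\<forall>s\<in>A. shift_up h s \<in> X \<longleftrightarrow> shift_up h s \<in> shift_up h ` B)"
    by (simp only: shift_down_mem inj_image_mem_iff[OF inj_shift_up])
  also have "\<dots> \<longleftrightarrow> X \<inter> shift_up h ` A = shift_up h ` B" using assms by blast
  finally show ?thesis .
qed

context toeplitz_model
begin

lemma model_event: "{X \<in> space (model p M N \<phi> n). X \<inter> A = B} \<in> sets (model p M N \<phi> n)"
  unfolding model_sets by auto

lemma shift_down_measurable: "shift_down h \<in> measurable (model p M N \<phi> n) (config_space (sites N))"
proof (rule measurableI)
  fix X assume "X \<in> space (model p M N \<phi> n)"
  then have "X \<subseteq> sites N" by (auto simp: model_sets configs_def)
  then show "shift_down h X \<in> space (config_space (sites N))"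
    unfolding space_config_space using shift_down_mem shift_up_sites by blast
qed (auto simp: model_sets)

text \<open>Patterns of the shifted set are patterns of the model at shifted sites, so the kernel is
  merely reindexed along an injection.\<close>

lemma shifted_correlations:
  fixes h :: int
  assumes n: "n \<ge> 1" and A: "finite A" "A \<subseteq> sites N" "B \<subseteq> A"
  defines "Q \<equiv> distr (model p M N \<phi> n) (config_space (sites N)) (shift_down h)"
  shows "complex_of_real (measure Q {X \<in> space Q. X \<inter> A = B}) =
    mixed_minor (\<lambda>s t. em_corr n (shift_up h s) (shift_up h t)) B (A - B)"
proof -
  have sp: "space Q = Pow (sites N)" by (simp add: Q_def space_config_space)
  have "measure Q {X \<in> space Q. X \<inter> A = B} =
      measure (model p M N \<phi> n) (shift_down h -` {X \<in> Pow (sites N). X \<inter> A = B} \<inter> space (model p M N \<phi> n))"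
    unfolding sp unfolding Q_def by (rule measure_distr[OF shift_down_measurable config_space_event[OF A]])
  also have "shift_down h -` {X \<in> Pow (sites N). X \<inter> A = B} \<inter> space (model p M N \<phi> n) =
      {X \<in> configs p N n. X \<inter> shift_up h ` A = shift_up h ` B}"
    using measurable_space[OF shift_down_measurable, of _ n h]
    by (auto simp: model_sets shift_down_event[OF A(3)] space_config_space)
  also have "complex_of_real (measure (model p M N \<phi> n) \<dots>) =
      mixed_minor (em_corr n) (shift_up h ` B) (shift_up h ` A - shift_up h ` B)"
    using A shift_up_sites by (intro model_correlations[OF n]) blast+
  also have "shift_up h ` A - shift_up h ` B = shift_up h ` (A - B)"
    by (rule image_set_diff[OF inj_shift_up, symmetric])
  also have "mixed_minor (em_corr n) (shift_up h ` B) (shift_up h ` (A - B)) =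
      mixed_minor (\<lambda>s t. em_corr n (shift_up h s) (shift_up h t)) B (A - B)"
    by (rule mixed_minor_image[OF _ _ inj_shift_up]) (use A finite_subset in auto)
  finally show ?thesis .
qed

end

context factored_model
begin

text \<open>The two kernels agree from \<open>n = 1\<close> on, which is all that a limit
  sees.\<close>

lemma K_fin_tendsto_iff:
  assumes "\<And>n. s n \<in> sites N" "\<And>n. s' n \<in> sites N"
  shows "(\<lambda>n. K_fin p M N \<phi> n (s n) (s' n)) \<longlonglongrightarrow> l \<longleftrightarrow> (\<lambda>n. em_corr n (s n) (s' n)) \<longlonglongrightarrow> l"
  by (rule tendsto_cong, rule eventually_sequentiallyI[of 1]) (rule K_fin_em_corr[OF _ assms])

lemma bottom_process: "converges_to_determinantal (sites N) (\<lambda>n. model p M N \<phi> n) (K_bottom p N \<phi> \<phi>p \<phi>m a b)"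
  by (rule converges_to_determinantalI[where K = em_corr, OF model_prob model_event _ K_bottom_limit])
    (auto simp: model_sets model_correlations)

lemma top_process: "converges_to_determinantal (sites N)
    (\<lambda>n. distr (model p M N \<phi> n) (config_space (sites N)) (shift_down (int p * int n))) (K_top p M N \<phi> \<psi>p \<psi>m a b)"
proof (rule converges_to_determinantalI[where
      K = "\<lambda>n s t. em_corr n (shift_up (int p * int n) s) (shift_up (int p * int n) t)"])
  fix n :: nat assume n: "n \<ge> 1"
  interpret prob_space "model p M N \<phi> n" by (rule model_prob[OF n])
  show "prob_space (distr (model p M N \<phi> n) (config_space (sites N)) (shift_down (int p * int n)))"
    by (rule prob_space_distr[OF shift_down_measurable])
next
  fix n :: nat and A B assume "finite A" "A \<subseteq> sites N" "B \<subseteq> A"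
  then show "{X \<in> space (distr (model p M N \<phi> n) (config_space (sites N)) (shift_down (int p * int n))). X \<inter> A = B}
      \<in> sets (distr (model p M N \<phi> n) (config_space (sites N)) (shift_down (int p * int n)))"
    using config_space_event by (simp add: space_config_space)
next
  fix s t assume "s \<in> sites N" "t \<in> sites N"
  then show "(\<lambda>n. em_corr n (shift_up (int p * int n) s) (shift_up (int p * int n) t)) \<longlonglongrightarrow> K_top p M N \<phi> \<psi>p \<psi>m a b s t"
    using K_top_limit by (cases s; cases t) simp
qed (rule shifted_correlations)

end

theorem theorem3p1:
  fixes p N :: nat and M :: int and \<rho> a b :: real
    and \<phi> :: "nat \<Rightarrow> complex \<Rightarrow> complex mat"
    and \<phi>p \<phi>m \<psi>p \<psi>m :: "complex \<Rightarrow> complex mat"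
  assumes "p \<ge> 1" and "N \<ge> 1" and "0 < \<rho>" and "\<rho> < 1"
    and "\<And>m. m \<in> {1..N} \<Longrightarrow> mat_holomorphic_on p (\<phi> m) (annulus \<rho>)"
    and "\<And>m z. m \<in> {1..N} \<Longrightarrow> z \<in> annulus \<rho> \<Longrightarrow> invertible_mat (\<phi> m z)"
    and "\<And>m. m \<in> {1..N} \<Longrightarrow> minors_nonneg (toeplitz p (\<phi> m))"
    and "\<And>n. n \<ge> 1 \<Longrightarrow> norm_const p M N \<phi> n > 0"
    and "plus_factor p \<phi>p" and "minus_factor p M \<phi>m"
    and "plus_factor p \<psi>p" and "minus_factor p M \<psi>m"
    and "\<And>z. norm z = 1 \<Longrightarrow> symbol_prod p \<phi> 0 N z = \<phi>p z * \<phi>m z"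
    and "\<And>z. norm z = 1 \<Longrightarrow> symbol_prod p \<phi> 0 N z = \<psi>m z * \<psi>p z"
    and "\<rho> < a" and "a < 1" and "1 < b" and "b < 1 / \<rho>"
  shows
    "(\<forall>x x' :: int. \<forall>m m'. 0 < m \<longrightarrow> m < N \<longrightarrow> 0 < m' \<longrightarrow> m' < N \<longrightarrow> (\<forall>i<p. \<forall>j<p.
        (\<lambda>n. K_fin p M N \<phi> n (m, int p * x + int j) (m', int p * x' + int i))
          \<longlonglongrightarrow> K_bottom p N \<phi> \<phi>p \<phi>m a b (m, int p * x + int j) (m', int p * x' + int i)))
     \<and> converges_to_determinantal (sites N) (\<lambda>n. model p M N \<phi> n)
          (K_bottom p N \<phi> \<phi>p \<phi>m a b)
     \<and> (\<forall>\<xi> \<xi>' :: int. \<forall>m m'. 0 < m \<longrightarrow> m < N \<longrightarrow> 0 < m' \<longrightarrow> m' < N \<longrightarrow> (\<forall>i<p. \<forall>j<p.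
        (\<lambda>n. K_fin p M N \<phi> n (m, int p * (int n + \<xi>) + int j) (m', int p * (int n + \<xi>') + int i))
          \<longlonglongrightarrow> K_top p M N \<phi> \<psi>p \<psi>m a b (m, int p * \<xi> + int j) (m', int p * \<xi>' + int i)))
     \<and> converges_to_determinantal (sites N)
          (\<lambda>n. distr (model p M N \<phi> n) (config_space (sites N)) (shift_down (int p * int n)))
          (K_top p M N \<phi> \<psi>p \<psi>m a b)"
proof -
  interpret factored_model p N M \<rho> \<phi> \<phi>p \<phi>m \<psi>p \<psi>m a b
    by unfold_locales (fact assms)+
  have site: "(m, u) \<in> sites N" if "0 < m" "m < N" for m and u :: int using that by (auto simp: sites_def)
  show ?thesis
  proof (intro conjI allI impI bottom_process top_process)
    fix x x' :: int and m m' i j :: nat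
    assume m: "0 < m" "m < N" "0 < m'" "m' < N"
    show "(\<lambda>n. K_fin p M N \<phi> n (m, int p * x + int j) (m', int p * x' + int i))
        \<longlonglongrightarrow> K_bottom p N \<phi> \<phi>p \<phi>m a b (m, int p * x + int j) (m', int p * x' + int i)"
      unfolding K_fin_tendsto_iff[OF site[OF m(1,2)] site[OF m(3,4)]]
      by (rule K_bottom_limit[OF site[OF m(1,2)] site[OF m(3,4)]])
    have e: "int p * (int n + y) + int k = (int p * y + int k) + int p * int n" for n k and y :: int
      by (simp add: algebra_simps)
    show "(\<lambda>n. K_fin p M N \<phi> n (m, int p * (int n + x) + int j) (m', int p * (int n + x') + int i))
        \<longlonglongrightarrow> K_top p M N \<phi> \<psi>p \<psi>m a b (m, int p * x + int j) (m', int p * x' + int i)"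
      unfolding e K_fin_tendsto_iff[OF site[OF m(1,2)] site[OF m(3,4)]]
      by (rule K_top_limit[OF site[OF m(1,2)] site[OF m(3,4)]])
  qed
qed

end
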